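(* Let $f\in Y^*$, $u_0\in L^2(\Omega)$, let $\widetilde u_0\in X$ be an extension of $u_0$ (i.e. $\widetilde u_0(\cdot,0)=u_0$), and let $\widetilde u\in X_0$ and $\widetilde u_h\in X_{0,h}$ be the unique solutions of $b(\widetilde u+\widetilde u_0,v)=\langle f,v\rangle_Q$ for all $v\in Y$, and of $b(\widetilde u_h+\widetilde u_0,v_h)=\langle f,v_h\rangle_Q$ for all $v_h\in Y_h$, respectively. Assume $\widetilde u\in L^2(0,T;H^2(\Omega))\cap H^2(0,T;L^2(\Omega))$, $\partial_t\widetilde u\in L^2(0,T;H^2(\Omega))$ and $\widetilde u\in H^2(0,T;H^2(\Omega))$, and let $h_t\simeq h_x$. Then $$\|\widetilde u-\widetilde u_h\|_X\le c(\widetilde u)\,h_x,\qquad c(\widetilde u)=c\,\Big[\|\widetilde u\|_{H^1(0,T;H^2(\Omega))}+\|\widetilde u\|_{H^2(0,T;H^2(\Omega))}\Big],$$ with a constant $c>0$ independent of $h_x$, $h_t$ and $\widetilde u$.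
   Context: Let $\Omega\subset\mathbb{R}^n$, $n\in\{1,2,3\}$, be a bounded Lipschitz domain, $T>0$, $Q:=\Omega\times(0,T)$. Put $Y:=L^2(0,T;H^1_0(\Omega))$ with $\|v\|_Y:=\|\nabla_x v\|_{L^2(Q)}$; $Y^*$ is its dual with the dual norm, and $\langle\cdot,\cdot\rangle_Q$ is the duality pairing extending the $L^2(Q)$ inner product. Put $X:=\{u\in Y:\partial_t u\in Y^*\}$ with $\|u\|_X:=(\|u\|_Y^2+\|\partial_t u\|_{Y^*}^2)^{1/2}$, $X_0:=\{u\in X:u(\cdot,0)=0\}$, and $b(u,v):=\langle\partial_t u,v\rangle_Q+\langle\nabla_x u,\nabla_x v\rangle_{L^2(Q)}$ for $u\in X$, $v\in Y$. Discretization: $V_{h_x}\subset H^1_0(\Omega)$ is the space of continuous piecewise linear functions on an admissible, shape regular, globally quasi-uniform simplicial decomposition of $\Omega$ of mesh size $h_x$. The interval $(0,T)$ is divided uniformly with $h_t=T/N_t$, $t_i=ih_t$. $W_{h_t}^1$ is the space of continuous piecewise linear functions on this temporal mesh vanishing at $t=0$, and $W_{h_t}^0$ the space of piecewise constant functions. $X_{0,h}:=W_{h_t}^1\otimes V_{h_x}\subset X_0$, $Y_h:=W_{h_t}^0\otimes V_{h_x}\subset Y$. Standing properties (constants independent of $h_x$): the inverse inequality $\|\nabla_x v_h\|_{L^2(\Omega)}\le c\,h_x^{-1}\|v_h\|_{L^2(\Omega)}$ for $v_h\in V_{h_x}$; and for the $H^1_0$ projection $P^1_{h_x}:H^1_0(\Omega)\to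 V_{h_x}$, $\langle\nabla_x P^1_{h_x}u,\nabla_x v_h\rangle_{L^2(\Omega)}=\langle\nabla_x u,\nabla_x v_h\rangle_{L^2(\Omega)}$ for all $v_h\in V_{h_x}$, the estimates $\|\nabla_x(u-P^1_{h_x}u)\|_{L^2(\Omega)}\le c\,h_x^{s-1}|u|_{H^s(\Omega)}$ and $\|u-P^1_{h_x}u\|_{L^2(\Omega)}\le c\,h_x^{s}|u|_{H^s(\Omega)}$ for $u\in H^1_0(\Omega)\cap H^s(\Omega)$, $s\in[1,2]$. $h_t\simeq h_x$ means that $h_t/h_x$ is bounded above and below by fixed positive constants; $c$ may depend on these, on $\Omega$, $T$ and the shape regularity and quasi-uniformity constants. *)

theory Defs
  imports "HOL-Analysis.Analysis"
begin

section \<open>Lipschitz domains\<close>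

text \<open>Locally, after choosing a direction \<nu>, the domain is the strict epigraph of a Lipschitz
  function defined on the hyperplane orthogonal to \<nu>.\<close>

definition bounded_lipschitz_domain :: "'a::euclidean_space set \<Rightarrow> bool" where
  "bounded_lipschitz_domain \<Omega> \<longleftrightarrow>
     open \<Omega> \<and> connected \<Omega> \<and> bounded \<Omega> \<and> \<Omega> \<noteq> {} \<and>
     (\<forall>p\<in>frontier \<Omega>. \<exists>U \<nu> L \<gamma>. open U \<and> p \<in> U \<and> norm \<nu> = 1 \<and>
        lipschitz_on L {y. y \<bullet> \<nu> = 0} \<gamma> \<and>
        \<Omega> \<inter> U = {x \<in> U. \<gamma> (x - (x \<bullet> \<nu>) *\<^sub>R \<nu>) < x \<bullet> \<nu>})"


section \<open>Test functions and Sobolev spaces on a domain\<close>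

definition partial :: "'a::euclidean_space \<Rightarrow> ('a \<Rightarrow> real) \<Rightarrow> 'a \<Rightarrow> real" where
  "partial b f = (\<lambda>x. frechet_derivative f (at x) b)"

primrec C_k :: "nat \<Rightarrow> ('a::euclidean_space \<Rightarrow> real) \<Rightarrow> bool" where
  "C_k 0 f \<longleftrightarrow> continuous_on UNIV f"
| "C_k (Suc k) f \<longleftrightarrow> (\<forall>x. f differentiable (at x)) \<and> (\<forall>b\<in>Basis. C_k k (partial b f))"

definition test_functions :: "'a::euclidean_space set \<Rightarrow> ('a \<Rightarrow> real) set" where
  "test_functions \<Omega> = {\<phi>. (\<forall>k. C_k k \<phi>) \<and>
     compact (closure {x. \<phi> x \<noteq> 0}) \<and> closure {x. \<phi> x \<noteq> 0} \<subseteq> \<Omega>}"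

text \<open>Elements of all function spaces are represented by functions on the whole type; only the
  values almost everywhere on the domain matter.\<close>

definition L2 :: "'a::euclidean_space set \<Rightarrow> ('a \<Rightarrow> real) set" where
  "L2 \<Omega> = {u. u \<in> borel_measurable (lebesgue_on \<Omega>) \<and> integrable (lebesgue_on \<Omega>) (\<lambda>x. (u x)\<^sup>2)}"

definition L2_inner :: "'a::euclidean_space set \<Rightarrow> ('a \<Rightarrow> real) \<Rightarrow> ('a \<Rightarrow> real) \<Rightarrow> real" where
  "L2_inner \<Omega> u v = (LINT x|lebesgue_on \<Omega>. u x * v x)"

definition L2_norm :: "'a::euclidean_space set \<Rightarrow> ('a \<Rightarrow> real) \<Rightarrow> real" where
  "L2_norm \<Omega> u = sqrt (L2_inner \<Omega> u u)"

definition weak_partial ::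
    "'a::euclidean_space set \<Rightarrow> 'a \<Rightarrow> ('a \<Rightarrow> real) \<Rightarrow> ('a \<Rightarrow> real) \<Rightarrow> bool" where
  "weak_partial \<Omega> b u g \<longleftrightarrow> g \<in> L2 \<Omega> \<and>
     (\<forall>\<phi>\<in>test_functions \<Omega>. L2_inner \<Omega> u (partial b \<phi>) = - L2_inner \<Omega> g \<phi>)"

definition wpartial :: "'a::euclidean_space set \<Rightarrow> 'a \<Rightarrow> ('a \<Rightarrow> real) \<Rightarrow> 'a \<Rightarrow> real" where
  "wpartial \<Omega> b u = (SOME g. weak_partial \<Omega> b u g)"

definition H1 :: "'a::euclidean_space set \<Rightarrow> ('a \<Rightarrow> real) set" where
  "H1 \<Omega> = {u \<in> L2 \<Omega>. \<forall>b\<in>Basis. \<exists>g. weak_partial \<Omega> b u g}"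

definition grad_inner :: "'a::euclidean_space set \<Rightarrow> ('a \<Rightarrow> real) \<Rightarrow> ('a \<Rightarrow> real) \<Rightarrow> real" where
  "grad_inner \<Omega> u v = (\<Sum>b\<in>Basis. L2_inner \<Omega> (wpartial \<Omega> b u) (wpartial \<Omega> b v))"

definition grad_norm :: "'a::euclidean_space set \<Rightarrow> ('a \<Rightarrow> real) \<Rightarrow> real" where
  "grad_norm \<Omega> u = sqrt (grad_inner \<Omega> u u)"

definition H1_norm :: "'a::euclidean_space set \<Rightarrow> ('a \<Rightarrow> real) \<Rightarrow> real" where
  "H1_norm \<Omega> u = sqrt ((L2_norm \<Omega> u)\<^sup>2 + (grad_norm \<Omega> u)\<^sup>2)"

definition H10 :: "'a::euclidean_space set \<Rightarrow> ('a \<Rightarrow> real) set" where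
  "H10 \<Omega> = {u \<in> H1 \<Omega>. \<exists>\<phi>::nat \<Rightarrow> 'a \<Rightarrow> real. (\<forall>k. \<phi> k \<in> test_functions \<Omega>) \<and>
     (\<lambda>k. H1_norm \<Omega> (\<lambda>x. u x - \<phi> k x)) \<longlonglongrightarrow> 0}"

definition H2 :: "'a::euclidean_space set \<Rightarrow> ('a \<Rightarrow> real) set" where
  "H2 \<Omega> = {u \<in> H1 \<Omega>. \<forall>b\<in>Basis. wpartial \<Omega> b u \<in> H1 \<Omega>}"

definition H2_seminorm :: "'a::euclidean_space set \<Rightarrow> ('a \<Rightarrow> real) \<Rightarrow> real" where
  "H2_seminorm \<Omega> u = sqrt (\<Sum>b\<in>Basis. (grad_norm \<Omega> (wpartial \<Omega> b u))\<^sup>2)"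

definition H2_norm :: "'a::euclidean_space set \<Rightarrow> ('a \<Rightarrow> real) \<Rightarrow> real" where
  "H2_norm \<Omega> u = sqrt ((H1_norm \<Omega> u)\<^sup>2 + (H2_seminorm \<Omega> u)\<^sup>2)"

text \<open>The spaces \<open>H\<^sup>s\<close> for \<open>1 \<le> s \<le> 2\<close>; for \<open>1 < s < 2\<close> these are the Sobolev--Slobodeckij spaces,
  with the double integral over \<open>\<Omega> \<times> \<Omega>\<close> applied to the first derivatives.\<close>

definition slobodeckij_kernel :: "real \<Rightarrow> ('a::euclidean_space \<Rightarrow> real) \<Rightarrow> 'a \<times> 'a \<Rightarrow> real" where
  "slobodeckij_kernel \<sigma> g = (\<lambda>(x, y). (g x - g y)\<^sup>2 / norm (x - y) powr (real DIM('a) + 2 * \<sigma>))"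

definition Hs :: "'a::euclidean_space set \<Rightarrow> real \<Rightarrow> ('a \<Rightarrow> real) set" where
  "Hs \<Omega> s =
     (if s = 1 then H1 \<Omega> else if s = 2 then H2 \<Omega>
      else {u \<in> H1 \<Omega>. \<forall>b\<in>Basis.
              integrable (lebesgue_on (\<Omega> \<times> \<Omega>)) (slobodeckij_kernel (s - 1) (wpartial \<Omega> b u))})"

definition Hs_seminorm :: "'a::euclidean_space set \<Rightarrow> real \<Rightarrow> ('a \<Rightarrow> real) \<Rightarrow> real" where
  "Hs_seminorm \<Omega> s u =
     (if s = 1 then grad_norm \<Omega> u else if s = 2 then H2_seminorm \<Omega> u
      else sqrt (\<Sum>b\<in>Basis.
             integral\<^sup>L (lebesgue_on (\<Omega> \<times> \<Omega>)) (slobodeckij_kernel (s - 1) (wpartial \<Omega> b u))))"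


section \<open>Bochner spaces\<close>

text \<open>A space \<open>V\<close> of functions on \<Omega> is given by its carrier and a (semi)norm \<open>N\<close>, so that strong
  measurability and \<open>L\<^sup>2(0,T;V)\<close> are spelled out relative to these data. A function of \<open>(x,t)\<close> is
  the curried map taking \<open>t\<close> to \<open>u(\<cdot>,t)\<close>.\<close>

definition strongly_measurable ::
    "real \<Rightarrow> ('a \<Rightarrow> real) set \<Rightarrow> (('a \<Rightarrow> real) \<Rightarrow> real) \<Rightarrow> (real \<Rightarrow> 'a \<Rightarrow> real) \<Rightarrow> bool" where
  "strongly_measurable T V N u \<longleftrightarrow>
     (\<exists>s::nat \<Rightarrow> real \<Rightarrow> 'a \<Rightarrow> real.
        (\<forall>k. simple_function (lebesgue_on {0<..<T}) (s k) \<and> s k ` {0<..<T} \<subseteq> V) \<and>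
        (AE t in lebesgue_on {0<..<T}. (\<lambda>k. N (\<lambda>x. s k t x - u t x)) \<longlonglongrightarrow> 0))"

definition L2B ::
    "real \<Rightarrow> ('a \<Rightarrow> real) set \<Rightarrow> (('a \<Rightarrow> real) \<Rightarrow> real) \<Rightarrow> (real \<Rightarrow> 'a \<Rightarrow> real) set" where
  "L2B T V N = {u. (AE t in lebesgue_on {0<..<T}. u t \<in> V) \<and> strongly_measurable T V N u \<and>
     integrable (lebesgue_on {0<..<T}) (\<lambda>t. (N (u t))\<^sup>2)}"

definition L2B_norm :: "real \<Rightarrow> (('a \<Rightarrow> real) \<Rightarrow> real) \<Rightarrow> (real \<Rightarrow> 'a \<Rightarrow> real) \<Rightarrow> real" where
  "L2B_norm T N u = sqrt (LINT t|lebesgue_on {0<..<T}. (N (u t))\<^sup>2)"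

text \<open>The identity \<open>\<integral> \<eta>' u dt = - \<integral> \<eta> w dt\<close> in \<open>L\<^sup>2(\<Omega>)\<close>, tested with the elements of \<open>L\<^sup>2(\<Omega>)\<close>.\<close>

definition weak_time_deriv ::
    "'a::euclidean_space set \<Rightarrow> real \<Rightarrow> (real \<Rightarrow> 'a \<Rightarrow> real) \<Rightarrow> (real \<Rightarrow> 'a \<Rightarrow> real) \<Rightarrow> bool" where
  "weak_time_deriv \<Omega> T u w \<longleftrightarrow>
     u \<in> L2B T (L2 \<Omega>) (L2_norm \<Omega>) \<and> w \<in> L2B T (L2 \<Omega>) (L2_norm \<Omega>) \<and>
     (\<forall>\<eta>\<in>test_functions {0<..<T}. \<forall>\<psi>\<in>L2 \<Omega>.
        (LINT t|lebesgue_on {0<..<T}. deriv \<eta> t * L2_inner \<Omega> (u t) \<psi>) =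
        - (LINT t|lebesgue_on {0<..<T}. \<eta> t * L2_inner \<Omega> (w t) \<psi>))"

definition time_deriv ::
    "'a::euclidean_space set \<Rightarrow> real \<Rightarrow> (real \<Rightarrow> 'a \<Rightarrow> real) \<Rightarrow> real \<Rightarrow> 'a \<Rightarrow> real" where
  "time_deriv \<Omega> T u = (SOME w. weak_time_deriv \<Omega> T u w)"

definition H1B ::
    "'a::euclidean_space set \<Rightarrow> real \<Rightarrow> ('a \<Rightarrow> real) set \<Rightarrow> (('a \<Rightarrow> real) \<Rightarrow> real) \<Rightarrow>
     (real \<Rightarrow> 'a \<Rightarrow> real) set" where
  "H1B \<Omega> T V N = {u \<in> L2B T V N. (\<exists>w. weak_time_deriv \<Omega> T u w) \<and> time_deriv \<Omega> T u \<in> L2B T V N}"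

definition H2B ::
    "'a::euclidean_space set \<Rightarrow> real \<Rightarrow> ('a \<Rightarrow> real) set \<Rightarrow> (('a \<Rightarrow> real) \<Rightarrow> real) \<Rightarrow>
     (real \<Rightarrow> 'a \<Rightarrow> real) set" where
  "H2B \<Omega> T V N = {u \<in> H1B \<Omega> T V N. time_deriv \<Omega> T u \<in> H1B \<Omega> T V N}"

definition H1B_norm ::
    "'a::euclidean_space set \<Rightarrow> real \<Rightarrow> (('a \<Rightarrow> real) \<Rightarrow> real) \<Rightarrow> (real \<Rightarrow> 'a \<Rightarrow> real) \<Rightarrow> real" where
  "H1B_norm \<Omega> T N u = sqrt ((L2B_norm T N u)\<^sup>2 + (L2B_norm T N (time_deriv \<Omega> T u))\<^sup>2)"

definition H2B_norm ::
    "'a::euclidean_space set \<Rightarrow> real \<Rightarrow> (('a \<Rightarrow> real) \<Rightarrow> real) \<Rightarrow> (real \<Rightarrow> 'a \<Rightarrow> real) \<Rightarrow> real" where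
  "H2B_norm \<Omega> T N u = sqrt ((H1B_norm \<Omega> T N u)\<^sup>2 +
     (L2B_norm T N (time_deriv \<Omega> T (time_deriv \<Omega> T u)))\<^sup>2)"


section \<open>The spaces \<open>Y\<close>, \<open>Y\<^sup>*\<close>, \<open>X\<close> and the bilinear form\<close>

definition Y_space :: "'a::euclidean_space set \<Rightarrow> real \<Rightarrow> (real \<Rightarrow> 'a \<Rightarrow> real) set" where
  "Y_space \<Omega> T = L2B T (H10 \<Omega>) (grad_norm \<Omega>)"

definition Y_norm :: "'a::euclidean_space set \<Rightarrow> real \<Rightarrow> (real \<Rightarrow> 'a \<Rightarrow> real) \<Rightarrow> real" where
  "Y_norm \<Omega> T = L2B_norm T (grad_norm \<Omega>)"

text \<open>A functional is total on curried functions; only its values on \<open>Y\<close> are meaningful. Linearity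
  and boundedness make it respect almost-everywhere equality.\<close>

definition Y_dual ::
    "'a::euclidean_space set \<Rightarrow> real \<Rightarrow> ((real \<Rightarrow> 'a \<Rightarrow> real) \<Rightarrow> real) set" where
  "Y_dual \<Omega> T = {l.
     (\<forall>v\<in>Y_space \<Omega> T. \<forall>w\<in>Y_space \<Omega> T. \<forall>\<alpha> \<beta>.
        l (\<lambda>t x. \<alpha> * v t x + \<beta> * w t x) = \<alpha> * l v + \<beta> * l w) \<and>
     (\<exists>C. \<forall>v\<in>Y_space \<Omega> T. \<bar>l v\<bar> \<le> C * Y_norm \<Omega> T v)}"

definition Y_dual_norm ::
    "'a::euclidean_space set \<Rightarrow> real \<Rightarrow> ((real \<Rightarrow> 'a \<Rightarrow> real) \<Rightarrow> real) \<Rightarrow> real" where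
  "Y_dual_norm \<Omega> T l = (SUP v\<in>{v \<in> Y_space \<Omega> T. Y_norm \<Omega> T v \<le> 1}. \<bar>l v\<bar>)"

text \<open>The time derivative in the sense of distributions, as an element of \<open>Y\<^sup>*\<close>; the products
  \<open>\<eta>(t) \<psi>(x)\<close> have dense span in \<open>Y\<close>, which makes it unique on \<open>Y\<close>.\<close>

definition dual_time_deriv ::
    "'a::euclidean_space set \<Rightarrow> real \<Rightarrow> (real \<Rightarrow> 'a \<Rightarrow> real) \<Rightarrow> ((real \<Rightarrow> 'a \<Rightarrow> real) \<Rightarrow> real) \<Rightarrow> bool"
  where
  "dual_time_deriv \<Omega> T u l \<longleftrightarrow> l \<in> Y_dual \<Omega> T \<and>
     (\<forall>\<eta>\<in>test_functions {0<..<T}. \<forall>\<psi>\<in>H10 \<Omega>.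
        l (\<lambda>t x. \<eta> t * \<psi> x) = - (LINT t|lebesgue_on {0<..<T}. deriv \<eta> t * L2_inner \<Omega> (u t) \<psi>))"

definition dt ::
    "'a::euclidean_space set \<Rightarrow> real \<Rightarrow> (real \<Rightarrow> 'a \<Rightarrow> real) \<Rightarrow> (real \<Rightarrow> 'a \<Rightarrow> real) \<Rightarrow> real" where
  "dt \<Omega> T u = (SOME l. dual_time_deriv \<Omega> T u l)"

definition X_space :: "'a::euclidean_space set \<Rightarrow> real \<Rightarrow> (real \<Rightarrow> 'a \<Rightarrow> real) set" where
  "X_space \<Omega> T = {u \<in> Y_space \<Omega> T. \<exists>l. dual_time_deriv \<Omega> T u l}"

definition X_norm :: "'a::euclidean_space set \<Rightarrow> real \<Rightarrow> (real \<Rightarrow> 'a \<Rightarrow> real) \<Rightarrow> real" where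
  "X_norm \<Omega> T u = sqrt ((Y_norm \<Omega> T u)\<^sup>2 + (Y_dual_norm \<Omega> T (dt \<Omega> T u))\<^sup>2)"

text \<open>\<open>u(\<cdot>,0) = u0\<close> through the representative of \<open>u\<close> in \<open>C([0,T];L\<^sup>2(\<Omega>))\<close>.\<close>

definition initial_value ::
    "'a::euclidean_space set \<Rightarrow> real \<Rightarrow> (real \<Rightarrow> 'a \<Rightarrow> real) \<Rightarrow> ('a \<Rightarrow> real) \<Rightarrow> bool" where
  "initial_value \<Omega> T u u0 \<longleftrightarrow>
     (\<exists>z. (\<forall>t\<in>{0..T}. z t \<in> L2 \<Omega> \<and>
             ((\<lambda>s. L2_norm \<Omega> (\<lambda>x. z s x - z t x)) \<longlongrightarrow> 0) (at t within {0..T})) \<and>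
          (AE t in lebesgue_on {0<..<T}. AE x in lebesgue_on \<Omega>. z t x = u t x) \<and>
          (AE x in lebesgue_on \<Omega>. z 0 x = u0 x))"

definition X0_space :: "'a::euclidean_space set \<Rightarrow> real \<Rightarrow> (real \<Rightarrow> 'a \<Rightarrow> real) set" where
  "X0_space \<Omega> T = {u \<in> X_space \<Omega> T. initial_value \<Omega> T u (\<lambda>x. 0)}"

definition bform ::
    "'a::euclidean_space set \<Rightarrow> real \<Rightarrow> (real \<Rightarrow> 'a \<Rightarrow> real) \<Rightarrow> (real \<Rightarrow> 'a \<Rightarrow> real) \<Rightarrow> real" where
  "bform \<Omega> T u v = dt \<Omega> T u v + (LINT t|lebesgue_on {0<..<T}. grad_inner \<Omega> (u t) (v t))"


section \<open>Space-time finite elements\<close>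

definition simplicial_decomposition :: "'a::euclidean_space set \<Rightarrow> 'a set set \<Rightarrow> bool" where
  "simplicial_decomposition \<Omega> \<T> \<longleftrightarrow>
     triangulation \<T> \<and> (\<forall>K\<in>\<T>. int DIM('a) simplex K) \<and> \<Union>\<T> = closure \<Omega>"

definition mesh_size :: "'a::euclidean_space set set \<Rightarrow> real" where
  "mesh_size \<T> = Max (diameter ` \<T>)"

definition shape_regular :: "real \<Rightarrow> 'a::euclidean_space set set \<Rightarrow> bool" where
  "shape_regular \<sigma> \<T> \<longleftrightarrow> (\<forall>K\<in>\<T>. \<exists>z r. 0 < r \<and> cball z r \<subseteq> K \<and> diameter K \<le> \<sigma> * r)"

definition quasi_uniform :: "real \<Rightarrow> 'a::euclidean_space set set \<Rightarrow> bool" where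
  "quasi_uniform \<kappa> \<T> \<longleftrightarrow> (\<forall>K\<in>\<T>. \<forall>K'\<in>\<T>. diameter K \<le> \<kappa> * diameter K')"

definition V_h :: "'a::euclidean_space set \<Rightarrow> 'a set set \<Rightarrow> ('a \<Rightarrow> real) set" where
  "V_h \<Omega> \<T> = {v \<in> H10 \<Omega>. continuous_on (closure \<Omega>) v \<and>
     (\<forall>K\<in>\<T>. \<exists>a c. \<forall>x\<in>K. v x = a \<bullet> x + c)}"

definition W1_h :: "real \<Rightarrow> nat \<Rightarrow> (real \<Rightarrow> real) set" where
  "W1_h T n = {w. continuous_on {0..T} w \<and> w 0 = 0 \<and>
     (\<forall>i<n. \<exists>a c. \<forall>t\<in>{real i * (T / real n)..real (Suc i) * (T / real n)}. w t = a * t + c)}"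

definition W0_h :: "real \<Rightarrow> nat \<Rightarrow> (real \<Rightarrow> real) set" where
  "W0_h T n = {w. \<forall>i<n. \<exists>c. \<forall>t\<in>{real i * (T / real n)<..<real (Suc i) * (T / real n)}. w t = c}"

definition tensor_space ::
    "(real \<Rightarrow> real) set \<Rightarrow> ('a \<Rightarrow> real) set \<Rightarrow> (real \<Rightarrow> 'a \<Rightarrow> real) set" where
  "tensor_space W V = {u. \<exists>(m::nat) w v. (\<forall>i<m. w i \<in> W \<and> v i \<in> V) \<and>
     u = (\<lambda>t x. \<Sum>i<m. w i t * v i x)}"

definition X0_h ::
    "'a::euclidean_space set \<Rightarrow> real \<Rightarrow> 'a set set \<Rightarrow> nat \<Rightarrow> (real \<Rightarrow> 'a \<Rightarrow> real) set" where
  "X0_h \<Omega> T \<T> n = tensor_space (W1_h T n) (V_h \<Omega> \<T>)"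

definition Y_h ::
    "'a::euclidean_space set \<Rightarrow> real \<Rightarrow> 'a set set \<Rightarrow> nat \<Rightarrow> (real \<Rightarrow> 'a \<Rightarrow> real) set" where
  "Y_h \<Omega> T \<T> n = tensor_space (W0_h T n) (V_h \<Omega> \<T>)"

definition inverse_inequality ::
    "'a::euclidean_space set \<Rightarrow> real \<Rightarrow> 'a set set \<Rightarrow> bool" where
  "inverse_inequality \<Omega> c \<T> \<longleftrightarrow>
     (\<forall>v\<in>V_h \<Omega> \<T>. grad_norm \<Omega> v \<le> c * inverse (mesh_size \<T>) * L2_norm \<Omega> v)"

definition H10_projection ::
    "'a::euclidean_space set \<Rightarrow> 'a set set \<Rightarrow> ('a \<Rightarrow> real) \<Rightarrow> ('a \<Rightarrow> real) \<Rightarrow> bool" where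
  "H10_projection \<Omega> \<T> u p \<longleftrightarrow> p \<in> V_h \<Omega> \<T> \<and>
     (\<forall>v\<in>V_h \<Omega> \<T>. grad_inner \<Omega> p v = grad_inner \<Omega> u v)"

text \<open>The constant may depend on the Sobolev index \<open>s\<close>.\<close>

definition H10_projection_estimates ::
    "'a::euclidean_space set \<Rightarrow> (real \<Rightarrow> real) \<Rightarrow> 'a set set \<Rightarrow> bool" where
  "H10_projection_estimates \<Omega> c \<T> \<longleftrightarrow>
     (\<forall>s\<in>{1..2}. \<forall>u \<in> H10 \<Omega> \<inter> Hs \<Omega> s. \<forall>p. H10_projection \<Omega> \<T> u p \<longrightarrow>
        grad_norm \<Omega> (\<lambda>x. u x - p x) \<le> c s * mesh_size \<T> powr (s - 1) * Hs_seminorm \<Omega> s u \<and>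
        L2_norm \<Omega> (\<lambda>x. u x - p x) \<le> c s * mesh_size \<T> powr s * Hs_seminorm \<Omega> s u)"

end

theory Submission
  imports Defs
begin

text \<open>
  Expand the discrete functions in a basis \<open>\<phi>\<^sub>j\<close> of \<open>V_h\<close> that is orthonormal for the gradient inner product, and
  compare \<open>uh\<close> with the nodal interpolant in time of the \<open>H10\<close> projection \<open>P u\<close>. Testing the Galerkin orthogonality
  on each time slab with the time derivative \<open>\<psi>\<close> of the difference gives
  \<open>h |\<psi>|\<^sup>2 + (D' - D) / 2 = \<integral> (w - P w, \<psi>) + \<integral> (\<nabla>(P u - interpolant of P u), \<nabla>\<psi>)\<close>, where \<open>w\<close> is the time derivative of \<open>u\<close>
  and \<open>D\<close>, \<open>D'\<close> are the squared gradient norms of the difference at the two ends of the slab. In the last term the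
  gradient of \<open>\<psi>\<close> is removed by Green's formula, since \<open>w(t)\<close> lies in \<open>H2\<close>; so both terms are of first order times
  \<open>|\<psi>|\<close>, and summing over the slabs bounds the difference in \<open>L2(0,T;H10)\<close> and its time derivative in \<open>L2(Q)\<close>. On
  \<open>X\<close> the dual norm of the time derivative is bounded by its \<open>L2(Q)\<close> norm through the Poincare inequality.

  The spaces are sets of functions, not quotients, and no Bochner integral is used: every statement about a
  curve \<open>t \<mapsto> u(t)\<close> is reduced to the scalar functions \<open>t \<mapsto> (u(t), \<psi>)\<close> and \<open>t \<mapsto> (\<nabla>u(t), \<nabla>v)\<close>.
\<close>

section \<open>Test functions\<close>

text \<open>Weak derivatives, time derivatives and the functional \<open>dt\<close> are picked by
  choice, so nothing can be computed from them before they are known to be unique up to norm zero.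
  For weak derivatives this rests on the density of the test functions in L2, for \<open>dt\<close>
  on density in Y; hence the smooth bumps and the density theorem precede the Sobolev spaces.
  Identities between such objects hold in a seminorm or almost everywhere.

  Two gaps in the regularity have to be closed. The projection estimates ask for functions in H10,
  while w is only assumed to take values in H2; its boundary values are inherited from u
  (\<open>time_deriv_H10\<close>). The initial value of u is given in L2 only, yet the comparison
  runs in the gradient product, where the constant of integration must vanish as well
  (\<open>grad_prim_initial\<close>).

  The basis makes nodal values of P u meaningful: each coefficient of u agrees almost everywhere
  with a primitive, which is continuous. The projection error of w is measured in L2 with s = 1,
  that of u in the gradient norm with s = 2; each gives one power of the mesh size.\<close>

lemma partial_eqI: "(f has_derivative f') (at x) \<Longrightarrow> partial b f x = f' b"
  unfolding partial_def using frechet_derivative_at by metis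

lemma C_k_Suc_imp: "C_k (Suc k) f \<Longrightarrow> C_k k f"
proof (induction k arbitrary: f)
  case 0
  then show ?case
    by (auto intro!: continuous_at_imp_continuous_on differentiable_imp_continuous_within)
qed (metis C_k.simps(2))

lemma C_k_const: "C_k k (\<lambda>x::'a::euclidean_space. c)"
proof (induction k arbitrary: c)
  case (Suc k)
  have "partial b (\<lambda>x::'a. c) = (\<lambda>x. 0)" for b
    by (intro ext, subst partial_eqI[OF has_derivative_const]) simp
  with Suc show ?case by simp
qed simp

lemma partial_add:
  assumes "f differentiable (at x)" "g differentiable (at x)"
  shows "partial b (\<lambda>x. f x + g x) x = partial b f x + partial b g x"
  using partial_eqI[OF has_derivative_add[OF assms[unfolded frechet_derivative_works]]]
  by (simp add: partial_def)

lemma partial_mult: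
  assumes "f differentiable (at x)" "g differentiable (at x)"
  shows "partial b (\<lambda>x. f x * g x) x = f x * partial b g x + partial b f x * g x"
  using partial_eqI[OF has_derivative_mult[OF assms[unfolded frechet_derivative_works]]]
  by (simp add: partial_def)

lemma C_k_add: "C_k k f \<Longrightarrow> C_k k g \<Longrightarrow> C_k k (\<lambda>x. f x + g x)"
proof (induction k arbitrary: f g)
  case (Suc k)
  then have "partial b (\<lambda>x. f x + g x) = (\<lambda>x. partial b f x + partial b g x)" for b
    by (intro ext partial_add) auto
  with Suc show ?case by auto
qed (auto intro: continuous_intros)

lemma C_k_mult: "C_k k f \<Longrightarrow> C_k k g \<Longrightarrow> C_k k (\<lambda>x. f x * g x)"
proof (induction k arbitrary: f g)
  case (Suc k)
  then have "partial b (\<lambda>x. f x * g x) = (\<lambda>x. f x * partial b g x + partial b f x * g x)" for b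
    by (intro ext partial_mult) auto
  with Suc C_k_Suc_imp[OF Suc.prems(1)] C_k_Suc_imp[OF Suc.prems(2)] show ?case
    by (auto intro!: C_k_add)
qed (auto intro: continuous_intros)

lemma C_k_prod: "(\<And>i. i \<in> I \<Longrightarrow> C_k k (f i)) \<Longrightarrow> C_k k (\<lambda>x. \<Prod>i\<in>I. f i x)"
  by (induction I rule: infinite_finite_induct) (auto intro: C_k_const C_k_mult)

lemma C_k_power: "C_k k f \<Longrightarrow> C_k k (\<lambda>x. f x ^ n)"
  by (induction n) (auto intro: C_k_const C_k_mult)

text \<open>The successive derivatives enter as a family \<open>F\<close>, so that one induction
  covers every function whose derivatives are known explicitly; differentiating moves one level up,
  which is why the level \<open>j\<close> is arbitrary.\<close>

lemma C_k_coord: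
  assumes F: "\<And>k x. (F k has_real_derivative F (Suc k) x) (at x)"
  shows "C_k k (\<lambda>x::'a::euclidean_space. F j (x \<bullet> b))"
proof (induction k arbitrary: j)
  case 0
  have "continuous_on UNIV (F j)"
    using F DERIV_isCont continuous_at_imp_continuous_on by blast
  then have "continuous_on UNIV (\<lambda>x. F j (x \<bullet> b))"
    by (rule continuous_on_compose2) (auto intro!: continuous_intros)
  then show ?case by simp
next
  case (Suc k)
  have d: "((\<lambda>x. F j (x \<bullet> b)) has_derivative (\<lambda>h. F (Suc j) (x \<bullet> b) * (h \<bullet> b))) (at x)" for x :: 'a
    using has_derivative_compose[of "\<lambda>x. x \<bullet> b" "\<lambda>h. h \<bullet> b" x UNIV "F j" "\<lambda>h. F (Suc j) (x \<bullet> b) * h"]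
      F[of j "x \<bullet> b"] bounded_linear_imp_has_derivative[OF bounded_linear_inner_left]
    by (auto simp: has_field_derivative_def)
  then have "partial c (\<lambda>x. F j (x \<bullet> b)) = (\<lambda>x. F (Suc j) (x \<bullet> b) * (c \<bullet> b))" for c
    by (intro ext partial_eqI)
  with d Suc C_k_mult[OF Suc C_k_const] show ?case
    by (auto simp: differentiable_def)
qed

section \<open>The smooth function exp(-1/x) and bumps supported in a box\<close>

definition exp_inv :: "real poly \<Rightarrow> real \<Rightarrow> real" where
  "exp_inv p x = (if 0 < x then poly p (1 / x) * exp (- (1 / x)) else 0)"

lemma poly_exp_decay: "((\<lambda>y::real. poly p y * exp (- y)) \<longlongrightarrow> 0) at_top"
proof -
  have "((\<lambda>y::real. \<Sum>i\<le>degree p. coeff p i * (y ^ i / exp y)) \<longlongrightarrow> (\<Sum>i\<le>degree p. coeff p i * 0)) at_top"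
    by (intro tendsto_intros tendsto_power_div_exp_0)
  then show ?thesis
    by (simp add: poly_altdef sum_distrib_right exp_minus divide_inverse mult.assoc)
qed

text \<open>For x > 0 the derivative of p(1/x) exp(-1/x) is (p - p')(1/x) exp(-1/x) / x^2, and the
  factor \<open>[:0, 0, 1:]\<close> is this 1/x^2: the family is closed under differentiation, so
  all derivatives exist at once. At 0 the difference quotient from the right is a polynomial in 1/h
  times exp(-1/h).\<close>

lemma has_real_derivative_exp_inv:
  "(exp_inv p has_real_derivative exp_inv ([:0, 0, 1:] * (p - pderiv p)) x) (at x)"
proof -
  consider "0 < x" | "x < 0" | "x = 0" by linarith
  then show ?thesis
  proof cases
    case 1
    have "((\<lambda>x. poly p (1 / x) * exp (- (1 / x))) has_real_derivative
        exp_inv ([:0, 0, 1:] * (p - pderiv p)) x) (at x)"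
      using 1 unfolding exp_inv_def
      by (auto intro!: derivative_eq_intros simp: field_simps power2_eq_square)
    from has_field_derivative_transform_within_open[OF this, of "{0<..}"] 1 show ?thesis
      by (auto simp: exp_inv_def)
  next
    case 2
    have "((\<lambda>x. 0) has_real_derivative exp_inv ([:0, 0, 1:] * (p - pderiv p)) x) (at x)"
      using 2 by (simp add: exp_inv_def)
    from has_field_derivative_transform_within_open[OF this, of "{..<0}"] 2 show ?thesis
      by (auto simp: exp_inv_def)
  next
    case 3
    have "((\<lambda>h. exp_inv p h / h) \<longlongrightarrow> 0) (at_right 0)"
    proof -
      have "((\<lambda>h::real. poly ([:0, 1:] * p) (inverse h) * exp (- inverse h)) \<longlongrightarrow> 0) (at_right 0)"
        by (rule filterlim_compose[OF poly_exp_decay filterlim_inverse_at_top_right])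
      then show ?thesis
        by (rule Lim_transform_eventually)
          (auto simp: eventually_at_right_less exp_inv_def field_simps
             intro!: eventually_mono[OF eventually_at_right_less])
    qed
    moreover have "((\<lambda>h. exp_inv p h / h) \<longlongrightarrow> 0) (at_left 0)"
      by (rule tendsto_eventually)
        (auto simp: exp_inv_def eventually_at_left_field intro!: exI[of _ "-1"])
    ultimately have "((\<lambda>h. exp_inv p h / h) \<longlongrightarrow> 0) (at 0)"
      using filterlim_split_at_real by blast
    then show ?thesis
      using 3 by (simp add: has_field_derivative_iff exp_inv_def)
  qed
qed

primrec exp_inv_poly :: "nat \<Rightarrow> real poly" where
  "exp_inv_poly 0 = 1"
| "exp_inv_poly (Suc k) = [:0, 0, 1:] * (exp_inv_poly k - pderiv (exp_inv_poly k))"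

definition bump1 :: "real \<Rightarrow> real" where
  "bump1 = exp_inv 1"

lemma bump1_bounds: "0 \<le> bump1 x" "bump1 x \<le> 1" "0 < bump1 x \<longleftrightarrow> 0 < x"
  by (auto simp: bump1_def exp_inv_def)

lemma C_k_bump1: "C_k k (\<lambda>x::'a::euclidean_space. bump1 (r * (x \<bullet> b) + s))"
proof -
  define F where "F = (\<lambda>k y. r ^ k * exp_inv (exp_inv_poly k) (r * y + s))"
  have "(F k has_real_derivative F (Suc k) y) (at y)" for k y
    unfolding F_def
    by (rule derivative_eq_intros DERIV_chain2[OF has_real_derivative_exp_inv] refl | simp)+
  from C_k_coord[of F, OF this, of k 0 b] show ?thesis
    by (simp add: F_def bump1_def)
qed

text \<open>Each coordinate contributes one bump rising from the lower face and one falling to the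
  upper face. The forms \<open>1 * _ + - _\<close> and \<open>- 1 * _ + _\<close> are instances of
  the affine argument in \<open>C_k_bump1\<close>.\<close>

definition box_bump :: "'a::euclidean_space \<Rightarrow> 'a \<Rightarrow> 'a \<Rightarrow> real" where
  "box_bump l u x = (\<Prod>i\<in>Basis. bump1 (1 * (x \<bullet> i) + - (l \<bullet> i)) * bump1 (- 1 * (x \<bullet> i) + u \<bullet> i))"

lemma box_bump_bounds: "0 \<le> box_bump l u x" "box_bump l u x \<le> 1"
  unfolding box_bump_def
  by (auto intro!: prod_nonneg prod_le_1 mult_nonneg_nonneg mult_le_one simp: bump1_bounds)

lemma box_bump_pos: "0 < box_bump l u x \<longleftrightarrow> x \<in> box l u"
proof -
  have "box_bump l u x \<noteq> 0 \<longleftrightarrow> x \<in> box l u"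
    using bump1_bounds(3)[THEN iffD2] bump1_bounds(1,3)
    unfolding box_bump_def mem_box by (auto simp: order.strict_iff_order)
  then show ?thesis
    using box_bump_bounds(1)[of l u x] by linarith
qed

text \<open>For a bump b with values in [0, 1] the functions 1 - (1 - b)^n tend to the indicator of
  the set where b is positive, and all of them vanish outside the same box. Plateau functions and
  convolutions are thereby avoided.\<close>

definition box_cutoff :: "'a::euclidean_space \<Rightarrow> 'a \<Rightarrow> nat \<Rightarrow> 'a \<Rightarrow> real" where
  "box_cutoff l u n x = 1 + - 1 * (1 + - 1 * box_bump l u x) ^ n"

lemma C_k_box_cutoff: "C_k k (box_cutoff l u n)"
  unfolding box_cutoff_def box_bump_def
  by (intro C_k_add C_k_mult C_k_const C_k_power C_k_prod C_k_bump1)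

lemma box_cutoff_bounds: "0 \<le> box_cutoff l u n x" "box_cutoff l u n x \<le> 1"
  using box_bump_bounds[of l u x] by (auto simp: box_cutoff_def power_le_one)

lemma box_cutoff_outside: "x \<notin> box l u \<Longrightarrow> box_cutoff l u n x = 0"
  using box_bump_pos[of l u x] box_bump_bounds(1)[of l u x] by (simp add: box_cutoff_def)

lemma box_cutoff_tendsto: "(\<lambda>n. box_cutoff l u n x) \<longlonglongrightarrow> indicator (box l u) x"
proof (cases "x \<in> box l u")
  case True
  have "(\<lambda>n. (1 - box_bump l u x) ^ n) \<longlonglongrightarrow> 0"
    using True box_bump_pos[of l u x] box_bump_bounds(2)[of l u x] by (intro LIMSEQ_realpow_zero) auto
  from tendsto_diff[OF tendsto_const this, of 1] True show ?thesis
    by (simp add: box_cutoff_def)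
qed (simp add: box_cutoff_outside)

lemma box_cutoff_test:
  assumes "cbox l u \<subseteq> \<Omega>"
  shows "box_cutoff l u n \<in> test_functions \<Omega>"
proof -
  have "{x. box_cutoff l u n x \<noteq> 0} \<subseteq> cbox l u"
    using box_cutoff_outside box_subset_cbox by blast
  then have "closure {x. box_cutoff l u n x \<noteq> 0} \<subseteq> cbox l u"
    by (intro closure_minimal closed_cbox)
  moreover from this have "compact (closure {x. box_cutoff l u n x \<noteq> 0})"
    by (metis bounded_cbox bounded_subset closed_closure compact_eq_bounded_closed)
  ultimately show ?thesis
    using assms by (auto simp: test_functions_def C_k_box_cutoff)
qed

section \<open>Stability properties of test functions\<close>

lemma test_function_differentiable: "\<phi> \<in> test_functions \<Omega> \<Longrightarrow> \<phi> differentiable (at x)"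
  unfolding test_functions_def using C_k.simps(2) by blast

lemma test_function_deriv:
  "\<phi> \<in> test_functions \<Omega> \<Longrightarrow> (\<phi> has_derivative frechet_derivative \<phi> (at x)) (at x)"
  using test_function_differentiable frechet_derivative_works by blast

lemma test_function_continuous: "\<phi> \<in> test_functions \<Omega> \<Longrightarrow> continuous_on S \<phi>"
  using test_function_differentiable
  by (metis continuous_at_imp_continuous_on differentiable_imp_continuous_within)

lemma test_function_subsupport:
  fixes f :: "'a::euclidean_space \<Rightarrow> real"
  assumes "f \<in> test_functions \<Omega>" "\<And>k. C_k k g" "{x. g x \<noteq> 0} \<subseteq> closure {x. f x \<noteq> 0}"
  shows "g \<in> test_functions \<Omega>"
proof -
  have "closure {x. g x \<noteq> 0} \<subseteq> closure {x. f x \<noteq> 0}"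
    using assms(3) by (simp add: closure_minimal)
  with assms show ?thesis
    unfolding test_functions_def
    by (auto simp: compact_eq_bounded_closed intro: bounded_subset)
qed

lemma test_function_mult:
  assumes "f \<in> test_functions \<Omega>" "\<And>k. C_k k g"
  shows "(\<lambda>x. g x * f x) \<in> test_functions \<Omega>"
  using assms(1)
  by (rule test_function_subsupport)
    (use assms closure_subset in \<open>fastforce intro: C_k_mult simp: test_functions_def\<close>)+

lemma test_function_partial:
  assumes "f \<in> test_functions \<Omega>" "b \<in> Basis"
  shows "partial b f \<in> test_functions \<Omega>"
  using assms(1)
proof (rule test_function_subsupport)
  show "C_k k (partial b f)" for k
    using assms C_k.simps(2) unfolding test_functions_def by blast
  show "{x. partial b f x \<noteq> 0} \<subseteq> closure {x. f x \<noteq> 0}"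
  proof (rule ccontr)
    assume "\<not> ?thesis"
    then obtain x where x: "partial b f x \<noteq> 0" "x \<in> - closure {x. f x \<noteq> 0}" by auto
    have "(f has_derivative (\<lambda>_. 0)) (at x)"
      by (rule has_derivative_transform_within_open[OF has_derivative_const[of 0] _ x(2)])
        (use closure_subset[of "{x. f x \<noteq> 0}"] in auto)
    from partial_eqI[OF this] x show False by simp
  qed
qed

lemma test_function_zero: "(\<lambda>x. 0) \<in> test_functions \<Omega>"
  by (simp add: test_functions_def C_k_const)

lemma test_function_support:
  "f \<in> test_functions \<Omega> \<Longrightarrow> compact (closure {x. f x \<noteq> 0})"
  "f \<in> test_functions \<Omega> \<Longrightarrow> closure {x. f x \<noteq> 0} \<subseteq> \<Omega>"
  by (auto simp: test_functions_def)

lemma test_function_add: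
  assumes "f \<in> test_functions \<Omega>" "g \<in> test_functions \<Omega>"
  shows "(\<lambda>x. f x + g x) \<in> test_functions \<Omega>"
proof -
  have "{x. f x + g x \<noteq> 0} \<subseteq> {x. f x \<noteq> 0} \<union> {x. g x \<noteq> 0}" by auto
  from closure_mono[OF this] have "closure {x. f x + g x \<noteq> 0} \<subseteq> closure {x. f x \<noteq> 0} \<union> closure {x. g x \<noteq> 0}"
    by simp
  moreover from this have "compact (closure {x. f x + g x \<noteq> 0})"
    using bounded_subset[OF bounded_Un[THEN iffD2, OF conjI]]
      assms[THEN test_function_support(1), THEN compact_imp_bounded]
    by (simp only: compact_eq_bounded_closed closed_closure) blast
  ultimately show ?thesis
    using assms by (auto simp: test_functions_def C_k_add)
qed

lemma test_function_scale: "f \<in> test_functions \<Omega> \<Longrightarrow> (\<lambda>x. c * f x) \<in> test_functions \<Omega>"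
  by (rule test_function_mult[OF _ C_k_const])

lemma test_function_outside: "f \<in> test_functions \<Omega> \<Longrightarrow> x \<notin> \<Omega> \<Longrightarrow> f x = 0"
  using closure_subset[of "{x. f x \<noteq> 0}"] by (auto simp: test_functions_def)

lemma test_function_bounded:
  assumes "f \<in> test_functions \<Omega>"
  obtains B where "0 \<le> B" "\<And>x. \<bar>f x\<bar> \<le> B"
proof -
  let ?K = "closure {x. f x \<noteq> 0}"
  have "compact (f ` ?K)"
    using assms test_function_continuous[OF assms] by (intro compact_continuous_image) (auto simp: test_functions_def)
  then obtain B where B: "\<And>x. x \<in> ?K \<Longrightarrow> \<bar>f x\<bar> \<le> B"
    using compact_imp_bounded bounded_iff by (metis image_eqI real_norm_def)
  have "\<bar>f x\<bar> \<le> max B 0" for x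
    using B[of x] closure_subset[of "{x. f x \<noteq> 0}"] by (cases "f x = 0") fastforce+
  then show ?thesis using that[of "max B 0"] by simp
qed

lemma test_function_borel: "f \<in> test_functions \<Omega> \<Longrightarrow> f \<in> borel_measurable borel"
  by (intro borel_measurable_continuous_onI test_function_continuous)

section \<open>Integrals of test functions and of their derivatives\<close>

lemma bounded_support_integrable:
  fixes f :: "'a::euclidean_space \<Rightarrow> real"
  assumes "f \<in> borel_measurable borel" "\<And>x. \<bar>f x\<bar> \<le> B" "\<And>x. R < norm x \<Longrightarrow> f x = 0"
  shows "integrable lborel f"
proof (rule Bochner_Integration.integrable_bound)
  show "integrable lborel (\<lambda>x::'a. B * indicat_real (cball 0 R) x)"
    by (intro integrable_mult_right integrable_real_indicator) (use emeasure_lborel_cball_finite in \<open>auto simp: infinity_ennreal_def\<close>)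
  show "AE x in lborel. norm (f x) \<le> norm (B * indicat_real (cball 0 R) x)"
    using assms(2) order_trans[OF abs_ge_zero assms(2)] assms(3)
    by (intro AE_I2) (auto simp: indicator_def not_le abs_of_nonneg)
qed (use assms in auto)

lemma test_function_norm_bound:
  assumes "f \<in> test_functions \<Omega>"
  obtains R where "0 < R" "\<And>x. R < norm x \<Longrightarrow> f x = 0"
proof -
  obtain R where R: "\<And>x. f x \<noteq> 0 \<Longrightarrow> norm x \<le> R"
    using test_function_support(1)[OF assms] closure_subset[of "{x. f x \<noteq> 0}"]
    by (auto dest!: compact_imp_bounded simp: bounded_iff)
  have "f x = 0" if "max R 1 < norm x" for x
    using R[of x] that by (cases "f x = 0") auto
  then show ?thesis using that[of "max R 1"] by force
qed

lemma test_function_integrable: "f \<in> test_functions \<Omega> \<Longrightarrow> integrable lborel f"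
proof -
  assume f: "f \<in> test_functions \<Omega>"
  obtain R where "\<And>x. R < norm x \<Longrightarrow> f x = 0"
    using test_function_norm_bound[OF f] by blast
  moreover obtain B where "\<And>x. \<bar>f x\<bar> \<le> B"
    using test_function_bounded[OF f] by blast
  ultimately show ?thesis
    using bounded_support_integrable[OF test_function_borel[OF f]] by blast
qed

lemma integral_translate:
  fixes f :: "'a::euclidean_space \<Rightarrow> real"
  assumes "f \<in> borel_measurable borel"
  shows "(LINT x|lborel. f (c + x)) = (LINT x|lborel. f x)"
proof -
  have "(LINT x|distr lborel borel ((+) c). f x) = (LINT x|lborel. f (c + x))"
    using assms by (intro integral_distr) auto
  then show ?thesis by (simp add: lborel_distr_plus)
qed

text \<open>By translation invariance all difference quotients integrate to zero.\<close>
lemma integral_partial_zero: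
  fixes f :: "'a::euclidean_space \<Rightarrow> real"
  assumes f: "f \<in> test_functions \<Omega>" and b: "b \<in> Basis"
  shows "(LINT x|lborel. partial b f x) = 0"
proof -
  define r where "r n = 1 / (real n + 1)" for n
  define D where "D n x = (f (r n *\<^sub>R b + x) - f x) / r n" for n x
  have r: "0 < r n" "r n \<le> 1" for n by (auto simp: r_def)
  have [measurable]: "f \<in> borel_measurable borel" by (rule test_function_borel[OF f])
  obtain R where R: "0 < R" "\<And>x. R < norm x \<Longrightarrow> f x = 0"
    using test_function_norm_bound[OF f] by blast
  obtain B where B: "0 \<le> B" "\<And>x. \<bar>partial b f x\<bar> \<le> B"
    using test_function_bounded[OF test_function_partial[OF f b]] by blast
  have der: "((\<lambda>s. f (s *\<^sub>R b + x)) has_real_derivative partial b f (s *\<^sub>R b + x)) (at s)" for s x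
  proof -
    let ?f' = "frechet_derivative f (at (s *\<^sub>R b + x))"
    have "((\<lambda>s. f (s *\<^sub>R b + x)) has_derivative (\<lambda>h. ?f' (h *\<^sub>R b))) (at s)"
      by (rule has_derivative_compose[OF _ test_function_deriv[OF f], of "\<lambda>s. s *\<^sub>R b + x"])
        (auto intro!: derivative_eq_intros)
    moreover have "?f' (h *\<^sub>R b) = h * partial b f (s *\<^sub>R b + x)" for h
      using linear_cmul[OF has_derivative_linear[OF test_function_deriv[OF f]]]
      by (simp add: partial_def)
    ultimately show ?thesis
      by (simp add: has_field_derivative_def mult.commute[of _ "partial b f (s *\<^sub>R b + x)"])
  qed
  have D_lim: "(\<lambda>n. D n x) \<longlonglongrightarrow> partial b f x" for x
  proof -
    have "((\<lambda>h. (f (h *\<^sub>R b + x) - f x) / h) \<longlongrightarrow> partial b f x) (at 0)"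
      using der[of x 0] by (simp add: has_field_derivative_iff)
    moreover have "filterlim r (at 0) sequentially"
      unfolding filterlim_at
    proof
      show "r \<longlonglongrightarrow> 0"
        using LIMSEQ_inverse_real_of_nat by (simp add: r_def[abs_def] inverse_eq_divide add.commute)
      show "\<forall>\<^sub>F n in sequentially. r n \<in> UNIV \<and> r n \<noteq> 0"
        using r(1) by (simp add: less_imp_neq[THEN not_sym])
    qed
    ultimately show ?thesis
      unfolding D_def by (rule filterlim_compose)
  qed
  \<comment> \<open>The mean value theorem bounds the quotients by the maximum of the derivative,
    and steps of length at most 1 keep them zero outside the ball of radius \<open>R + 1\<close>:
    this is the majorant for dominated convergence.\<close>
  have D_bound: "\<bar>D n x\<bar> \<le> B * indicator (cball 0 (R + 1)) x" for n x
  proof (cases "norm x \<le> R + 1")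
    case True
    obtain z where "f (r n *\<^sub>R b + x) - f (0 *\<^sub>R b + x) = (r n - 0) * partial b f (z *\<^sub>R b + x)"
      using MVT2[OF r(1)[of n] der[of x]] by metis
    then have "D n x = partial b f (z *\<^sub>R b + x)"
      using r(1)[of n] by (simp add: D_def)
    with B True show ?thesis by simp
  next
    case False
    have "norm (r n *\<^sub>R b) \<le> 1" using r[of n] b by simp
    then have "R < norm (r n *\<^sub>R b + x)"
      using False norm_triangle_ineq2[of x "- (r n *\<^sub>R b)"] by (simp add: add.commute)
    with False R show ?thesis by (simp add: D_def)
  qed
  have int0: "(LINT x|lborel. D n x) = 0" for n
  proof -
    have i: "integrable lborel f" by (rule test_function_integrable[OF f])
    have "integrable lborel (\<lambda>x. f (r n *\<^sub>R b + x))"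
    proof (rule integrable_distr[of "(+) (r n *\<^sub>R b)" lborel borel])
      show "integrable (distr lborel borel ((+) (r n *\<^sub>R b))) f"
        using i by (simp add: lborel_distr_plus)
    qed simp
    with i show ?thesis
      unfolding D_def using integral_translate[of f "r n *\<^sub>R b"] by simp
  qed
  have "(\<lambda>n. LINT x|lborel. D n x) \<longlonglongrightarrow> (LINT x|lborel. partial b f x)"
  proof (rule integral_dominated_convergence)
    show "integrable lborel (\<lambda>x::'a. B * indicat_real (cball 0 (R + 1)) x)"
      by (intro integrable_mult_right integrable_real_indicator) (use emeasure_lborel_cball_finite in \<open>auto simp: infinity_ennreal_def\<close>)
    show "partial b f \<in> borel_measurable lborel"
      using test_function_borel[OF test_function_partial[OF f b]] by simp
    show "D n \<in> borel_measurable lborel" for n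
      unfolding D_def by measurable
  qed (use D_lim D_bound in auto)
  then have "(\<lambda>n::nat. 0) \<longlonglongrightarrow> (LINT x|lborel. partial b f x)"
    by (simp only: int0)
  from LIMSEQ_unique[OF this tendsto_const] show ?thesis .
qed

section \<open>Square integrable functions\<close>

text \<open>Function spaces are sets of functions, so a vanishing norm does not identify an element;
  a semidefinite form on a carrier is the common structure of L2, of H1 and H10 with the gradient
  form, and of the finite element space. Symmetry and nonnegativity carry no membership conditions,
  which lets \<open>N_nonneg\<close> act as an unconditional simplification rule.\<close>

locale semi_inner =
  fixes V :: "('a \<Rightarrow> real) set" and ip :: "('a \<Rightarrow> real) \<Rightarrow> ('a \<Rightarrow> real) \<Rightarrow> real"
    and N :: "('a \<Rightarrow> real) \<Rightarrow> real"
  assumes zero_mem: "(\<lambda>x. 0) \<in> V"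
    and comb_mem: "u \<in> V \<Longrightarrow> v \<in> V \<Longrightarrow> (\<lambda>x. a * u x + b * v x) \<in> V"
    and sym: "ip u v = ip v u"
    and comb_left: "u \<in> V \<Longrightarrow> v \<in> V \<Longrightarrow> w \<in> V \<Longrightarrow>
      ip (\<lambda>x. a * u x + b * v x) w = a * ip u w + b * ip v w"
    and self_nonneg: "0 \<le> ip u u"
    and N_eq: "N u = sqrt (ip u u)"
begin

lemma N_nonneg [simp]: "0 \<le> N u" and N_sq: "(N u)\<^sup>2 = ip u u"
  by (simp_all add: N_eq self_nonneg)

lemma add_mem: "u \<in> V \<Longrightarrow> v \<in> V \<Longrightarrow> (\<lambda>x. u x + v x) \<in> V"
  using comb_mem[of u v 1 1] by simp

lemma diff_mem: "u \<in> V \<Longrightarrow> v \<in> V \<Longrightarrow> (\<lambda>x. u x - v x) \<in> V"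
  using comb_mem[of u v 1 "-1"] by simp

lemma scale_mem: "u \<in> V \<Longrightarrow> (\<lambda>x. a * u x) \<in> V"
  using comb_mem[of u u a 0] by simp

lemma sum_mem: "(\<And>i. i \<in> I \<Longrightarrow> f i \<in> V) \<Longrightarrow> (\<lambda>x. \<Sum>i\<in>I. c i * f i x) \<in> V"
proof (induction I rule: infinite_finite_induct)
  case (insert i I)
  then show ?case using comb_mem[of "f i" "\<lambda>x. \<Sum>i\<in>I. c i * f i x" "c i" 1] by simp
qed (simp_all add: zero_mem)

lemma comb_right: "u \<in> V \<Longrightarrow> v \<in> V \<Longrightarrow> w \<in> V \<Longrightarrow>
    ip w (\<lambda>x. a * u x + b * v x) = a * ip w u + b * ip w v"
  using comb_left[of u v w a b] sym by simp

lemma add_left: "u \<in> V \<Longrightarrow> v \<in> V \<Longrightarrow> w \<in> V \<Longrightarrow> ip (\<lambda>x. u x + v x) w = ip u w + ip v w"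
  using comb_left[of u v w 1 1] by simp

lemma diff_left: "u \<in> V \<Longrightarrow> v \<in> V \<Longrightarrow> w \<in> V \<Longrightarrow> ip (\<lambda>x. u x - v x) w = ip u w - ip v w"
  using comb_left[of u v w 1 "-1"] by simp

lemma diff_right: "u \<in> V \<Longrightarrow> v \<in> V \<Longrightarrow> w \<in> V \<Longrightarrow> ip w (\<lambda>x. u x - v x) = ip w u - ip w v"
  using comb_right[of u v w 1 "-1"] by simp

lemma scale_left: "u \<in> V \<Longrightarrow> w \<in> V \<Longrightarrow> ip (\<lambda>x. a * u x) w = a * ip u w"
  using comb_left[of u u w a 0] by simp

lemma scale_right: "u \<in> V \<Longrightarrow> w \<in> V \<Longrightarrow> ip w (\<lambda>x. a * u x) = a * ip w u"
  using scale_left sym by metis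

lemma zero_left: "w \<in> V \<Longrightarrow> ip (\<lambda>x. 0) w = 0"
  using scale_left[of w w 0] by simp

lemma N_zero: "N (\<lambda>x. 0) = 0"
  by (simp add: N_eq zero_left zero_mem)

lemma sum_left: "(\<And>i. i \<in> I \<Longrightarrow> f i \<in> V) \<Longrightarrow> w \<in> V \<Longrightarrow>
    ip (\<lambda>x. \<Sum>i\<in>I. c i * f i x) w = (\<Sum>i\<in>I. c i * ip (f i) w)"
proof (induction I rule: infinite_finite_induct)
  case (insert i I)
  then show ?case
    using comb_left[of "f i" "\<lambda>x. \<Sum>i\<in>I. c i * f i x" w "c i" 1] sum_mem[of I f c] by simp
qed (simp_all add: zero_left)

lemma sum_right: "(\<And>i. i \<in> I \<Longrightarrow> f i \<in> V) \<Longrightarrow> w \<in> V \<Longrightarrow>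
    ip w (\<lambda>x. \<Sum>i\<in>I. c i * f i x) = (\<Sum>i\<in>I. c i * ip w (f i))"
  using sum_left[of I f w c] sym by simp

lemma N_scale: "u \<in> V \<Longrightarrow> N (\<lambda>x. a * u x) = \<bar>a\<bar> * N u"
proof -
  assume "u \<in> V"
  then have "ip (\<lambda>x. a * u x) (\<lambda>x. a * u x) = a\<^sup>2 * ip u u"
    by (simp add: scale_left scale_right scale_mem power2_eq_square)
  then show ?thesis by (simp add: N_eq real_sqrt_mult)
qed

lemma comb_self: "u \<in> V \<Longrightarrow> v \<in> V \<Longrightarrow>
    ip (\<lambda>x. a * u x + b * v x) (\<lambda>x. a * u x + b * v x) = a\<^sup>2 * ip u u + 2 * a * b * ip u v + b\<^sup>2 * ip v v"
  using sym[of u v]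
  by (simp add: comb_left comb_right comb_mem power2_eq_square algebra_simps)

text \<open>The form may be degenerate. If \<open>ip v v = 0\<close>, the nonnegative quadratic is
  affine in \<open>b\<close> for fixed \<open>a\<close>, so its slope has to vanish; otherwise the
  usual choice of coefficients applies.\<close>

lemma cauchy_schwarz:
  assumes "u \<in> V" "v \<in> V"
  shows "\<bar>ip u v\<bar> \<le> N u * N v"
proof -
  have q: "0 \<le> a\<^sup>2 * ip u u + 2 * a * b * ip u v + b\<^sup>2 * ip v v" for a b
    using comb_self[OF assms, of a b] self_nonneg by metis
  have "(ip u v)\<^sup>2 \<le> ip u u * ip v v"
  proof (cases "ip v v = 0")
    case True
    have "ip u v = 0"
    proof (rule ccontr)
      assume nz: "ip u v \<noteq> 0"
      \<comment> \<open>This value of \<open>b\<close> would make the affine expression equal to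
        -1.\<close>
      have "0 \<le> ip u u + 2 * (- (ip u u + 1) / (2 * ip u v)) * ip u v"
        using q[of 1 "- (ip u u + 1) / (2 * ip u v)"] True by simp
      then show False using nz by (simp add: field_simps)
    qed
    then show ?thesis using self_nonneg by simp
  next
    case False
    then have "0 < ip v v" using self_nonneg[of v] by simp
    moreover have "0 \<le> ip v v * (ip u u * ip v v - (ip u v)\<^sup>2)"
      using q[of "ip v v" "- ip u v"] by (simp add: power2_eq_square algebra_simps)
    ultimately show ?thesis
      by (simp add: zero_le_mult_iff)
  qed
  then have "sqrt ((ip u v)\<^sup>2) \<le> sqrt (ip u u * ip v v)"
    by (rule real_sqrt_le_mono)
  then show ?thesis by (simp add: N_eq real_sqrt_mult)
qed

lemma triangle:
  assumes "u \<in> V" "v \<in> V"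
  shows "N (\<lambda>x. u x + v x) \<le> N u + N v"
proof (rule power2_le_imp_le)
  show "(N (\<lambda>x. u x + v x))\<^sup>2 \<le> (N u + N v)\<^sup>2"
    using comb_self[OF assms, of 1 1] cauchy_schwarz[OF assms]
    by (simp add: N_sq power2_sum)
qed simp

lemma N_minus_commute: "u \<in> V \<Longrightarrow> v \<in> V \<Longrightarrow> N (\<lambda>x. u x - v x) = N (\<lambda>x. v x - u x)"
  using N_scale[of "\<lambda>x. u x - v x" "-1"] diff_mem by simp

lemma triangle_diff: "u \<in> V \<Longrightarrow> v \<in> V \<Longrightarrow> N (\<lambda>x. u x - v x) \<le> N u + N v"
  using triangle[of u "\<lambda>x. (-1) * v x"] N_scale[of v "-1"] scale_mem[of v "-1"] by simp

lemma triangle_via: "u \<in> V \<Longrightarrow> v \<in> V \<Longrightarrow> w \<in> V \<Longrightarrow>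
    N (\<lambda>x. u x - w x) \<le> N (\<lambda>x. u x - v x) + N (\<lambda>x. v x - w x)"
  using triangle[of "\<lambda>x. u x - v x" "\<lambda>x. v x - w x"] diff_mem by simp

lemma N_le_diff: "u \<in> V \<Longrightarrow> v \<in> V \<Longrightarrow> N u \<le> N v + N (\<lambda>x. u x - v x)"
  using triangle[of v "\<lambda>x. u x - v x"] diff_mem by simp

text \<open>Takes the place of passing to a quotient: elements at distance zero are interchangeable
  inside the form. Every chosen representative is handled by this rule.\<close>

lemma ip_diff_zero:
  assumes "u \<in> V" "v \<in> V" "w \<in> V" "N (\<lambda>x. u x - v x) = 0"
  shows "ip u w = ip v w"
  using cauchy_schwarz[of "\<lambda>x. u x - v x" w] assms by (simp add: diff_mem diff_left)

lemma tendsto_ip: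
  assumes "\<And>n. s n \<in> V" "\<And>n. r n \<in> V" "u \<in> V" "v \<in> V"
    and s: "(\<lambda>n. N (\<lambda>x. s n x - u x)) \<longlonglongrightarrow> 0" and r: "(\<lambda>n. N (\<lambda>x. r n x - v x)) \<longlonglongrightarrow> 0"
  shows "(\<lambda>n. ip (s n) (r n)) \<longlonglongrightarrow> ip u v"
proof -
  have "\<bar>ip (s n) (r n) - ip u v\<bar> \<le>
      N (\<lambda>x. s n x - u x) * N (\<lambda>x. r n x - v x) + N (\<lambda>x. s n x - u x) * N v + N u * N (\<lambda>x. r n x - v x)" for n
  proof -
    have "ip (s n) (r n) - ip u v =
        ip (\<lambda>x. s n x - u x) (\<lambda>x. r n x - v x) + ip (\<lambda>x. s n x - u x) v + ip u (\<lambda>x. r n x - v x)"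
      using assms by (simp add: diff_left diff_right diff_mem)
    then show ?thesis
      using cauchy_schwarz[of "\<lambda>x. s n x - u x" "\<lambda>x. r n x - v x"]
        cauchy_schwarz[of "\<lambda>x. s n x - u x" v] cauchy_schwarz[of u "\<lambda>x. r n x - v x"] assms
      by (simp add: diff_mem)
  qed
  then have "\<forall>n. norm (ip (s n) (r n) - ip u v) \<le>
      N (\<lambda>x. s n x - u x) * N (\<lambda>x. r n x - v x) + N (\<lambda>x. s n x - u x) * N v + N u * N (\<lambda>x. r n x - v x)"
    by simp
  moreover have "(\<lambda>n. N (\<lambda>x. s n x - u x) * N (\<lambda>x. r n x - v x) + N (\<lambda>x. s n x - u x) * N v
      + N u * N (\<lambda>x. r n x - v x)) \<longlonglongrightarrow> 0"
    by (rule tendsto_eq_intros s r refl | simp)+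
  ultimately have "(\<lambda>n. ip (s n) (r n) - ip u v) \<longlonglongrightarrow> 0"
    by (rule Lim_null_comparison[OF always_eventually])
  then show ?thesis by (simp add: LIM_zero_cancel)
qed

lemma tendsto_N:
  assumes "\<And>n. s n \<in> V" "u \<in> V" "(\<lambda>n. N (\<lambda>x. s n x - u x)) \<longlonglongrightarrow> 0"
  shows "(\<lambda>n. N (s n)) \<longlonglongrightarrow> N u"
  unfolding N_eq by (intro tendsto_intros tendsto_ip assms)

end

section \<open>The space L2 as a semi-inner product space\<close>

lemma L2_measurable: "u \<in> L2 \<Omega> \<Longrightarrow> u \<in> borel_measurable (lebesgue_on \<Omega>)"
  and L2_square_integrable: "u \<in> L2 \<Omega> \<Longrightarrow> integrable (lebesgue_on \<Omega>) (\<lambda>x. (u x)\<^sup>2)"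
  by (auto simp: L2_def)

lemma L2_mult_integrable:
  assumes "u \<in> L2 \<Omega>" "v \<in> L2 \<Omega>"
  shows "integrable (lebesgue_on \<Omega>) (\<lambda>x. u x * v x)"
proof (rule Bochner_Integration.integrable_bound)
  show "integrable (lebesgue_on \<Omega>) (\<lambda>x. (u x)\<^sup>2 + (v x)\<^sup>2)"
    using assms by (auto simp: L2_def)
  have "\<bar>a * b\<bar> \<le> a\<^sup>2 + b\<^sup>2" for a b :: real
    unfolding abs_mult
    using sum_squares_bound[of "\<bar>a\<bar>" "\<bar>b\<bar>", unfolded power2_abs]
      mult_nonneg_nonneg[OF abs_ge_zero abs_ge_zero, of a b] by linarith
  then show "AE x in lebesgue_on \<Omega>. norm (u x * v x) \<le> norm ((u x)\<^sup>2 + (v x)\<^sup>2)"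
    by (auto intro!: AE_I2)
qed (use assms in \<open>auto simp: L2_def\<close>)

lemma L2_comb:
  assumes "u \<in> L2 \<Omega>" "v \<in> L2 \<Omega>"
  shows "(\<lambda>x. a * u x + b * v x) \<in> L2 \<Omega>"
proof -
  have "integrable (lebesgue_on \<Omega>) (\<lambda>x. a\<^sup>2 * (u x)\<^sup>2 + b\<^sup>2 * (v x)\<^sup>2 + 2 * a * b * (u x * v x))"
    using assms L2_mult_integrable[OF assms] by (auto simp: L2_def)
  then have "integrable (lebesgue_on \<Omega>) (\<lambda>x. (a * u x + b * v x)\<^sup>2)"
    by (simp add: power2_eq_square algebra_simps)
  with assms show ?thesis by (auto simp: L2_def)
qed

global_interpretation L2: semi_inner "L2 \<Omega>" "L2_inner \<Omega>" "L2_norm \<Omega>" for \<Omega> :: "'a::euclidean_space set"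
proof
  show "(\<lambda>x. 0) \<in> L2 \<Omega>" by (simp add: L2_def)
  show "L2_inner \<Omega> u v = L2_inner \<Omega> v u" for u v by (simp add: L2_inner_def mult.commute)
  show "0 \<le> L2_inner \<Omega> u u" for u by (simp add: L2_inner_def)
  show "L2_inner \<Omega> (\<lambda>x. a * u x + b * v x) w = a * L2_inner \<Omega> u w + b * L2_inner \<Omega> v w"
    if "u \<in> L2 \<Omega>" "v \<in> L2 \<Omega>" "w \<in> L2 \<Omega>" for u v w a b
    using L2_mult_integrable[OF that(1,3)] L2_mult_integrable[OF that(2,3)]
    by (simp add: L2_inner_def distrib_right mult.assoc)
qed (simp_all add: L2_comb L2_norm_def)

lemma L2_norm_eq: "(L2_norm \<Omega> u)\<^sup>2 = (LINT x|lebesgue_on \<Omega>. (u x)\<^sup>2)"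
  unfolding L2.N_sq L2_inner_def by (simp add: power2_eq_square)

lemma L2_bound:
  assumes "g \<in> L2 \<Omega>" "f \<in> borel_measurable (lebesgue_on \<Omega>)" "AE x in lebesgue_on \<Omega>. \<bar>f x\<bar> \<le> \<bar>g x\<bar>"
  shows "f \<in> L2 \<Omega>"
proof -
  have "integrable (lebesgue_on \<Omega>) (\<lambda>x. (f x)\<^sup>2)"
    by (rule Bochner_Integration.integrable_bound[OF L2_square_integrable[OF assms(1)]])
      (use assms in \<open>auto simp: abs_le_square_iff\<close>)
  with assms(2) show ?thesis by (simp add: L2_def)
qed

lemma L2_norm_cong_AE:
  assumes "u \<in> borel_measurable (lebesgue_on \<Omega>)" "v \<in> borel_measurable (lebesgue_on \<Omega>)"
    "AE x in lebesgue_on \<Omega>. u x = v x"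
  shows "L2_norm \<Omega> u = L2_norm \<Omega> v"
proof -
  have "L2_inner \<Omega> u u = L2_inner \<Omega> v v"
    unfolding L2_inner_def by (rule integral_cong_AE) (use assms in auto)
  then show ?thesis by (simp add: L2_norm_def)
qed

lemma L2_norm_zero_AE:
  assumes "u \<in> L2 \<Omega>" "L2_norm \<Omega> u = 0"
  shows "AE x in lebesgue_on \<Omega>. u x = 0"
proof -
  have "(LINT x|lebesgue_on \<Omega>. (u x)\<^sup>2) = 0"
    using L2_norm_eq[of \<Omega> u] assms(2) by simp
  then have "AE x in lebesgue_on \<Omega>. (u x)\<^sup>2 = 0"
    by (subst (asm) integral_nonneg_eq_0_iff_AE) (use assms in \<open>auto simp: L2_square_integrable\<close>)
  then show ?thesis by simp
qed

text \<open>Dominated convergence for the squares, with majorant (2g)^2. Membership of the limit and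
  of the terms is part of the conclusion, so that only measurability and pointwise bounds have to be
  checked when it is applied.\<close>

lemma L2_dominated:
  assumes "g \<in> L2 \<Omega>" "\<And>n. f n \<in> borel_measurable (lebesgue_on \<Omega>)" "F \<in> borel_measurable (lebesgue_on \<Omega>)"
    and lim: "AE x in lebesgue_on \<Omega>. (\<lambda>n. f n x) \<longlonglongrightarrow> F x"
    and bd: "\<And>n. AE x in lebesgue_on \<Omega>. \<bar>f n x\<bar> \<le> g x"
  shows "F \<in> L2 \<Omega>" "\<And>n. f n \<in> L2 \<Omega>" "(\<lambda>n. L2_norm \<Omega> (\<lambda>x. F x - f n x)) \<longlonglongrightarrow> 0"
proof -
  have all: "AE x in lebesgue_on \<Omega>. \<forall>n. \<bar>f n x\<bar> \<le> g x"
    using bd by (simp add: AE_all_countable)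
  have F: "AE x in lebesgue_on \<Omega>. \<bar>F x\<bar> \<le> g x"
    using all lim
  proof eventually_elim
    case (elim x)
    then show ?case by (intro LIMSEQ_le_const2[OF tendsto_rabs[OF elim(2)]]) auto
  qed
  show "F \<in> L2 \<Omega>"
    by (rule L2_bound[OF assms(1,3)]) (use F in auto)
  show "f n \<in> L2 \<Omega>" for n
    by (rule L2_bound[OF assms(1,2)]) (use bd[of n] in auto)
  have "(\<lambda>n. LINT x|lebesgue_on \<Omega>. (F x - f n x)\<^sup>2) \<longlonglongrightarrow> (LINT x|lebesgue_on \<Omega>. 0)"
  proof (rule integral_dominated_convergence)
    show "integrable (lebesgue_on \<Omega>) (\<lambda>x. (2 * g x)\<^sup>2)"
      using L2_square_integrable[OF L2.scale_mem[OF assms(1)]] .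
    show "AE x in lebesgue_on \<Omega>. (\<lambda>n. (F x - f n x)\<^sup>2) \<longlonglongrightarrow> 0"
      using lim
    proof eventually_elim
      case (elim x)
      then show ?case using tendsto_power[OF tendsto_diff[OF tendsto_const elim], of "F x" 2] by simp
    qed
    show "AE x in lebesgue_on \<Omega>. norm ((F x - f n x)\<^sup>2) \<le> (2 * g x)\<^sup>2" for n
      using all F
    proof eventually_elim
      case (elim x)
      then have "\<bar>F x - f n x\<bar> \<le> 2 * g x" using abs_triangle_ineq4[of "F x" "f n x"] by (auto dest: spec[of _ n])
      then have "\<bar>F x - f n x\<bar>\<^sup>2 \<le> (2 * g x)\<^sup>2" by (intro power_mono) auto
      then show ?case by simp
    qed
  qed (use assms in auto)
  then have "(\<lambda>n. sqrt ((L2_norm \<Omega> (\<lambda>x. F x - f n x))\<^sup>2)) \<longlonglongrightarrow> sqrt 0"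
    unfolding L2_norm_eq by (intro tendsto_intros) simp
  then show "(\<lambda>n. L2_norm \<Omega> (\<lambda>x. F x - f n x)) \<longlonglongrightarrow> 0" by simp
qed

section \<open>Density of the test functions in L2\<close>

lemma borel_lebesgue_on: "f \<in> borel_measurable borel \<Longrightarrow> f \<in> borel_measurable (lebesgue_on \<Omega>)"
  by (simp add: measurable_completion measurable_restrict_space1)

lemma integral_lebesgue_on_outside:
  fixes f :: "'a::euclidean_space \<Rightarrow> real"
  assumes "\<Omega> \<in> sets lebesgue" "f \<in> borel_measurable borel" "\<And>x. x \<notin> \<Omega> \<Longrightarrow> f x = 0"
  shows "(LINT x|lebesgue_on \<Omega>. f x) = (LINT x|lborel. f x)"
    and "integrable (lebesgue_on \<Omega>) f \<longleftrightarrow> integrable lborel f"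
proof -
  have "(\<lambda>x. indicator \<Omega> x *\<^sub>R f x) = f"
    using assms(3) by (force simp: indicator_def)
  with assms show "(LINT x|lebesgue_on \<Omega>. f x) = (LINT x|lborel. f x)"
    "integrable (lebesgue_on \<Omega>) f \<longleftrightarrow> integrable lborel f"
    by (simp_all add: integral_restrict_space integrable_restrict_space integral_completion integrable_completion)
qed

lemma test_function_L2:
  assumes "open \<Omega>" "\<phi> \<in> test_functions \<Omega>"
  shows "\<phi> \<in> L2 \<Omega>"
proof -
  have *: "(\<lambda>x. \<phi> x * \<phi> x) \<in> test_functions \<Omega>"
    by (rule test_function_mult[OF assms(2)]) (use assms in \<open>auto simp: test_functions_def\<close>)
  have "integrable (lebesgue_on \<Omega>) (\<lambda>x. \<phi> x * \<phi> x)"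
    by (subst integral_lebesgue_on_outside(2))
      (use assms test_function_integrable[OF *] test_function_outside[OF *] test_function_borel[OF *] in auto)
  then show ?thesis
    using borel_lebesgue_on[OF test_function_borel[OF assms(2)]] by (simp add: L2_def power2_eq_square)
qed

text \<open>The L2 closure of the test functions. As a named set it can be shown to be stable under
  linear combinations and dominated limits, until it exhausts L2.\<close>

definition test_closure :: "'a::euclidean_space set \<Rightarrow> ('a \<Rightarrow> real) set" where
  "test_closure \<Omega> = {f \<in> L2 \<Omega>. \<forall>\<epsilon>>0. \<exists>\<phi>\<in>test_functions \<Omega>. L2_norm \<Omega> (\<lambda>x. f x - \<phi> x) < \<epsilon>}"

lemma test_closure_limit:
  assumes "open \<Omega>" "\<And>n::nat. f n \<in> test_closure \<Omega>" "F \<in> L2 \<Omega>"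
    "(\<lambda>n. L2_norm \<Omega> (\<lambda>x. F x - f n x)) \<longlonglongrightarrow> 0"
  shows "F \<in> test_closure \<Omega>"
proof -
  have "\<exists>\<phi>\<in>test_functions \<Omega>. L2_norm \<Omega> (\<lambda>x. F x - \<phi> x) < \<epsilon>" if "0 < \<epsilon>" for \<epsilon>
  proof -
    have "0 < \<epsilon> / 2" using that by simp
    then obtain n where n: "L2_norm \<Omega> (\<lambda>x. F x - f n x) < \<epsilon> / 2"
      using eventually_happens'[OF sequentially_bot order_tendstoD(2)[OF assms(4)]] by blast
    obtain \<phi> where \<phi>: "\<phi> \<in> test_functions \<Omega>" "L2_norm \<Omega> (\<lambda>x. f n x - \<phi> x) < \<epsilon> / 2"
      using assms(2)[of n] \<open>0 < \<epsilon> / 2\<close> unfolding test_closure_def by blast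
    have "L2_norm \<Omega> (\<lambda>x. F x - \<phi> x) < \<epsilon>"
      using L2.triangle_via[OF assms(3), of "f n" \<phi>] n \<phi> assms(2)[of n] test_function_L2[OF assms(1) \<phi>(1)]
      by (simp add: test_closure_def)
    with \<phi> show ?thesis by blast
  qed
  with assms show ?thesis by (simp add: test_closure_def)
qed

lemma test_function_closure:
  assumes "open \<Omega>" "\<phi> \<in> test_functions \<Omega>"
  shows "\<phi> \<in> test_closure \<Omega>"
  using assms test_function_L2[OF assms]
  by (auto simp: test_closure_def L2.N_zero intro!: bexI[of _ \<phi>])

lemma test_closure_comb:
  assumes "open \<Omega>" "f \<in> test_closure \<Omega>" "g \<in> test_closure \<Omega>"
  shows "(\<lambda>x. a * f x + b * g x) \<in> test_closure \<Omega>"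
proof -
  have L: "f \<in> L2 \<Omega>" "g \<in> L2 \<Omega>" using assms by (auto simp: test_closure_def)
  have "\<exists>\<phi>\<in>test_functions \<Omega>. L2_norm \<Omega> (\<lambda>x. a * f x + b * g x - \<phi> x) < \<epsilon>" if "0 < \<epsilon>" for \<epsilon>
  proof -
    define \<delta> where "\<delta> = \<epsilon> / (\<bar>a\<bar> + \<bar>b\<bar> + 1)"
    have \<delta>: "0 < \<delta>" using that by (simp add: \<delta>_def)
    obtain \<phi> where \<phi>: "\<phi> \<in> test_functions \<Omega>" "L2_norm \<Omega> (\<lambda>x. f x - \<phi> x) < \<delta>"
      using assms(2) \<delta> by (auto simp: test_closure_def)
    obtain \<psi> where \<psi>: "\<psi> \<in> test_functions \<Omega>" "L2_norm \<Omega> (\<lambda>x. g x - \<psi> x) < \<delta>"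
      using assms(3) \<delta> by (auto simp: test_closure_def)
    have d: "(\<lambda>x. f x - \<phi> x) \<in> L2 \<Omega>" "(\<lambda>x. g x - \<psi> x) \<in> L2 \<Omega>"
      using L \<phi> \<psi> assms(1) by (simp_all add: L2.diff_mem test_function_L2)
    have "L2_norm \<Omega> (\<lambda>x. a * f x + b * g x - (a * \<phi> x + b * \<psi> x))
        = L2_norm \<Omega> (\<lambda>x. a * (f x - \<phi> x) + b * (g x - \<psi> x))"
      by (simp add: algebra_simps)
    also have "\<dots> \<le> \<bar>a\<bar> * L2_norm \<Omega> (\<lambda>x. f x - \<phi> x) + \<bar>b\<bar> * L2_norm \<Omega> (\<lambda>x. g x - \<psi> x)"
      using L2.triangle[OF L2.scale_mem[OF d(1), of a] L2.scale_mem[OF d(2), of b]] d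
      by (simp add: L2.N_scale)
    also have "\<dots> \<le> \<bar>a\<bar> * \<delta> + \<bar>b\<bar> * \<delta>"
      using \<phi> \<psi> by (intro add_mono mult_left_mono) auto
    also have "\<dots> < \<epsilon>"
      using that by (simp add: \<delta>_def field_simps add_pos_nonneg add_nonneg_pos)
    finally show ?thesis
      using \<phi> \<psi> by (intro bexI[of _ "\<lambda>x. a * \<phi> x + b * \<psi> x"] test_function_add test_function_scale)
  qed
  with L show ?thesis by (simp add: test_closure_def L2_comb)
qed

lemma test_closure_sum:
  assumes "open \<Omega>"
  shows "(\<And>i. i \<in> I \<Longrightarrow> f i \<in> test_closure \<Omega>) \<Longrightarrow> (\<lambda>x. \<Sum>i\<in>I. c i * f i x) \<in> test_closure \<Omega>"
proof (induction I rule: infinite_finite_induct)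
  case (insert i I)
  then show ?case
    using test_closure_comb[OF assms, of "f i" "\<lambda>x. \<Sum>i\<in>I. c i * f i x" "c i" 1] by simp
qed (simp_all add: test_function_closure[OF assms test_function_zero])

lemma indicator_bounded_L2:
  fixes A :: "'a::euclidean_space set"
  assumes "open \<Omega>" "bounded A" "A \<in> sets borel"
  shows "indicat_real A \<in> L2 \<Omega>"
proof -
  have "emeasure lborel A < \<infinity>" using emeasure_bounded_finite[OF assms(2)] by simp
  then have "integrable lborel (indicat_real A)"
    using assms by (intro integrable_real_indicator) auto
  then have "integrable lebesgue (indicat_real A)"
    using assms by (subst integrable_completion) auto
  then have "integrable (lebesgue_on \<Omega>) (indicat_real A)"
    using assms(1) integrable_mult_indicator[of \<Omega> lebesgue "indicat_real A"]
    by (subst integrable_restrict_space) auto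
  moreover have "(\<lambda>x. (indicat_real A x)\<^sup>2) = indicat_real A"
    by (auto simp: indicator_def)
  ultimately show ?thesis
    using assms by (auto simp: L2_def intro!: borel_lebesgue_on)
qed

lemma test_closure_dominated:
  assumes "open \<Omega>" "g \<in> L2 \<Omega>" "\<And>n::nat. f n \<in> test_closure \<Omega>" "F \<in> borel_measurable (lebesgue_on \<Omega>)"
    "AE x in lebesgue_on \<Omega>. (\<lambda>n. f n x) \<longlonglongrightarrow> F x" "\<And>n. AE x in lebesgue_on \<Omega>. \<bar>f n x\<bar> \<le> g x"
  shows "F \<in> test_closure \<Omega>"
proof -
  have m: "f n \<in> borel_measurable (lebesgue_on \<Omega>)" for n
    using assms(3) by (auto simp: test_closure_def L2_def)
  note d = L2_dominated[OF assms(2) m assms(4-6)]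
  show ?thesis by (rule test_closure_limit[OF assms(1,3) d(1,3)])
qed

text \<open>A Dynkin argument: the sets \<open>A\<close> with this property contain the boxes, which
  form an intersection stable generator of the Borel sets, and are closed under complements and
  countable disjoint unions. Cutting with one fixed box supplies an L2 majorant and keeps everything
  inside \<Omega>.\<close>

lemma box_test_closure:
  fixes \<Omega> :: "'a::euclidean_space set"
  assumes "open \<Omega>" "cbox l u \<subseteq> \<Omega>" "A \<in> sets borel"
  shows "indicat_real (A \<inter> box l u) \<in> test_closure \<Omega>"
proof -
  let ?G = "range (\<lambda>(a, b). box a b :: 'a set)"
  have bd: "indicat_real (S \<inter> box l u) \<in> L2 \<Omega>" if "S \<in> sets borel" for S
    using that assms(1) bounded_subset[OF bounded_box[of l u], of "S \<inter> box l u"]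
    by (intro indicator_bounded_L2) auto
  have bd': "indicat_real (box l u) \<in> L2 \<Omega>" using bd[of UNIV] by simp
  have boxes: "indicat_real (box l' u') \<in> test_closure \<Omega>" if "cbox l' u' \<subseteq> \<Omega>" for l' u' :: 'a
  proof (rule test_closure_dominated[OF assms(1)])
    show "indicat_real (box l' u') \<in> L2 \<Omega>"
      using assms(1) by (intro indicator_bounded_L2) auto
    show "box_cutoff l' u' n \<in> test_closure \<Omega>" for n
      by (rule test_function_closure[OF assms(1) box_cutoff_test[OF that]])
    show "AE x in lebesgue_on \<Omega>. (\<lambda>n. box_cutoff l' u' n x) \<longlonglongrightarrow> indicat_real (box l' u') x"
      using box_cutoff_tendsto by (intro AE_I2)
    show "AE x in lebesgue_on \<Omega>. \<bar>box_cutoff l' u' n x\<bar> \<le> indicat_real (box l' u') x" for n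
      using box_cutoff_bounds[of l' u' n] box_cutoff_outside[of _ l' u' n]
      by (intro AE_I2) (auto simp: indicator_def)
  qed (auto intro!: borel_lebesgue_on)
  have box_closure: "indicat_real (box l u) \<in> test_closure \<Omega>"
    by (rule boxes[OF assms(2)])
  have sets_eq: "sigma_sets UNIV ?G = sets borel"
    by (subst borel_eq_box) simp
  have A: "A \<in> sigma_sets UNIV ?G" using assms(3) sets_eq by simp
  have stable: "Int_stable ?G"
    by (auto simp: Int_stable_def box_Int_box)
  have sub: "?G \<subseteq> Pow UNIV" by simp
  from stable sub A show ?thesis
  proof (induction rule: sigma_sets_induct_disjoint)
    case (basic B)
    then obtain a b where "B = box a b" by auto
    then obtain a' b' where eq: "B \<inter> box l u = box a' b'" using box_Int_box[of a b l u] by blast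
    \<comment> \<open>Only a nonempty open box has the corresponding closed box as its closure; for
      such a box the inclusion in \<open>cbox l u\<close> carries over.\<close>
    show ?case
    proof (cases "box a' b' = {}")
      case True
      then show ?thesis
        using test_function_closure[OF assms(1) test_function_zero] eq by (simp add: indicator_def)
    next
      case False
      have "cbox a' b' = closure (B \<inter> box l u)" using False eq by (simp add: closure_box)
      also have "\<dots> \<subseteq> cbox l u" by (intro closure_minimal) (auto simp: box_subset_cbox[THEN subsetD])
      finally show ?thesis using boxes[of a' b'] assms(2) eq by auto
    qed
  next
    case empty
    show ?case
      using test_function_closure[OF assms(1) test_function_zero] by (simp add: indicator_def)
  next
    case (compl B)
    have "indicat_real ((UNIV - B) \<inter> box l u) = (\<lambda>x. 1 * indicat_real (box l u) x + (-1) * indicat_real (B \<inter> box l u) x)"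
      by (auto simp: indicator_def)
    with test_closure_comb[OF assms(1) box_closure compl(2), of 1 "-1"] show ?case by simp
  next
    case (union B)
    have B: "B i \<in> sets borel" for i using union(2) sets_eq by auto
    show ?case
    proof (rule test_closure_dominated[OF assms(1) bd'])
      show "(\<lambda>x. \<Sum>i<n. 1 * indicat_real (B i \<inter> box l u) x) \<in> test_closure \<Omega>" for n
        by (rule test_closure_sum[OF assms(1) union(3)])
      have eq: "(\<Sum>i<n. 1 * indicat_real (B i \<inter> box l u) x) = indicat_real ((\<Union>i<n. B i) \<inter> box l u) x" for n x
      proof -
        have "indicat_real (\<Union>i<n. B i) x = (\<Sum>i<n. indicat_real (B i) x)"
          using union(1) disjoint_family_on_mono[of "{..<n}" UNIV B]
          by (intro indicator_UN_disjoint) auto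
        then show ?thesis
          by (simp add: indicator_inter_arith sum_distrib_right[symmetric])
      qed
      show "AE x in lebesgue_on \<Omega>. \<bar>\<Sum>i<n. 1 * indicat_real (B i \<inter> box l u) x\<bar> \<le> indicat_real (box l u) x" for n
        unfolding eq by (intro AE_I2) (auto simp: indicator_def)
      show "AE x in lebesgue_on \<Omega>. (\<lambda>n. \<Sum>i<n. 1 * indicat_real (B i \<inter> box l u) x)
          \<longlonglongrightarrow> indicat_real ((\<Union>i. B i) \<inter> box l u) x"
        unfolding eq unfolding indicator_inter_arith
        by (intro AE_I2 tendsto_mult tendsto_const LIMSEQ_indicator_UN)
      show "indicat_real ((\<Union>i. B i) \<inter> box l u) \<in> borel_measurable (lebesgue_on \<Omega>)"
        using B by (intro borel_lebesgue_on) auto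
    qed
  qed
qed

text \<open>Up to the faces of countably many boxes, \<Omega> is exhausted by finite unions
  \<open>U n\<close> of open boxes. Simple functions approximating a Borel version of
  \<open>f\<close>, cut off to \<open>U n\<close>, are finite combinations of indicators that
  already lie in the closure, and they are dominated by 2|f|.\<close>

theorem L2_dense:
  fixes \<Omega> :: "'a::euclidean_space set"
  assumes "open \<Omega>" "f \<in> L2 \<Omega>"
  shows "f \<in> test_closure \<Omega>"
proof (cases "\<Omega> = {}")
  case True
  then have "L2_norm \<Omega> g = 0" for g
    by (simp add: L2_norm_def L2_inner_def)
  then show ?thesis
    using assms(2) test_function_zero by (auto simp: test_closure_def intro: bexI[of _ "\<lambda>x. 0"])
next
  case False
  obtain D where D: "countable D" "D \<subseteq> Pow \<Omega>" "\<And>X. X \<in> D \<Longrightarrow> \<exists>a b. X = cbox a b" "\<Union>D = \<Omega>"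
    using open_countable_Union_open_cbox[OF assms(1)] by metis
  have "D \<noteq> {}" using D(4) False by auto
  then have range_D: "range (from_nat_into D) = D" using D(1) by (rule range_from_nat_into)
  then have "\<forall>n. \<exists>a b. from_nat_into D n = cbox a b" using D(3) by blast
  then obtain l r where lr: "\<And>n. from_nat_into D n = cbox (l n) (r n)" by metis
  have sub: "cbox (l n) (r n) \<subseteq> \<Omega>" for n
    using D(2) range_D lr by (metis PowD rangeI subsetD)
  have cover: "(\<Union>n. cbox (l n) (r n)) = \<Omega>"
    using D(4) range_D lr by (metis (no_types, lifting) SUP_cong)
  define U where "U n = (\<Union>i<n. box (l i) (r i))" for n :: nat
  have [measurable]: "U n \<in> sets borel" for n by (auto simp: U_def)
  have ind_U: "indicat_real (A \<inter> U n) \<in> test_closure \<Omega>" if "A \<in> sets borel" for A n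
    using that
  proof (induction n)
    case 0
    then show ?case using test_function_closure[OF assms(1) test_function_zero] by (simp add: U_def indicator_def)
  next
    case (Suc n)
    have "indicat_real (A \<inter> U (Suc n)) =
        (\<lambda>x. 1 * indicat_real (A \<inter> U n) x + 1 * indicat_real ((A - U n) \<inter> box (l n) (r n)) x)"
      by (rule ext) (auto simp: U_def lessThan_Suc indicator_def)
    moreover have "A - U n \<in> sets borel" using Suc.prems by auto
    ultimately show ?case
      using test_closure_comb[OF assms(1) Suc.IH[OF Suc.prems] box_test_closure[OF assms(1) sub], of "A - U n" 1 1]
      by simp
  qed
  have fm: "f \<in> borel_measurable (lebesgue_on \<Omega>)" using assms(2) by (rule L2_measurable)
  then have "(\<lambda>x. if x \<in> \<Omega> then f x else 0) \<in> borel_measurable lebesgue"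
    using assms(1) by (simp add: borel_measurable_if)
  \<comment> \<open>So far the closure is known to contain indicators of Borel sets only, while
    \<open>f\<close> is Lebesgue measurable; hence the passage to a Borel function that agrees with
    it almost everywhere.\<close>
  then obtain f' where f': "f' \<in> borel_measurable lborel" "AE x in lborel. (if x \<in> \<Omega> then f x else 0) = f' x"
    using completion_ex_borel_measurable_real by blast
  obtain s where s: "\<And>i. simple_function lborel (s i)" "\<And>x. (\<lambda>i. s i x) \<longlonglongrightarrow> f' x"
      "\<And>i x. \<bar>s i x\<bar> \<le> 2 * \<bar>f' x\<bar>"
    using borel_measurable_implies_sequence_metric[OF f'(1), of 0] by (auto simp: dist_real_def)
  define g where "g n x = (\<Sum>y\<in>range (s n). y * indicat_real (s n -` {y} \<inter> U n) x)" for n x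
  have g_eq: "g n x = s n x * indicat_real (U n) x" for n x
  proof -
    have "g n x = (\<Sum>y\<in>range (s n). if y = s n x then y * indicat_real (U n) x else 0)"
      unfolding g_def by (intro sum.cong) (auto simp: indicator_def)
    also have "\<dots> = s n x * indicat_real (U n) x"
      using simple_functionD(1)[OF s(1)[of n]] by (subst sum.delta) auto
    finally show ?thesis .
  qed
  have ae: "AE x in lebesgue_on \<Omega>. f x = f' x"
  proof -
    have "AE x in lebesgue. (if x \<in> \<Omega> then f x else 0) = f' x"
      using f'(2) by (rule AE_completion)
    then show ?thesis
      using assms(1) by (subst AE_restrict_space_iff) auto
  qed
  \<comment> \<open>The closed boxes cover \<Omega>, but the sets \<open>U n\<close> are built from
    open ones; the faces in between form a null set.\<close>
  have ae_box: "AE x in lebesgue_on \<Omega>. \<forall>n. x \<in> cbox (l n) (r n) \<longrightarrow> x \<in> box (l n) (r n)"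
  proof -
    have "AE x in lebesgue. x \<notin> cbox (l n) (r n) - box (l n) (r n)" for n
      using negligible_frontier_interval[of "l n" "r n"]
      by (intro AE_not_in) (simp add: negligible_iff_null_sets)
    then have "AE x in lebesgue. \<forall>n. x \<notin> cbox (l n) (r n) - box (l n) (r n)"
      by (simp add: AE_all_countable)
    then show ?thesis
      using assms(1) by (subst AE_restrict_space_iff) auto
  qed
  show ?thesis
  proof (rule test_closure_dominated[OF assms(1), where g = "\<lambda>x. 2 * \<bar>f x\<bar>" and f = g])
    have "(\<lambda>x. \<bar>f x\<bar>) \<in> L2 \<Omega>" using fm by (intro L2_bound[OF assms(2)]) auto
    then show "(\<lambda>x. 2 * \<bar>f x\<bar>) \<in> L2 \<Omega>" by (rule L2.scale_mem)
    show "g n \<in> test_closure \<Omega>" for n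
      unfolding g_def[abs_def]
    proof (rule test_closure_sum[OF assms(1)])
      fix y
      have "s n -` {y} \<in> sets borel"
        using simple_functionD(2)[OF s(1)[of n], of "{y}"] by simp
      then show "indicat_real (s n -` {y} \<inter> U n) \<in> test_closure \<Omega>" by (rule ind_U)
    qed
    show "f \<in> borel_measurable (lebesgue_on \<Omega>)" by (rule fm)
    show "AE x in lebesgue_on \<Omega>. (\<lambda>n. g n x) \<longlonglongrightarrow> f x"
      using ae ae_box AE_space
    proof eventually_elim
      case (elim x)
      then have "x \<in> (\<Union>n. cbox (l n) (r n))" using cover by (simp add: space_restrict_space)
      then obtain k where "x \<in> box (l k) (r k)" using elim by blast
      then have "x \<in> U n" if "n > k" for n using that by (auto simp: U_def)
      then have "eventually (\<lambda>n. s n x = g n x) sequentially"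
        unfolding eventually_sequentially g_eq by (auto intro!: exI[of _ "Suc k"])
      from Lim_transform_eventually[OF s(2) this] elim show ?case by simp
    qed
    show "AE x in lebesgue_on \<Omega>. \<bar>g n x\<bar> \<le> 2 * \<bar>f x\<bar>" for n
      using ae
    proof eventually_elim
      case (elim x)
      have "\<bar>g n x\<bar> \<le> \<bar>s n x\<bar>" by (simp add: g_eq indicator_def)
      also have "\<dots> \<le> 2 * \<bar>f x\<bar>" using s(3)[of n x] elim by simp
      finally show ?case .
    qed
  qed
qed

lemma L2_approx:
  assumes "open \<Omega>" "f \<in> L2 \<Omega>" "0 < \<epsilon>"
  obtains \<phi> where "\<phi> \<in> test_functions \<Omega>" "L2_norm \<Omega> (\<lambda>x. f x - \<phi> x) < \<epsilon>"
  using L2_dense[OF assms(1,2)] assms(3) by (auto simp: test_closure_def)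

lemma L2_approx_sequence:
  assumes "open \<Omega>" "f \<in> L2 \<Omega>"
  obtains \<phi> :: "nat \<Rightarrow> 'a::euclidean_space \<Rightarrow> real"
  where "\<And>n. \<phi> n \<in> test_functions \<Omega>" "(\<lambda>n. L2_norm \<Omega> (\<lambda>x. f x - \<phi> n x)) \<longlonglongrightarrow> 0"
proof -
  have "\<exists>\<phi>\<in>test_functions \<Omega>. L2_norm \<Omega> (\<lambda>x. f x - \<phi> x) < inverse (real (Suc n))" for n
    using L2_approx[OF assms, of "inverse (real (Suc n))"] by auto
  then obtain \<phi> where \<phi>: "\<And>n. \<phi> n \<in> test_functions \<Omega>"
      "\<And>n. L2_norm \<Omega> (\<lambda>x. f x - \<phi> n x) < inverse (real (Suc n))"
    by metis
  have "(\<lambda>n. L2_norm \<Omega> (\<lambda>x. f x - \<phi> n x)) \<longlonglongrightarrow> 0"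
    by (rule tendsto_sandwich[OF always_eventually always_eventually tendsto_const LIMSEQ_inverse_real_of_nat])
      (use \<phi>(2) in \<open>auto intro: less_imp_le\<close>)
  with \<phi>(1) that show ?thesis by blast
qed

section \<open>Sobolev spaces\<close>

lemma tendsto_zero_le:
  fixes a b :: "nat \<Rightarrow> real"
  assumes "\<And>n. 0 \<le> a n" "\<And>n. a n \<le> b n" "b \<longlonglongrightarrow> 0"
  shows "a \<longlonglongrightarrow> 0"
  by (rule tendsto_sandwich[OF always_eventually always_eventually tendsto_const assms(3)]) (use assms in auto)

section \<open>Weak derivatives on an open set\<close>

locale open_domain =
  fixes \<Omega> :: "'a::euclidean_space set"
  assumes open_dom: "open \<Omega>"
begin

lemma sets_dom: "\<Omega> \<in> sets lebesgue"
  using open_dom by simp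

lemma test_L2: "\<phi> \<in> test_functions \<Omega> \<Longrightarrow> \<phi> \<in> L2 \<Omega>"
  by (rule test_function_L2[OF open_dom])

text \<open>The fundamental lemma of the calculus of variations: test functions that converge to
  \<open>d\<close> itself turn the hypothesis into <d, d> = 0.\<close>

lemma L2_inner_self_zero:
  assumes d: "d \<in> L2 \<Omega>" and z: "\<And>\<phi>. \<phi> \<in> test_functions \<Omega> \<Longrightarrow> L2_inner \<Omega> d \<phi> = 0"
  shows "L2_norm \<Omega> d = 0"
proof -
  obtain \<phi> where \<phi>: "\<And>n. \<phi> n \<in> test_functions \<Omega>" "(\<lambda>n. L2_norm \<Omega> (\<lambda>x. d x - \<phi> n x)) \<longlonglongrightarrow> 0"
    using L2_approx_sequence[OF open_dom d] by blast
  have "(\<lambda>n. L2_inner \<Omega> d (\<phi> n)) \<longlonglongrightarrow> L2_inner \<Omega> d d"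
  proof (rule L2.tendsto_ip[OF d _ d d])
    show "\<phi> n \<in> L2 \<Omega>" for n using \<phi>(1) by (rule test_L2)
    show "(\<lambda>n. L2_norm \<Omega> (\<lambda>x. \<phi> n x - d x)) \<longlonglongrightarrow> 0"
      using \<phi>(2) L2.N_minus_commute[OF d test_L2[OF \<phi>(1)]] by simp
  qed (simp add: L2.N_zero)
  then have "(\<lambda>n::nat. 0) \<longlonglongrightarrow> L2_inner \<Omega> d d" using z \<phi>(1) by simp
  from LIMSEQ_unique[OF this tendsto_const] show ?thesis by (simp add: L2_norm_def)
qed

lemma weak_partial_L2: "weak_partial \<Omega> b u g \<Longrightarrow> g \<in> L2 \<Omega>"
  by (simp add: weak_partial_def)

lemma weak_partialD: "weak_partial \<Omega> b u g \<Longrightarrow> \<phi> \<in> test_functions \<Omega> \<Longrightarrow>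
    L2_inner \<Omega> u (partial b \<phi>) = - L2_inner \<Omega> g \<phi>"
  by (simp add: weak_partial_def)

text \<open>This gives the choice in \<open>wpartial\<close> a meaning: whatever function is chosen,
  its distance to any other candidate is zero.\<close>

lemma weak_partial_unique:
  assumes "weak_partial \<Omega> b u g" "weak_partial \<Omega> b u h"
  shows "L2_norm \<Omega> (\<lambda>x. g x - h x) = 0"
proof (rule L2_inner_self_zero)
  note L = assms[THEN weak_partial_L2]
  show "(\<lambda>x. g x - h x) \<in> L2 \<Omega>" by (rule L2.diff_mem[OF L])
  show "L2_inner \<Omega> (\<lambda>x. g x - h x) \<phi> = 0" if "\<phi> \<in> test_functions \<Omega>" for \<phi>
    using weak_partialD[OF assms(1) that] weak_partialD[OF assms(2) that]
    by (simp add: L2.diff_left[OF L test_L2[OF that]])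
qed

lemma weak_partial_comb:
  assumes "u \<in> L2 \<Omega>" "v \<in> L2 \<Omega>" "b \<in> Basis" "weak_partial \<Omega> b u g" "weak_partial \<Omega> b v h"
  shows "weak_partial \<Omega> b (\<lambda>x. \<alpha> * u x + \<beta> * v x) (\<lambda>x. \<alpha> * g x + \<beta> * h x)"
proof -
  note L = assms(4,5)[THEN weak_partial_L2]
  show ?thesis
    using assms weak_partialD[OF assms(4)] weak_partialD[OF assms(5)]
    by (auto simp: weak_partial_def L2_comb L2.comb_left[OF L test_L2]
        L2.comb_left[OF assms(1,2) test_L2[OF test_function_partial[OF _ assms(3)]]])
qed

text \<open>The derivative of the product of two test functions integrates to zero, and the product
  rule splits that integral into the two sides.\<close>

lemma weak_partial_test:
  assumes \<phi>: "\<phi> \<in> test_functions \<Omega>" and b: "b \<in> Basis"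
  shows "weak_partial \<Omega> b \<phi> (partial b \<phi>)"
  unfolding weak_partial_def
proof (intro conjI ballI)
  show "partial b \<phi> \<in> L2 \<Omega>" by (rule test_L2[OF test_function_partial[OF assms]])
  fix \<psi> assume \<psi>: "\<psi> \<in> test_functions \<Omega>"
  have prod: "(\<lambda>x. \<phi> x * \<psi> x) \<in> test_functions \<Omega>"
    by (rule test_function_mult[OF \<psi>]) (use \<phi> in \<open>simp add: test_functions_def\<close>)
  have eq: "partial b (\<lambda>x. \<phi> x * \<psi> x) x = \<phi> x * partial b \<psi> x + partial b \<phi> x * \<psi> x" for x
    using \<phi> \<psi> by (intro partial_mult test_function_differentiable)
  have "0 = (LINT x|lborel. partial b (\<lambda>x. \<phi> x * \<psi> x) x)"
    by (rule integral_partial_zero[OF prod b, symmetric])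
  also have "\<dots> = (LINT x|lebesgue_on \<Omega>. partial b (\<lambda>x. \<phi> x * \<psi> x) x)"
    using test_function_partial[OF prod b] sets_dom
    by (intro integral_lebesgue_on_outside(1)[symmetric]) (auto intro: test_function_borel test_function_outside)
  also have "\<dots> = L2_inner \<Omega> \<phi> (partial b \<psi>) + L2_inner \<Omega> (partial b \<phi>) \<psi>"
    unfolding eq L2_inner_def using \<phi> \<psi> b
    by (intro Bochner_Integration.integral_add L2_mult_integrable test_L2 test_function_partial)
  finally show "L2_inner \<Omega> \<phi> (partial b \<psi>) = - L2_inner \<Omega> (partial b \<phi>) \<psi>" by simp
qed

lemma H1_L2: "u \<in> H1 \<Omega> \<Longrightarrow> u \<in> L2 \<Omega>"
  by (simp add: H1_def)

lemma wpartial_weak: "u \<in> H1 \<Omega> \<Longrightarrow> b \<in> Basis \<Longrightarrow> weak_partial \<Omega> b u (wpartial \<Omega> b u)"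
  unfolding wpartial_def H1_def using someI_ex[of "weak_partial \<Omega> b u"] by simp

lemma wpartial_L2: "u \<in> H1 \<Omega> \<Longrightarrow> b \<in> Basis \<Longrightarrow> wpartial \<Omega> b u \<in> L2 \<Omega>"
  by (rule weak_partial_L2[OF wpartial_weak])

lemma wpartial_eq:
  assumes "weak_partial \<Omega> b u g"
  shows "L2_norm \<Omega> (\<lambda>x. wpartial \<Omega> b u x - g x) = 0"
  by (rule weak_partial_unique[OF _ assms]) (simp add: wpartial_def someI[of "weak_partial \<Omega> b u", OF assms])

lemma H1_zero: "(\<lambda>x. 0) \<in> H1 \<Omega>"
  using weak_partial_test[OF test_function_zero] test_L2[OF test_function_zero] by (auto simp: H1_def)

lemma H1_comb:
  assumes "u \<in> H1 \<Omega>" "v \<in> H1 \<Omega>"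
  shows "(\<lambda>x. \<alpha> * u x + \<beta> * v x) \<in> H1 \<Omega>"
  using weak_partial_comb[OF H1_L2[OF assms(1)] H1_L2[OF assms(2)] _ wpartial_weak[OF assms(1)] wpartial_weak[OF assms(2)]]
  by (auto simp: H1_def intro!: L2_comb assms[THEN H1_L2])

text \<open>The choice in \<open>wpartial\<close> need not respect linear combinations, so linearity
  is available only up to a function of norm zero.\<close>

lemma wpartial_comb:
  assumes "u \<in> H1 \<Omega>" "v \<in> H1 \<Omega>" "b \<in> Basis"
  shows "L2_norm \<Omega> (\<lambda>x. wpartial \<Omega> b (\<lambda>x. \<alpha> * u x + \<beta> * v x) x
      - (\<alpha> * wpartial \<Omega> b u x + \<beta> * wpartial \<Omega> b v x)) = 0"
  by (rule wpartial_eq[OF weak_partial_comb]) (use assms in \<open>auto intro: H1_L2 wpartial_weak\<close>)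

end

text \<open>Although the chosen weak derivatives are linear only up to null functions, their inner
  products are exactly linear, because null differences drop out of the form. The gradient alone
  need not give a norm on H1, which \<open>semi_inner\<close> tolerates.\<close>

sublocale open_domain \<subseteq> H1: semi_inner "H1 \<Omega>" "grad_inner \<Omega>" "grad_norm \<Omega>"
proof
  show "grad_inner \<Omega> u v = grad_inner \<Omega> v u" for u v
    unfolding grad_inner_def by (simp add: L2.sym)
  show "0 \<le> grad_inner \<Omega> u u" for u
    unfolding grad_inner_def by (intro sum_nonneg L2.self_nonneg)
  show "grad_inner \<Omega> (\<lambda>x. a * u x + b * v x) w = a * grad_inner \<Omega> u w + b * grad_inner \<Omega> v w"
    if "u \<in> H1 \<Omega>" "v \<in> H1 \<Omega>" "w \<in> H1 \<Omega>" for u v w a b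
  proof -
    have "L2_inner \<Omega> (wpartial \<Omega> i (\<lambda>x. a * u x + b * v x)) (wpartial \<Omega> i w) =
        a * L2_inner \<Omega> (wpartial \<Omega> i u) (wpartial \<Omega> i w) + b * L2_inner \<Omega> (wpartial \<Omega> i v) (wpartial \<Omega> i w)"
      if i: "i \<in> Basis" for i
    proof -
      note L = wpartial_L2[OF \<open>u \<in> H1 \<Omega>\<close> i] wpartial_L2[OF \<open>v \<in> H1 \<Omega>\<close> i] wpartial_L2[OF \<open>w \<in> H1 \<Omega>\<close> i]
        wpartial_L2[OF H1_comb[OF \<open>u \<in> H1 \<Omega>\<close> \<open>v \<in> H1 \<Omega>\<close>] i]
      show ?thesis
        using L2.ip_diff_zero[OF L(4) L2_comb[OF L(1,2)] L(3) wpartial_comb[OF \<open>u \<in> H1 \<Omega>\<close> \<open>v \<in> H1 \<Omega>\<close> i]]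
          L2.comb_left[OF L(1,2,3)] by simp
    qed
    then show ?thesis
      by (simp add: grad_inner_def sum.distrib sum_distrib_left)
  qed
qed (simp_all add: H1_zero H1_comb grad_norm_def)

section \<open>Norm comparisons, closedness and linearity of H10\<close>

context open_domain begin

lemma L2_le_H1_norm: "L2_norm \<Omega> u \<le> H1_norm \<Omega> u"
  and grad_le_H1_norm: "grad_norm \<Omega> u \<le> H1_norm \<Omega> u"
  by (auto simp: H1_norm_def intro!: real_le_rsqrt)

lemma H1_norm_le: "H1_norm \<Omega> u \<le> L2_norm \<Omega> u + grad_norm \<Omega> u"
  unfolding H1_norm_def by (intro sqrt_sum_squares_le_sum) auto

lemma H1_le_H2_norm: "H1_norm \<Omega> u \<le> H2_norm \<Omega> u"
  and H2_semi_le_H2_norm: "H2_seminorm \<Omega> u \<le> H2_norm \<Omega> u"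
  by (auto simp: H2_norm_def intro!: real_le_rsqrt)

lemma L2_le_H2_norm: "L2_norm \<Omega> u \<le> H2_norm \<Omega> u"
  and grad_le_H2_norm: "grad_norm \<Omega> u \<le> H2_norm \<Omega> u"
  using H1_le_H2_norm[of u] L2_le_H1_norm[of u] grad_le_H1_norm[of u] by linarith+

lemma grad_inner_self: "(grad_norm \<Omega> u)\<^sup>2 = (\<Sum>b\<in>Basis. (L2_norm \<Omega> (wpartial \<Omega> b u))\<^sup>2)"
  by (simp add: H1.N_sq grad_inner_def L2.N_sq)

lemma wpartial_le_grad: "b \<in> Basis \<Longrightarrow> L2_norm \<Omega> (wpartial \<Omega> b u) \<le> grad_norm \<Omega> u"
  by (rule power2_le_imp_le, unfold grad_inner_self)
    (auto intro: member_le_sum[of b Basis "\<lambda>b. (L2_norm \<Omega> (wpartial \<Omega> b u))\<^sup>2"])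

lemma grad_le_sum: "grad_norm \<Omega> u \<le> (\<Sum>b\<in>Basis. L2_norm \<Omega> (wpartial \<Omega> b u))"
proof -
  have "grad_norm \<Omega> u = L2_set (\<lambda>b. L2_norm \<Omega> (wpartial \<Omega> b u)) Basis"
    unfolding L2_set_def using grad_inner_self[of u] by (metis H1.N_nonneg real_sqrt_unique)
  also have "\<dots> \<le> (\<Sum>b\<in>Basis. L2_norm \<Omega> (wpartial \<Omega> b u))"
    by (rule L2_set_le_sum) simp
  finally show ?thesis .
qed

lemma test_H1: "\<phi> \<in> test_functions \<Omega> \<Longrightarrow> \<phi> \<in> H1 \<Omega>"
  using weak_partial_test test_L2 by (auto simp: H1_def)

lemma H1_norm_tendsto_iff:
  "(\<lambda>n. H1_norm \<Omega> (f n)) \<longlonglongrightarrow> 0 \<longleftrightarrow>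
    (\<lambda>n. L2_norm \<Omega> (f n)) \<longlonglongrightarrow> 0 \<and> (\<lambda>n. grad_norm \<Omega> (f n)) \<longlonglongrightarrow> 0"
proof (intro iffI conjI)
  assume *: "(\<lambda>n. H1_norm \<Omega> (f n)) \<longlonglongrightarrow> 0"
  show "(\<lambda>n. L2_norm \<Omega> (f n)) \<longlonglongrightarrow> 0"
    by (rule tendsto_sandwich[OF always_eventually always_eventually tendsto_const *])
      (auto simp: L2_le_H1_norm)
  show "(\<lambda>n. grad_norm \<Omega> (f n)) \<longlonglongrightarrow> 0"
    by (rule tendsto_sandwich[OF always_eventually always_eventually tendsto_const *])
      (auto simp: grad_le_H1_norm)
next
  assume *: "(\<lambda>n. L2_norm \<Omega> (f n)) \<longlonglongrightarrow> 0 \<and> (\<lambda>n. grad_norm \<Omega> (f n)) \<longlonglongrightarrow> 0"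
  have "(\<lambda>n. L2_norm \<Omega> (f n) + grad_norm \<Omega> (f n)) \<longlonglongrightarrow> 0"
    using tendsto_add[OF conjunct1[OF *] conjunct2[OF *]] by simp
  from tendsto_zero_le[OF _ H1_norm_le this] show "(\<lambda>n. H1_norm \<Omega> (f n)) \<longlonglongrightarrow> 0"
    by (simp add: H1_norm_def)
qed

lemma H10_H1: "u \<in> H10 \<Omega> \<Longrightarrow> u \<in> H1 \<Omega>"
  by (simp add: H10_def)

lemma H10_L2: "u \<in> H10 \<Omega> \<Longrightarrow> u \<in> L2 \<Omega>"
  by (rule H1_L2[OF H10_H1])

lemma H10_approx:
  assumes "u \<in> H10 \<Omega>"
  obtains \<phi> :: "nat \<Rightarrow> 'a \<Rightarrow> real" where "\<And>k. \<phi> k \<in> test_functions \<Omega>"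
    "(\<lambda>k. L2_norm \<Omega> (\<lambda>x. \<phi> k x - u x)) \<longlonglongrightarrow> 0" "(\<lambda>k. grad_norm \<Omega> (\<lambda>x. \<phi> k x - u x)) \<longlonglongrightarrow> 0"
proof -
  obtain \<phi> :: "nat \<Rightarrow> 'a \<Rightarrow> real" where \<phi>: "\<And>k. \<phi> k \<in> test_functions \<Omega>"
      "(\<lambda>k. H1_norm \<Omega> (\<lambda>x. u x - \<phi> k x)) \<longlonglongrightarrow> 0"
    using assms by (auto simp: H10_def)
  have "L2_norm \<Omega> (\<lambda>x. u x - \<phi> k x) = L2_norm \<Omega> (\<lambda>x. \<phi> k x - u x)"
      "grad_norm \<Omega> (\<lambda>x. u x - \<phi> k x) = grad_norm \<Omega> (\<lambda>x. \<phi> k x - u x)" for k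
    using H10_H1[OF assms] test_H1[OF \<phi>(1)] H1_L2 L2.N_minus_commute H1.N_minus_commute by blast+
  with \<phi>(2) have "(\<lambda>k. L2_norm \<Omega> (\<lambda>x. \<phi> k x - u x)) \<longlonglongrightarrow> 0" "(\<lambda>k. grad_norm \<Omega> (\<lambda>x. \<phi> k x - u x)) \<longlonglongrightarrow> 0"
    by (simp_all add: H1_norm_tendsto_iff)
  with \<phi>(1) that show ?thesis by blast
qed

text \<open>Approximation by elements of H10 is what can be verified for the values of a time
  derivative. Passing on to test functions with accuracies 1/(n+1) produces the sequence that the
  definition demands.\<close>

lemma H10_closed:
  assumes "u \<in> H1 \<Omega>" "\<And>\<epsilon>. 0 < \<epsilon> \<Longrightarrow> \<exists>v\<in>H10 \<Omega>. L2_norm \<Omega> (\<lambda>x. u x - v x) < \<epsilon> \<and> grad_norm \<Omega> (\<lambda>x. u x - v x) < \<epsilon>"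
  shows "u \<in> H10 \<Omega>"
proof -
  have "\<exists>\<phi>\<in>test_functions \<Omega>. L2_norm \<Omega> (\<lambda>x. u x - \<phi> x) < \<epsilon> \<and> grad_norm \<Omega> (\<lambda>x. u x - \<phi> x) < \<epsilon>" if "0 < \<epsilon>" for \<epsilon>
  proof -
    have e2: "0 < \<epsilon> / 2" using that by simp
    obtain v where v: "v \<in> H10 \<Omega>" "L2_norm \<Omega> (\<lambda>x. u x - v x) < \<epsilon> / 2" "grad_norm \<Omega> (\<lambda>x. u x - v x) < \<epsilon> / 2"
      using assms(2)[OF e2] by blast
    obtain \<phi> :: "nat \<Rightarrow> 'a \<Rightarrow> real" where \<phi>: "\<And>k. \<phi> k \<in> test_functions \<Omega>"
        "(\<lambda>k. L2_norm \<Omega> (\<lambda>x. \<phi> k x - v x)) \<longlonglongrightarrow> 0" "(\<lambda>k. grad_norm \<Omega> (\<lambda>x. \<phi> k x - v x)) \<longlonglongrightarrow> 0"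
      using H10_approx[OF v(1)] by blast
    have "\<forall>\<^sub>F k in sequentially. L2_norm \<Omega> (\<lambda>x. \<phi> k x - v x) < \<epsilon> / 2 \<and> grad_norm \<Omega> (\<lambda>x. \<phi> k x - v x) < \<epsilon> / 2"
      by (intro eventually_conj order_tendstoD(2)[OF \<phi>(2) e2] order_tendstoD(2)[OF \<phi>(3) e2])
    then obtain k where k: "L2_norm \<Omega> (\<lambda>x. \<phi> k x - v x) < \<epsilon> / 2" "grad_norm \<Omega> (\<lambda>x. \<phi> k x - v x) < \<epsilon> / 2"
      using eventually_happens'[OF sequentially_bot] by blast
    note M = assms(1) H10_H1[OF v(1)] test_H1[OF \<phi>(1)[of k]]
    have "L2_norm \<Omega> (\<lambda>x. u x - \<phi> k x) < \<epsilon>"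
      using L2.triangle_via[OF M[THEN H1_L2]] L2.N_minus_commute[OF M(2,3)[THEN H1_L2]] v(2) k(1) by simp
    moreover have "grad_norm \<Omega> (\<lambda>x. u x - \<phi> k x) < \<epsilon>"
      using H1.triangle_via[OF M] H1.N_minus_commute[OF M(2,3)] v(3) k(2) by simp
    ultimately show ?thesis using \<phi>(1) by blast
  qed
  from this[OF inverse_positive_iff_positive[THEN iffD2, OF of_nat_0_less_iff[THEN iffD2, OF zero_less_Suc]]]
  have "\<forall>n. \<exists>\<phi>\<in>test_functions \<Omega>. L2_norm \<Omega> (\<lambda>x. u x - \<phi> x) < inverse (real (Suc n)) \<and> grad_norm \<Omega> (\<lambda>x. u x - \<phi> x) < inverse (real (Suc n))"
    by blast
  then obtain \<phi> where \<phi>: "\<And>n. \<phi> n \<in> test_functions \<Omega>" "\<And>n. L2_norm \<Omega> (\<lambda>x. u x - \<phi> n x) < inverse (real (Suc n))"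
      "\<And>n. grad_norm \<Omega> (\<lambda>x. u x - \<phi> n x) < inverse (real (Suc n))"
    by metis
  have "(\<lambda>n. L2_norm \<Omega> (\<lambda>x. u x - \<phi> n x)) \<longlonglongrightarrow> 0"
    by (rule tendsto_sandwich[OF always_eventually always_eventually tendsto_const LIMSEQ_inverse_real_of_nat])
      (use \<phi>(2) in \<open>auto intro: less_imp_le\<close>)
  moreover have "(\<lambda>n. grad_norm \<Omega> (\<lambda>x. u x - \<phi> n x)) \<longlonglongrightarrow> 0"
    by (rule tendsto_sandwich[OF always_eventually always_eventually tendsto_const LIMSEQ_inverse_real_of_nat])
      (use \<phi>(3) in \<open>auto intro: less_imp_le\<close>)
  ultimately show ?thesis
    using \<phi>(1) assms(1) by (auto simp: H10_def H1_norm_tendsto_iff)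
qed

lemma test_H10: "\<phi> \<in> test_functions \<Omega> \<Longrightarrow> \<phi> \<in> H10 \<Omega>"
  unfolding H10_def using test_H1[of \<phi>]
  by (auto intro!: exI[of _ "\<lambda>_. \<phi>"] simp: H1_norm_tendsto_iff L2.N_zero H1.N_zero)

lemma H10_zero: "(\<lambda>x. 0) \<in> H10 \<Omega>"
  by (rule test_H10[OF test_function_zero])

lemma H10_comb:
  assumes "u \<in> H10 \<Omega>" "v \<in> H10 \<Omega>"
  shows "(\<lambda>x. \<alpha> * u x + \<beta> * v x) \<in> H10 \<Omega>"
proof -
  obtain \<phi> :: "nat \<Rightarrow> 'a \<Rightarrow> real" where \<phi>: "\<And>k. \<phi> k \<in> test_functions \<Omega>"
      "(\<lambda>k. L2_norm \<Omega> (\<lambda>x. \<phi> k x - u x)) \<longlonglongrightarrow> 0" "(\<lambda>k. grad_norm \<Omega> (\<lambda>x. \<phi> k x - u x)) \<longlonglongrightarrow> 0"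
    using H10_approx[OF assms(1)] by blast
  obtain \<psi> :: "nat \<Rightarrow> 'a \<Rightarrow> real" where \<psi>: "\<And>k. \<psi> k \<in> test_functions \<Omega>"
      "(\<lambda>k. L2_norm \<Omega> (\<lambda>x. \<psi> k x - v x)) \<longlonglongrightarrow> 0" "(\<lambda>k. grad_norm \<Omega> (\<lambda>x. \<psi> k x - v x)) \<longlonglongrightarrow> 0"
    using H10_approx[OF assms(2)] by blast
  let ?w = "\<lambda>k x. \<alpha> * \<phi> k x + \<beta> * \<psi> k x"
  note D = H1.diff_mem[OF test_H1[OF \<phi>(1)] H10_H1[OF assms(1)]] H1.diff_mem[OF test_H1[OF \<psi>(1)] H10_H1[OF assms(2)]]
  have eq: "(\<lambda>x. \<alpha> * u x + \<beta> * v x - ?w k x) = (\<lambda>x. (-\<alpha>) * (\<phi> k x - u x) + (-\<beta>) * (\<psi> k x - v x))" for k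
    by (auto simp: algebra_simps)
  have bound1: "L2_norm \<Omega> (\<lambda>x. \<alpha> * u x + \<beta> * v x - ?w k x)
      \<le> \<bar>\<alpha>\<bar> * L2_norm \<Omega> (\<lambda>x. \<phi> k x - u x) + \<bar>\<beta>\<bar> * L2_norm \<Omega> (\<lambda>x. \<psi> k x - v x)" for k
    unfolding eq
    using L2.triangle[OF L2.scale_mem[OF H1_L2[OF D(1)]] L2.scale_mem[OF H1_L2[OF D(2)]], of "-\<alpha>" k "-\<beta>" k]
      L2.N_scale[OF H1_L2[OF D(1)], of "-\<alpha>" k] L2.N_scale[OF H1_L2[OF D(2)], of "-\<beta>" k]
    by simp
  have bound2: "grad_norm \<Omega> (\<lambda>x. \<alpha> * u x + \<beta> * v x - ?w k x)
      \<le> \<bar>\<alpha>\<bar> * grad_norm \<Omega> (\<lambda>x. \<phi> k x - u x) + \<bar>\<beta>\<bar> * grad_norm \<Omega> (\<lambda>x. \<psi> k x - v x)" for k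
    unfolding eq
    using H1.triangle[OF H1.scale_mem[OF D(1)] H1.scale_mem[OF D(2)], of "-\<alpha>" k "-\<beta>" k]
      H1.N_scale[OF D(1), of "-\<alpha>" k] H1.N_scale[OF D(2), of "-\<beta>" k]
    by simp
  have lim: "(\<lambda>k. \<bar>\<alpha>\<bar> * L2_norm \<Omega> (\<lambda>x. \<phi> k x - u x) + \<bar>\<beta>\<bar> * L2_norm \<Omega> (\<lambda>x. \<psi> k x - v x)) \<longlonglongrightarrow> 0"
      "(\<lambda>k. \<bar>\<alpha>\<bar> * grad_norm \<Omega> (\<lambda>x. \<phi> k x - u x) + \<bar>\<beta>\<bar> * grad_norm \<Omega> (\<lambda>x. \<psi> k x - v x)) \<longlonglongrightarrow> 0"
    by (rule tendsto_eq_intros \<phi>(2,3) \<psi>(2,3) refl | simp)+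
  have
    "(\<lambda>k. L2_norm \<Omega> (\<lambda>x. \<alpha> * u x + \<beta> * v x - ?w k x)) \<longlonglongrightarrow> 0"
    "(\<lambda>k. grad_norm \<Omega> (\<lambda>x. \<alpha> * u x + \<beta> * v x - ?w k x)) \<longlonglongrightarrow> 0"
    using tendsto_zero_le[OF L2.N_nonneg bound1 lim(1)] tendsto_zero_le[OF H1.N_nonneg bound2 lim(2)] .
  then show ?thesis
    using H1_comb[OF assms[THEN H10_H1]] \<phi>(1) \<psi>(1)
    unfolding H10_def H1_norm_tendsto_iff
    by (auto intro!: exI[of _ ?w] test_function_add test_function_scale)
qed

end

sublocale open_domain \<subseteq> H10: semi_inner "H10 \<Omega>" "grad_inner \<Omega>" "grad_norm \<Omega>"
  by unfold_locales
    (auto simp: H10_zero H10_comb H1.comb_left H10_H1 H1.self_nonneg H1.N_eq intro: H1.sym)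

section \<open>The Poincare inequality\<close>

context open_domain begin

lemma grad_norm_test_eq:
  assumes "\<phi> \<in> test_functions \<Omega>" "b \<in> Basis"
  shows "L2_norm \<Omega> (\<lambda>x. wpartial \<Omega> b \<phi> x - partial b \<phi> x) = 0"
  by (rule wpartial_eq[OF weak_partial_test[OF assms]])

lemma partial_le_grad:
  assumes "\<phi> \<in> test_functions \<Omega>" "b \<in> Basis"
  shows "L2_norm \<Omega> (partial b \<phi>) \<le> grad_norm \<Omega> \<phi>"
proof -
  have L: "wpartial \<Omega> b \<phi> \<in> L2 \<Omega>" "partial b \<phi> \<in> L2 \<Omega>"
    using assms by (auto intro: wpartial_L2 test_H1 test_L2 test_function_partial)
  show ?thesis
    using L2.N_le_diff[OF L(2,1)] L2.N_minus_commute[OF L] grad_norm_test_eq[OF assms]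
      wpartial_le_grad[OF assms(2), of \<phi>] by simp
qed

text \<open>The divergence of the field \<open>x \<mapsto> (x \<bullet> b) (\<phi> x)\<^sup>2 b\<close> has integral zero.\<close>
lemma poincare_test:
  assumes \<phi>: "\<phi> \<in> test_functions \<Omega>" and R: "\<And>x. x \<in> \<Omega> \<Longrightarrow> norm x \<le> R" "0 \<le> R"
  shows "L2_norm \<Omega> \<phi> \<le> 2 * R * grad_norm \<Omega> \<phi>"
proof -
  obtain b :: 'a where b: "b \<in> Basis" using nonempty_Basis by blast
  \<comment> \<open>The coordinate function with its derivatives y, 1, 0, 0, ... in the form
    expected by \<open>C_k_coord\<close>.\<close>
  define F :: "nat \<Rightarrow> real \<Rightarrow> real" where "F k y = (if k = 0 then y else if k = 1 then 1 else 0)" for k y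
  have "(F k has_real_derivative F (Suc k) y) (at y)" for k y
    unfolding F_def by (cases "k = 0") (auto intro!: derivative_eq_intros)
  from C_k_coord[of F, OF this, of _ 0 b] have coord: "C_k k (\<lambda>x. x \<bullet> b)" for k
    by (simp add: F_def)
  define \<psi> where "\<psi> = (\<lambda>x. (x \<bullet> b) * \<phi> x)"
  have \<psi>: "\<psi> \<in> test_functions \<Omega>"
    unfolding \<psi>_def by (rule test_function_mult[OF \<phi> coord])
  have cd: "(\<lambda>x::'a. x \<bullet> b) differentiable (at x)" for x
    using bounded_linear_imp_differentiable[OF bounded_linear_inner_left] .
  have pc: "partial b (\<lambda>x::'a. x \<bullet> b) x = 1" for x
    using partial_eqI[OF bounded_linear_imp_has_derivative[OF bounded_linear_inner_left, of b], of b x] b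
    by simp
  have eq: "partial b \<psi> x = \<phi> x + (x \<bullet> b) * partial b \<phi> x" for x
    unfolding \<psi>_def using partial_mult[OF cd test_function_differentiable[OF \<phi>], of b x] pc[of x] by simp
  note D\<phi> = test_function_partial[OF \<phi> b]
  have xD: "(\<lambda>x. (x \<bullet> b) * partial b \<phi> x) \<in> test_functions \<Omega>"
    by (rule test_function_mult[OF D\<phi> coord])
  have "L2_inner \<Omega> \<psi> (partial b \<phi>) = - L2_inner \<Omega> (partial b \<psi>) \<phi>"
    by (rule weak_partialD[OF weak_partial_test[OF \<psi> b] \<phi>])
  also have "L2_inner \<Omega> (partial b \<psi>) \<phi> = L2_inner \<Omega> \<phi> \<phi> + L2_inner \<Omega> (\<lambda>x. (x \<bullet> b) * partial b \<phi> x) \<phi>"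
    unfolding eq[abs_def] by (rule L2.add_left) (use \<phi> xD in \<open>auto intro: test_L2\<close>)
  also have "L2_inner \<Omega> (\<lambda>x. (x \<bullet> b) * partial b \<phi> x) \<phi> = L2_inner \<Omega> \<psi> (partial b \<phi>)"
    unfolding L2_inner_def \<psi>_def by (rule Bochner_Integration.integral_cong) auto
  \<comment> \<open>The mixed term occurs on both sides of the integration by parts; this is the
    origin of the 2 in the Poincare constant.\<close>
  finally have "(L2_norm \<Omega> \<phi>)\<^sup>2 = - 2 * L2_inner \<Omega> \<psi> (partial b \<phi>)"
    by (simp add: L2.N_sq)
  also have "\<dots> \<le> 2 * (L2_norm \<Omega> \<psi> * L2_norm \<Omega> (partial b \<phi>))"
    using L2.cauchy_schwarz[OF test_L2[OF \<psi>] test_L2[OF D\<phi>]] by (simp add: abs_le_iff)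
  also have "\<dots> \<le> 2 * ((R * L2_norm \<Omega> \<phi>) * grad_norm \<Omega> \<phi>)"
  proof (intro mult_left_mono mult_mono)
    have "(L2_norm \<Omega> \<psi>)\<^sup>2 \<le> (LINT x|lebesgue_on \<Omega>. R\<^sup>2 * (\<phi> x)\<^sup>2)"
      unfolding L2_norm_eq
    proof (rule integral_mono')
      show "integrable (lebesgue_on \<Omega>) (\<lambda>x. R\<^sup>2 * (\<phi> x)\<^sup>2)"
        using L2_square_integrable[OF test_L2[OF \<phi>]] by simp
      fix x assume "x \<in> space (lebesgue_on \<Omega>)"
      then have "norm x \<le> R" using R by (simp add: space_restrict_space)
      then have "\<bar>x \<bullet> b\<bar> \<le> R" using Basis_le_norm[OF b, of x] by simp
      then have "(x \<bullet> b)\<^sup>2 \<le> R\<^sup>2" using abs_le_square_iff[of "x \<bullet> b" R] R by simp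
      then show "(\<psi> x)\<^sup>2 \<le> R\<^sup>2 * (\<phi> x)\<^sup>2"
        by (simp add: \<psi>_def power_mult_distrib mult_right_mono)
    qed simp
    also have "\<dots> = (R * L2_norm \<Omega> \<phi>)\<^sup>2" by (simp add: L2_norm_eq power_mult_distrib)
    finally show "L2_norm \<Omega> \<psi> \<le> R * L2_norm \<Omega> \<phi>" by (rule power2_le_imp_le) (use R in simp)
    show "L2_norm \<Omega> (partial b \<phi>) \<le> grad_norm \<Omega> \<phi>" by (rule partial_le_grad[OF \<phi> b])
  qed (use R in auto)
  finally have "L2_norm \<Omega> \<phi> * L2_norm \<Omega> \<phi> \<le> (2 * R * grad_norm \<Omega> \<phi>) * L2_norm \<Omega> \<phi>"
    by (simp add: power2_eq_square mult_ac)
  then show ?thesis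
    using R(2) by (cases "L2_norm \<Omega> \<phi> = 0") (auto simp: mult_le_cancel_right less_le)
qed

lemma poincare:
  assumes u: "u \<in> H10 \<Omega>" and R: "\<And>x. x \<in> \<Omega> \<Longrightarrow> norm x \<le> R" "0 \<le> R"
  shows "L2_norm \<Omega> u \<le> 2 * R * grad_norm \<Omega> u"
proof -
  obtain \<phi> :: "nat \<Rightarrow> 'a \<Rightarrow> real" where \<phi>: "\<And>k. \<phi> k \<in> test_functions \<Omega>"
      "(\<lambda>k. L2_norm \<Omega> (\<lambda>x. \<phi> k x - u x)) \<longlonglongrightarrow> 0" "(\<lambda>k. grad_norm \<Omega> (\<lambda>x. \<phi> k x - u x)) \<longlonglongrightarrow> 0"
    using H10_approx[OF u] by blast
  have l: "(\<lambda>k. L2_norm \<Omega> (\<phi> k)) \<longlonglongrightarrow> L2_norm \<Omega> u"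
    by (rule L2.tendsto_N[OF test_L2[OF \<phi>(1)] H10_L2[OF u] \<phi>(2)])
  have r: "(\<lambda>k. 2 * R * grad_norm \<Omega> (\<phi> k)) \<longlonglongrightarrow> 2 * R * grad_norm \<Omega> u"
    by (intro tendsto_intros H1.tendsto_N[OF test_H1[OF \<phi>(1)] H10_H1[OF u] \<phi>(3)])
  show ?thesis
    by (rule LIMSEQ_le[OF l r]) (use poincare_test[OF \<phi>(1) R] in auto)
qed

section \<open>Green's formula for H2 functions\<close>

lemma H2_H1: "u \<in> H2 \<Omega> \<Longrightarrow> u \<in> H1 \<Omega>" "u \<in> H2 \<Omega> \<Longrightarrow> b \<in> Basis \<Longrightarrow> wpartial \<Omega> b u \<in> H1 \<Omega>"
  by (auto simp: H2_def)

lemma H2_partial_le: "b \<in> Basis \<Longrightarrow> grad_norm \<Omega> (wpartial \<Omega> b u) \<le> H2_seminorm \<Omega> u"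
  unfolding H2_seminorm_def
  by (rule real_le_rsqrt)
    (auto intro: member_le_sum[of b Basis "\<lambda>b. (grad_norm \<Omega> (wpartial \<Omega> b u))\<^sup>2"])

text \<open>Green's formula for \<open>-\<Delta>u\<close>, in the form of a bound.\<close>
lemma grad_inner_H2_bound:
  assumes u: "u \<in> H2 \<Omega>" and v: "v \<in> H10 \<Omega>"
  shows "\<bar>grad_inner \<Omega> u v\<bar> \<le> real DIM('a) * H2_seminorm \<Omega> u * L2_norm \<Omega> v"
proof -
  note u1 = H2_H1[OF u]
  obtain \<phi> :: "nat \<Rightarrow> 'a \<Rightarrow> real" where \<phi>: "\<And>k. \<phi> k \<in> test_functions \<Omega>"
      "(\<lambda>k. L2_norm \<Omega> (\<lambda>x. \<phi> k x - v x)) \<longlonglongrightarrow> 0" "(\<lambda>k. grad_norm \<Omega> (\<lambda>x. \<phi> k x - v x)) \<longlonglongrightarrow> 0"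
    using H10_approx[OF v] by blast
  have bound: "\<bar>grad_inner \<Omega> u \<psi>\<bar> \<le> real DIM('a) * H2_seminorm \<Omega> u * L2_norm \<Omega> \<psi>"
    if \<psi>: "\<psi> \<in> test_functions \<Omega>" for \<psi>
  proof -
    have "\<bar>L2_inner \<Omega> (wpartial \<Omega> b u) (wpartial \<Omega> b \<psi>)\<bar> \<le> H2_seminorm \<Omega> u * L2_norm \<Omega> \<psi>"
      if b: "b \<in> Basis" for b
    proof -
      have L: "wpartial \<Omega> b u \<in> L2 \<Omega>" "wpartial \<Omega> b \<psi> \<in> L2 \<Omega>" "partial b \<psi> \<in> L2 \<Omega>"
          "wpartial \<Omega> b (wpartial \<Omega> b u) \<in> L2 \<Omega>"
        using u1(1) u1(2)[OF b] \<psi> b by (auto intro: wpartial_L2 test_H1 test_L2 test_function_partial)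
      \<comment> \<open>The weak derivative of the test function is exchanged for its classical one,
        so that the derivative of \<open>u\<close>, itself in H1, can be integrated by
        parts.\<close>
      have "L2_inner \<Omega> (wpartial \<Omega> b u) (wpartial \<Omega> b \<psi>) = L2_inner \<Omega> (wpartial \<Omega> b u) (partial b \<psi>)"
        using L2.ip_diff_zero[OF L(2,3,1) grad_norm_test_eq[OF \<psi> b]] L2.sym by metis
      also have "\<dots> = - L2_inner \<Omega> (wpartial \<Omega> b (wpartial \<Omega> b u)) \<psi>"
        by (rule weak_partialD[OF wpartial_weak[OF u1(2)[OF b] b] \<psi>])
      finally have "\<bar>L2_inner \<Omega> (wpartial \<Omega> b u) (wpartial \<Omega> b \<psi>)\<bar>
          \<le> L2_norm \<Omega> (wpartial \<Omega> b (wpartial \<Omega> b u)) * L2_norm \<Omega> \<psi>"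
        using L2.cauchy_schwarz[OF L(4) test_L2[OF \<psi>]] by simp
      also have "\<dots> \<le> H2_seminorm \<Omega> u * L2_norm \<Omega> \<psi>"
        using wpartial_le_grad[OF b, of "wpartial \<Omega> b u"] H2_partial_le[OF b, of u]
        by (intro mult_right_mono) auto
      finally show ?thesis .
    qed
    then have "\<bar>grad_inner \<Omega> u \<psi>\<bar> \<le> (\<Sum>b::'a\<in>Basis. H2_seminorm \<Omega> u * L2_norm \<Omega> \<psi>)"
      unfolding grad_inner_def by (intro sum_abs[THEN order_trans] sum_mono)
    then show ?thesis by simp
  qed
  have l: "(\<lambda>k. \<bar>grad_inner \<Omega> u (\<phi> k)\<bar>) \<longlonglongrightarrow> \<bar>grad_inner \<Omega> u v\<bar>"
    by (intro tendsto_intros H1.tendsto_ip[OF u1(1) test_H1[OF \<phi>(1)] u1(1) H10_H1[OF v] _ \<phi>(3)])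
      (simp add: H1.N_zero)
  have r: "(\<lambda>k. real DIM('a) * H2_seminorm \<Omega> u * L2_norm \<Omega> (\<phi> k))
      \<longlonglongrightarrow> real DIM('a) * H2_seminorm \<Omega> u * L2_norm \<Omega> v"
    by (intro tendsto_intros L2.tendsto_N[OF test_L2[OF \<phi>(1)] H10_L2[OF v] \<phi>(2)])
  show ?thesis
    by (rule LIMSEQ_le[OF l r]) (use bound[OF \<phi>(1)] in auto)
qed

end

section \<open>Bochner spaces\<close>

text \<open>Completeness of Lebesgue measure transfers measurability; extension by zero reduces the
  restricted measure to the full one.\<close>

lemma measurable_lebesgue_on_AE:
  fixes f g :: "'a::euclidean_space \<Rightarrow> real"
  assumes "S \<in> sets lebesgue" "f \<in> borel_measurable (lebesgue_on S)" "AE x in lebesgue_on S. f x = g x"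
  shows "g \<in> borel_measurable (lebesgue_on S)"
proof -
  have "(\<lambda>x. if x \<in> S then f x else 0) \<in> borel_measurable lebesgue"
    using assms by (simp add: borel_measurable_if)
  moreover have "AE x in lebesgue. (if x \<in> S then f x else 0) = (if x \<in> S then g x else 0)"
    using assms(1,3) by (subst (asm) AE_restrict_space_iff) auto
  ultimately have "(\<lambda>x. if x \<in> S then g x else 0) \<in> borel_measurable lebesgue"
    by (rule borel_measurable_AE)
  then show ?thesis using assms(1) by (simp add: borel_measurable_if)
qed

lemma measurable_lebesgue_on_lim:
  fixes f :: "nat \<Rightarrow> 'a::euclidean_space \<Rightarrow> real"
  assumes "S \<in> sets lebesgue" "\<And>n. f n \<in> borel_measurable (lebesgue_on S)"
    "AE x in lebesgue_on S. (\<lambda>n. f n x) \<longlonglongrightarrow> g x"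
  shows "g \<in> borel_measurable (lebesgue_on S)"
proof (rule measurable_lebesgue_on_AE[OF assms(1)])
  show "(\<lambda>x. lim (\<lambda>n. f n x)) \<in> borel_measurable (lebesgue_on S)"
    using assms(2) by (rule borel_measurable_lim_metric)
  show "AE x in lebesgue_on S. lim (\<lambda>n. f n x) = g x"
    using assms(3) by eventually_elim (rule limI)
qed

section \<open>The time interval as a measure space\<close>

abbreviation time :: "real \<Rightarrow> real measure" where
  "time T \<equiv> lebesgue_on {0<..<T}"

lemma open_time: "open {0<..<T::real}" and sets_time: "{0<..<T::real} \<in> sets lebesgue"
  by auto

lemma space_time: "space (time T) = {0<..<T}"
  by (simp add: space_restrict_space)

lemma finite_measure_time: "finite_measure (time T)"
  by (intro finite_measure_lebesgue_on bounded_set_imp_lmeasurable sets_time bounded_subset[OF bounded_closed_interval[of 0 T]])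
    auto

lemma bounded_time_L2:
  assumes "f \<in> borel_measurable (time T)" "AE t in time T. \<bar>f t\<bar> \<le> B"
  shows "f \<in> L2 {0<..<T}"
proof -
  interpret finite_measure "time T" by (rule finite_measure_time)
  have "integrable (time T) (\<lambda>t. (f t)\<^sup>2)"
  proof (rule integrable_const_bound)
    show "AE t in time T. norm ((f t)\<^sup>2) \<le> B\<^sup>2"
      using assms(2) by eventually_elim (simp add: abs_le_square_iff[symmetric])
  qed (use assms in auto)
  then show ?thesis using assms by (simp add: L2_def)
qed

lemma const_time_L2: "(\<lambda>t. c) \<in> L2 {0<..<T::real}"
  by (rule bounded_time_L2[where B = "\<bar>c\<bar>"]) auto

lemma L2_abs: "f \<in> L2 \<Omega> \<Longrightarrow> (\<lambda>x. \<bar>f x\<bar>) \<in> L2 \<Omega>"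
  by (rule L2_bound[of f]) (auto intro: borel_measurable_abs L2_measurable)

lemma L2_time_integrable: "f \<in> L2 {0<..<T} \<Longrightarrow> integrable (time T) f"
  using L2_mult_integrable[OF _ const_time_L2[of 1]] by simp

lemma L2B_norm_eq: "(\<And>f. 0 \<le> N f) \<Longrightarrow> L2B_norm T N u = L2_norm {0<..<T} (\<lambda>t. N (u t))"
  by (simp add: L2B_norm_def L2_norm_def L2_inner_def power2_eq_square)

lemma L2B_norm_L2:
  assumes "u \<in> L2B T V N" "\<And>f. 0 \<le> N f"
  shows "(\<lambda>t. N (u t)) \<in> L2 {0<..<T}"
proof -
  have i: "integrable (time T) (\<lambda>t. (N (u t))\<^sup>2)" using assms(1) by (simp add: L2B_def)
  then have "(\<lambda>t. sqrt ((N (u t))\<^sup>2)) \<in> borel_measurable (time T)" by measurable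
  then have "(\<lambda>t. N (u t)) \<in> borel_measurable (time T)" using assms(2) by simp
  with i show ?thesis by (simp add: L2_def)
qed

section \<open>Square integrable curves in a semi-inner product space\<close>

context semi_inner begin

lemma strongly_measurable_approx:
  assumes "strongly_measurable T V N u"
  obtains s :: "nat \<Rightarrow> real \<Rightarrow> 'a \<Rightarrow> real" where "\<And>k. simple_function (time T) (s k)"
    "\<And>k t. t \<in> {0<..<T} \<Longrightarrow> s k t \<in> V" "AE t in time T. (\<lambda>k. N (\<lambda>x. s k t x - u t x)) \<longlonglongrightarrow> 0"
proof -
  obtain s :: "nat \<Rightarrow> real \<Rightarrow> 'a \<Rightarrow> real" where s: "\<forall>k. simple_function (time T) (s k) \<and> s k ` {0<..<T} \<subseteq> V"
      "AE t in time T. (\<lambda>k. N (\<lambda>x. s k t x - u t x)) \<longlonglongrightarrow> 0"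
    using assms unfolding strongly_measurable_def by blast
  show ?thesis
    by (rule that[of s]) (use s in blast)+
qed

lemma simple_ip_measurable:
  assumes "simple_function (time T) s" "simple_function (time T) r"
  shows "(\<lambda>t. ip (s t) (r t)) \<in> borel_measurable (time T)"
  by (rule borel_measurable_simple_function[OF simple_function_compose2[OF assms]])

text \<open>Strong measurability supplies simple curves that converge in \<open>N\<close> for almost
  every t. Their products are simple scalar functions, and these converge by continuity of the form;
  no sigma-algebra on \<open>V\<close> is involved.\<close>

lemma ip_time_measurable:
  assumes u: "strongly_measurable T V N u" "AE t in time T. u t \<in> V"
    and v: "strongly_measurable T V N v" "AE t in time T. v t \<in> V"
  shows "(\<lambda>t. ip (u t) (v t)) \<in> borel_measurable (time T)"
proof -
  obtain s where s: "\<And>k. simple_function (time T) (s k)"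
    "\<And>k t. t \<in> {0<..<T} \<Longrightarrow> s k t \<in> V" "AE t in time T. (\<lambda>k. N (\<lambda>x. s k t x - u t x)) \<longlonglongrightarrow> 0"
    using strongly_measurable_approx[OF u(1)] by blast
  obtain r where r: "\<And>k. simple_function (time T) (r k)"
    "\<And>k t. t \<in> {0<..<T} \<Longrightarrow> r k t \<in> V" "AE t in time T. (\<lambda>k. N (\<lambda>x. r k t x - v t x)) \<longlonglongrightarrow> 0"
    using strongly_measurable_approx[OF v(1)] by blast
  show ?thesis
  proof (rule measurable_lebesgue_on_lim[OF sets_time])
    show "(\<lambda>t. ip (s k t) (r k t)) \<in> borel_measurable (time T)" for k
      by (rule simple_ip_measurable[OF s(1) r(1)])
    show "AE t in time T. (\<lambda>k. ip (s k t) (r k t)) \<longlonglongrightarrow> ip (u t) (v t)"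
      using u(2) v(2) s(3) r(3) AE_space
    proof eventually_elim
      case (elim t)
      then show ?case by (intro tendsto_ip s(2) r(2)) (auto simp: space_time)
    qed
  qed
qed

lemma N_time_measurable:
  assumes "strongly_measurable T V N u" "AE t in time T. u t \<in> V"
  shows "(\<lambda>t. N (u t)) \<in> borel_measurable (time T)"
  unfolding N_eq using ip_time_measurable[OF assms assms] by measurable

lemma strongly_measurable_comb:
  assumes u: "strongly_measurable T V N u" "AE t in time T. u t \<in> V"
    and v: "strongly_measurable T V N v" "AE t in time T. v t \<in> V"
  shows "strongly_measurable T V N (\<lambda>t x. a * u t x + b * v t x)"
proof -
  obtain s where s: "\<And>k. simple_function (time T) (s k)"
    "\<And>k t. t \<in> {0<..<T} \<Longrightarrow> s k t \<in> V" "AE t in time T. (\<lambda>k. N (\<lambda>x. s k t x - u t x)) \<longlonglongrightarrow> 0"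
    using strongly_measurable_approx[OF u(1)] by blast
  obtain r where r: "\<And>k. simple_function (time T) (r k)"
    "\<And>k t. t \<in> {0<..<T} \<Longrightarrow> r k t \<in> V" "AE t in time T. (\<lambda>k. N (\<lambda>x. r k t x - v t x)) \<longlonglongrightarrow> 0"
    using strongly_measurable_approx[OF v(1)] by blast
  have "simple_function (time T) (\<lambda>t x. a * s k t x + b * r k t x)" for k
    by (rule simple_function_compose2[OF s(1) r(1), of "\<lambda>f g x. a * f x + b * g x"])
  moreover have "AE t in time T. (\<lambda>k. N (\<lambda>x. a * s k t x + b * r k t x - (a * u t x + b * v t x))) \<longlonglongrightarrow> 0"
    using u(2) v(2) s(3) r(3) AE_space
  proof eventually_elim
    case (elim t)
    then have V: "(\<lambda>x. s k t x - u t x) \<in> V" "(\<lambda>x. r k t x - v t x) \<in> V" for k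
      using s(2) r(2) by (auto simp: space_time intro: diff_mem)
    have "N (\<lambda>x. a * s k t x + b * r k t x - (a * u t x + b * v t x))
        \<le> \<bar>a\<bar> * N (\<lambda>x. s k t x - u t x) + \<bar>b\<bar> * N (\<lambda>x. r k t x - v t x)" for k
      using triangle[OF scale_mem[OF V(1)] scale_mem[OF V(2)], of a k b k] N_scale[OF V(1), of a k]
        N_scale[OF V(2), of b k] by (simp add: algebra_simps)
    moreover have "(\<lambda>k. \<bar>a\<bar> * N (\<lambda>x. s k t x - u t x) + \<bar>b\<bar> * N (\<lambda>x. r k t x - v t x)) \<longlonglongrightarrow> 0"
      by (rule tendsto_eq_intros elim(3,4) refl | simp)+
    ultimately show ?case by (rule tendsto_zero_le[OF N_nonneg])
  qed
  ultimately show ?thesis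
    unfolding strongly_measurable_def using s(2) r(2)
    by (intro exI[of _ "\<lambda>k t x. a * s k t x + b * r k t x"]) (auto intro: comb_mem)
qed

lemma L2B_D:
  assumes "u \<in> L2B T V N"
  shows "AE t in time T. u t \<in> V" "strongly_measurable T V N u" "(\<lambda>t. N (u t)) \<in> L2 {0<..<T}"
  using assms L2B_norm_L2[OF assms N_nonneg] by (auto simp: L2B_def)

lemma L2B_I:
  assumes "AE t in time T. u t \<in> V" "strongly_measurable T V N u"
    "g \<in> L2 {0<..<T}" "AE t in time T. N (u t) \<le> g t"
  shows "u \<in> L2B T V N"
proof -
  have "(\<lambda>t. N (u t)) \<in> L2 {0<..<T}"
  proof (rule L2_bound[OF assms(3)])
    show "AE t in time T. \<bar>N (u t)\<bar> \<le> \<bar>g t\<bar>" using assms(4) by eventually_elim simp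
  qed (rule N_time_measurable[OF assms(2,1)])
  then show ?thesis using assms(1,2) by (simp add: L2B_def L2_square_integrable)
qed

lemma L2B_comb:
  assumes "u \<in> L2B T V N" "v \<in> L2B T V N"
  shows "(\<lambda>t x. a * u t x + b * v t x) \<in> L2B T V N"
proof (rule L2B_I)
  note u = L2B_D[OF assms(1)] and v = L2B_D[OF assms(2)]
  show "strongly_measurable T V N (\<lambda>t x. a * u t x + b * v t x)"
    by (rule strongly_measurable_comb) (use u v in auto)
  show "AE t in time T. (\<lambda>x. a * u t x + b * v t x) \<in> V"
    using u(1) v(1) by eventually_elim (rule comb_mem)
  show "(\<lambda>t. \<bar>a\<bar> * N (u t) + \<bar>b\<bar> * N (v t)) \<in> L2 {0<..<T}"
    by (rule L2_comb) (use u v in auto)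
  show "AE t in time T. N (\<lambda>x. a * u t x + b * v t x) \<le> \<bar>a\<bar> * N (u t) + \<bar>b\<bar> * N (v t)"
    using u(1) v(1)
  proof eventually_elim
    case (elim t)
    then show ?case
      using triangle[OF scale_mem scale_mem, of "u t" "v t" a b] by (simp add: N_scale)
  qed
qed

lemma L2B_ip_integrable:
  assumes "u \<in> L2B T V N" "v \<in> L2B T V N"
  shows "integrable (time T) (\<lambda>t. ip (u t) (v t))"
proof (rule Bochner_Integration.integrable_bound)
  note u = L2B_D[OF assms(1)] and v = L2B_D[OF assms(2)]
  show "integrable (time T) (\<lambda>t. N (u t) * N (v t))"
    by (rule L2_mult_integrable) (use u v in auto)
  show "(\<lambda>t. ip (u t) (v t)) \<in> borel_measurable (time T)"
    by (rule ip_time_measurable) (use u v in auto)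
  show "AE t in time T. norm (ip (u t) (v t)) \<le> norm (N (u t) * N (v t))"
    using u(1) v(1)
  proof eventually_elim
    case (elim t)
    then show ?case using cauchy_schwarz[of "u t" "v t"] by simp
  qed
qed

lemma L2B_ip_bound:
  assumes "u \<in> L2B T V N" "v \<in> L2B T V N"
  shows "\<bar>LINT t|time T. ip (u t) (v t)\<bar> \<le> L2B_norm T N u * L2B_norm T N v"
proof -
  note u = L2B_D[OF assms(1)] and v = L2B_D[OF assms(2)]
  have "\<bar>LINT t|time T. ip (u t) (v t)\<bar> \<le> (LINT t|time T. \<bar>ip (u t) (v t)\<bar>)"
    by (rule integral_abs_bound)
  also have "\<dots> \<le> (LINT t|time T. N (u t) * N (v t))"
  proof (rule integral_mono_AE)
    show "integrable (time T) (\<lambda>t. N (u t) * N (v t))"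
      by (rule L2_mult_integrable) (use u v in auto)
    show "AE t in time T. \<bar>ip (u t) (v t)\<bar> \<le> N (u t) * N (v t)"
      using u(1) v(1) by eventually_elim (rule cauchy_schwarz)
  qed (use L2B_ip_integrable[OF assms] in simp)
  also have "\<dots> = L2_inner {0<..<T} (\<lambda>t. N (u t)) (\<lambda>t. N (v t))" by (simp add: L2_inner_def)
  also have "\<dots> \<le> L2B_norm T N u * L2B_norm T N v"
    using L2.cauchy_schwarz[OF u(3) v(3)] by (simp add: L2B_norm_eq)
  finally show ?thesis .
qed

lemma L2B_ip_const:
  assumes "u \<in> L2B T V N" "\<psi> \<in> V"
  shows "(\<lambda>t. ip (u t) \<psi>) \<in> L2 {0<..<T}"
proof -
  note u = L2B_D[OF assms(1)]
  have "strongly_measurable T V N (\<lambda>t. \<psi>)"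
    unfolding strongly_measurable_def
    using assms(2) by (intro exI[of _ "\<lambda>k t. \<psi>"]) (auto simp: N_zero)
  then have m: "(\<lambda>t. ip (u t) \<psi>) \<in> borel_measurable (time T)"
    using u assms(2) by (intro ip_time_measurable) auto
  show ?thesis
  proof (rule L2_bound[OF L2.scale_mem[OF u(3), of "N \<psi>"] m])
    show "AE t in time T. \<bar>ip (u t) \<psi>\<bar> \<le> \<bar>N \<psi> * N (u t)\<bar>"
      using u(1)
    proof eventually_elim
      case (elim t)
      then show ?case using cauchy_schwarz[OF elim assms(2)] by (simp add: mult.commute)
    qed
  qed
qed

lemma L2B_tensor:
  assumes f: "f \<in> L2 {0<..<T}" and \<psi>: "\<psi> \<in> V"
  shows "(\<lambda>t x. f t * \<psi> x) \<in> L2B T V N"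
proof (rule L2B_I)
  obtain F where F: "\<And>i. simple_function (time T) (F i)" "\<And>t. t \<in> space (time T) \<Longrightarrow> (\<lambda>i. F i t) \<longlonglongrightarrow> f t"
    using borel_measurable_implies_sequence_metric[OF L2_measurable[OF f], of 0] by blast
  have "AE t in time T. (\<lambda>k. N (\<lambda>x. F k t * \<psi> x - f t * \<psi> x)) \<longlonglongrightarrow> 0"
  proof (rule AE_I2)
    fix t assume "t \<in> space (time T)"
    then have "(\<lambda>k. \<bar>F k t - f t\<bar> * N \<psi>) \<longlonglongrightarrow> 0"
      using F(2)[of t] by (auto intro!: tendsto_eq_intros)
    then show "(\<lambda>k. N (\<lambda>x. F k t * \<psi> x - f t * \<psi> x)) \<longlonglongrightarrow> 0"
      using N_scale[OF \<psi>] by (simp add: left_diff_distrib[symmetric])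
  qed
  moreover have "simple_function (time T) (\<lambda>t x. F k t * \<psi> x)" for k
    using simple_function_compose1[OF F(1), of "\<lambda>c x. c * \<psi> x"] .
  ultimately show "strongly_measurable T V N (\<lambda>t x. f t * \<psi> x)"
    unfolding strongly_measurable_def
    by (intro exI[of _ "\<lambda>k t x. F k t * \<psi> x"]) (auto intro: scale_mem[OF \<psi>])
  show "(\<lambda>t. N \<psi> * \<bar>f t\<bar>) \<in> L2 {0<..<T}" by (rule L2.scale_mem[OF L2_abs[OF f]])
qed (auto simp: N_scale[OF \<psi>] scale_mem[OF \<psi>])

text \<open>Approximating simple functions are cut off where they exceed the limit by more than one.\<close>
lemma L2B_simple_approx:
  assumes u: "u \<in> L2B T V N" and "0 < \<epsilon>"
  obtains s where "simple_function (time T) s" "\<And>t. t \<in> {0<..<T} \<Longrightarrow> s t \<in> V" "s \<in> L2B T V N"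
    "L2B_norm T N (\<lambda>t x. s t x - u t x) < \<epsilon>"
proof -
  note uD = L2B_D[OF u]
  obtain s where s: "\<And>k. simple_function (time T) (s k)"
    "\<And>k t. t \<in> {0<..<T} \<Longrightarrow> s k t \<in> V" "AE t in time T. (\<lambda>k. N (\<lambda>x. s k t x - u t x)) \<longlonglongrightarrow> 0"
    using strongly_measurable_approx[OF uD(2)] by blast
  define r where "r k t = (if t \<in> {t\<in>space (time T). N (s k t) \<le> N (u t) + 1} then s k t else (\<lambda>x. 0))" for k t
  have simple: "simple_function (time T) (r k)" for k
    unfolding r_def
  proof (rule simple_function_If_set[OF s(1)])
    have "(\<lambda>t. N (s k t)) \<in> borel_measurable (time T)"
      by (rule borel_measurable_simple_function[OF simple_function_compose1[OF s(1)]])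
    then show "{t \<in> space (time T). N (s k t) \<le> N (u t) + 1} \<inter> space (time T) \<in> sets (time T)"
      using L2_measurable[OF uD(3)] by measurable
  qed simp
  have V: "r k t \<in> V" if "t \<in> {0<..<T}" for k t
    using s(2)[OF that] zero_mem by (simp add: r_def)
  have le: "N (r k t) \<le> N (u t) + 1" for k t
    by (auto simp: r_def N_zero add_nonneg_nonneg)
  have sm: "strongly_measurable T V N (r k)" for k
    unfolding strongly_measurable_def using simple[of k] V[of _ k]
    by (intro exI[of _ "\<lambda>_. r k"]) (auto simp: N_zero)
  have AEV: "AE t in time T. r k t \<in> V" for k
    using V by (intro AE_I2) (simp add: space_time)
  \<comment> \<open>The smaller majorant places the truncated curves in the space, the larger one
    dominates their distance to \<open>u\<close>.\<close>
  have g: "(\<lambda>t. N (u t) + 1) \<in> L2 {0<..<T}" "(\<lambda>t. 2 * N (u t) + 1) \<in> L2 {0<..<T}"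
    using L2_comb[OF uD(3) const_time_L2[of 1], of 1 1] L2_comb[OF uD(3) const_time_L2[of 1], of 2 1] by auto
  have rL: "r k \<in> L2B T V N" for k
    by (rule L2B_I[OF AEV sm g(1)]) (simp add: le)
  have dL: "(\<lambda>t x. r k t x - u t x) \<in> L2B T V N" for k
    using L2B_comb[OF rL[of k] u, of 1 "-1"] by simp
  have "(\<lambda>k. L2_norm {0<..<T} (\<lambda>t. 0 - N (\<lambda>x. r k t x - u t x))) \<longlonglongrightarrow> 0"
  proof (rule L2_dominated(3)[OF g(2)])
    show "(\<lambda>t. N (\<lambda>x. r k t x - u t x)) \<in> borel_measurable (time T)" for k
      using L2B_D(3)[OF dL] by (rule L2_measurable)
    show "AE t in time T. (\<lambda>k. N (\<lambda>x. r k t x - u t x)) \<longlonglongrightarrow> 0"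
      using s(3) uD(1) AE_space
    proof eventually_elim
      case (elim t)
      \<comment> \<open>Once a simple value is within distance 1 of \<open>u t\<close> the cutoff
        does not act, so truncation leaves the pointwise limit intact.\<close>
      have "\<forall>\<^sub>F k in sequentially. N (\<lambda>x. s k t x - u t x) < 1"
        using elim(1) by (rule order_tendstoD) simp
      then have "\<forall>\<^sub>F k in sequentially. N (\<lambda>x. s k t x - u t x) = N (\<lambda>x. r k t x - u t x)"
      proof eventually_elim
        case (elim k)
        have "N (s k t) \<le> N (u t) + 1"
          using N_le_diff[of "s k t" "u t"] s(2)[of t k] \<open>t \<in> space (time T)\<close> \<open>u t \<in> V\<close> elim
          by (simp add: space_time)
        then show ?case using \<open>t \<in> space (time T)\<close> by (simp add: r_def)
      qed
      from Lim_transform_eventually[OF elim(1) this] show ?case .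
    qed
    show "AE t in time T. \<bar>N (\<lambda>x. r k t x - u t x)\<bar> \<le> 2 * N (u t) + 1" for k
      using uD(1) AEV[of k]
    proof eventually_elim
      case (elim t)
      then show ?case using triangle_diff[of "r k t" "u t"] le[of k t] by simp
    qed
  qed simp
  then have "(\<lambda>k. L2B_norm T N (\<lambda>t x. r k t x - u t x)) \<longlonglongrightarrow> 0"
    by (simp add: L2B_norm_def L2_norm_def L2_inner_def power2_eq_square)
  from eventually_happens'[OF sequentially_bot order_tendstoD(2)[OF this assms(2)]]
  obtain k where "L2B_norm T N (\<lambda>t x. r k t x - u t x) < \<epsilon>" by blast
  with simple V rL show ?thesis using that by blast
qed

text \<open>Passage to a weaker norm on a larger space. The estimate for differences is a separate
  hypothesis because no linear structure of \<open>V'\<close> is assumed; this admits H2, of which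
  only the norm is at hand.\<close>

lemma L2B_change:
  assumes u: "u \<in> L2B T V' N'" and sub: "V' \<subseteq> V" and C: "0 \<le> C" "\<And>f. 0 \<le> N' f"
    and le: "\<And>f. f \<in> V' \<Longrightarrow> N f \<le> C * N' f"
    and le_diff: "\<And>f g. f \<in> V' \<Longrightarrow> g \<in> V' \<Longrightarrow> N (\<lambda>x. f x - g x) \<le> C * N' (\<lambda>x. f x - g x)"
  shows "u \<in> L2B T V N"
proof (rule L2B_I)
  have ae: "AE t in time T. u t \<in> V'" using u by (simp add: L2B_def)
  then show "AE t in time T. u t \<in> V" by eventually_elim (use sub in blast)
  obtain s :: "nat \<Rightarrow> real \<Rightarrow> 'a \<Rightarrow> real" where s: "\<forall>k. simple_function (time T) (s k) \<and> s k ` {0<..<T} \<subseteq> V'"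
      "AE t in time T. (\<lambda>k. N' (\<lambda>x. s k t x - u t x)) \<longlonglongrightarrow> 0"
    using u unfolding L2B_def strongly_measurable_def by blast
  have "AE t in time T. (\<lambda>k. N (\<lambda>x. s k t x - u t x)) \<longlonglongrightarrow> 0"
    using s(2) ae AE_space
  proof eventually_elim
    case (elim t)
    have "N (\<lambda>x. s k t x - u t x) \<le> C * N' (\<lambda>x. s k t x - u t x)" for k
      using s(1) elim by (intro le_diff) (auto simp: space_time image_subset_iff)
    moreover have "(\<lambda>k. C * N' (\<lambda>x. s k t x - u t x)) \<longlonglongrightarrow> 0"
      using elim(1) by (rule tendsto_mult_right_zero)
    ultimately show ?case by (rule tendsto_zero_le[OF N_nonneg])
  qed
  then show "strongly_measurable T V N u"
    unfolding strongly_measurable_def using s(1) sub by (intro exI[of _ s]) blast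
  show "(\<lambda>t. C * N' (u t)) \<in> L2 {0<..<T}"
    by (rule L2.scale_mem[OF L2B_norm_L2[OF u C(2)]])
  show "AE t in time T. N (u t) \<le> C * N' (u t)"
    using ae by eventually_elim (rule le)
qed

end

section \<open>Primitives on the time interval\<close>

lemma continuous_time_L2:
  fixes f :: "real \<Rightarrow> real"
  assumes "continuous_on {0..T} f"
  shows "f \<in> L2 {0<..<T}"
proof -
  have "compact (f ` {0..T})" using assms by (intro compact_continuous_image) auto
  then obtain B where B: "\<forall>x\<in>{0..T}. \<bar>f x\<bar> \<le> B"
    using compact_imp_bounded bounded_iff by (metis imageI real_norm_def)
  show ?thesis
  proof (rule bounded_time_L2)
    show "f \<in> borel_measurable (time T)"
      by (rule continuous_imp_measurable_on_sets_lebesgue[OF continuous_on_subset[OF assms]]) auto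
    show "AE t in time T. \<bar>f t\<bar> \<le> B"
      using B by (intro AE_I2) (auto simp: space_time)
  qed
qed

lemma test_real_derivative:
  fixes \<eta> :: "real \<Rightarrow> real"
  assumes "\<eta> \<in> test_functions S"
  shows "(\<eta> has_real_derivative deriv \<eta> t) (at t)" and "deriv \<eta> = partial 1 \<eta>"
    and "deriv \<eta> \<in> test_functions S"
proof -
  show 1: "(\<eta> has_real_derivative deriv \<eta> t) (at t)" for t
    using test_function_differentiable[OF assms, of t]
    by (simp add: DERIV_deriv_iff_real_differentiable)
  show "deriv \<eta> = partial 1 \<eta>"
    using partial_eqI[OF 1[unfolded has_field_derivative_def], of 1] by auto
  then show "deriv \<eta> \<in> test_functions S"
    using test_function_partial[OF assms, of 1] by simp
qed

text \<open>The finite exceptional set admits continuous functions with kinks, in particular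
  discrete functions at the nodes; the boundary terms vanish together with \<eta>.\<close>

lemma time_integration_by_parts:
  assumes \<eta>: "\<eta> \<in> test_functions {0<..<T}" and T: "0 < T"
    and f: "continuous_on {0..T} f" "finite S"
    and der: "\<And>t. t \<in> {0<..<T} - S \<Longrightarrow> (f has_real_derivative f' t) (at t)"
    and f': "f' \<in> L2 {0<..<T}"
  shows "(LINT t|time T. deriv \<eta> t * f t) = - (LINT t|time T. \<eta> t * f' t)"
proof -
  note D = test_real_derivative[OF \<eta>]
  have L: "\<eta> \<in> L2 {0<..<T}" "deriv \<eta> \<in> L2 {0<..<T}" "f \<in> L2 {0<..<T}"
    using \<eta> D(3) f continuous_time_L2 by (auto intro: test_function_L2)
  have "((\<lambda>t. deriv \<eta> t * f t + \<eta> t * f' t) has_integral (\<eta> T * f T - \<eta> 0 * f 0)) {0..T}"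
  proof (rule fundamental_theorem_of_calculus_interior_strong[OF f(2)])
    show "((\<lambda>t. \<eta> t * f t) has_vector_derivative deriv \<eta> t * f t + \<eta> t * f' t) (at t)"
      if "t \<in> {0<..<T} - S" for t
      using DERIV_mult[OF D(1) der[OF that]] by (simp add: has_real_derivative_iff_has_vector_derivative add.commute mult.commute)
    show "continuous_on {0..T} (\<lambda>t. \<eta> t * f t)"
      using f(1) test_function_continuous[OF \<eta>] by (intro continuous_on_mult)
  qed (use T in simp)
  moreover have "\<eta> 0 = 0" "\<eta> T = 0"
    using test_function_outside[OF \<eta>] by auto
  ultimately have "((\<lambda>t. deriv \<eta> t * f t + \<eta> t * f' t) has_integral 0) {0<..<T}"
    by (simp add: has_integral_Icc_iff_Ioo)
  moreover have i: "integrable (time T) (\<lambda>t. deriv \<eta> t * f t)" "integrable (time T) (\<lambda>t. \<eta> t * f' t)"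
    using L f' by (auto intro: L2_mult_integrable)
  ultimately have "(LINT t|time T. deriv \<eta> t * f t + \<eta> t * f' t) = 0"
    using has_integral_integral_lebesgue_on[OF Bochner_Integration.integrable_add[OF i] sets_time]
    by (meson has_integral_unique)
  then show ?thesis using i by simp
qed

text \<open>The primitive from 0, written as an inner product with an indicator: linearity in
  \<beta> and Hoelder continuity in t become instances of the rules for L2. The indicator of all s
  \<le> t serves because the measure lives on (0, T).\<close>

definition prim :: "real \<Rightarrow> (real \<Rightarrow> real) \<Rightarrow> real \<Rightarrow> real" where
  "prim T \<beta> t = L2_inner {0<..<T} (indicat_real {..t}) \<beta>"

lemma indicator_time_L2: "A \<in> sets borel \<Longrightarrow> indicat_real A \<in> L2 {0<..<T::real}"
  by (rule bounded_time_L2[where B = 1]) (auto simp: indicator_def intro!: borel_lebesgue_on)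

lemma prim_diff:
  assumes "\<beta> \<in> L2 {0<..<T}" "r \<le> t"
  shows "prim T \<beta> t - prim T \<beta> r = (LINT s|time T. indicat_real {r<..t} s * \<beta> s)"
proof -
  have "indicat_real {r<..t} = (\<lambda>s. indicat_real {..t} s - indicat_real {..r} s)"
    using assms(2) by (auto simp: indicator_def)
  then show ?thesis
    using L2.diff_left[OF indicator_time_L2 indicator_time_L2 assms(1), of "{..t}" "{..r}"]
    by (simp add: prim_def L2_inner_def)
qed

lemma prim_0: "prim T \<beta> 0 = 0"
proof -
  have "prim T \<beta> 0 = (LINT s|time T. 0)"
    unfolding prim_def L2_inner_def
    by (rule Bochner_Integration.integral_cong) (auto simp: space_time indicator_def)
  then show ?thesis by simp
qed

lemma integral_indicator_time:
  assumes "0 \<le> r" "r \<le> t" "t \<le> T"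
  shows "(LINT s|time T. indicat_real {r<..t} s) = t - r"
proof -
  have "(LINT s|time T. indicat_real {r<..t} s) = measure (time T) ({r<..t} \<inter> space (time T))"
    by (simp add: Int_commute)
  also have "{r<..t} \<inter> space (time T) = (if t < T then {r<..t} else {r<..<t})"
    using assms by (auto simp: space_time)
  also have "measure (time T) \<dots> = t - r"
  proof (cases "t < T")
    case True
    then show ?thesis using assms by (subst measure_restrict_space) auto
  next
    case False
    then show ?thesis using assms by (subst measure_restrict_space) auto
  qed
  finally show ?thesis .
qed

lemma indicator_time_norm:
  assumes "0 \<le> r" "r \<le> t" "t \<le> T"
  shows "L2_norm {0<..<T} (indicat_real {r<..t}) = sqrt (t - r)"
proof -
  have "(\<lambda>s. indicat_real {r<..t} s * indicat_real {r<..t} s) = indicat_real {r<..t}"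
    by (auto simp: indicator_def)
  then show ?thesis using integral_indicator_time[OF assms] by (simp add: L2_norm_def L2_inner_def)
qed

lemma prim_holder:
  assumes "\<beta> \<in> L2 {0<..<T}" "0 \<le> r" "r \<le> t" "t \<le> T"
  shows "\<bar>prim T \<beta> t - prim T \<beta> r\<bar> \<le> sqrt (t - r) * L2_norm {0<..<T} \<beta>"
  using L2.cauchy_schwarz[OF indicator_time_L2 assms(1), of "{r<..t}"] assms
  by (simp add: prim_diff indicator_time_norm L2_inner_def)

lemma prim_bound:
  assumes "\<beta> \<in> L2 {0<..<T}" "0 \<le> t" "t \<le> T"
  shows "\<bar>prim T \<beta> t\<bar> \<le> sqrt T * L2_norm {0<..<T} \<beta>"
proof -
  have "\<bar>prim T \<beta> t\<bar> \<le> sqrt t * L2_norm {0<..<T} \<beta>"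
    using prim_holder[OF assms(1), of 0 t] assms by (simp add: prim_0)
  also have "\<dots> \<le> sqrt T * L2_norm {0<..<T} \<beta>"
    using assms by (intro mult_right_mono) auto
  finally show ?thesis .
qed

lemma prim_continuous:
  assumes "\<beta> \<in> L2 {0<..<T}"
  shows "continuous_on {0..T} (prim T \<beta>)"
proof -
  let ?L = "L2_norm {0<..<T} \<beta>"
  have le: "\<bar>prim T \<beta> s - prim T \<beta> t\<bar> \<le> sqrt \<bar>s - t\<bar> * ?L" if "s \<in> {0..T}" "t \<in> {0..T}" for s t
    using prim_holder[OF assms, of s t] prim_holder[OF assms, of t s] that
    by (cases "s \<le> t") (auto simp: abs_minus_commute)
  have "(prim T \<beta> \<longlongrightarrow> prim T \<beta> t) (at t within {0..T})" if t: "t \<in> {0..T}" for t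
  proof (rule Lim_null_comparison[THEN LIM_zero_cancel])
    show "\<forall>\<^sub>F s in at t within {0..T}. norm (prim T \<beta> s - prim T \<beta> t) \<le> sqrt \<bar>s - t\<bar> * ?L"
      using le[OF _ t] by (auto simp: eventually_at_filter)
    show "((\<lambda>s. sqrt \<bar>s - t\<bar> * ?L) \<longlongrightarrow> 0) (at t within {0..T})"
      by (auto intro!: tendsto_eq_intros)
  qed
  then show ?thesis by (simp add: continuous_on)
qed

lemma prim_L2: "\<beta> \<in> L2 {0<..<T} \<Longrightarrow> prim T \<beta> \<in> L2 {0<..<T}"
  by (rule continuous_time_L2[OF prim_continuous])

lemma prim_comb:
  assumes "\<alpha> \<in> L2 {0<..<T}" "\<beta> \<in> L2 {0<..<T}"
  shows "prim T (\<lambda>s. a * \<alpha> s + b * \<beta> s) t = a * prim T \<alpha> t + b * prim T \<beta> t"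
  unfolding prim_def by (rule L2.comb_right) (use assms indicator_time_L2 in auto)

text \<open>The lower limit may lie to the left of the time interval, where \<xi> vanishes. This
  leaves room to differentiate the primitive at every real t, also outside (0, T).\<close>

lemma prim_test_eq:
  assumes \<xi>: "\<xi> \<in> test_functions {0<..<T}" and a: "a \<le> 0" "a \<le> t"
  shows "prim T \<xi> t = integral {a..t} \<xi>"
proof -
  let ?g = "\<lambda>s. indicat_real {..t} s * \<xi> s"
  have "\<xi> \<in> L2 {0<..<T}" using \<xi> by (intro test_function_L2) auto
  then have "integrable (time T) ?g"
    by (intro L2_mult_integrable indicator_time_L2) auto
  then have "(?g has_integral prim T \<xi> t) {0<..<T}"
    unfolding prim_def L2_inner_def using sets_time by (rule has_integral_integral_lebesgue_on)
  then have "((\<lambda>s. if s \<in> {0<..<T} then ?g s else 0) has_integral prim T \<xi> t) UNIV"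
    by (simp only: has_integral_restrict_UNIV)
  also have "(\<lambda>s. if s \<in> {0<..<T} then ?g s else 0) = (\<lambda>s. if s \<in> {a..t} then \<xi> s else 0)"
    using a test_function_outside[OF \<xi>] by (auto simp: indicator_def fun_eq_iff)
  finally show ?thesis
    by (simp only: has_integral_restrict_UNIV integral_unique)
qed

lemma prim_test_derivative:
  assumes \<xi>: "\<xi> \<in> test_functions {0<..<T}"
  shows "(prim T \<xi> has_real_derivative \<xi> t) (at t)"
proof -
  define a where "a = min 0 t - 1"
  have "((\<lambda>x. integral {a..x} \<xi>) has_real_derivative \<xi> t) (at t within {a..t + 1})"
    using test_function_continuous[OF \<xi>] by (intro integral_has_real_derivative) (auto simp: a_def)
  then have "((\<lambda>x. integral {a..x} \<xi>) has_real_derivative \<xi> t) (at t)"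
    by (subst (asm) at_within_interior) (auto simp: a_def)
  then show ?thesis
    by (rule has_field_derivative_transform_within_open[where S = "{a<..}"])
      (auto simp: a_def intro!: prim_test_eq[OF \<xi>, symmetric])
qed

text \<open>Mean value zero is what makes the primitive vanish to the right of the support of \<xi>;
  to the left it vanishes in any case.\<close>

lemma prim_test_function:
  assumes \<xi>: "\<xi> \<in> test_functions {0<..<T}" and z: "(LINT t|time T. \<xi> t) = 0"
  shows "prim T \<xi> \<in> test_functions {0<..<T}" "deriv (prim T \<xi>) = \<xi>"
proof -
  note d = prim_test_derivative[OF \<xi>]
  show "deriv (prim T \<xi>) = \<xi>" using DERIV_imp_deriv[OF d] by auto
  have p: "partial b (prim T \<xi>) = \<xi>" if "b \<in> Basis" for b
    using partial_eqI[OF d[unfolded has_field_derivative_def], of 1] that by auto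
  have Ck: "C_k k (prim T \<xi>)" for k
  proof (cases k)
    case 0
    then show ?thesis using d DERIV_isCont continuous_at_imp_continuous_on by simp blast
  next
    case (Suc m)
    then show ?thesis using p d \<xi> by (auto simp: test_functions_def real_differentiable_def)
  qed
  let ?K = "closure {t. \<xi> t \<noteq> 0}"
  have K: "compact ?K" "?K \<subseteq> {0<..<T}" using test_function_support[OF \<xi>] by auto
  \<comment> \<open>For an empty support a one-point interval inside (0, T) serves; if (0, T) is
    itself empty, \<open>{1..T - 1}\<close> is an empty interval that meets the bounds.\<close>
  obtain p q where pq: "0 < p" "q < T" "?K \<subseteq> {p..q}"
  proof (cases "?K = {}")
    case True
    show ?thesis
    proof (cases "0 < T")
      case True
      then show ?thesis using that[of "T/2" "T/2"] \<open>?K = {}\<close> by auto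
    next
      case False
      then show ?thesis using that[of 1 "T - 1"] \<open>?K = {}\<close> by auto
    qed
  next
    case False
    obtain p q where "p \<in> ?K" "q \<in> ?K" "\<forall>t\<in>?K. p \<le> t" "\<forall>t\<in>?K. t \<le> q"
      using compact_attains_inf[OF K(1) False] compact_attains_sup[OF K(1) False] by blast
    then show ?thesis using K(2) by (intro that[of p q]) auto
  qed
  have zero: "\<xi> t = 0" if "t \<notin> {p..q}" for t
    using that pq(3) closure_subset[of "{t. \<xi> t \<noteq> 0}"] by auto
  have "prim T \<xi> t = 0" if "t \<notin> {p..q}" for t
  proof (cases "t < p")
    case True
    have "prim T \<xi> t = (LINT s|time T. 0)"
      unfolding prim_def L2_inner_def
      by (rule Bochner_Integration.integral_cong) (use zero True in \<open>auto simp: indicator_def\<close>)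
    then show ?thesis by simp
  next
    case False
    then have "q < t" using that by auto
    have "prim T \<xi> t = (LINT s|time T. \<xi> s)"
      unfolding prim_def L2_inner_def
      by (rule Bochner_Integration.integral_cong) (use zero \<open>q < t\<close> in \<open>auto simp: indicator_def\<close>)
    then show ?thesis using z by simp
  qed
  then have "{t. prim T \<xi> t \<noteq> 0} \<subseteq> {p..q}" by blast
  then have "closure {t. prim T \<xi> t \<noteq> 0} \<subseteq> {p..q}"
    by (intro closure_minimal) auto
  moreover from this have "compact (closure {t. prim T \<xi> t \<noteq> 0})"
    using bounded_subset[OF bounded_closed_interval] by (simp add: compact_eq_bounded_closed)
  ultimately show "prim T \<xi> \<in> test_functions {0<..<T}"
    using Ck pq unfolding test_functions_def by fastforce
qed

section \<open>Weak derivatives in one variable\<close>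

lemma L2_zero_AE_test:
  assumes "open \<Omega>" "d \<in> L2 \<Omega>" "\<And>\<phi>. \<phi> \<in> test_functions \<Omega> \<Longrightarrow> L2_inner \<Omega> \<phi> d = 0"
  shows "AE x in lebesgue_on \<Omega>. d x = 0"
proof -
  interpret open_domain \<Omega> by unfold_locales (rule assms)
  show ?thesis
    by (rule L2_norm_zero_AE[OF assms(2) L2_inner_self_zero[OF assms(2)]]) (subst L2.sym, rule assms(3))
qed

text \<open>With a fixed test function \<zeta> of integral 1, subtracting from any \<phi> its
  integral times \<zeta> leaves the derivative of a test function. Hence \<gamma> acts on \<phi>
  like the constant <\<zeta>, \<gamma>>.\<close>

lemma du_bois_reymond:
  assumes T: "0 < T" and \<gamma>: "\<gamma> \<in> L2 {0<..<T}"
    and z: "\<And>\<eta>. \<eta> \<in> test_functions {0<..<T} \<Longrightarrow> (LINT t|time T. deriv \<eta> t * \<gamma> t) = 0"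
  shows "\<exists>c. AE t in time T. \<gamma> t = c"
proof -
  \<comment> \<open>A bump on the middle third; it is positive on an interval, so its integral is
    not zero and it can be normalised.\<close>
  have "box_cutoff (T/3) (2*T/3) 1 \<in> test_functions {0<..<T}" (is "?b \<in> _")
    using T by (intro box_cutoff_test) auto
  note b = this
  have L: "\<phi> \<in> L2 {0<..<T}" if "\<phi> \<in> test_functions {0<..<T}" for \<phi>
    using that by (intro test_function_L2) auto
  have "(LINT t|time T. ?b t) \<noteq> 0"
  proof
    assume "(LINT t|time T. ?b t) = 0"
    then have "AE t in time T. ?b t = 0"
      by (subst (asm) integral_nonneg_eq_0_iff_AE) (use L2_time_integrable[OF L[OF b]] in \<open>auto intro!: AE_I2 box_cutoff_bounds(1)\<close>)
    then have "AE t in lebesgue. t \<in> {0<..<T} \<longrightarrow> ?b t = 0"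
      by (subst (asm) AE_restrict_space_iff) auto
    then have "AE t in lebesgue. t \<notin> box (T/3) (2*T/3)"
    proof eventually_elim
      case (elim t)
      show ?case
      proof
        assume t: "t \<in> box (T/3) (2*T/3)"
        then have "0 < ?b t" using box_bump_pos[of "T/3" "2*T/3" t] by (simp add: box_cutoff_def)
        with t T elim show False by simp
      qed
    qed
    then have "box (T/3) (2*T/3) \<in> null_sets lebesgue"
      using AE_iff_null_sets[of "box (T/3) (2*T/3)" lebesgue] by simp
    then have "emeasure lebesgue (box (T/3) (2*T/3)) = 0" by auto
    then show False using T by simp
  qed
  then obtain \<zeta> where \<zeta>: "\<zeta> \<in> test_functions {0<..<T}" "(LINT t|time T. \<zeta> t) = 1"
    using test_function_scale[OF b, of "1 / (LINT t|time T. ?b t)"] by force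
  define c where "c = L2_inner {0<..<T} \<zeta> \<gamma>"
  have "AE t in time T. \<gamma> t - c = 0"
  proof (rule L2_zero_AE_test)
    show "(\<lambda>t. \<gamma> t - c) \<in> L2 {0<..<T}" by (rule L2.diff_mem[OF \<gamma> const_time_L2])
    fix \<phi> :: "real \<Rightarrow> real" assume \<phi>: "\<phi> \<in> test_functions {0<..<T}"
    let ?m = "LINT t|time T. \<phi> t"
    let ?\<xi> = "\<lambda>t. 1 * \<phi> t + (- ?m) * \<zeta> t"
    have \<xi>: "?\<xi> \<in> test_functions {0<..<T}"
      using \<phi> \<zeta> by (intro test_function_add test_function_scale)
    have "(LINT t|time T. ?\<xi> t) = 0"
      using \<zeta> L2_time_integrable[OF L[OF \<phi>]] L2_time_integrable[OF L[OF \<zeta>(1)]] by simp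
    note p = prim_test_function[OF \<xi> this]
    have "L2_inner {0<..<T} ?\<xi> \<gamma> = 0"
      using z[OF p(1)] unfolding p(2) by (simp only: L2_inner_def)
    then have "L2_inner {0<..<T} \<phi> \<gamma> = ?m * c"
      using L2.comb_left[OF L[OF \<phi>] L[OF \<zeta>(1)] \<gamma>, of 1 "- ?m"] by (simp add: c_def)
    moreover have "L2_inner {0<..<T} \<phi> (\<lambda>t. c) = ?m * c"
      by (simp add: L2_inner_def)
    ultimately show "L2_inner {0<..<T} \<phi> (\<lambda>t. \<gamma> t - c) = 0"
      using L2.diff_right[OF \<gamma> const_time_L2 L[OF \<phi>]] by simp
  qed auto
  then show ?thesis by auto
qed

text \<open>For a test function in place of \<beta> the primitive is differentiable and the
  classical rule applies. Both sides depend continuously on \<beta> in L2, so density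
  concludes.\<close>

lemma prim_by_parts:
  assumes T: "0 < T" and \<beta>: "\<beta> \<in> L2 {0<..<T}" and \<eta>: "\<eta> \<in> test_functions {0<..<T}"
  shows "(LINT t|time T. deriv \<eta> t * prim T \<beta> t) = - (LINT t|time T. \<eta> t * \<beta> t)"
proof -
  have L: "\<phi> \<in> L2 {0<..<T}" if "\<phi> \<in> test_functions {0<..<T}" for \<phi>
    using that by (intro test_function_L2) auto
  obtain \<phi> where \<phi>: "\<And>n. \<phi> n \<in> test_functions {0<..<T}" "(\<lambda>n. L2_norm {0<..<T} (\<lambda>x. \<beta> x - \<phi> n x)) \<longlonglongrightarrow> 0"
    using L2_approx_sequence[OF open_time \<beta>] by blast
  have lim: "(\<lambda>n. L2_norm {0<..<T} (\<lambda>x. \<phi> n x - \<beta> x)) \<longlonglongrightarrow> 0"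
    using \<phi>(2) L2.N_minus_commute[OF \<beta> L[OF \<phi>(1)]] by simp
  have lim_prim: "(\<lambda>n. L2_norm {0<..<T} (\<lambda>x. prim T (\<phi> n) x - prim T \<beta> x)) \<longlonglongrightarrow> 0"
  proof (rule tendsto_zero_le[OF L2.N_nonneg])
    show "L2_norm {0<..<T} (\<lambda>x. prim T (\<phi> n) x - prim T \<beta> x)
        \<le> L2_norm {0<..<T} (\<lambda>x. \<phi> n x - \<beta> x) * (sqrt T * L2_norm {0<..<T} (\<lambda>t. 1))" for n
    proof -
      let ?d = "\<lambda>x. \<phi> n x - \<beta> x"
      have d: "?d \<in> L2 {0<..<T}" by (rule L2.diff_mem[OF L[OF \<phi>(1)] \<beta>])
      have eq: "(\<lambda>x. prim T (\<phi> n) x - prim T \<beta> x) = prim T ?d"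
        using prim_comb[OF L[OF \<phi>(1)] \<beta>, of 1 n "-1"] by (intro ext) simp
      have "(L2_norm {0<..<T} (\<lambda>x. prim T (\<phi> n) x - prim T \<beta> x))\<^sup>2 = (L2_norm {0<..<T} (prim T ?d))\<^sup>2"
        unfolding eq ..
      also have "\<dots> \<le> (LINT t|time T. (sqrt T * L2_norm {0<..<T} ?d)\<^sup>2 * 1\<^sup>2)"
        unfolding L2_norm_eq[of _ "prim T ?d"]
      proof (rule integral_mono)
        show "(prim T ?d t)\<^sup>2 \<le> (sqrt T * L2_norm {0<..<T} ?d)\<^sup>2 * 1\<^sup>2" if "t \<in> space (time T)" for t
          using prim_bound[OF d, of t] that T by (simp add: space_time abs_le_square_iff[symmetric])
        show "integrable (time T) (\<lambda>t. (sqrt T * L2_norm {0<..<T} ?d)\<^sup>2 * 1\<^sup>2)"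
          by (rule L2_time_integrable[OF const_time_L2])
      qed (rule L2_square_integrable[OF prim_L2[OF d]])
      also have "\<dots> = (L2_norm {0<..<T} ?d * (sqrt T * L2_norm {0<..<T} (\<lambda>t. 1)))\<^sup>2"
        using L2_norm_eq[of "{0<..<T}" "\<lambda>t. 1"] by (simp add: power_mult_distrib)
      finally show ?thesis by (rule power2_le_imp_le) (use T in simp)
    qed
    show "(\<lambda>n. L2_norm {0<..<T} (\<lambda>x. \<phi> n x - \<beta> x) * (sqrt T * L2_norm {0<..<T} (\<lambda>t. 1))) \<longlonglongrightarrow> 0"
      by (rule tendsto_mult_left_zero[OF lim])
  qed
  have step: "L2_inner {0<..<T} (deriv \<eta>) (prim T (\<phi> n)) = - L2_inner {0<..<T} \<eta> (\<phi> n)" for n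
    unfolding L2_inner_def
    by (rule time_integration_by_parts[OF \<eta> T prim_continuous[OF L[OF \<phi>(1)]], of "{}"])
      (use prim_test_derivative[OF \<phi>(1)] L[OF \<phi>(1)] in auto)
  note D = L[OF test_real_derivative(3)[OF \<eta>]]
  have c: "(\<lambda>n::nat. L2_norm {0<..<T} (\<lambda>x. f x - f x)) \<longlonglongrightarrow> 0" for f :: "real \<Rightarrow> real"
    by (simp add: L2.N_zero)
  have "(\<lambda>n. L2_inner {0<..<T} (deriv \<eta>) (prim T (\<phi> n))) \<longlonglongrightarrow> L2_inner {0<..<T} (deriv \<eta>) (prim T \<beta>)"
    by (rule L2.tendsto_ip[OF D prim_L2[OF L[OF \<phi>(1)]] D prim_L2[OF \<beta>] c lim_prim])
  moreover have "(\<lambda>n. - L2_inner {0<..<T} \<eta> (\<phi> n)) \<longlonglongrightarrow> - L2_inner {0<..<T} \<eta> \<beta>"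
    by (intro tendsto_minus L2.tendsto_ip[OF L[OF \<eta>] L[OF \<phi>(1)] L[OF \<eta>] \<beta> c lim])
  ultimately have "L2_inner {0<..<T} (deriv \<eta>) (prim T \<beta>) = - L2_inner {0<..<T} \<eta> \<beta>"
    unfolding step by (rule LIMSEQ_unique)
  then show ?thesis by (simp add: L2_inner_def)
qed

text \<open>The difference of \<alpha> and the primitive of \<beta> has weak derivative zero. Weak
  differentiability is used in this form, since a primitive has values at the nodes and at time
  0.\<close>

lemma weak_derivative_prim:
  assumes T: "0 < T" and \<alpha>: "\<alpha> \<in> L2 {0<..<T}" and \<beta>: "\<beta> \<in> L2 {0<..<T}"
    and w: "\<And>\<eta>. \<eta> \<in> test_functions {0<..<T} \<Longrightarrow>
      (LINT t|time T. deriv \<eta> t * \<alpha> t) = - (LINT t|time T. \<eta> t * \<beta> t)"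
  shows "\<exists>c. AE t in time T. \<alpha> t = c + prim T \<beta> t"
proof -
  have "\<exists>c. AE t in time T. \<alpha> t - prim T \<beta> t = c"
  proof (rule du_bois_reymond[OF T])
    show "(\<lambda>t. \<alpha> t - prim T \<beta> t) \<in> L2 {0<..<T}" by (rule L2.diff_mem[OF \<alpha> prim_L2[OF \<beta>]])
    fix \<eta> assume \<eta>: "\<eta> \<in> test_functions {0<..<T}"
    have D: "deriv \<eta> \<in> L2 {0<..<T}"
      using test_real_derivative(3)[OF \<eta>] by (intro test_function_L2) auto
    show "(LINT t|time T. deriv \<eta> t * (\<alpha> t - prim T \<beta> t)) = 0"
      using w[OF \<eta>] prim_by_parts[OF T \<beta> \<eta>] L2_mult_integrable[OF D \<alpha>] L2_mult_integrable[OF D prim_L2[OF \<beta>]]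
      by (simp add: right_diff_distrib)
  qed
  then obtain c where "AE t in time T. \<alpha> t - prim T \<beta> t = c" by blast
  then have "AE t in time T. \<alpha> t = c + prim T \<beta> t" by eventually_elim simp
  then show ?thesis by blast
qed

section \<open>Functionals on \<open>Y\<close> and the time derivative\<close>

text \<open>\<open>R\<close> is the radius of a ball about the origin that contains \<Omega>. It
  makes the Poincare constant 2R explicit and reappears in the final constant.\<close>

locale cylinder = open_domain \<Omega> for \<Omega> :: "'a::euclidean_space set" +
  fixes T R :: real
  assumes T_pos: "0 < T" and R_nonneg: "0 \<le> R" and R_bound: "\<And>x. x \<in> \<Omega> \<Longrightarrow> norm x \<le> R"
begin

lemma H10_poincare: "u \<in> H10 \<Omega> \<Longrightarrow> L2_norm \<Omega> u \<le> 2 * R * grad_norm \<Omega> u"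
  by (rule poincare[OF _ R_bound R_nonneg])

lemma Y_L2B: "v \<in> Y_space \<Omega> T \<Longrightarrow> v \<in> L2B T (H10 \<Omega>) (grad_norm \<Omega>)"
  by (simp add: Y_space_def)

lemma Y_L2B_L2:
  assumes "v \<in> Y_space \<Omega> T"
  shows "v \<in> L2B T (L2 \<Omega>) (L2_norm \<Omega>)"
  by (rule L2.L2B_change[OF Y_L2B[OF assms], where C = "2 * R"])
    (auto simp: R_nonneg H10_L2 H10.diff_mem H10_poincare)

lemma Y_L2B_H1:
  assumes "v \<in> Y_space \<Omega> T"
  shows "v \<in> L2B T (H1 \<Omega>) (grad_norm \<Omega>)"
  by (rule H1.L2B_change[OF Y_L2B[OF assms], where C = 1]) (auto simp: H10_H1)

lemma H2_norm_nonneg: "0 \<le> H2_norm \<Omega> u"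
  using L2_le_H2_norm[of u] L2.N_nonneg[of \<Omega> u] by linarith

lemma H2_L2B_L2:
  assumes "v \<in> L2B T (H2 \<Omega>) (H2_norm \<Omega>)"
  shows "v \<in> L2B T (L2 \<Omega>) (L2_norm \<Omega>)"
  by (rule L2.L2B_change[OF assms, where C = 1]) (auto simp: H2_norm_nonneg L2_le_H2_norm intro: H1_L2 H2_H1)

lemma H2_L2B_H1:
  assumes "v \<in> L2B T (H2 \<Omega>) (H2_norm \<Omega>)"
  shows "v \<in> L2B T (H1 \<Omega>) (grad_norm \<Omega>)"
  by (rule H1.L2B_change[OF assms, where C = 1]) (auto simp: H2_norm_nonneg grad_le_H2_norm intro: H2_H1)

lemma L2B_norm_L2_le_Y:
  assumes "v \<in> Y_space \<Omega> T"
  shows "L2B_norm T (L2_norm \<Omega>) v \<le> 2 * R * Y_norm \<Omega> T v"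
proof -
  note v = H10.L2B_D[OF Y_L2B[OF assms]]
  have "(L2_norm {0<..<T} (\<lambda>t. L2_norm \<Omega> (v t)))\<^sup>2 \<le> (L2_norm {0<..<T} (\<lambda>t. 2 * R * grad_norm \<Omega> (v t)))\<^sup>2"
    unfolding L2_norm_eq[of "{0<..<T}"]
  proof (rule integral_mono_AE)
    show "integrable (time T) (\<lambda>t. (L2_norm \<Omega> (v t))\<^sup>2)"
      by (rule L2_square_integrable[OF L2.L2B_D(3)[OF Y_L2B_L2[OF assms]]])
    show "integrable (time T) (\<lambda>t. (2 * R * grad_norm \<Omega> (v t))\<^sup>2)"
      by (rule L2_square_integrable[OF L2.scale_mem[OF v(3)]])
    show "AE t in time T. (L2_norm \<Omega> (v t))\<^sup>2 \<le> (2 * R * grad_norm \<Omega> (v t))\<^sup>2"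
      using v(1) by eventually_elim (intro power_mono H10_poincare L2.N_nonneg)
  qed
  then have "L2_norm {0<..<T} (\<lambda>t. L2_norm \<Omega> (v t)) \<le> L2_norm {0<..<T} (\<lambda>t. 2 * R * grad_norm \<Omega> (v t))"
    by (rule power2_le_imp_le) simp
  also have "\<dots> = 2 * R * Y_norm \<Omega> T v"
    using R_nonneg by (simp add: L2.N_scale[OF v(3)] Y_norm_def L2B_norm_eq)
  finally show ?thesis by (simp add: L2B_norm_eq)
qed

lemma Y_comb: "v \<in> Y_space \<Omega> T \<Longrightarrow> w \<in> Y_space \<Omega> T \<Longrightarrow> (\<lambda>t x. a * v t x + b * w t x) \<in> Y_space \<Omega> T"
  unfolding Y_space_def by (rule H10.L2B_comb)

lemma Y_tensor: "f \<in> L2 {0<..<T} \<Longrightarrow> \<psi> \<in> H10 \<Omega> \<Longrightarrow> (\<lambda>t x. f t * \<psi> x) \<in> Y_space \<Omega> T"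
  unfolding Y_space_def by (rule H10.L2B_tensor)

lemma Y_norm_tensor:
  assumes "f \<in> L2 {0<..<T}" "\<psi> \<in> H10 \<Omega>"
  shows "Y_norm \<Omega> T (\<lambda>t x. f t * \<psi> x) = L2_norm {0<..<T} f * grad_norm \<Omega> \<psi>"
proof -
  have "grad_norm \<Omega> (\<lambda>x. f t * \<psi> x) = grad_norm \<Omega> \<psi> * \<bar>f t\<bar>" for t
    by (subst H10.N_scale[OF assms(2)]) (rule mult.commute)
  then have "Y_norm \<Omega> T (\<lambda>t x. f t * \<psi> x) = L2_norm {0<..<T} (\<lambda>t. grad_norm \<Omega> \<psi> * \<bar>f t\<bar>)"
    by (simp add: Y_norm_def L2B_norm_eq)
  also have "\<dots> = grad_norm \<Omega> \<psi> * L2_norm {0<..<T} (\<lambda>t. \<bar>f t\<bar>)"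
    using L2.N_scale[OF L2_abs[OF assms(1)]] by simp
  also have "L2_norm {0<..<T} (\<lambda>t. \<bar>f t\<bar>) = L2_norm {0<..<T} f"
    by (simp add: L2_norm_def L2_inner_def)
  finally show ?thesis by simp
qed

section \<open>Functionals on Y and uniqueness of the time derivative\<close>

lemma Y_dual_linear:
  assumes "l \<in> Y_dual \<Omega> T" "v \<in> Y_space \<Omega> T" "w \<in> Y_space \<Omega> T"
  shows "l (\<lambda>t x. a * v t x + b * w t x) = a * l v + b * l w"
  using assms by (simp add: Y_dual_def)

lemma Y_dual_bound:
  assumes "l \<in> Y_dual \<Omega> T"
  obtains C where "0 \<le> C" "\<And>v. v \<in> Y_space \<Omega> T \<Longrightarrow> \<bar>l v\<bar> \<le> C * Y_norm \<Omega> T v"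
proof -
  obtain C where C: "\<And>v. v \<in> Y_space \<Omega> T \<Longrightarrow> \<bar>l v\<bar> \<le> C * Y_norm \<Omega> T v"
    using assms unfolding Y_dual_def by blast
  have "0 \<le> Y_norm \<Omega> T v" for v by (simp add: Y_norm_def L2B_norm_def)
  then have "\<bar>l v\<bar> \<le> max C 0 * Y_norm \<Omega> T v" if "v \<in> Y_space \<Omega> T" for v
    using order_trans[OF C[OF that] mult_right_mono[of C "max C 0" "Y_norm \<Omega> T v"]] by simp
  then show ?thesis using that[of "max C 0"] by simp
qed

lemma Y_dual_comb:
  assumes "l \<in> Y_dual \<Omega> T" "k \<in> Y_dual \<Omega> T"
  shows "(\<lambda>v. a * l v + b * k v) \<in> Y_dual \<Omega> T"
proof -
  obtain C where C: "0 \<le> C" "\<And>v. v \<in> Y_space \<Omega> T \<Longrightarrow> \<bar>l v\<bar> \<le> C * Y_norm \<Omega> T v"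
    using Y_dual_bound[OF assms(1)] by blast
  obtain D where D: "0 \<le> D" "\<And>v. v \<in> Y_space \<Omega> T \<Longrightarrow> \<bar>k v\<bar> \<le> D * Y_norm \<Omega> T v"
    using Y_dual_bound[OF assms(2)] by blast
  have "\<bar>a * l v + b * k v\<bar> \<le> (\<bar>a\<bar> * C + \<bar>b\<bar> * D) * Y_norm \<Omega> T v" if "v \<in> Y_space \<Omega> T" for v
  proof -
    have "\<bar>a * l v + b * k v\<bar> \<le> \<bar>a\<bar> * \<bar>l v\<bar> + \<bar>b\<bar> * \<bar>k v\<bar>"
      using abs_triangle_ineq[of "a * l v" "b * k v"] by (simp add: abs_mult)
    also have "\<dots> \<le> \<bar>a\<bar> * (C * Y_norm \<Omega> T v) + \<bar>b\<bar> * (D * Y_norm \<Omega> T v)"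
      using C(2)[OF that] D(2)[OF that] by (intro add_mono mult_left_mono) auto
    finally show ?thesis by (simp add: algebra_simps)
  qed
  then have "\<exists>C. \<forall>v\<in>Y_space \<Omega> T. \<bar>a * l v + b * k v\<bar> \<le> C * Y_norm \<Omega> T v" by blast
  moreover have "a * l (\<lambda>t x. c * v t x + d * w t x) + b * k (\<lambda>t x. c * v t x + d * w t x)
      = c * (a * l v + b * k v) + d * (a * l w + b * k w)"
    if "v \<in> Y_space \<Omega> T" "w \<in> Y_space \<Omega> T" for v w c d
    using Y_dual_linear[OF assms(1) that] Y_dual_linear[OF assms(2) that] by (simp add: algebra_simps)
  ultimately show ?thesis by (simp add: Y_dual_def)
qed

lemma Y_dual_sum:
  assumes l: "l \<in> Y_dual \<Omega> T" and "finite I" "\<And>i. i \<in> I \<Longrightarrow> f i \<in> L2 {0<..<T}" "\<And>i. i \<in> I \<Longrightarrow> \<psi> i \<in> H10 \<Omega>"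
    "\<And>i. i \<in> I \<Longrightarrow> l (\<lambda>t x. f i t * \<psi> i x) = 0"
  shows "(\<lambda>t x. \<Sum>i\<in>I. f i t * \<psi> i x) \<in> Y_space \<Omega> T \<and> l (\<lambda>t x. \<Sum>i\<in>I. f i t * \<psi> i x) = 0"
  using assms(2-)
proof (induction I rule: finite_induct)
  case empty
  have z: "(\<lambda>t x. 0) \<in> Y_space \<Omega> T"
    using Y_tensor[OF const_time_L2[of 0] H10_zero] by simp
  moreover have "l (\<lambda>t x. 0) = 0"
    using Y_dual_linear[OF l z z, of 0 0] by simp
  ultimately show ?case by simp
next
  case (insert i I)
  then have I: "(\<lambda>t x. \<Sum>i\<in>I. f i t * \<psi> i x) \<in> Y_space \<Omega> T" "l (\<lambda>t x. \<Sum>i\<in>I. f i t * \<psi> i x) = 0"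
    and i: "(\<lambda>t x. f i t * \<psi> i x) \<in> Y_space \<Omega> T" "l (\<lambda>t x. f i t * \<psi> i x) = 0"
    by (auto intro: Y_tensor)
  from Y_comb[OF i(1) I(1), of 1 1] Y_dual_linear[OF l i(1) I(1), of 1 1] i I insert.hyps
  show ?case by simp
qed

text \<open>The span of the products \<open>\<eta>(t) \<psi>(x)\<close> is dense in \<open>Y\<close>.\<close>
lemma Y_dual_zero:
  assumes l: "l \<in> Y_dual \<Omega> T"
    and z: "\<And>\<eta> \<psi>. \<eta> \<in> test_functions {0<..<T} \<Longrightarrow> \<psi> \<in> H10 \<Omega> \<Longrightarrow> l (\<lambda>t x. \<eta> t * \<psi> x) = 0"
    and v: "v \<in> Y_space \<Omega> T"
  shows "l v = 0"
proof -
  obtain C where C: "0 \<le> C" "\<And>v. v \<in> Y_space \<Omega> T \<Longrightarrow> \<bar>l v\<bar> \<le> C * Y_norm \<Omega> T v"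
    using Y_dual_bound[OF l] by blast
  have diff: "\<bar>l v - l w\<bar> \<le> C * Y_norm \<Omega> T (\<lambda>t x. v t x - w t x)"
    if "v \<in> Y_space \<Omega> T" "w \<in> Y_space \<Omega> T" for v w
    using C(2)[OF Y_comb[OF that, of 1 "-1"]] Y_dual_linear[OF l that, of 1 "-1"] by simp
  \<comment> \<open>Density on the time interval extends the hypothesis from smooth \<eta> to all
    square integrable factors, in particular to indicators of level sets.\<close>
  have tensor: "l (\<lambda>t x. f t * \<psi> x) = 0" if f: "f \<in> L2 {0<..<T}" and \<psi>: "\<psi> \<in> H10 \<Omega>" for f \<psi>
  proof -
    obtain \<phi> where \<phi>: "\<And>n. \<phi> n \<in> test_functions {0<..<T}" "(\<lambda>n. L2_norm {0<..<T} (\<lambda>x. f x - \<phi> n x)) \<longlonglongrightarrow> 0"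
      using L2_approx_sequence[OF open_time f] by blast
    have \<phi>L: "\<phi> n \<in> L2 {0<..<T}" for n using \<phi>(1) by (intro test_function_L2) auto
    have "\<bar>l (\<lambda>t x. f t * \<psi> x)\<bar> \<le> C * grad_norm \<Omega> \<psi> * L2_norm {0<..<T} (\<lambda>x. f x - \<phi> n x)" for n
    proof -
      have "Y_norm \<Omega> T (\<lambda>t x. f t * \<psi> x - \<phi> n t * \<psi> x) = L2_norm {0<..<T} (\<lambda>x. f x - \<phi> n x) * grad_norm \<Omega> \<psi>"
        using Y_norm_tensor[OF L2.diff_mem[OF f \<phi>L] \<psi>, of n] by (simp only: left_diff_distrib)
      then show ?thesis
        using diff[OF Y_tensor[OF f \<psi>] Y_tensor[OF \<phi>L \<psi>], of n] z[OF \<phi>(1) \<psi>, of n]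
        by (simp only: mult_ac)
    qed
    from LIMSEQ_le_const[OF tendsto_mult_right_zero[OF \<phi>(2)], OF exI[of _ 0]] this
    have "\<bar>l (\<lambda>t x. f t * \<psi> x)\<bar> \<le> 0" by blast
    then show ?thesis by simp
  qed
  have "\<bar>l v\<bar> \<le> C * \<epsilon>" if eps: "0 < \<epsilon>" for \<epsilon>
  proof -
    obtain s where s: "simple_function (time T) s" "\<And>t. t \<in> {0<..<T} \<Longrightarrow> s t \<in> H10 \<Omega>"
        "s \<in> L2B T (H10 \<Omega>) (grad_norm \<Omega>)" "L2B_norm T (grad_norm \<Omega>) (\<lambda>t x. s t x - v t x) < \<epsilon>"
      using H10.L2B_simple_approx[OF Y_L2B[OF v] eps] by blast
    have sY: "s \<in> Y_space \<Omega> T" using s(3) by (simp add: Y_space_def)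
    let ?I = "s ` {0<..<T}"
    let ?A = "\<lambda>\<psi>. s -` {\<psi>} \<inter> {0<..<T}"
    have fin: "finite ?I" using simple_functionD(1)[OF s(1)] by (simp add: space_time)
    have A: "indicat_real (?A \<psi>) \<in> L2 {0<..<T}" for \<psi>
      using simple_functionD(2)[OF s(1), of "{\<psi>}"]
      by (intro bounded_time_L2[where B = 1]) (auto simp: space_time indicator_def)
    have sum: "(\<lambda>t x. \<Sum>\<psi>\<in>?I. indicat_real (?A \<psi>) t * \<psi> x) \<in> Y_space \<Omega> T \<and>
        l (\<lambda>t x. \<Sum>\<psi>\<in>?I. indicat_real (?A \<psi>) t * \<psi> x) = 0" (is "?s \<in> _ \<and> _")
      by (rule Y_dual_sum[OF l fin A]) (use s(2) tensor[OF A] in auto)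
    have "?s t = s t" if "t \<in> {0<..<T}" for t
    proof
      fix x
      have "?s t x = (\<Sum>\<psi>\<in>?I. if \<psi> = s t then \<psi> x else 0)"
        using that by (intro sum.cong) (auto simp: indicator_def)
      also have "\<dots> = s t x" using fin that by (subst sum.delta) auto
      finally show "?s t x = s t x" .
    qed
    note s_eq = this
    \<comment> \<open>The sum over the level sets is known to agree with \<open>s\<close> on (0, T)
      only. As functions the two may differ, so \<open>l\<close> is compared on them through its
      bound and not by rewriting.\<close>
    have "grad_norm \<Omega> (\<lambda>x. s t x - ?s t x) = 0" if "t \<in> {0<..<T}" for t
    proof -
      have "(\<lambda>x. s t x - ?s t x) = (\<lambda>x. 0)" using fun_cong[OF s_eq[OF that]] by simp
      then show ?thesis by (simp only: H1.N_zero)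
    qed
    then have "Y_norm \<Omega> T (\<lambda>t x. s t x - ?s t x) = sqrt (LINT t|time T. 0)"
      unfolding Y_norm_def L2B_norm_def
      by (intro arg_cong[where f = sqrt] Bochner_Integration.integral_cong) (auto simp: space_time)
    then have "l s = 0"
      using diff[OF sY, of ?s] sum by simp
    then have "\<bar>l v\<bar> \<le> C * Y_norm \<Omega> T (\<lambda>t x. s t x - v t x)"
      using diff[OF sY v] by simp
    also have "\<dots> \<le> C * \<epsilon>" using s(4) C(1) by (intro mult_left_mono) (auto simp: Y_norm_def)
    finally show ?thesis .
  qed
  note le = this
  have "\<bar>l v\<bar> \<le> 0 + e" if "0 < e" for e
  proof -
    have "\<bar>l v\<bar> \<le> C * (e / (C + 1))" using le[of "e / (C + 1)"] that C(1) by simp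
    also have "\<dots> \<le> e" using that C(1) by (simp add: field_simps)
    finally show ?thesis by simp
  qed
  then have "\<bar>l v\<bar> \<le> 0" by (rule field_le_epsilon)
  then show ?thesis by simp
qed

lemma dual_time_deriv_unique:
  assumes "dual_time_deriv \<Omega> T u l" "dual_time_deriv \<Omega> T u k" "v \<in> Y_space \<Omega> T"
  shows "l v = k v"
proof -
  have "(\<lambda>v. 1 * l v + (-1) * k v) \<in> Y_dual \<Omega> T"
    by (rule Y_dual_comb) (use assms(1,2) in \<open>auto simp: dual_time_deriv_def\<close>)
  from Y_dual_zero[OF this _ assms(3)] have "1 * l v + (-1) * k v = 0"
    using assms(1,2) by (simp add: dual_time_deriv_def)
  then show ?thesis by simp
qed

text \<open>The chosen functional can be computed on Y as soon as one candidate is exhibited; off Y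
  two candidates may differ.\<close>

lemma dt_eq:
  assumes "dual_time_deriv \<Omega> T u l" "v \<in> Y_space \<Omega> T"
  shows "dt \<Omega> T u v = l v"
proof (rule dual_time_deriv_unique[OF _ assms])
  show "dual_time_deriv \<Omega> T u (dt \<Omega> T u)"
    unfolding dt_def by (rule someI[of "dual_time_deriv \<Omega> T u", OF assms(1)])
qed

section \<open>Time derivatives represented by square integrable curves\<close>

lemma test_time_L2: "\<eta> \<in> test_functions {0<..<T} \<Longrightarrow> \<eta> \<in> L2 {0<..<T}"
  by (rule test_function_L2[OF open_time])

lemma deriv_test_L2: "\<eta> \<in> test_functions {0<..<T} \<Longrightarrow> deriv \<eta> \<in> L2 {0<..<T}"
  by (intro test_time_L2 test_real_derivative(3))

lemma dual_time_deriv_comb: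
  assumes d: "dual_time_deriv \<Omega> T u l" "dual_time_deriv \<Omega> T w k"
    and L: "u \<in> L2B T (L2 \<Omega>) (L2_norm \<Omega>)" "w \<in> L2B T (L2 \<Omega>) (L2_norm \<Omega>)"
  shows "dual_time_deriv \<Omega> T (\<lambda>t x. a * u t x + b * w t x) (\<lambda>v. a * l v + b * k v)"
  unfolding dual_time_deriv_def
proof (intro conjI ballI)
  show "(\<lambda>v. a * l v + b * k v) \<in> Y_dual \<Omega> T"
    using d by (intro Y_dual_comb) (auto simp: dual_time_deriv_def)
  fix \<eta> \<psi> assume \<eta>: "\<eta> \<in> test_functions {0<..<T}" and \<psi>: "\<psi> \<in> H10 \<Omega>"
  note \<psi>L = H10_L2[OF \<psi>]
  note i = L2_mult_integrable[OF deriv_test_L2[OF \<eta>] L2.L2B_ip_const[OF L(1) \<psi>L]]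
    L2_mult_integrable[OF deriv_test_L2[OF \<eta>] L2.L2B_ip_const[OF L(2) \<psi>L]]
  have "(LINT t|time T. deriv \<eta> t * L2_inner \<Omega> (\<lambda>x. a * u t x + b * w t x) \<psi>) =
      (LINT t|time T. a * (deriv \<eta> t * L2_inner \<Omega> (u t) \<psi>) + b * (deriv \<eta> t * L2_inner \<Omega> (w t) \<psi>))"
  proof (rule integral_cong_AE)
    show "AE t in time T. deriv \<eta> t * L2_inner \<Omega> (\<lambda>x. a * u t x + b * w t x) \<psi> =
        a * (deriv \<eta> t * L2_inner \<Omega> (u t) \<psi>) + b * (deriv \<eta> t * L2_inner \<Omega> (w t) \<psi>)"
      using L2.L2B_D(1)[OF L(1)] L2.L2B_D(1)[OF L(2)]
      by eventually_elim (simp add: L2.comb_left \<psi>L algebra_simps)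
    show "(\<lambda>t. deriv \<eta> t * L2_inner \<Omega> (\<lambda>x. a * u t x + b * w t x) \<psi>) \<in> borel_measurable (time T)"
      using L2_measurable[OF deriv_test_L2[OF \<eta>]] L2_measurable[OF L2.L2B_ip_const[OF L2.L2B_comb[OF L, of a b] \<psi>L]]
      by measurable
  qed (use i in measurable)
  also have "\<dots> = a * (LINT t|time T. deriv \<eta> t * L2_inner \<Omega> (u t) \<psi>) + b * (LINT t|time T. deriv \<eta> t * L2_inner \<Omega> (w t) \<psi>)"
    using i by simp
  finally show "a * l (\<lambda>t x. \<eta> t * \<psi> x) + b * k (\<lambda>t x. \<eta> t * \<psi> x) =
      - (LINT t|time T. deriv \<eta> t * L2_inner \<Omega> (\<lambda>x. a * u t x + b * w t x) \<psi>)"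
    using d \<eta> \<psi> by (simp add: dual_time_deriv_def)
qed

text \<open>The functional on Y represented by a curve in L2(Q). Its boundedness in the norm of Y
  comes from the Poincare inequality.\<close>

definition pairing :: "(real \<Rightarrow> 'a \<Rightarrow> real) \<Rightarrow> (real \<Rightarrow> 'a \<Rightarrow> real) \<Rightarrow> real" where
  "pairing w v = (LINT t|time T. L2_inner \<Omega> (w t) (v t))"

lemma pairing_dual:
  assumes w: "w \<in> L2B T (L2 \<Omega>) (L2_norm \<Omega>)"
  shows "pairing w \<in> Y_dual \<Omega> T"
  unfolding Y_dual_def mem_Collect_eq
proof (intro conjI ballI allI exI)
  fix v v' a b assume v: "v \<in> Y_space \<Omega> T" "v' \<in> Y_space \<Omega> T"
  note L = v[THEN Y_L2B_L2]
  note i = L2.L2B_ip_integrable[OF w L(1)] L2.L2B_ip_integrable[OF w L(2)]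
  have "pairing w (\<lambda>t x. a * v t x + b * v' t x) =
      (LINT t|time T. a * L2_inner \<Omega> (w t) (v t) + b * L2_inner \<Omega> (w t) (v' t))"
    unfolding pairing_def
  proof (rule integral_cong_AE)
    show "AE t in time T. L2_inner \<Omega> (w t) (\<lambda>x. a * v t x + b * v' t x) =
        a * L2_inner \<Omega> (w t) (v t) + b * L2_inner \<Omega> (w t) (v' t)"
      using L2.L2B_D(1)[OF w] L2.L2B_D(1)[OF L(1)] L2.L2B_D(1)[OF L(2)]
      by eventually_elim (rule L2.comb_right)
    show "(\<lambda>t. L2_inner \<Omega> (w t) (\<lambda>x. a * v t x + b * v' t x)) \<in> borel_measurable (time T)"
      using L2.L2B_ip_integrable[OF w L2.L2B_comb[OF L, of a b]] by measurable
  qed (use i in measurable)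
  also have "\<dots> = a * pairing w v + b * pairing w v'"
    using i by (simp add: pairing_def)
  finally show "pairing w (\<lambda>t x. a * v t x + b * v' t x) = a * pairing w v + b * pairing w v'" .
next
  fix v assume v: "v \<in> Y_space \<Omega> T"
  have "\<bar>pairing w v\<bar> \<le> L2B_norm T (L2_norm \<Omega>) w * L2B_norm T (L2_norm \<Omega>) v"
    unfolding pairing_def by (rule L2.L2B_ip_bound[OF w Y_L2B_L2[OF v]])
  also have "\<dots> \<le> L2B_norm T (L2_norm \<Omega>) w * (2 * R * Y_norm \<Omega> T v)"
    by (intro mult_left_mono L2B_norm_L2_le_Y v) (simp add: L2B_norm_def)
  finally show "\<bar>pairing w v\<bar> \<le> (L2B_norm T (L2_norm \<Omega>) w * (2 * R)) * Y_norm \<Omega> T v" by (simp add: mult.assoc)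
qed

text \<open>Connects the two notions of time derivative: the L2 derivative used to express
  regularity represents the functional that enters the bilinear form and the norm of X.\<close>

lemma weak_time_deriv_dual:
  assumes "weak_time_deriv \<Omega> T u w"
  shows "dual_time_deriv \<Omega> T u (pairing w)"
  unfolding dual_time_deriv_def
proof (intro conjI ballI)
  have w: "w \<in> L2B T (L2 \<Omega>) (L2_norm \<Omega>)" using assms by (simp add: weak_time_deriv_def)
  show "pairing w \<in> Y_dual \<Omega> T" by (rule pairing_dual[OF w])
  fix \<eta> \<psi> assume \<eta>: "\<eta> \<in> test_functions {0<..<T}" and \<psi>: "\<psi> \<in> H10 \<Omega>"
  note \<psi>L = H10_L2[OF \<psi>]
  have "pairing w (\<lambda>t x. \<eta> t * \<psi> x) = (LINT t|time T. \<eta> t * L2_inner \<Omega> (w t) \<psi>)"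
    unfolding pairing_def
  proof (rule integral_cong_AE)
    show "AE t in time T. L2_inner \<Omega> (w t) (\<lambda>x. \<eta> t * \<psi> x) = \<eta> t * L2_inner \<Omega> (w t) \<psi>"
      using L2.L2B_D(1)[OF w] by eventually_elim (rule L2.scale_right[OF \<psi>L])
    show "(\<lambda>t. L2_inner \<Omega> (w t) (\<lambda>x. \<eta> t * \<psi> x)) \<in> borel_measurable (time T)"
      using L2.L2B_ip_integrable[OF w L2.L2B_tensor[OF test_time_L2[OF \<eta>] \<psi>L]] by measurable
    show "(\<lambda>t. \<eta> t * L2_inner \<Omega> (w t) \<psi>) \<in> borel_measurable (time T)"
      using L2_mult_integrable[OF test_time_L2[OF \<eta>] L2.L2B_ip_const[OF w \<psi>L]] by measurable
  qed
  also have "\<dots> = - (LINT t|time T. deriv \<eta> t * L2_inner \<Omega> (u t) \<psi>)"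
    using assms \<eta> \<psi>L by (simp add: weak_time_deriv_def)
  finally show "pairing w (\<lambda>t x. \<eta> t * \<psi> x) = - (LINT t|time T. deriv \<eta> t * L2_inner \<Omega> (u t) \<psi>)" .
qed

end

section \<open>Regularity of the time derivative\<close>

lemma L2_norm_mono:
  assumes "g \<in> L2 \<Omega>" "AE x in lebesgue_on \<Omega>. \<bar>f x\<bar> \<le> \<bar>g x\<bar>"
  shows "L2_norm \<Omega> f \<le> L2_norm \<Omega> g"
proof (rule power2_le_imp_le)
  show "(L2_norm \<Omega> f)\<^sup>2 \<le> (L2_norm \<Omega> g)\<^sup>2"
    unfolding L2_norm_eq
    by (rule integral_mono_AE'[OF L2_square_integrable[OF assms(1)]])
      (use assms(2) in \<open>auto simp: abs_le_square_iff\<close>)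
qed simp

context open_domain begin

text \<open>Test functions converging to \<open>d\<close> turn the hypothesis into <d, d> \<le> K
  |d|.\<close>

lemma L2_norm_le_by_test:
  assumes d: "d \<in> L2 \<Omega>" and le: "\<And>\<phi>. \<phi> \<in> test_functions \<Omega> \<Longrightarrow> \<bar>L2_inner \<Omega> d \<phi>\<bar> \<le> K * L2_norm \<Omega> \<phi>"
    and K: "0 \<le> K"
  shows "L2_norm \<Omega> d \<le> K"
proof -
  obtain \<phi> where \<phi>: "\<And>n. \<phi> n \<in> test_functions \<Omega>" "(\<lambda>n. L2_norm \<Omega> (\<lambda>x. d x - \<phi> n x)) \<longlonglongrightarrow> 0"
    using L2_approx_sequence[OF open_dom d] by blast
  have lim: "(\<lambda>n. L2_norm \<Omega> (\<lambda>x. \<phi> n x - d x)) \<longlonglongrightarrow> 0"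
    using \<phi>(2) L2.N_minus_commute[OF d test_L2[OF \<phi>(1)]] by simp
  have c: "(\<lambda>n::nat. L2_norm \<Omega> (\<lambda>x. d x - d x)) \<longlonglongrightarrow> 0" by (simp add: L2.N_zero)
  have l: "(\<lambda>n. \<bar>L2_inner \<Omega> d (\<phi> n)\<bar>) \<longlonglongrightarrow> \<bar>L2_inner \<Omega> d d\<bar>"
    by (intro tendsto_rabs L2.tendsto_ip[OF d test_L2[OF \<phi>(1)] d d c lim])
  have r: "(\<lambda>n. K * L2_norm \<Omega> (\<phi> n)) \<longlonglongrightarrow> K * L2_norm \<Omega> d"
    by (intro tendsto_mult tendsto_const L2.tendsto_N[OF test_L2[OF \<phi>(1)] d lim])
  have "\<bar>L2_inner \<Omega> d d\<bar> \<le> K * L2_norm \<Omega> d"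
    by (rule LIMSEQ_le[OF l r]) (use le[OF \<phi>(1)] in auto)
  then have "L2_norm \<Omega> d * L2_norm \<Omega> d \<le> K * L2_norm \<Omega> d"
    using L2.N_sq[of \<Omega> d] L2.self_nonneg[of \<Omega> d] by (simp add: power2_eq_square)
  then show ?thesis
    using K L2.N_nonneg[of \<Omega> d] by (cases "L2_norm \<Omega> d = 0") (auto simp: mult_le_cancel_right)
qed

text \<open>As a functional of f, the product (grad f, grad v) need not be bounded on L2, so
  identities known against L2 functions do not apply to it. Replacing each weak derivative of v by a
  nearby test function and integrating by parts yields an L2 representative, with an error
  controlled by the gradient norm of f.\<close>

lemma grad_functional_approx:
  assumes v: "v \<in> H1 \<Omega>" and e: "0 < e"
  obtains \<psi> where "\<psi> \<in> L2 \<Omega>"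
    "\<And>f. f \<in> H1 \<Omega> \<Longrightarrow> \<bar>grad_inner \<Omega> f v - L2_inner \<Omega> f \<psi>\<bar> \<le> e * grad_norm \<Omega> f"
proof -
  \<comment> \<open>An equal share of the tolerance for each coordinate direction.\<close>
  define \<delta> where "\<delta> = e / real DIM('a)"
  have \<delta>: "0 < \<delta>" using e by (simp add: \<delta>_def)
  have "\<exists>\<phi>\<in>test_functions \<Omega>. L2_norm \<Omega> (\<lambda>x. wpartial \<Omega> b v x - \<phi> x) < \<delta>" if "b \<in> Basis" for b
    using L2_approx[OF open_dom wpartial_L2[OF v that] \<delta>] by blast
  then obtain \<phi> where \<phi>: "\<And>b. b \<in> Basis \<Longrightarrow> \<phi> b \<in> test_functions \<Omega>"
      "\<And>b. b \<in> Basis \<Longrightarrow> L2_norm \<Omega> (\<lambda>x. wpartial \<Omega> b v x - \<phi> b x) < \<delta>"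
    by metis
  define \<psi> where "\<psi> x = (\<Sum>b\<in>Basis. (-1) * partial b (\<phi> b) x)" for x
  have D: "partial b (\<phi> b) \<in> L2 \<Omega>" if "b \<in> Basis" for b
    by (rule test_L2[OF test_function_partial[OF \<phi>(1)[OF that] that]])
  have "\<bar>grad_inner \<Omega> f v - L2_inner \<Omega> f \<psi>\<bar> \<le> e * grad_norm \<Omega> f" if f: "f \<in> H1 \<Omega>" for f
  proof -
    have "L2_inner \<Omega> f \<psi> = (\<Sum>b\<in>Basis. (-1) * L2_inner \<Omega> f (partial b (\<phi> b)))"
      unfolding \<psi>_def[abs_def] by (rule L2.sum_right[OF D H1_L2[OF f]])
    also have "\<dots> = (\<Sum>b\<in>Basis. L2_inner \<Omega> (wpartial \<Omega> b f) (\<phi> b))"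
      using weak_partialD[OF wpartial_weak[OF f] \<phi>(1)] by (intro sum.cong) auto
    finally have "grad_inner \<Omega> f v - L2_inner \<Omega> f \<psi> =
        (\<Sum>b\<in>Basis. L2_inner \<Omega> (wpartial \<Omega> b f) (\<lambda>x. wpartial \<Omega> b v x - \<phi> b x))"
      using L2.diff_right[OF wpartial_L2[OF v] test_L2[OF \<phi>(1)] wpartial_L2[OF f]]
      by (simp add: grad_inner_def sum_subtractf)
    also have "\<bar>\<dots>\<bar> \<le> (\<Sum>b::'a\<in>Basis. grad_norm \<Omega> f * \<delta>)"
    proof (rule order_trans[OF sum_abs sum_mono])
      fix b :: 'a assume b: "b \<in> Basis"
      have "\<bar>L2_inner \<Omega> (wpartial \<Omega> b f) (\<lambda>x. wpartial \<Omega> b v x - \<phi> b x)\<bar>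
          \<le> L2_norm \<Omega> (wpartial \<Omega> b f) * L2_norm \<Omega> (\<lambda>x. wpartial \<Omega> b v x - \<phi> b x)"
        using b f v \<phi> by (intro L2.cauchy_schwarz L2.diff_mem wpartial_L2 test_L2) auto
      also have "\<dots> \<le> grad_norm \<Omega> f * \<delta>"
        using \<phi>(2)[OF b] wpartial_le_grad[OF b, of f] by (intro mult_mono) auto
      finally show "\<bar>L2_inner \<Omega> (wpartial \<Omega> b f) (\<lambda>x. wpartial \<Omega> b v x - \<phi> b x)\<bar> \<le> grad_norm \<Omega> f * \<delta>" .
    qed
    also have "\<dots> = e * grad_norm \<Omega> f" by (simp add: \<delta>_def)
    finally show ?thesis .
  qed
  moreover have "\<psi> \<in> L2 \<Omega>" unfolding \<psi>_def[abs_def] by (rule L2.sum_mem[OF D])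
  ultimately show ?thesis using that by blast
qed

end

section \<open>The time derivative takes values in H10\<close>

context cylinder begin

lemma L2B_const: "g \<in> L2 \<Omega> \<Longrightarrow> (\<lambda>t. g) \<in> L2B T (L2 \<Omega>) (L2_norm \<Omega>)"
  using L2.L2B_tensor[OF const_time_L2[of 1 T]] by simp

lemma H1B_const: "g \<in> H1 \<Omega> \<Longrightarrow> (\<lambda>t. g) \<in> L2B T (H1 \<Omega>) (grad_norm \<Omega>)"
  using H1.L2B_tensor[OF const_time_L2[of 1 T]] by simp

text \<open>Where \<open>w\<close> is \<open>\<epsilon>\<close>-close to \<open>g\<close>, test the weak derivative with \<open>\<eta> \<approx> indicator A\<close> and replace \<open>u\<close> by a
  simple function with values in \<open>H10\<close>: the resulting average \<open>F\<close> of difference quotients is close to \<open>g\<close>.\<close>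
lemma H10_near_time_deriv:
  assumes u: "u \<in> Y_space \<Omega> T" and wt: "weak_time_deriv \<Omega> T u w"
    and w1: "w \<in> L2B T (H1 \<Omega>) (grad_norm \<Omega>)" and g: "g \<in> H1 \<Omega>" and \<epsilon>: "0 < \<epsilon>"
    and A: "A \<in> sets (time T)" "0 < measure (time T) A"
    and near: "\<And>t. t \<in> A \<Longrightarrow> L2_norm \<Omega> (\<lambda>x. w t x - g x) \<le> \<epsilon>" "\<And>t. t \<in> A \<Longrightarrow> grad_norm \<Omega> (\<lambda>x. w t x - g x) \<le> \<epsilon>"
  obtains F where "F \<in> H10 \<Omega>" "L2_norm \<Omega> (\<lambda>x. g x - F x) \<le> 2 * \<epsilon>"
    "grad_norm \<Omega> (\<lambda>x. g x - F x) \<le> 2 * real DIM('a) * \<epsilon>"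
proof -
  define m where "m = measure (time T) A"
  have m: "0 < m" using A by (simp add: m_def)
  have w: "w \<in> L2B T (L2 \<Omega>) (L2_norm \<Omega>)" using wt by (simp add: weak_time_deriv_def)
  note wD = L2.L2B_D[OF w] and w1D = H1.L2B_D[OF w1]
  note uL = Y_L2B_L2[OF u]
  have a: "indicat_real A \<in> L2 {0<..<T}"
    using A by (intro bounded_time_L2[where B = 1]) (auto simp: indicator_def)
  \<comment> \<open>A common bound for \<open>w\<close> in both norms, since one estimate will serve
    for either; the summand 1 permits the division below.\<close>
  define W where "W = L2_norm {0<..<T} (\<lambda>t. L2_norm \<Omega> (w t)) + L2_norm {0<..<T} (\<lambda>t. grad_norm \<Omega> (w t)) + 1"
  have W: "1 \<le> W" "L2_norm {0<..<T} (\<lambda>t. L2_norm \<Omega> (w t)) \<le> W" "L2_norm {0<..<T} (\<lambda>t. grad_norm \<Omega> (w t)) \<le> W"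
    by (auto simp: W_def add_nonneg_nonneg)
  \<comment> \<open>The tolerances \<delta> and \<theta> are such that the errors from \<eta> and
    from the simple curve contribute \<epsilon> m / 2 each. Together with \<epsilon> m for the
    spread of \<open>w\<close> over \<open>A\<close> this gives the 2\<epsilon> of the conclusion,
    after division by m.\<close>
  define \<delta> where "\<delta> = \<epsilon> * m / (2 * W)"
  have \<delta>: "0 < \<delta>" "\<delta> * W = \<epsilon> * m / 2" using \<epsilon> m W by (auto simp: \<delta>_def)
  obtain \<eta> where \<eta>: "\<eta> \<in> test_functions {0<..<T}" "L2_norm {0<..<T} (\<lambda>t. indicat_real A t - \<eta> t) < \<delta>"
    using L2_approx[OF open_time a \<delta>(1)] by blast
  note \<eta>L = test_time_L2[OF \<eta>(1)] and DL = deriv_test_L2[OF \<eta>(1)]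
  \<comment> \<open>The factor 1 + 2R covers the gradient error as well as the L2 error, which the
    Poincare inequality bounds with a factor 2R.\<close>
  define M where "M = (L2_norm {0<..<T} (deriv \<eta>) + 1) * (1 + 2 * R)"
  have "0 < 1 + 2 * R" using R_nonneg by linarith
  then have M: "0 < M" unfolding M_def by (intro mult_pos_pos) (simp_all add: add_nonneg_pos)
  define \<theta> where "\<theta> = \<epsilon> * m / (2 * M)"
  have \<theta>: "0 < \<theta>" "M * \<theta> = \<epsilon> * m / 2" using \<epsilon> m M by (auto simp: \<theta>_def)
  obtain s where s: "simple_function (time T) s" "\<And>t. t \<in> {0<..<T} \<Longrightarrow> s t \<in> H10 \<Omega>"
      "s \<in> L2B T (H10 \<Omega>) (grad_norm \<Omega>)" "L2B_norm T (grad_norm \<Omega>) (\<lambda>t x. s t x - u t x) < \<theta>"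
    using H10.L2B_simple_approx[OF Y_L2B[OF u] \<theta>(1)] by blast
  have sY: "s \<in> Y_space \<Omega> T" using s(3) by (simp add: Y_space_def)
  have dY: "(\<lambda>t x. s t x - u t x) \<in> Y_space \<Omega> T" using Y_comb[OF sY u, of 1 "-1"] by simp
  note dL2 = L2.L2B_D[OF Y_L2B_L2[OF dY]] and dgrad = H10.L2B_D[OF Y_L2B[OF dY]]
  have su_grad: "L2_norm {0<..<T} (deriv \<eta>) * L2_norm {0<..<T} (\<lambda>t. grad_norm \<Omega> (\<lambda>x. s t x - u t x)) \<le> \<epsilon> * m / 2"
    and su_L2: "L2_norm {0<..<T} (deriv \<eta>) * L2_norm {0<..<T} (\<lambda>t. L2_norm \<Omega> (\<lambda>x. s t x - u t x)) \<le> \<epsilon> * m / 2"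
  proof -
    have Yn: "Y_norm \<Omega> T (\<lambda>t x. s t x - u t x) \<le> \<theta>" using s(4) by (simp add: Y_norm_def)
    have Y0: "0 \<le> Y_norm \<Omega> T (\<lambda>t x. s t x - u t x)" by (simp add: Y_norm_def L2B_norm_def)
    let ?n = "L2_norm {0<..<T} (deriv \<eta>)"
    have "L2_norm {0<..<T} (\<lambda>t. grad_norm \<Omega> (\<lambda>x. s t x - u t x)) \<le> (1 + 2 * R) * \<theta>"
      using Yn R_nonneg \<theta>(1) by (simp add: Y_norm_def L2B_norm_eq algebra_simps add_increasing2)
    then have "?n * L2_norm {0<..<T} (\<lambda>t. grad_norm \<Omega> (\<lambda>x. s t x - u t x)) \<le> (?n + 1) * ((1 + 2 * R) * \<theta>)"
      by (intro mult_mono) auto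
    then show "?n * L2_norm {0<..<T} (\<lambda>t. grad_norm \<Omega> (\<lambda>x. s t x - u t x)) \<le> \<epsilon> * m / 2"
      using \<theta>(2) by (simp add: M_def mult.assoc)
    have "L2_norm {0<..<T} (\<lambda>t. L2_norm \<Omega> (\<lambda>x. s t x - u t x)) \<le> 2 * R * Y_norm \<Omega> T (\<lambda>t x. s t x - u t x)"
      using L2B_norm_L2_le_Y[OF dY] by (simp add: L2B_norm_eq)
    also have "\<dots> \<le> (1 + 2 * R) * \<theta>"
      using Yn Y0 R_nonneg by (intro mult_mono) auto
    finally have "?n * L2_norm {0<..<T} (\<lambda>t. L2_norm \<Omega> (\<lambda>x. s t x - u t x)) \<le> (?n + 1) * ((1 + 2 * R) * \<theta>)"
      by (intro mult_mono) auto
    then show "?n * L2_norm {0<..<T} (\<lambda>t. L2_norm \<Omega> (\<lambda>x. s t x - u t x)) \<le> \<epsilon> * m / 2"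
      using \<theta>(2) by (simp add: M_def mult.assoc)
  qed
  let ?I = "s ` {0<..<T}"
  let ?A = "\<lambda>\<psi>. s -` {\<psi>} \<inter> {0<..<T}"
  have fin: "finite ?I" using simple_functionD(1)[OF s(1)] by (simp add: space_time)
  have indA: "indicat_real (?A \<psi>) \<in> L2 {0<..<T}" for \<psi>
    using simple_functionD(2)[OF s(1), of "{\<psi>}"]
    by (intro bounded_time_L2[where B = 1]) (auto simp: space_time indicator_def)
  \<comment> \<open>These are the coefficients of -1/m times the integral of
    \<open>deriv \<eta>\<close> against the simple curve. That integral is a finite combination of
    values of the curve and therefore stays in H10.\<close>
  define c where "c \<psi> = - L2_inner {0<..<T} (deriv \<eta>) (indicat_real (?A \<psi>)) / m" for \<psi>
  define F where "F = (\<lambda>x. \<Sum>\<psi>\<in>?I. c \<psi> * \<psi> x)"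
  have F: "F \<in> H10 \<Omega>" unfolding F_def using s(2) H10.sum_mem[of ?I "\<lambda>\<psi>. \<psi>" c] by blast
  note FL = H10_L2[OF F] and gL = H1_L2[OF g]
  have F_ip: "m * L2_inner \<Omega> F \<xi> = - L2_inner {0<..<T} (deriv \<eta>) (\<lambda>t. L2_inner \<Omega> (s t) \<xi>)"
    if \<xi>: "\<xi> \<in> L2 \<Omega>" for \<xi>
  proof -
    have "L2_inner \<Omega> F \<xi> = (\<Sum>\<psi>\<in>?I. c \<psi> * L2_inner \<Omega> \<psi> \<xi>)"
      unfolding F_def using s(2) H10_L2 by (intro L2.sum_left[OF _ \<xi>]) blast
    then have "m * L2_inner \<Omega> F \<xi> = - (\<Sum>\<psi>\<in>?I. L2_inner \<Omega> \<psi> \<xi> * L2_inner {0<..<T} (deriv \<eta>) (indicat_real (?A \<psi>)))"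
      using m by (simp add: c_def sum_distrib_left sum_negf mult.commute)
    also have "\<dots> = - L2_inner {0<..<T} (deriv \<eta>) (\<lambda>t. \<Sum>\<psi>\<in>?I. L2_inner \<Omega> \<psi> \<xi> * indicat_real (?A \<psi>) t)"
      using L2.sum_right[where I = ?I and f = "\<lambda>\<psi>. indicat_real (?A \<psi>)" and w = "deriv \<eta>"
          and c = "\<lambda>\<psi>. L2_inner \<Omega> \<psi> \<xi>", OF indA DL] by simp
    also have "L2_inner {0<..<T} (deriv \<eta>) (\<lambda>t. \<Sum>\<psi>\<in>?I. L2_inner \<Omega> \<psi> \<xi> * indicat_real (?A \<psi>) t)
        = L2_inner {0<..<T} (deriv \<eta>) (\<lambda>t. L2_inner \<Omega> (s t) \<xi>)"
      unfolding L2_inner_def[of "{0<..<T}"]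
    proof (rule Bochner_Integration.integral_cong[OF refl])
      fix t assume "t \<in> space (time T)"
      then have t: "t \<in> {0<..<T}" by (simp add: space_time)
      have "(\<Sum>\<psi>\<in>?I. L2_inner \<Omega> \<psi> \<xi> * indicat_real (?A \<psi>) t) = (\<Sum>\<psi>\<in>?I. if \<psi> = s t then L2_inner \<Omega> \<psi> \<xi> else 0)"
        using t by (intro sum.cong) (auto simp: indicator_def)
      also have "\<dots> = L2_inner \<Omega> (s t) \<xi>" using fin t by (subst sum.delta) auto
      finally show "deriv \<eta> t * (\<Sum>\<psi>\<in>?I. L2_inner \<Omega> \<psi> \<xi> * indicat_real (?A \<psi>) t) = deriv \<eta> t * L2_inner \<Omega> (s t) \<xi>"
        by simp
    qed
    finally show ?thesis .
  qed
  \<comment> \<open>Stated for an abstract size \<open>p\<close>, because it is needed twice: with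
    the L2 norm to bound the difference itself, and with the gradient norm, tested against
    derivatives, to bound its weak derivatives.\<close>
  have core: "\<bar>L2_inner \<Omega> (\<lambda>x. g x - F x) \<xi>\<bar> \<le> k * (2 * \<epsilon>)"
    if \<xi>: "\<xi> \<in> L2 \<Omega>" and k: "0 \<le> k" and p: "\<And>f. f \<in> H1 \<Omega> \<Longrightarrow> \<bar>L2_inner \<Omega> f \<xi>\<bar> \<le> k * p f"
      and pw: "(\<lambda>t. p (w t)) \<in> L2 {0<..<T}" "L2_norm {0<..<T} (\<lambda>t. p (w t)) \<le> W"
      and pd: "(\<lambda>t. p (\<lambda>x. s t x - u t x)) \<in> L2 {0<..<T}"
        "L2_norm {0<..<T} (deriv \<eta>) * L2_norm {0<..<T} (\<lambda>t. p (\<lambda>x. s t x - u t x)) \<le> \<epsilon> * m / 2"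
      and pA: "\<And>t. t \<in> A \<Longrightarrow> p (\<lambda>x. w t x - g x) \<le> \<epsilon>" and p0: "\<And>f. 0 \<le> p f"
    for \<xi> k p
  proof -
    define S where "S t = L2_inner \<Omega> (s t) \<xi>" for t
    define U where "U t = L2_inner \<Omega> (u t) \<xi>" for t
    define V where "V t = L2_inner \<Omega> (w t) \<xi>" for t
    define G where "G = L2_inner \<Omega> g \<xi>"
    have SL: "S \<in> L2 {0<..<T}" and UL: "U \<in> L2 {0<..<T}" and VL: "V \<in> L2 {0<..<T}"
      unfolding S_def[abs_def] U_def[abs_def] V_def[abs_def]
      using L2.L2B_ip_const[OF Y_L2B_L2[OF sY] \<xi>] L2.L2B_ip_const[OF uL \<xi>] L2.L2B_ip_const[OF w \<xi>] by auto
    have e1: "m * L2_inner \<Omega> F \<xi> = - L2_inner {0<..<T} (deriv \<eta>) S"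
      unfolding S_def[abs_def] by (rule F_ip[OF \<xi>])
    have e2: "L2_inner {0<..<T} (deriv \<eta>) U = - L2_inner {0<..<T} \<eta> V"
      using wt \<eta>(1) \<xi> by (simp add: weak_time_deriv_def L2_inner_def[of "{0<..<T}"] U_def V_def)
    have e3: "m * G = L2_inner {0<..<T} (indicat_real A) (\<lambda>t. G)"
      using sets.sets_into_space[OF A(1)] by (simp add: L2_inner_def m_def Int_absorb2 space_time)
    \<comment> \<open>Three errors: simple curve against \<open>u\<close>, spread of
      \<open>w\<close> over \<open>A\<close>, and indicator against test function. The remaining
      terms cancel by the weak derivative identity \<open>e2\<close>.\<close>
    have "m * L2_inner \<Omega> (\<lambda>x. g x - F x) \<xi> =
        L2_inner {0<..<T} (deriv \<eta>) (\<lambda>t. S t - U t) - L2_inner {0<..<T} (indicat_real A) (\<lambda>t. V t - G)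
        + L2_inner {0<..<T} (\<lambda>t. indicat_real A t - \<eta> t) V"
      using e1 e2 e3 L2.diff_left[OF gL FL \<xi>] L2.diff_right[OF SL UL DL] L2.diff_right[OF VL const_time_L2 a, of G]
        L2.diff_left[OF a \<eta>L VL]
      by (simp add: G_def right_diff_distrib)
    moreover have "\<bar>L2_inner {0<..<T} (deriv \<eta>) (\<lambda>t. S t - U t)\<bar> \<le> k * (\<epsilon> * m / 2)"
    proof -
      have "AE t in time T. \<bar>S t - U t\<bar> \<le> \<bar>k * p (\<lambda>x. s t x - u t x)\<bar>"
        using H10.L2B_D(1)[OF Y_L2B[OF u]] AE_space
      proof eventually_elim
        case (elim t)
        then have st: "s t \<in> H10 \<Omega>" using s(2) by (simp add: space_time)
        have "\<bar>S t - U t\<bar> = \<bar>L2_inner \<Omega> (\<lambda>x. s t x - u t x) \<xi>\<bar>"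
          using L2.diff_left[OF H10_L2[OF st] H10_L2[OF elim(1)] \<xi>] by (simp add: S_def U_def)
        also have "\<dots> \<le> k * p (\<lambda>x. s t x - u t x)"
          by (intro p H1.diff_mem H10_H1 st elim(1))
        finally show ?case using k p0 by simp
      qed
      then have "L2_norm {0<..<T} (\<lambda>t. S t - U t) \<le> L2_norm {0<..<T} (\<lambda>t. k * p (\<lambda>x. s t x - u t x))"
        by (rule L2_norm_mono[OF L2.scale_mem[OF pd(1)]])
      also have "\<dots> = k * L2_norm {0<..<T} (\<lambda>t. p (\<lambda>x. s t x - u t x))"
        using L2.N_scale[OF pd(1), of k] k by simp
      finally have n: "L2_norm {0<..<T} (\<lambda>t. S t - U t) \<le> k * L2_norm {0<..<T} (\<lambda>t. p (\<lambda>x. s t x - u t x))" .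
      have "\<bar>L2_inner {0<..<T} (deriv \<eta>) (\<lambda>t. S t - U t)\<bar>
          \<le> L2_norm {0<..<T} (deriv \<eta>) * (k * L2_norm {0<..<T} (\<lambda>t. p (\<lambda>x. s t x - u t x)))"
        by (rule order_trans[OF L2.cauchy_schwarz[OF DL L2.diff_mem[OF SL UL]] mult_left_mono[OF n L2.N_nonneg]])
      also have "\<dots> \<le> k * (\<epsilon> * m / 2)"
        using mult_left_mono[OF pd(2) k] by (simp add: mult_ac)
      finally show ?thesis .
    qed
    moreover have "\<bar>L2_inner {0<..<T} (\<lambda>t. indicat_real A t - \<eta> t) V\<bar> \<le> k * (\<epsilon> * m / 2)"
    proof -
      have "AE t in time T. \<bar>V t\<bar> \<le> \<bar>k * p (w t)\<bar>"
        using w1D(1) by eventually_elim (use p p0 k in \<open>auto simp: V_def abs_mult\<close>)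
      then have "L2_norm {0<..<T} V \<le> L2_norm {0<..<T} (\<lambda>t. k * p (w t))"
        by (rule L2_norm_mono[OF L2.scale_mem[OF pw(1)]])
      also have "\<dots> \<le> k * W"
        using L2.N_scale[OF pw(1), of k] k mult_left_mono[OF pw(2) k] by simp
      finally have "L2_norm {0<..<T} V \<le> k * W" .
      then have "L2_norm {0<..<T} (\<lambda>t. indicat_real A t - \<eta> t) * L2_norm {0<..<T} V \<le> \<delta> * (k * W)"
        using \<eta>(2) \<delta>(1) by (intro mult_mono) auto
      also have "\<delta> * (k * W) = k * (\<delta> * W)" by simp
      finally show ?thesis
        using L2.cauchy_schwarz[OF L2.diff_mem[OF a \<eta>L] VL] unfolding \<delta>(2) by (rule order_trans[rotated])
    qed
    moreover have "\<bar>L2_inner {0<..<T} (indicat_real A) (\<lambda>t. V t - G)\<bar> \<le> k * \<epsilon> * m"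
    proof -
      have "\<bar>L2_inner {0<..<T} (indicat_real A) (\<lambda>t. V t - G)\<bar> \<le> (LINT t|time T. \<bar>indicat_real A t * (V t - G)\<bar>)"
        unfolding L2_inner_def by (rule integral_abs_bound)
      also have "\<dots> \<le> (LINT t|time T. indicat_real A t * (k * \<epsilon>))"
      proof (rule integral_mono_AE')
        show "integrable (time T) (\<lambda>t. indicat_real A t * (k * \<epsilon>))"
          using L2_time_integrable[OF a] by simp
        show "AE t in time T. \<bar>indicat_real A t * (V t - G)\<bar> \<le> indicat_real A t * (k * \<epsilon>)"
          using w1D(1)
        proof eventually_elim
          case (elim t)
          show ?case
          proof (cases "t \<in> A")
            case True
            have "\<bar>V t - G\<bar> = \<bar>L2_inner \<Omega> (\<lambda>x. w t x - g x) \<xi>\<bar>"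
              using L2.diff_left[OF H1_L2[OF elim] gL \<xi>] by (simp add: V_def G_def)
            also have "\<dots> \<le> k * p (\<lambda>x. w t x - g x)" by (intro p H1.diff_mem elim g)
            also have "\<dots> \<le> k * \<epsilon>" using pA[OF True] k by (rule mult_left_mono)
            finally show ?thesis using True by simp
          qed simp
        qed
        show "AE t in time T. 0 \<le> indicat_real A t * (k * \<epsilon>)" using k \<epsilon> by simp
      qed
      also have "\<dots> = k * \<epsilon> * m"
        using sets.sets_into_space[OF A(1)] by (simp add: m_def Int_absorb2 space_time)
      finally show ?thesis .
    qed
    ultimately have "\<bar>m * L2_inner \<Omega> (\<lambda>x. g x - F x) \<xi>\<bar> \<le> k * (\<epsilon> * m / 2) + k * \<epsilon> * m + k * (\<epsilon> * m / 2)"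
      by linarith
    also have "\<dots> = m * (k * (2 * \<epsilon>))" by (simp add: field_simps)
    finally show ?thesis using m by (simp add: abs_mult)
  qed
  have gF: "(\<lambda>x. g x - F x) \<in> H1 \<Omega>" by (rule H1.diff_mem[OF g H10_H1[OF F]])
  have "L2_norm \<Omega> (\<lambda>x. g x - F x) \<le> 2 * \<epsilon>"
  proof (rule L2_norm_le_by_test[OF H1_L2[OF gF]])
    fix \<phi> assume \<phi>: "\<phi> \<in> test_functions \<Omega>"
    have "\<bar>L2_inner \<Omega> (\<lambda>x. g x - F x) \<phi>\<bar> \<le> L2_norm \<Omega> \<phi> * (2 * \<epsilon>)"
    proof (rule core[where p = "L2_norm \<Omega>"])
      show "\<bar>L2_inner \<Omega> f \<phi>\<bar> \<le> L2_norm \<Omega> \<phi> * L2_norm \<Omega> f" if "f \<in> H1 \<Omega>" for f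
        using L2.cauchy_schwarz[OF H1_L2[OF that] test_L2[OF \<phi>]] by (simp add: mult.commute)
    qed (use test_L2[OF \<phi>] wD W dL2 su_L2 near in auto)
    then show "\<bar>L2_inner \<Omega> (\<lambda>x. g x - F x) \<phi>\<bar> \<le> 2 * \<epsilon> * L2_norm \<Omega> \<phi>" by (simp add: mult.commute)
  qed (use \<epsilon> in simp)
  moreover have "grad_norm \<Omega> (\<lambda>x. g x - F x) \<le> 2 * real DIM('a) * \<epsilon>"
  proof -
    have "L2_norm \<Omega> (wpartial \<Omega> b (\<lambda>x. g x - F x)) \<le> 2 * \<epsilon>" if b: "b \<in> Basis" for b
    proof (rule L2_norm_le_by_test[OF wpartial_L2[OF gF b]])
      fix \<phi> assume \<phi>: "\<phi> \<in> test_functions \<Omega>"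
      note D\<phi> = test_L2[OF test_function_partial[OF \<phi> b]]
      have "\<bar>L2_inner \<Omega> (\<lambda>x. g x - F x) (partial b \<phi>)\<bar> \<le> L2_norm \<Omega> \<phi> * (2 * \<epsilon>)"
      proof (rule core[where p = "grad_norm \<Omega>"])
        show "\<bar>L2_inner \<Omega> f (partial b \<phi>)\<bar> \<le> L2_norm \<Omega> \<phi> * grad_norm \<Omega> f" if "f \<in> H1 \<Omega>" for f
        proof -
          have "\<bar>L2_inner \<Omega> f (partial b \<phi>)\<bar> = \<bar>L2_inner \<Omega> (wpartial \<Omega> b f) \<phi>\<bar>"
            using weak_partialD[OF wpartial_weak[OF that b] \<phi>] by simp
          also have "\<dots> \<le> L2_norm \<Omega> (wpartial \<Omega> b f) * L2_norm \<Omega> \<phi>"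
            by (rule L2.cauchy_schwarz[OF wpartial_L2[OF that b] test_L2[OF \<phi>]])
          also have "\<dots> \<le> grad_norm \<Omega> f * L2_norm \<Omega> \<phi>"
            by (rule mult_right_mono[OF wpartial_le_grad[OF b]]) simp
          finally show ?thesis by (simp add: mult.commute)
        qed
      qed (use D\<phi> w1D W dgrad su_grad near in auto)
      then show "\<bar>L2_inner \<Omega> (wpartial \<Omega> b (\<lambda>x. g x - F x)) \<phi>\<bar> \<le> 2 * \<epsilon> * L2_norm \<Omega> \<phi>"
        using weak_partialD[OF wpartial_weak[OF gF b] \<phi>] by (simp add: mult.commute)
    qed (use \<epsilon> in simp)
    then have "grad_norm \<Omega> (\<lambda>x. g x - F x) \<le> (\<Sum>b::'a\<in>Basis. 2 * \<epsilon>)"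
      by (intro order_trans[OF grad_le_sum] sum_mono)
    then show ?thesis by simp
  qed
  ultimately show ?thesis using that F by blast
qed

text \<open>The candidates g are the countably many values of simple curves approximating w in the
  H2 norm. Where w stays close to g on a set of positive measure, g is close to H10 by averaging;
  the other such sets are discarded as null sets. Outside the union of the exceptional sets w(t) has
  a close g, hence is a limit of elements of H10, and H10 is closed.\<close>

lemma time_deriv_H10:
  assumes u: "u \<in> Y_space \<Omega> T" and wt: "weak_time_deriv \<Omega> T u w"
    and w2: "w \<in> L2B T (H2 \<Omega>) (H2_norm \<Omega>)"
  shows "AE t in time T. w t \<in> H10 \<Omega>"
proof -
  interpret finite_measure "time T" by (rule finite_measure_time)
  have w: "w \<in> L2B T (L2 \<Omega>) (L2_norm \<Omega>)" using wt by (simp add: weak_time_deriv_def)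
  have w1: "w \<in> L2B T (H1 \<Omega>) (grad_norm \<Omega>)" by (rule H2_L2B_H1[OF w2])
  obtain s :: "nat \<Rightarrow> real \<Rightarrow> 'a \<Rightarrow> real" where s: "\<And>k. simple_function (time T) (s k)" "\<And>k. s k ` {0<..<T} \<subseteq> H2 \<Omega>"
      "AE t in time T. (\<lambda>k. H2_norm \<Omega> (\<lambda>x. s k t x - w t x)) \<longlonglongrightarrow> 0"
    using w2 unfolding L2B_def strongly_measurable_def by blast
  define G where "G = (\<Union>k. s k ` {0<..<T})"
  have G: "countable G" "G \<subseteq> H1 \<Omega>"
  proof -
    have "finite (s k ` {0<..<T})" for k using simple_functionD(1)[OF s(1)[of k]] by (simp add: space_time)
    then show "countable G" unfolding G_def by (auto intro: countable_finite)
    show "G \<subseteq> H1 \<Omega>" using s(2) H2_H1(1) by (auto simp: G_def)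
  qed
  define e where "e n = inverse (real (Suc n))" for n
  have e: "0 < e n" for n by (simp add: e_def)
  define A where "A g n = {t \<in> space (time T). L2_norm \<Omega> (\<lambda>x. w t x - g x) < e n \<and> grad_norm \<Omega> (\<lambda>x. w t x - g x) < e n}" for g n
  define P where "P g n \<longleftrightarrow> (\<exists>F\<in>H10 \<Omega>. L2_norm \<Omega> (\<lambda>x. g x - F x) \<le> 2 * e n \<and> grad_norm \<Omega> (\<lambda>x. g x - F x) \<le> 2 * real DIM('a) * e n)" for g n
  have ae: "AE t in time T. t \<in> A g n \<longrightarrow> P g n" if "g \<in> G" for g n
  proof -
    have g: "g \<in> H1 \<Omega>" using that G by blast
    have "(\<lambda>t. L2_norm \<Omega> (\<lambda>x. w t x - g x)) \<in> L2 {0<..<T}" "(\<lambda>t. grad_norm \<Omega> (\<lambda>x. w t x - g x)) \<in> L2 {0<..<T}"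
      using L2.L2B_D(3)[OF L2.L2B_comb[OF w L2B_const[OF H1_L2[OF g]], of 1 "-1"]]
        H1.L2B_D(3)[OF H1.L2B_comb[OF w1 H1B_const[OF g], of 1 "-1"]] by simp_all
    note [measurable] = this[THEN L2_measurable]
    have meas: "A g n \<in> sets (time T)" unfolding A_def by measurable
    \<comment> \<open>A set of positive measure carries the averaging argument, while a null set is
      simply excluded.\<close>
    show ?thesis
    proof (cases "measure (time T) (A g n) = 0")
      case True
      then have "A g n \<in> null_sets (time T)" using meas by (simp add: emeasure_eq_measure null_setsI)
      then have "AE t in time T. t \<notin> A g n" by (rule AE_not_in)
      then show ?thesis by eventually_elim simp
    next
      case False
      then have pos: "0 < measure (time T) (A g n)" by (simp add: zero_less_measure_iff)
      obtain F where "F \<in> H10 \<Omega>" "L2_norm \<Omega> (\<lambda>x. g x - F x) \<le> 2 * e n" "grad_norm \<Omega> (\<lambda>x. g x - F x) \<le> 2 * real DIM('a) * e n"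
        by (rule H10_near_time_deriv[OF u wt w1 g e[of n] meas pos]) (auto simp: A_def)
      then show ?thesis by (auto simp: P_def)
    qed
  qed
  have "AE t in time T. \<forall>g\<in>G. \<forall>n. t \<in> A g n \<longrightarrow> P g n"
    using ae by (subst AE_ball_countable[OF G(1)]) (auto simp: AE_all_countable)
  then show ?thesis
    using s(3) H1.L2B_D(1)[OF w1] AE_space
  proof eventually_elim
    case (elim t)
    note wH = \<open>w t \<in> H1 \<Omega>\<close>
    show ?case
    proof (rule H10_closed[OF wH])
      fix \<epsilon> :: real assume \<epsilon>: "0 < \<epsilon>"
      have D: "0 < real DIM('a)" by simp
      \<comment> \<open>The distance from w(t) to \<open>F\<close> is at most \<open>e n\<close>
        plus 2 DIM times \<open>e n\<close>, hence the factor 3.\<close>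
      obtain n where n: "e n < \<epsilon> / (3 * real DIM('a))"
        using reals_Archimedean[of "\<epsilon> / (3 * real DIM('a))"] \<epsilon> D by (auto simp: e_def)
      have n3: "3 * (real DIM('a) * e n) < \<epsilon>" using n by (simp add: field_simps)
      have "e n \<le> real DIM('a) * e n" using e[of n] DIM_positive[where 'a = 'a] by (simp add: Suc_le_eq)
      with n3 have n1: "3 * e n < \<epsilon>" by linarith
      have "\<forall>\<^sub>F k in sequentially. H2_norm \<Omega> (\<lambda>x. s k t x - w t x) < e n"
        by (rule order_tendstoD(2)[OF elim(2) e])
      then obtain k where k: "H2_norm \<Omega> (\<lambda>x. s k t x - w t x) < e n"
        using eventually_happens'[OF sequentially_bot] by blast
      have tT: "t \<in> {0<..<T}" using elim(4) by (simp add: space_time)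
      have gG: "s k t \<in> G" unfolding G_def using tT by blast
      have gH: "s k t \<in> H1 \<Omega>" using gG G by blast
      have near: "L2_norm \<Omega> (\<lambda>x. w t x - s k t x) < e n" "grad_norm \<Omega> (\<lambda>x. w t x - s k t x) < e n"
        using k L2_le_H2_norm[of "\<lambda>x. s k t x - w t x"] grad_le_H2_norm[of "\<lambda>x. s k t x - w t x"]
          L2.N_minus_commute[OF H1_L2[OF wH] H1_L2[OF gH]] H1.N_minus_commute[OF wH gH] by auto
      then have "t \<in> A (s k t) n" using elim(4) by (simp add: A_def)
      with elim(1) gG have "P (s k t) n" by blast
      then obtain F where F: "F \<in> H10 \<Omega>" "L2_norm \<Omega> (\<lambda>x. s k t x - F x) \<le> 2 * e n"
          "grad_norm \<Omega> (\<lambda>x. s k t x - F x) \<le> 2 * real DIM('a) * e n"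
        by (auto simp: P_def)
      have "L2_norm \<Omega> (\<lambda>x. w t x - F x) < \<epsilon>"
        using L2.triangle_via[OF H1_L2[OF wH] H1_L2[OF gH] H10_L2[OF F(1)]] near(1) F(2) n1 by linarith
      moreover have "grad_norm \<Omega> (\<lambda>x. w t x - F x) < \<epsilon>"
        using H1.triangle_via[OF wH gH H10_H1[OF F(1)]] near(2) F(3) n3 \<open>e n \<le> real DIM('a) * e n\<close> by linarith
      ultimately show "\<exists>v\<in>H10 \<Omega>. L2_norm \<Omega> (\<lambda>x. w t x - v x) < \<epsilon> \<and> grad_norm \<Omega> (\<lambda>x. w t x - v x) < \<epsilon>"
        using F(1) by blast
    qed
  qed
qed

section \<open>Gradient products as primitives in time\<close>

lemma L2_functional_diff:
  assumes w: "w \<in> L2B T (L2 \<Omega>) (L2_norm \<Omega>)" and w1: "w \<in> L2B T (H1 \<Omega>) (grad_norm \<Omega>)"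
    and v: "v \<in> H1 \<Omega>" and e: "0 \<le> e" and \<psi>: "\<psi> \<in> L2 \<Omega>"
    and le: "\<And>f. f \<in> H1 \<Omega> \<Longrightarrow> \<bar>grad_inner \<Omega> f v - L2_inner \<Omega> f \<psi>\<bar> \<le> e * grad_norm \<Omega> f"
  shows "(\<lambda>t. grad_inner \<Omega> (w t) v - L2_inner \<Omega> (w t) \<psi>) \<in> L2 {0<..<T}"
    and "L2_norm {0<..<T} (\<lambda>t. grad_inner \<Omega> (w t) v - L2_inner \<Omega> (w t) \<psi>)
      \<le> e * L2_norm {0<..<T} (\<lambda>t. grad_norm \<Omega> (w t))"
proof -
  note w1D = H1.L2B_D[OF w1]
  show "(\<lambda>t. grad_inner \<Omega> (w t) v - L2_inner \<Omega> (w t) \<psi>) \<in> L2 {0<..<T}"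
    by (rule L2.diff_mem[OF H1.L2B_ip_const[OF w1 v] L2.L2B_ip_const[OF w \<psi>]])
  have "AE t in time T. \<bar>grad_inner \<Omega> (w t) v - L2_inner \<Omega> (w t) \<psi>\<bar> \<le> \<bar>e * grad_norm \<Omega> (w t)\<bar>"
    using w1D(1)
  proof eventually_elim
    case (elim t)
    then show ?case using le[OF elim] e by simp
  qed
  from L2_norm_mono[OF L2.scale_mem[OF w1D(3)] this]
  show "L2_norm {0<..<T} (\<lambda>t. grad_inner \<Omega> (w t) v - L2_inner \<Omega> (w t) \<psi>)
      \<le> e * L2_norm {0<..<T} (\<lambda>t. grad_norm \<Omega> (w t))"
    using L2.N_scale[OF w1D(3), of e] e by simp
qed

text \<open>The weak time derivative is tested with L2 functions only. Exchanging the gradient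
  functional for an L2 functional changes the sum of the two integrals by at most e times the fixed
  constant \<open>K\<close>, and e is arbitrary.\<close>

lemma grad_weak_derivative:
  assumes wt: "weak_time_deriv \<Omega> T u w"
    and u1: "u \<in> L2B T (H1 \<Omega>) (grad_norm \<Omega>)" and w1: "w \<in> L2B T (H1 \<Omega>) (grad_norm \<Omega>)"
    and v: "v \<in> H1 \<Omega>" and \<eta>: "\<eta> \<in> test_functions {0<..<T}"
  shows "(LINT t|time T. deriv \<eta> t * grad_inner \<Omega> (u t) v) = - (LINT t|time T. \<eta> t * grad_inner \<Omega> (w t) v)"
proof -
  have u: "u \<in> L2B T (L2 \<Omega>) (L2_norm \<Omega>)" and w: "w \<in> L2B T (L2 \<Omega>) (L2_norm \<Omega>)"
    using wt by (auto simp: weak_time_deriv_def)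
  note \<eta>L = test_time_L2[OF \<eta>] and DL = deriv_test_L2[OF \<eta>]
  define X where "X = L2_inner {0<..<T} (deriv \<eta>) (\<lambda>t. grad_inner \<Omega> (u t) v) + L2_inner {0<..<T} \<eta> (\<lambda>t. grad_inner \<Omega> (w t) v)"
  define K where "K = L2_norm {0<..<T} (deriv \<eta>) * L2_norm {0<..<T} (\<lambda>t. grad_norm \<Omega> (u t))
      + L2_norm {0<..<T} \<eta> * L2_norm {0<..<T} (\<lambda>t. grad_norm \<Omega> (w t))"
  have K: "0 \<le> K" by (simp add: K_def)
  have le: "\<bar>X\<bar> \<le> e * K" if e: "0 < e" for e
  proof -
    obtain \<psi> where \<psi>: "\<psi> \<in> L2 \<Omega>"
      "\<And>f. f \<in> H1 \<Omega> \<Longrightarrow> \<bar>grad_inner \<Omega> f v - L2_inner \<Omega> f \<psi>\<bar> \<le> e * grad_norm \<Omega> f"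
      using grad_functional_approx[OF v e] by blast
    note du = L2_functional_diff[OF u u1 v less_imp_le[OF e] \<psi>]
      and dw = L2_functional_diff[OF w w1 v less_imp_le[OF e] \<psi>]
    have "L2_inner {0<..<T} (deriv \<eta>) (\<lambda>t. L2_inner \<Omega> (u t) \<psi>) = - L2_inner {0<..<T} \<eta> (\<lambda>t. L2_inner \<Omega> (w t) \<psi>)"
      using wt \<eta> \<psi>(1) by (simp add: weak_time_deriv_def L2_inner_def[of "{0<..<T}"])
    then have X_eq: "X = L2_inner {0<..<T} (deriv \<eta>) (\<lambda>t. grad_inner \<Omega> (u t) v - L2_inner \<Omega> (u t) \<psi>)
        + L2_inner {0<..<T} \<eta> (\<lambda>t. grad_inner \<Omega> (w t) v - L2_inner \<Omega> (w t) \<psi>)"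
      using L2.diff_right[OF H1.L2B_ip_const[OF u1 v] L2.L2B_ip_const[OF u \<psi>(1)] DL]
        L2.diff_right[OF H1.L2B_ip_const[OF w1 v] L2.L2B_ip_const[OF w \<psi>(1)] \<eta>L]
      by (simp add: X_def)
    have "\<bar>X\<bar> \<le> L2_norm {0<..<T} (deriv \<eta>) * (e * L2_norm {0<..<T} (\<lambda>t. grad_norm \<Omega> (u t)))
        + L2_norm {0<..<T} \<eta> * (e * L2_norm {0<..<T} (\<lambda>t. grad_norm \<Omega> (w t)))"
      unfolding X_eq
      by (rule order_trans[OF abs_triangle_ineq add_mono[OF
            order_trans[OF L2.cauchy_schwarz[OF DL du(1)] mult_left_mono[OF du(2) L2.N_nonneg]]
            order_trans[OF L2.cauchy_schwarz[OF \<eta>L dw(1)] mult_left_mono[OF dw(2) L2.N_nonneg]]]])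
    also have "\<dots> = e * K" by (simp only: K_def distrib_left mult.left_commute)
    finally show ?thesis .
  qed
  have "\<bar>X\<bar> \<le> 0 + \<epsilon>" if "0 < \<epsilon>" for \<epsilon>
  proof -
    have "\<bar>X\<bar> \<le> \<epsilon> / (K + 1) * K" using that K by (intro le) simp
    also have "\<dots> \<le> \<epsilon>" using that K by (simp add: field_simps)
    finally show ?thesis by simp
  qed
  then have "\<bar>X\<bar> \<le> 0" by (rule field_le_epsilon)
  then show ?thesis by (simp add: X_def L2_inner_def[of "{0<..<T}"])
qed

lemma grad_prim:
  assumes wt: "weak_time_deriv \<Omega> T u w"
    and u1: "u \<in> L2B T (H1 \<Omega>) (grad_norm \<Omega>)" and w1: "w \<in> L2B T (H1 \<Omega>) (grad_norm \<Omega>)"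
    and v: "v \<in> H1 \<Omega>"
  shows "\<exists>c. AE t in time T. grad_inner \<Omega> (u t) v = c + prim T (\<lambda>s. grad_inner \<Omega> (w s) v) t"
  by (rule weak_derivative_prim[OF T_pos H1.L2B_ip_const[OF u1 v] H1.L2B_ip_const[OF w1 v]
        grad_weak_derivative[OF wt u1 w1 v]])

text \<open>If the value at 0 were different from c, so would be all values on an interval to the
  right of 0, which has positive measure.\<close>

lemma AE_time_eq_at_0:
  assumes "continuous_on {0..T} h" "AE t in time T. h t = c"
  shows "h 0 = (c::real)"
proof (rule ccontr)
  assume ne: "h 0 \<noteq> c"
  have "(h \<longlongrightarrow> h 0) (at 0 within {0..T})"
    using assms(1) T_pos by (simp add: continuous_on)
  then have "\<forall>\<^sub>F t in at 0 within {0..T}. h t \<noteq> c" using ne by (rule tendsto_imp_eventually_ne)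
  then obtain d where d: "0 < d" "\<And>t. t \<in> {0..T} \<Longrightarrow> t \<noteq> 0 \<Longrightarrow> dist t 0 < d \<Longrightarrow> h t \<noteq> c"
    by (auto simp: eventually_at)
  define r where "r = min d T"
  have r: "0 < r" "r \<le> d" "r \<le> T" using d(1) T_pos by (auto simp: r_def)
  have "AE t in lebesgue. t \<in> {0<..<T} \<longrightarrow> h t = c"
    using assms(2) by (subst (asm) AE_restrict_space_iff) auto
  then have "AE t in lebesgue. t \<notin> {0<..<r}"
  proof eventually_elim
    case (elim t)
    then show ?case using d(2)[of t] r by (auto simp: dist_real_def)
  qed
  then have "{0<..<r} \<in> null_sets lebesgue"
    using AE_iff_null_sets[of "{0<..<r}" lebesgue] by simp
  then have "emeasure lebesgue {0<..<r} = 0" by auto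
  then show False using r by simp
qed

text \<open>Identifies the constant of integration. The initial value is given through an L2
  continuous representative \<open>z\<close>, so the products with \<psi> are continuous up to time
  0 and can be evaluated there.\<close>

lemma L2_prim_initial:
  assumes wt: "weak_time_deriv \<Omega> T u w" and init: "initial_value \<Omega> T u (\<lambda>x. 0)" and \<psi>: "\<psi> \<in> L2 \<Omega>"
  shows "AE t in time T. L2_inner \<Omega> (u t) \<psi> = prim T (\<lambda>s. L2_inner \<Omega> (w s) \<psi>) t"
proof -
  have u: "u \<in> L2B T (L2 \<Omega>) (L2_norm \<Omega>)" and w: "w \<in> L2B T (L2 \<Omega>) (L2_norm \<Omega>)"
    using wt by (auto simp: weak_time_deriv_def)
  note wL = L2.L2B_ip_const[OF w \<psi>]
  obtain c where c: "AE t in time T. L2_inner \<Omega> (u t) \<psi> = c + prim T (\<lambda>s. L2_inner \<Omega> (w s) \<psi>) t"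
    using weak_derivative_prim[OF T_pos L2.L2B_ip_const[OF u \<psi>] wL] wt \<psi> by (auto simp: weak_time_deriv_def)
  obtain z where z: "\<And>t. t \<in> {0..T} \<Longrightarrow> z t \<in> L2 \<Omega>"
      "\<And>t. t \<in> {0..T} \<Longrightarrow> ((\<lambda>s. L2_norm \<Omega> (\<lambda>x. z s x - z t x)) \<longlongrightarrow> 0) (at t within {0..T})"
      "AE t in time T. AE x in lebesgue_on \<Omega>. z t x = u t x" "AE x in lebesgue_on \<Omega>. z 0 x = 0"
    using init unfolding initial_value_def by blast
  define Z where "Z t = L2_inner \<Omega> (z t) \<psi>" for t
  have "(Z \<longlongrightarrow> Z t) (at t within {0..T})" if t: "t \<in> {0..T}" for t
  proof (rule LIM_zero_cancel, rule Lim_null_comparison)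
    show "\<forall>\<^sub>F s in at t within {0..T}. norm (Z s - Z t) \<le> L2_norm \<Omega> (\<lambda>x. z s x - z t x) * L2_norm \<Omega> \<psi>"
    proof (rule eventually_at_filter[THEN iffD2], rule always_eventually, intro allI impI)
      fix s assume "s \<in> {0..T}"
      then show "norm (Z s - Z t) \<le> L2_norm \<Omega> (\<lambda>x. z s x - z t x) * L2_norm \<Omega> \<psi>"
        using L2.cauchy_schwarz[OF L2.diff_mem[OF z(1) z(1)[OF t]] \<psi>, of s] L2.diff_left[OF z(1) z(1)[OF t] \<psi>, of s]
        by (simp add: Z_def)
    qed
    show "((\<lambda>s. L2_norm \<Omega> (\<lambda>x. z s x - z t x) * L2_norm \<Omega> \<psi>) \<longlongrightarrow> 0) (at t within {0..T})"
      by (rule tendsto_mult_left_zero[OF z(2)[OF t]])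
  qed
  then have "continuous_on {0..T} Z" by (simp add: continuous_on)
  then have "continuous_on {0..T} (\<lambda>t. Z t - prim T (\<lambda>s. L2_inner \<Omega> (w s) \<psi>) t)"
    by (intro continuous_on_diff prim_continuous wL)
  moreover have "AE t in time T. Z t - prim T (\<lambda>s. L2_inner \<Omega> (w s) \<psi>) t = c"
    using c z(3) L2.L2B_D(1)[OF u] AE_space
  proof eventually_elim
    case (elim t)
    then have "z t \<in> L2 \<Omega>" using z(1) by (simp add: space_time)
    then have "L2_norm \<Omega> (\<lambda>x. z t x - u t x) = L2_norm \<Omega> (\<lambda>x. 0)"
      using elim(2,3) by (intro L2_norm_cong_AE) (auto intro!: L2_measurable L2.diff_mem simp del: L2.N_nonneg)
    then have "Z t = L2_inner \<Omega> (u t) \<psi>"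
      using L2.ip_diff_zero[OF \<open>z t \<in> L2 \<Omega>\<close> elim(3) \<psi>] by (simp add: Z_def L2.N_zero)
    then show ?case using elim(1) by simp
  qed
  ultimately have "Z 0 - prim T (\<lambda>s. L2_inner \<Omega> (w s) \<psi>) 0 = c"
    by (rule AE_time_eq_at_0)
  moreover have "Z 0 = 0"
  proof -
    have z0: "z 0 \<in> L2 \<Omega>" using z(1) T_pos by simp
    have "L2_norm \<Omega> (z 0) = L2_norm \<Omega> (\<lambda>x. 0)"
      using z(4) z0 by (intro L2_norm_cong_AE) (auto intro: L2_measurable)
    then show ?thesis
      using L2.cauchy_schwarz[OF z0 \<psi>] by (simp add: Z_def L2.N_zero)
  qed
  ultimately have "c = 0" by (simp add: prim_0)
  with c show ?thesis by simp
qed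

text \<open>No continuity of u in the gradient norm is at hand, so the constant cannot be read off
  at time 0. It is inherited from the L2 statement through L2 functionals close to the gradient
  functional; the accuracies 1/(n+1) keep the exceptional set a null set.\<close>

lemma grad_prim_initial:
  assumes wt: "weak_time_deriv \<Omega> T u w" and init: "initial_value \<Omega> T u (\<lambda>x. 0)"
    and u1: "u \<in> L2B T (H1 \<Omega>) (grad_norm \<Omega>)" and w1: "w \<in> L2B T (H1 \<Omega>) (grad_norm \<Omega>)"
    and v: "v \<in> H1 \<Omega>"
  shows "AE t in time T. grad_inner \<Omega> (u t) v = prim T (\<lambda>s. grad_inner \<Omega> (w s) v) t"
proof -
  have u: "u \<in> L2B T (L2 \<Omega>) (L2_norm \<Omega>)" and w: "w \<in> L2B T (L2 \<Omega>) (L2_norm \<Omega>)"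
    using wt by (auto simp: weak_time_deriv_def)
  define W where "W = sqrt T * L2_norm {0<..<T} (\<lambda>t. grad_norm \<Omega> (w t))"
  define d where "d t = \<bar>grad_inner \<Omega> (u t) v - prim T (\<lambda>s. grad_inner \<Omega> (w s) v) t\<bar>" for t
  have "AE t in time T. d t \<le> inverse (real (Suc n)) * (grad_norm \<Omega> (u t) + W)" for n
  proof -
    define e where "e = inverse (real (Suc n))"
    have e: "0 < e" by (simp add: e_def)
    obtain \<psi> where \<psi>: "\<psi> \<in> L2 \<Omega>"
      "\<And>f. f \<in> H1 \<Omega> \<Longrightarrow> \<bar>grad_inner \<Omega> f v - L2_inner \<Omega> f \<psi>\<bar> \<le> e * grad_norm \<Omega> f"
      using grad_functional_approx[OF v e] by blast
    note dw = L2_functional_diff[OF w w1 v less_imp_le[OF e] \<psi>]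
    show ?thesis
      using L2_prim_initial[OF wt init \<psi>(1)] H1.L2B_D(1)[OF u1] AE_space
      unfolding e_def[symmetric]
    proof eventually_elim
      case (elim t)
      have "prim T (\<lambda>s. grad_inner \<Omega> (w s) v) t - prim T (\<lambda>s. L2_inner \<Omega> (w s) \<psi>) t
          = prim T (\<lambda>s. grad_inner \<Omega> (w s) v - L2_inner \<Omega> (w s) \<psi>) t"
        using prim_comb[OF H1.L2B_ip_const[OF w1 v] L2.L2B_ip_const[OF w \<psi>(1)], of 1 "-1" t] by simp
      also have "\<bar>\<dots>\<bar> \<le> sqrt T * (e * L2_norm {0<..<T} (\<lambda>t. grad_norm \<Omega> (w t)))"
        by (intro order_trans[OF prim_bound[OF dw(1)] mult_left_mono[OF dw(2)]])
          (use elim(3) T_pos in \<open>auto simp: space_time\<close>)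
      finally show ?case
        using \<psi>(2)[OF elim(2)] elim(1) unfolding d_def W_def by (simp add: algebra_simps)
    qed
  qed
  then have "AE t in time T. \<forall>n. d t \<le> inverse (real (Suc n)) * (grad_norm \<Omega> (u t) + W)"
    by (simp add: AE_all_countable)
  then show ?thesis
  proof eventually_elim
    case (elim t)
    have "(\<lambda>n. inverse (real (Suc n)) * (grad_norm \<Omega> (u t) + W)) \<longlonglongrightarrow> 0"
      by (rule tendsto_mult_left_zero[OF LIMSEQ_inverse_real_of_nat])
    then have "d t \<le> 0" by (rule LIMSEQ_le_const) (use elim in auto)
    then show ?case by (simp add: d_def)
  qed
qed

end

section \<open>Finite element basis and projection\<close>

lemma (in semi_inner) semi_inner_subspace:
  assumes "V' \<subseteq> V" "(\<lambda>x. 0) \<in> V'" "\<And>u v a b. u \<in> V' \<Longrightarrow> v \<in> V' \<Longrightarrow> (\<lambda>x. a * u x + b * v x) \<in> V'"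
  shows "semi_inner V' ip N"
  by unfold_locales (use assms in \<open>auto simp: self_nonneg N_eq intro: sym comb_left\<close>)

text \<open>Induction on the number of points that separate the elements of \<open>V\<close>: an element that does not vanish
  at the new point, made orthogonal to the basis so far, is the only further direction.\<close>
lemma ex_orthonormal_basis:
  fixes V :: "('a \<Rightarrow> real) set"
  assumes "finite X" "semi_inner V ip N" "\<And>v. v \<in> V \<Longrightarrow> (\<And>x. x \<in> X \<Longrightarrow> v x = 0) \<Longrightarrow> N v = 0"
  shows "\<exists>(m::nat) \<phi>. (\<forall>j<m. \<phi> j \<in> V) \<and> (\<forall>i<m. \<forall>j<m. ip (\<phi> i) (\<phi> j) = (if i = j then 1 else 0)) \<and>
    (\<forall>v\<in>V. N (\<lambda>x. v x - (\<Sum>j<m. ip v (\<phi> j) * \<phi> j x)) = 0)"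
  using assms
proof (induction X arbitrary: V rule: finite_induct)
  case empty
  then have "\<forall>v\<in>V. N v = 0" by blast
  then show ?case by (intro exI[of _ "0::nat"]) auto
next
  case (insert p X)
  interpret semi_inner V ip N by (rule insert.prems(1))
  \<comment> \<open>The elements of \<open>V\<close> that vanish at \<open>p\<close> are separated
    by the remaining points \<open>X\<close>, so the induction hypothesis applies to them.\<close>
  define V' where "V' = {v \<in> V. v p = 0}"
  have sub: "semi_inner V' ip N"
    by (rule semi_inner_subspace) (auto simp: V'_def zero_mem comb_mem)
  interpret V': semi_inner V' ip N by (rule sub)
  have sep: "N v = 0" if "v \<in> V'" "\<And>x. x \<in> X \<Longrightarrow> v x = 0" for v
    using that by (intro insert.prems(2)) (auto simp: V'_def)
  obtain m :: nat and \<phi> where mem: "\<And>j. j < m \<Longrightarrow> \<phi> j \<in> V'"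
    and ortho: "\<And>i j. i < m \<Longrightarrow> j < m \<Longrightarrow> ip (\<phi> i) (\<phi> j) = (if i = j then 1 else 0)"
    and complete: "\<And>v. v \<in> V' \<Longrightarrow> N (\<lambda>x. v x - (\<Sum>j<m. ip v (\<phi> j) * \<phi> j x)) = 0"
    using insert.IH[OF sub sep] by blast
  have mem': "\<phi> j \<in> V" if "j < m" for j using mem[OF that] by (simp add: V'_def)
  define E where "E v x = (\<Sum>j<m. ip v (\<phi> j) * \<phi> j x)" for v x
  have E_mem: "E v \<in> V'" for v
    unfolding E_def[abs_def] by (rule V'.sum_mem) (use mem in auto)
  have E_ip: "ip (E v) (\<phi> i) = ip v (\<phi> i)" if "i < m" for v i
  proof -
    have "ip (E v) (\<phi> i) = (\<Sum>j<m. ip v (\<phi> j) * ip (\<phi> j) (\<phi> i))"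
      unfolding E_def[abs_def] by (rule sum_left) (use mem' that in auto)
    also have "\<dots> = (\<Sum>j<m. if j = i then ip v (\<phi> i) else 0)"
      using ortho that by (intro sum.cong) auto
    also have "\<dots> = ip v (\<phi> i)" using that by (subst sum.delta) auto
    finally show ?thesis .
  qed
  show ?case
  proof (cases "\<exists>v0\<in>V. v0 p \<noteq> 0")
    case False
    then have "V' = V" by (auto simp: V'_def)
    then show ?thesis using mem ortho complete by (intro exI[of _ m] exI[of _ \<phi>]) auto
  next
    case True
    then obtain v0 where v0: "v0 \<in> V" "v0 p \<noteq> 0" by blast
    define \<phi>0 where "\<phi>0 x = v0 x - E v0 x" for x
    have E_V: "E v \<in> V" for v using E_mem by (simp add: V'_def)
    have E_p: "E v p = 0" for v using E_mem by (simp add: V'_def)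
    have \<phi>0: "\<phi>0 \<in> V" "\<phi>0 p = v0 p"
      using diff_mem[OF v0(1) E_V] E_p by (auto simp: \<phi>0_def[abs_def])
    have \<phi>0_ip: "ip \<phi>0 (\<phi> j) = 0" if "j < m" for j
      unfolding \<phi>0_def[abs_def] using diff_left[OF v0(1) E_V mem'[OF that]] E_ip[OF that] by simp
    \<comment> \<open>The multiple of \<phi>0 whose removal makes the remainder vanish at
      \<open>p\<close>, so that the remainder lies in \<open>V'\<close>.\<close>
    define c where "c v = v p / \<phi>0 p" for v :: "'a \<Rightarrow> real"
    define r where "r v x = v x - c v * \<phi>0 x" for v x
    have r_mem: "r v \<in> V'" if "v \<in> V" for v
      using comb_mem[OF that \<phi>0(1), of 1 "- c v"] v0(2) \<phi>0(2) by (auto simp: V'_def r_def[abs_def] c_def)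
    have r_ip: "ip (r v) (\<phi> j) = ip v (\<phi> j)" if "v \<in> V" "j < m" for v j
      unfolding r_def[abs_def]
      using comb_left[OF that(1) \<phi>0(1) mem'[OF that(2)], of 1 "- c v"] \<phi>0_ip[OF that(2)] by simp
    have r_E: "N (\<lambda>x. r v x - E v x) = 0" if "v \<in> V" for v
      using complete[OF r_mem[OF that]] r_ip[OF that] by (simp add: E_def)
    have rE_mem: "(\<lambda>x. r v x - E v x) \<in> V" if "v \<in> V" for v
      using V'.diff_mem[OF r_mem[OF that] E_mem] by (simp add: V'_def)
    have r_\<phi>0: "ip (r v) \<phi>0 = 0" if "v \<in> V" for v
    proof -
      have "ip (r v) \<phi>0 = ip (E v) \<phi>0"
        using r_mem[OF that] r_E[OF that] E_V \<phi>0(1) by (intro ip_diff_zero) (auto simp: V'_def)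
      also have "\<dots> = (\<Sum>j<m. ip v (\<phi> j) * ip (\<phi> j) \<phi>0)"
        unfolding E_def[abs_def] by (rule sum_left) (use mem' \<phi>0 in auto)
      also have "\<dots> = 0" using \<phi>0_ip sym by (intro sum.neutral) auto
      finally show ?thesis .
    qed
    \<comment> \<open>The form may be degenerate: if \<phi>0 has norm zero, it adds no direction and
      the old basis is already complete; otherwise it is normalised and appended.\<close>
    show ?thesis
    proof (cases "N \<phi>0 = 0")
      case True
      have "N (\<lambda>x. v x - E v x) = 0" if v: "v \<in> V" for v
      proof -
        have "(\<lambda>x. v x - E v x) = (\<lambda>x. (r v x - E v x) + c v * \<phi>0 x)" by (simp add: r_def algebra_simps)
        then have "N (\<lambda>x. v x - E v x) \<le> N (\<lambda>x. r v x - E v x) + N (\<lambda>x. c v * \<phi>0 x)"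
          using triangle[OF rE_mem[OF v] scale_mem[OF \<phi>0(1), of "c v"]] by simp
        then show ?thesis using r_E[OF v] N_scale[OF \<phi>0(1)] True N_nonneg[of "\<lambda>x. v x - E v x"] by simp
      qed
      then show ?thesis
        using mem' ortho by (intro exI[of _ m] exI[of _ \<phi>]) (auto simp: E_def)
    next
      case False
      define \<phi>' where "\<phi>' j = (if j < m then \<phi> j else (\<lambda>x. inverse (N \<phi>0) * \<phi>0 x))" for j
      have new: "\<phi>' m = (\<lambda>x. inverse (N \<phi>0) * \<phi>0 x)" by (simp add: \<phi>'_def)
      have old: "\<phi>' j = \<phi> j" if "j < m" for j using that by (simp add: \<phi>'_def)
      have n1: "\<phi>' m \<in> V" unfolding new by (rule scale_mem[OF \<phi>0(1)])
      have n2: "ip (\<phi>' m) (\<phi>' m) = 1"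
      proof -
        have "N (\<phi>' m) = 1"
          unfolding new using N_scale[OF \<phi>0(1), of "inverse (N \<phi>0)"] False by simp
        then show ?thesis using N_sq[of "\<phi>' m"] by simp
      qed
      have n3: "ip (\<phi>' m) (\<phi> j) = 0" "ip (\<phi> j) (\<phi>' m) = 0" if "j < m" for j
        unfolding new using \<phi>0_ip[OF that] sym[of "\<phi> j" "\<lambda>x. inverse (N \<phi>0) * \<phi>0 x"] scale_left[OF \<phi>0(1) mem'[OF that]]
        by auto
      have "N (\<lambda>x. v x - (\<Sum>j<Suc m. ip v (\<phi>' j) * \<phi>' j x)) = 0" if v: "v \<in> V" for v
      proof -
        have v_eq: "v = (\<lambda>x. 1 * r v x + c v * \<phi>0 x)" by (simp add: r_def)
        have "ip v \<phi>0 = c v * (N \<phi>0)\<^sup>2"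
          using comb_left[of "r v" \<phi>0 \<phi>0 1 "c v"] r_mem[OF v] \<phi>0(1) r_\<phi>0[OF v] v_eq N_sq[of \<phi>0]
          by (auto simp: V'_def)
        then have "ip v (\<phi>' m) = c v * N \<phi>0"
          unfolding new using False scale_right[OF \<phi>0(1) v] by (simp add: power2_eq_square)
        then have "ip v (\<phi>' m) * \<phi>' m x = c v * \<phi>0 x" for x
          using False by (simp add: new)
        then have "(\<lambda>x. v x - (\<Sum>j<Suc m. ip v (\<phi>' j) * \<phi>' j x)) = (\<lambda>x. r v x - E v x)"
          using old by (intro ext) (simp add: r_def E_def)
        then show ?thesis using r_E[OF v] by simp
      qed
      moreover have "\<phi>' j \<in> V" if "j < Suc m" for j
        using that n1 mem' old by (cases "j = m") auto
      moreover have "ip (\<phi>' i) (\<phi>' j) = (if i = j then 1 else 0)" if "i < Suc m" "j < Suc m" for i j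
        using that n2 n3 ortho old by (cases "i = m"; cases "j = m") auto
      ultimately show ?thesis
        by (intro exI[of _ "Suc m"] exI[of _ \<phi>']) auto
    qed
  qed
qed

text \<open>An affine function that vanishes at the vertices of a simplex vanishes on it, so the
  vertices of all simplices separate the finite element functions on \<Omega>. They are the points
  on which the construction of the basis runs its induction.\<close>

lemma finite_element_unisolvent:
  fixes \<T> :: "'a::euclidean_space set set"
  assumes "simplicial_decomposition \<Omega> \<T>"
  obtains X where "finite X" "\<And>v x. v \<in> V_h \<Omega> \<T> \<Longrightarrow> (\<And>x. x \<in> X \<Longrightarrow> v x = 0) \<Longrightarrow> x \<in> \<Omega> \<Longrightarrow> v x = 0"
proof -
  have fin: "finite \<T>" and cover: "\<Union>\<T> = closure \<Omega>"
    using assms by (auto simp: simplicial_decomposition_def triangulation_def)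
  have "\<exists>C. finite C \<and> K = convex hull C" if "K \<in> \<T>" for K
    using assms that by (auto simp: simplicial_decomposition_def simplex)
  then obtain C where C: "\<And>K. K \<in> \<T> \<Longrightarrow> finite (C K) \<and> K = convex hull (C K)" by metis
  show ?thesis
  proof (rule that[of "\<Union>K\<in>\<T>. C K"])
    show "finite (\<Union>K\<in>\<T>. C K)" using fin C by blast
    fix v x assume v: "v \<in> V_h \<Omega> \<T>" and z: "\<And>x. x \<in> (\<Union>K\<in>\<T>. C K) \<Longrightarrow> v x = 0" and x: "x \<in> \<Omega>"
    obtain K where K: "K \<in> \<T>" "x \<in> K" using x cover closure_subset[of \<Omega>] by blast
    obtain a c where ac: "\<And>x. x \<in> K \<Longrightarrow> v x = a \<bullet> x + c" using v K(1) unfolding V_h_def by blast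
    have "C K \<subseteq> K" using C[OF K(1)] hull_subset[of "C K" convex] by simp
    then have "C K \<subseteq> {y. a \<bullet> y = - c}"
      using z ac K(1) by (force simp: add_eq_0_iff2)
    then have "convex hull (C K) \<subseteq> {y. a \<bullet> y = - c}"
      by (rule hull_minimal) (rule convex_hyperplane)
    then show "v x = 0" using K C[OF K(1)] ac by auto
  qed
qed

lemma V_h_comb:
  assumes "open \<Omega>" "u \<in> V_h \<Omega> \<T>" "v \<in> V_h \<Omega> \<T>"
  shows "(\<lambda>x. a * u x + b * v x) \<in> V_h \<Omega> \<T>"
proof -
  interpret open_domain \<Omega> by unfold_locales (rule assms)
  have "\<exists>a' c. \<forall>x\<in>K. a * u x + b * v x = a' \<bullet> x + c" if "K \<in> \<T>" for K
  proof -
    obtain a1 c1 a2 c2 where "\<forall>x\<in>K. u x = a1 \<bullet> x + c1" "\<forall>x\<in>K. v x = a2 \<bullet> x + c2"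
      using assms(2,3) \<open>K \<in> \<T>\<close> unfolding V_h_def by blast
    then show ?thesis
      by (intro exI[of _ "a *\<^sub>R a1 + b *\<^sub>R a2"] exI[of _ "a * c1 + b * c2"])
        (simp add: inner_left_distrib algebra_simps)
  qed
  with assms(2,3) show ?thesis
    by (auto simp: V_h_def H10_comb intro!: continuous_intros)
qed

lemma V_h_zero: "open \<Omega> \<Longrightarrow> (\<lambda>x. 0) \<in> V_h \<Omega> \<T>"
proof -
  assume "open \<Omega>"
  then interpret open_domain \<Omega> by unfold_locales
  have "\<exists>a c. \<forall>x\<in>K. (0::real) = a \<bullet> x + c" for K :: "'a set"
    by (intro exI[of _ 0]) simp
  then show ?thesis by (simp add: V_h_def H10_zero)
qed

text \<open>Members of \<open>V_h\<close> are unconstrained outside the closure of \<Omega>, so as a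
  set of functions it has no finite basis, and completeness can only mean distance zero.
  Orthonormality in the gradient product makes the coefficients of the H10 projection inner
  products.\<close>

locale galerkin = cylinder \<Omega> T R for \<Omega> :: "'a::euclidean_space set" and T R +
  fixes \<T> :: "'a set set" and m :: nat and \<phi> :: "nat \<Rightarrow> 'a \<Rightarrow> real"
  assumes basis_mem: "\<And>j. j < m \<Longrightarrow> \<phi> j \<in> V_h \<Omega> \<T>"
    and basis_ortho: "\<And>i j. i < m \<Longrightarrow> j < m \<Longrightarrow> grad_inner \<Omega> (\<phi> i) (\<phi> j) = (if i = j then 1 else 0)"
    and basis_complete: "\<And>v. v \<in> V_h \<Omega> \<T> \<Longrightarrow>
      grad_norm \<Omega> (\<lambda>x. v x - (\<Sum>j<m. grad_inner \<Omega> v (\<phi> j) * \<phi> j x)) = 0"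

lemma (in cylinder) ex_galerkin:
  assumes "simplicial_decomposition \<Omega> \<T>"
  shows "\<exists>m \<phi>. galerkin \<Omega> T R \<T> m \<phi>"
proof -
  obtain X where X: "finite X" "\<And>v x. v \<in> V_h \<Omega> \<T> \<Longrightarrow> (\<And>x. x \<in> X \<Longrightarrow> v x = 0) \<Longrightarrow> x \<in> \<Omega> \<Longrightarrow> v x = 0"
    using finite_element_unisolvent[OF assms] by blast
  have sub: "semi_inner (V_h \<Omega> \<T>) (grad_inner \<Omega>) (grad_norm \<Omega>)"
    by (rule H10.semi_inner_subspace) (auto simp: V_h_zero V_h_comb open_dom, simp add: V_h_def)
  have "grad_norm \<Omega> v = 0" if v: "v \<in> V_h \<Omega> \<T>" "\<And>x. x \<in> X \<Longrightarrow> v x = 0" for v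
  proof -
    have z: "v x = 0" if "x \<in> \<Omega>" for x using X(2)[OF v that] .
    have "v \<in> H10 \<Omega>" using v by (simp add: V_h_def)
    then have vH: "v \<in> H1 \<Omega>" by (rule H10_H1)
    have "L2_norm \<Omega> (wpartial \<Omega> b v) = 0" if b: "b \<in> Basis" for b
    proof -
      \<comment> \<open>Since \<open>wpartial\<close> is a choice, that the derivative of a function
        vanishing on \<Omega> is null has to be recognised by testing.\<close>
      have "L2_norm \<Omega> (wpartial \<Omega> b v) \<le> 0"
      proof (rule L2_norm_le_by_test[OF wpartial_L2[OF vH b]])
        fix \<psi> assume \<psi>: "\<psi> \<in> test_functions \<Omega>"
        have "L2_inner \<Omega> v (partial b \<psi>) = (LINT x|lebesgue_on \<Omega>. 0)"
          unfolding L2_inner_def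
          by (rule Bochner_Integration.integral_cong) (auto simp: z space_restrict_space)
        then show "\<bar>L2_inner \<Omega> (wpartial \<Omega> b v) \<psi>\<bar> \<le> 0 * L2_norm \<Omega> \<psi>"
          using weak_partialD[OF wpartial_weak[OF vH b] \<psi>] by simp
      qed simp
      then show ?thesis using L2.N_nonneg[of \<Omega> "wpartial \<Omega> b v"] by linarith
    qed
    then have "(grad_norm \<Omega> v)\<^sup>2 = 0" unfolding grad_inner_self by simp
    then show ?thesis by simp
  qed
  from ex_orthonormal_basis[OF X(1) sub this]
  obtain m :: nat and \<phi> where "\<forall>j<m. \<phi> j \<in> V_h \<Omega> \<T>"
    "\<forall>i<m. \<forall>j<m. grad_inner \<Omega> (\<phi> i) (\<phi> j) = (if i = j then 1 else 0)"
    "\<forall>v\<in>V_h \<Omega> \<T>. grad_norm \<Omega> (\<lambda>x. v x - (\<Sum>j<m. grad_inner \<Omega> v (\<phi> j) * \<phi> j x)) = 0"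
    by blast
  then have "galerkin \<Omega> T R \<T> m \<phi>" by unfold_locales auto
  then show ?thesis by blast
qed

section \<open>Projection and expansions in coordinates\<close>

context galerkin begin

lemma V_h_H10: "v \<in> V_h \<Omega> \<T> \<Longrightarrow> v \<in> H10 \<Omega>"
  by (simp add: V_h_def)

sublocale V: semi_inner "V_h \<Omega> \<T>" "grad_inner \<Omega>" "grad_norm \<Omega>"
  by (rule H10.semi_inner_subspace) (auto simp: V_h_zero V_h_comb open_dom V_h_H10)

definition lincomb :: "(nat \<Rightarrow> real) \<Rightarrow> 'a \<Rightarrow> real" where
  "lincomb c = (\<lambda>x. \<Sum>j<m. c j * \<phi> j x)"

lemma basis_H1: "j < m \<Longrightarrow> \<phi> j \<in> H1 \<Omega>"
  by (rule H10_H1[OF V_h_H10[OF basis_mem]])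

lemma lincomb_mem: "lincomb c \<in> V_h \<Omega> \<T>"
  unfolding lincomb_def by (rule V.sum_mem) (simp add: basis_mem)

lemma lincomb_H10: "lincomb c \<in> H10 \<Omega>"
  by (rule V_h_H10[OF lincomb_mem])

lemma lincomb_H1: "lincomb c \<in> H1 \<Omega>"
  by (rule H10_H1[OF lincomb_H10])

lemma lincomb_L2: "lincomb c \<in> L2 \<Omega>"
  by (rule H1_L2[OF lincomb_H1])

lemma lincomb_ip: "v \<in> H1 \<Omega> \<Longrightarrow> grad_inner \<Omega> v (lincomb c) = (\<Sum>j<m. c j * grad_inner \<Omega> v (\<phi> j))"
  unfolding lincomb_def by (rule H1.sum_right) (simp_all add: basis_H1)

lemma lincomb_basis:
  assumes "i < m"
  shows "grad_inner \<Omega> (lincomb c) (\<phi> i) = c i"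
proof -
  have "grad_inner \<Omega> (lincomb c) (\<phi> i) = (\<Sum>j<m. c j * grad_inner \<Omega> (\<phi> j) (\<phi> i))"
    unfolding lincomb_def by (rule H1.sum_left) (simp_all add: basis_H1 assms)
  also have "\<dots> = (\<Sum>j<m. if j = i then c i else 0)"
    using assms by (intro sum.cong) (auto simp: basis_ortho)
  also have "\<dots> = c i" using assms by (subst sum.delta) auto
  finally show ?thesis .
qed

lemma lincomb_norm: "(grad_norm \<Omega> (lincomb c))\<^sup>2 = (\<Sum>j<m. (c j)\<^sup>2)"
  unfolding H1.N_sq lincomb_ip[OF lincomb_H1] by (simp add: lincomb_basis power2_eq_square)

lemma lincomb_diff: "(\<lambda>x. lincomb c x - lincomb d x) = lincomb (\<lambda>j. c j - d j)"
  by (auto simp: lincomb_def sum_subtractf left_diff_distrib)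

lemma lincomb_add: "(\<lambda>x. lincomb c x + lincomb d x) = lincomb (\<lambda>j. c j + d j)"
  by (auto simp: lincomb_def sum.distrib distrib_right)

text \<open>The H10 projection through its coefficients: with an orthonormal basis its existence is
  a formula.\<close>

definition proj :: "('a \<Rightarrow> real) \<Rightarrow> 'a \<Rightarrow> real" where
  "proj g = lincomb (\<lambda>j. grad_inner \<Omega> g (\<phi> j))"

lemma proj_V_h: "v \<in> V_h \<Omega> \<T> \<Longrightarrow> grad_norm \<Omega> (\<lambda>x. v x - proj v x) = 0"
  using basis_complete by (simp add: proj_def lincomb_def)

lemma H10_null:
  assumes "u \<in> H10 \<Omega>" "grad_norm \<Omega> u = 0"
  shows "L2_norm \<Omega> u = 0"
  using H10_poincare[OF assms(1)] assms(2) L2.N_nonneg[of \<Omega> u] by simp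

lemma proj_V_h_L2:
  assumes "v \<in> V_h \<Omega> \<T>"
  shows "L2_norm \<Omega> (\<lambda>x. v x - proj v x) = 0"
  by (rule H10_null[OF H10.diff_mem[OF V_h_H10[OF assms]] proj_V_h[OF assms]]) (simp add: proj_def lincomb_H10)

lemma ip_proj:
  assumes "g \<in> H1 \<Omega>" "v \<in> V_h \<Omega> \<T>"
  shows "grad_inner \<Omega> g v = (\<Sum>j<m. grad_inner \<Omega> v (\<phi> j) * grad_inner \<Omega> g (\<phi> j))"
proof -
  note v = H10_H1[OF V_h_H10[OF assms(2)]]
  have "grad_inner \<Omega> v g = grad_inner \<Omega> (proj v) g"
    by (rule H1.ip_diff_zero[OF v _ assms(1) proj_V_h[OF assms(2)]]) (simp add: proj_def lincomb_H1)
  then have "grad_inner \<Omega> g v = grad_inner \<Omega> g (proj v)" using H1.sym by metis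
  then show ?thesis by (simp add: proj_def lincomb_ip[OF assms(1)])
qed

lemma proj_is_projection:
  assumes "g \<in> H1 \<Omega>"
  shows "H10_projection \<Omega> \<T> g (proj g)"
  unfolding H10_projection_def
proof (intro conjI ballI)
  show "proj g \<in> V_h \<Omega> \<T>" by (simp add: proj_def lincomb_mem)
  fix v assume v: "v \<in> V_h \<Omega> \<T>"
  have "grad_inner \<Omega> (proj g) v = (\<Sum>j<m. grad_inner \<Omega> v (\<phi> j) * grad_inner \<Omega> g (\<phi> j))"
    by (subst ip_proj[OF _ v]) (simp_all add: proj_def lincomb_H1 lincomb_basis)
  then show "grad_inner \<Omega> (proj g) v = grad_inner \<Omega> g v" using ip_proj[OF assms v] by simp
qed

lemma V_h_norm:
  assumes "v \<in> V_h \<Omega> \<T>"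
  shows "(grad_norm \<Omega> v)\<^sup>2 = (\<Sum>j<m. (grad_inner \<Omega> v (\<phi> j))\<^sup>2)"
  unfolding H1.N_sq using ip_proj[OF H10_H1[OF V_h_H10[OF assms]] assms] by (simp add: power2_eq_square)

text \<open>The projection satisfies |P g|^2 = (g, P g), and Cauchy-Schwarz gives |P g| \<le>
  |g|.\<close>

lemma bessel:
  assumes "g \<in> H1 \<Omega>"
  shows "(\<Sum>j<m. (grad_inner \<Omega> g (\<phi> j))\<^sup>2) \<le> (grad_norm \<Omega> g)\<^sup>2"
proof -
  have P: "proj g \<in> H1 \<Omega>" by (simp add: proj_def lincomb_H1)
  let ?S = "\<Sum>j<m. (grad_inner \<Omega> g (\<phi> j))\<^sup>2"
  have S: "(grad_norm \<Omega> (proj g))\<^sup>2 = ?S" by (simp add: proj_def lincomb_norm)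
  have "?S = grad_inner \<Omega> g (proj g)"
    by (simp add: proj_def lincomb_ip[OF assms] power2_eq_square)
  also have "\<dots> \<le> grad_norm \<Omega> g * grad_norm \<Omega> (proj g)"
    using H1.cauchy_schwarz[OF assms P] by simp
  finally have le: "grad_norm \<Omega> (proj g) * grad_norm \<Omega> (proj g) \<le> grad_norm \<Omega> g * grad_norm \<Omega> (proj g)"
    using S by (simp add: power2_eq_square)
  have "grad_norm \<Omega> (proj g) \<le> grad_norm \<Omega> g"
    using le H1.N_nonneg[of "proj g"] H1.N_nonneg[of g]
    by (cases "grad_norm \<Omega> (proj g) = 0") (auto simp: mult_le_cancel_right)
  then show ?thesis using S power_mono[of "grad_norm \<Omega> (proj g)" "grad_norm \<Omega> g" 2] by simp
qed

end

section \<open>The time mesh\<close>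

text \<open>Starting from energy zero, summation over the steps cancels the energies in pairs. What
  remains bounds the energy at every node and the accumulated dissipation \<open>q\<close> at the
  same time.\<close>

lemma telescoping_energy:
  fixes e q r :: "nat \<Rightarrow> real"
  assumes e0: "e 0 = 0" and pos: "\<And>i. 0 \<le> e i" "\<And>i. 0 \<le> q i" "\<And>i. 0 \<le> r i"
    and step: "\<And>i. i < n \<Longrightarrow> q i + e (Suc i) - e i \<le> r i"
  shows "i \<le> n \<Longrightarrow> e i \<le> (\<Sum>j<n. r j)" and "(\<Sum>j<n. q j) \<le> (\<Sum>j<n. r j)"
proof -
  have le: "(\<Sum>j<i. q j) + e i \<le> (\<Sum>j<i. r j)" if "i \<le> n" for i
    using that
  proof (induction i)
    case (Suc i)
    then show ?case using step[of i] by simp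
  qed (simp add: e0)
  show "e i \<le> (\<Sum>j<n. r j)" if "i \<le> n"
  proof -
    have "e i \<le> (\<Sum>j<i. r j)" using le[OF that] sum_nonneg[of "{..<i}" q] pos(2) by force
    also have "\<dots> \<le> (\<Sum>j<n. r j)" using that pos(3) by (intro sum_mono2) auto
    finally show ?thesis .
  qed
  show "(\<Sum>j<n. q j) \<le> (\<Sum>j<n. r j)" using le[of n] pos(1)[of n] by simp
qed

section \<open>Slabs, step functions and integrals over slabs\<close>

locale mesh = galerkin \<Omega> T R \<T> m \<phi> for \<Omega> :: "'a::euclidean_space set" and T R \<T> m \<phi> +
  fixes n :: nat
  assumes n_pos: "0 < n"
begin

definition h :: real where "h = T / real n"

definition node :: "nat \<Rightarrow> real" where "node i = real i * (T / real n)"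

text \<open>Open on the left and closed on the right: the first n slabs partition (0, T], and their
  indicators are those that occur in differences of \<open>prim\<close>.\<close>

definition slab :: "nat \<Rightarrow> real set" where "slab i = {node i<..node (Suc i)}"

definition seg :: "nat \<Rightarrow> (real \<Rightarrow> real) \<Rightarrow> real" where
  "seg i f = (LINT t|time T. indicat_real (slab i) t * f t)"

definition steps :: "(nat \<Rightarrow> real) \<Rightarrow> real \<Rightarrow> real" where
  "steps q t = (\<Sum>i<n. q i * indicat_real (slab i) t)"

lemma h_pos: "0 < h"
  using T_pos n_pos by (simp add: h_def)

lemma node_Suc: "node (Suc i) = node i + h"
  unfolding node_def h_def of_nat_Suc by (simp only: distrib_right mult_1_left add.commute)

lemma node_0: "node 0 = 0" and node_n: "node n = T"
  using n_pos by (simp_all add: node_def)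

lemma node_nonneg: "0 \<le> node i"
  using T_pos by (simp add: node_def)

lemma node_mono: "i \<le> j \<Longrightarrow> node i \<le> node j"
  unfolding node_def using T_pos by (intro mult_right_mono) auto

lemma node_le_T: "i \<le> n \<Longrightarrow> node i \<le> T"
  using node_mono[of i n] node_n by simp

lemma slab_iff: "t \<in> slab i \<longleftrightarrow> node i < t \<and> t \<le> node i + h"
  by (simp add: slab_def node_Suc)

lemma slab_disjoint:
  assumes "t \<in> slab i" "t \<in> slab j"
  shows "i = j"
proof (rule ccontr)
  assume "i \<noteq> j"
  then consider "Suc i \<le> j" | "Suc j \<le> i" by linarith
  then show False
    using node_mono assms by cases (fastforce simp: slab_def)+
qed

lemma ex_slab:
  assumes "t \<in> {0<..<T}"
  obtains i where "i < n" "t \<in> slab i"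
proof -
  have ex: "\<exists>i. t \<le> node i" using node_n assms by (intro exI[of _ n]) auto
  define k where "k = (LEAST i. t \<le> node i)"
  have k: "t \<le> node k" unfolding k_def using ex by (rule LeastI_ex)
  have "k \<noteq> 0" using k node_0 assms by (cases k) auto
  then obtain i where i: "k = Suc i" by (cases k) auto
  have "\<not> t \<le> node i" using not_less_Least[of i "\<lambda>i. t \<le> node i"] i by (simp add: k_def)
  moreover have "k \<le> n" unfolding k_def using node_n assms by (intro Least_le) auto
  ultimately show ?thesis using that[of i] i k by (simp add: slab_def)
qed

lemma steps_eq:
  assumes "i < n" "t \<in> slab i"
  shows "steps q t = q i"
proof -
  have "steps q t = (\<Sum>j<n. if j = i then q i else 0)"
    unfolding steps_def using assms slab_disjoint by (intro sum.cong) (auto simp: indicator_def)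
  then show ?thesis using assms by (subst (asm) sum.delta) auto
qed

lemma slab_L2: "indicat_real (slab i) \<in> L2 {0<..<T}"
  by (rule indicator_time_L2) (simp add: slab_def)

lemma steps_L2: "steps q \<in> L2 {0<..<T}"
  unfolding steps_def[abs_def] by (rule L2.sum_mem[OF slab_L2])

lemma seg_integrable: "f \<in> L2 {0<..<T} \<Longrightarrow> integrable (time T) (\<lambda>t. indicat_real (slab i) t * f t)"
  by (rule L2_mult_integrable[OF slab_L2])

lemma seg_integrable': "integrable (time T) f \<Longrightarrow> integrable (time T) (\<lambda>t. indicat_real (slab i) t * f t)"
proof -
  assume f: "integrable (time T) f"
  have "(\<lambda>t. indicat_real (slab i) t * f t) \<in> borel_measurable (time T)"
    by (intro borel_measurable_times L2_measurable[OF slab_L2] borel_measurable_integrable f)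
  then show ?thesis
    by (rule Bochner_Integration.integrable_bound[OF f]) (auto simp: indicator_def)
qed

lemma slab_integral:
  assumes "i < n"
  shows "(LINT t|time T. indicat_real (slab i) t) = h"
  unfolding slab_def using integral_indicator_time[of "node i" "node (Suc i)" T] node_nonneg[of i]
    node_le_T[of "Suc i"] node_mono[of i "Suc i"] assms
  by (simp add: node_Suc)

lemma slab_norm: "i < n \<Longrightarrow> L2_norm {0<..<T} (indicat_real (slab i)) = sqrt h"
  unfolding slab_def using indicator_time_norm[of "node i" "node (Suc i)" T] node_nonneg[of i]
    node_le_T[of "Suc i"] node_mono[of i "Suc i"]
  by (simp add: node_Suc)

lemma steps_integral: "(LINT t|time T. steps q t) = h * (\<Sum>i<n. q i)"
proof -
  have "(LINT t|time T. steps q t) = (\<Sum>i<n. q i * (LINT t|time T. indicat_real (slab i) t))"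
    unfolding steps_def using L2_time_integrable[OF slab_L2]
    by (subst Bochner_Integration.integral_sum) auto
  also have "\<dots> = (\<Sum>i<n. q i * h)" by (intro sum.cong refl) (simp only: lessThan_iff slab_integral)
  finally show ?thesis by (simp add: sum_distrib_left mult.commute)
qed

lemma seg_const: "i < n \<Longrightarrow> seg i (\<lambda>t. c) = h * c"
  using slab_integral by (simp add: seg_def)

lemma seg_mono:
  assumes "g \<in> L2 {0<..<T}" "AE t in time T. t \<in> slab i \<longrightarrow> f t \<le> g t" "AE t in time T. 0 \<le> g t"
  shows "seg i f \<le> seg i g"
  unfolding seg_def
proof (rule integral_mono_AE'[OF seg_integrable[OF assms(1)]])
  show "AE t in time T. indicat_real (slab i) t * f t \<le> indicat_real (slab i) t * g t"
    using assms(2) by eventually_elim (simp add: indicator_def)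
  show "AE t in time T. 0 \<le> indicat_real (slab i) t * g t"
    using assms(3) by eventually_elim simp
qed

lemma seg_nonneg: "AE t in time T. 0 \<le> f t \<Longrightarrow> 0 \<le> seg i f"
  unfolding seg_def by (rule integral_nonneg_AE) (auto elim: eventually_mono)

lemma sum_seg_le:
  assumes f: "integrable (time T) f" "\<And>t. 0 \<le> f t"
  shows "(\<Sum>i<n. seg i f) \<le> (LINT t|time T. f t)"
proof -
  have "(\<Sum>i<n. seg i f) = (LINT t|time T. (\<Sum>i<n. indicat_real (slab i) t * f t))"
    unfolding seg_def using seg_integrable'[OF f(1)] by (subst Bochner_Integration.integral_sum) auto
  also have "\<dots> \<le> (LINT t|time T. f t)"
  proof (rule integral_mono[OF _ f(1)])
    show "integrable (time T) (\<lambda>t. \<Sum>i<n. indicat_real (slab i) t * f t)"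
      by (intro Bochner_Integration.integrable_sum seg_integrable' f(1))
    fix t assume "t \<in> space (time T)"
    then obtain i where i: "i < n" "t \<in> slab i" using ex_slab[of t] by (auto simp: space_time)
    have "(\<Sum>i<n. indicat_real (slab i) t * f t) = steps (\<lambda>_. f t) t"
      by (simp add: steps_def mult.commute)
    also have "\<dots> = f t" by (rule steps_eq[OF i])
    finally show "(\<Sum>i<n. indicat_real (slab i) t * f t) \<le> f t" by (rule eq_refl)
  qed
  finally show ?thesis .
qed

lemma seg_cauchy_schwarz:
  assumes f: "f \<in> L2 {0<..<T}" and i: "i < n"
  shows "(seg i (\<lambda>t. \<bar>f t\<bar>))\<^sup>2 \<le> h * seg i (\<lambda>t. (f t)\<^sup>2)"
proof -
  let ?g = "\<lambda>t. indicat_real (slab i) t * \<bar>f t\<bar>"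
  have g: "?g \<in> L2 {0<..<T}"
    by (intro L2_bound[OF f] borel_measurable_times borel_measurable_abs L2_measurable[OF slab_L2] L2_measurable[OF f])
      (auto simp: indicator_def)
  have "seg i (\<lambda>t. \<bar>f t\<bar>) = L2_inner {0<..<T} (indicat_real (slab i)) ?g"
    unfolding seg_def L2_inner_def by (rule Bochner_Integration.integral_cong) (auto simp: indicator_def)
  also have "\<dots> \<le> sqrt h * L2_norm {0<..<T} ?g"
    using L2.cauchy_schwarz[OF slab_L2 g, of i] slab_norm[OF i] by simp
  finally have "(seg i (\<lambda>t. \<bar>f t\<bar>))\<^sup>2 \<le> (sqrt h * L2_norm {0<..<T} ?g)\<^sup>2"
    by (intro power_mono seg_nonneg) auto
  also have "\<dots> = h * (L2_norm {0<..<T} ?g)\<^sup>2" using h_pos by (simp add: power_mult_distrib)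
  also have "(L2_norm {0<..<T} ?g)\<^sup>2 = seg i (\<lambda>t. (f t)\<^sup>2)"
    unfolding L2_norm_eq seg_def by (rule Bochner_Integration.integral_cong) (auto simp: indicator_def)
  finally show ?thesis .
qed

section \<open>Interpolation and averaging on a slab\<close>

lemma prim_node_diff:
  assumes "\<beta> \<in> L2 {0<..<T}"
  shows "prim T \<beta> (node (Suc i)) - prim T \<beta> (node i) = seg i \<beta>"
  using prim_diff[OF assms node_mono[of i "Suc i"]] by (simp add: seg_def slab_def)

lemma prim_slab_diff:
  assumes \<beta>: "\<beta> \<in> L2 {0<..<T}" and s: "node i \<le> s" "s \<le> t" "t \<le> node (Suc i)"
  shows "\<bar>prim T \<beta> t - prim T \<beta> s\<bar> \<le> seg i (\<lambda>r. \<bar>\<beta> r\<bar>)"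
proof -
  have "\<bar>prim T \<beta> t - prim T \<beta> s\<bar> \<le> (LINT r|time T. \<bar>indicat_real {s<..t} r * \<beta> r\<bar>)"
    unfolding prim_diff[OF \<beta> s(2)] by (rule integral_abs_bound)
  also have "\<dots> \<le> seg i (\<lambda>r. \<bar>\<beta> r\<bar>)"
    unfolding seg_def
    by (rule integral_mono_AE'[OF seg_integrable[OF L2_abs[OF \<beta>]]])
      (use s in \<open>auto intro!: AE_I2 simp: indicator_def slab_def\<close>)
  finally show ?thesis .
qed

text \<open>With \<theta> the relative position in the slab and f the primitive, the error is (1 -
  \<theta>)(f(t) - f(left)) + \<theta> (f(t) - f(right)). Each difference is at most the integral of
  |\<beta>| over the slab.\<close>

lemma prim_interpolation:
  assumes \<beta>: "\<beta> \<in> L2 {0<..<T}" and t: "t \<in> slab i"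
  shows "\<bar>prim T \<beta> t - (prim T \<beta> (node i) + (t - node i) * (seg i \<beta> / h))\<bar> \<le> seg i (\<lambda>r. \<bar>\<beta> r\<bar>)"
proof -
  define \<theta> where "\<theta> = (t - node i) / h"
  have \<theta>: "0 \<le> \<theta>" "\<theta> \<le> 1" using t h_pos by (auto simp: \<theta>_def slab_iff field_simps)
  let ?B = "prim T \<beta>" and ?S = "seg i (\<lambda>r. \<bar>\<beta> r\<bar>)"
  have "?B t - (?B (node i) + (t - node i) * (seg i \<beta> / h)) =
      (1 - \<theta>) * (?B t - ?B (node i)) + \<theta> * (?B t - ?B (node (Suc i)))"
    unfolding prim_node_diff[OF \<beta>, of i, symmetric] \<theta>_def by (simp add: algebra_simps add_divide_distrib diff_divide_distrib)
  also have "\<bar>\<dots>\<bar> \<le> (1 - \<theta>) * \<bar>?B t - ?B (node i)\<bar> + \<theta> * \<bar>?B (node (Suc i)) - ?B t\<bar>"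
    using \<theta> abs_triangle_ineq[of "(1 - \<theta>) * (?B t - ?B (node i))" "\<theta> * (?B t - ?B (node (Suc i)))"]
    by (simp add: abs_mult abs_minus_commute)
  also have "\<dots> \<le> (1 - \<theta>) * ?S + \<theta> * ?S"
    using \<theta> t by (intro add_mono mult_left_mono prim_slab_diff[OF \<beta>]) (auto simp: slab_def)
  finally show ?thesis by (simp add: algebra_simps)
qed

text \<open>The deviation from the average is the average over s of f(t) - f(s), and each of these
  differences is at most the integral of |\<gamma>| over the slab. The result holds for almost every
  t because f is given as a primitive only almost everywhere.\<close>

lemma average_deviation:
  assumes f: "f \<in> L2 {0<..<T}" and \<gamma>: "\<gamma> \<in> L2 {0<..<T}" and i: "i < n"
    and eq: "AE t in time T. f t = c + prim T \<gamma> t"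
  shows "AE t in time T. t \<in> slab i \<longrightarrow> \<bar>f t - seg i f / h\<bar> \<le> seg i (\<lambda>r. \<bar>\<gamma> r\<bar>)"
  using eq
proof eventually_elim
  case (elim t)
  show ?case
  proof
    assume t: "t \<in> slab i"
    let ?S = "seg i (\<lambda>r. \<bar>\<gamma> r\<bar>)"
    have le: "\<bar>prim T \<gamma> t - prim T \<gamma> s\<bar> \<le> ?S" if "s \<in> slab i" for s
      using prim_slab_diff[OF \<gamma>, of i s t] prim_slab_diff[OF \<gamma>, of i t s] t that
      by (cases "s \<le> t") (auto simp: slab_def abs_minus_commute)
    have i1: "integrable (time T) (\<lambda>s. indicat_real (slab i) s * f t)"
      using L2_time_integrable[OF slab_L2[of i]] by simp
    have "h * (f t - seg i f / h) = h * f t - seg i f"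
      using h_pos by (simp add: right_diff_distrib)
    also have "\<dots> = (LINT s|time T. indicat_real (slab i) s * f t - indicat_real (slab i) s * f s)"
      unfolding Bochner_Integration.integral_diff[OF i1 seg_integrable[OF f]]
      using seg_const[OF i, of "f t"] by (simp only: seg_def)
    also have "\<bar>\<dots>\<bar> \<le> (LINT s|time T. \<bar>indicat_real (slab i) s * f t - indicat_real (slab i) s * f s\<bar>)"
      by (rule integral_abs_bound)
    also have "\<dots> \<le> (LINT s|time T. indicat_real (slab i) s * ?S)"
    proof (rule integral_mono_AE)
      show "AE s in time T. \<bar>indicat_real (slab i) s * f t - indicat_real (slab i) s * f s\<bar> \<le> indicat_real (slab i) s * ?S"
        using eq
      proof eventually_elim
        case (elim s)
        then show ?case using le[of s] \<open>f t = c + prim T \<gamma> t\<close> by (simp add: indicator_def)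
      qed
    qed (use i1 seg_integrable[OF f, of i] L2_time_integrable[OF slab_L2[of i]] in auto)
    also have "\<dots> = h * ?S" using seg_const[OF i, of ?S] by (simp add: seg_def)
    finally show "\<bar>f t - seg i f / h\<bar> \<le> ?S" using h_pos by (simp add: abs_mult)
  qed
qed

section \<open>Discrete functions and their time derivative\<close>

definition increment :: "(real \<Rightarrow> 'a \<Rightarrow> real) \<Rightarrow> nat \<Rightarrow> 'a \<Rightarrow> real" where
  "increment uh i = (\<lambda>x. 1 / h * uh (node (Suc i)) x + - (1 / h) * uh (node i) x)"

definition discrete_dt :: "(real \<Rightarrow> 'a \<Rightarrow> real) \<Rightarrow> real \<Rightarrow> 'a \<Rightarrow> real" where
  "discrete_dt uh t = (\<lambda>x. \<Sum>i<n. indicat_real (slab i) t * increment uh i x)"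

lemma discrete_dt_eq:
  assumes "i < n" "t \<in> slab i"
  shows "discrete_dt uh t = increment uh i"
proof
  fix x
  have "discrete_dt uh t x = steps (\<lambda>i. increment uh i x) t"
    by (simp add: discrete_dt_def steps_def mult.commute)
  then show "discrete_dt uh t x = increment uh i x" using steps_eq[OF assms] by simp
qed

lemma X0_h_props:
  assumes "uh \<in> X0_h \<Omega> T \<T> n"
  shows "uh t \<in> V_h \<Omega> \<T>" and "uh 0 = (\<lambda>x. 0)"
    and "i < n \<Longrightarrow> t \<in> {node i..node (Suc i)} \<Longrightarrow> uh t x = uh (node i) x + (t - node i) * increment uh i x"
    and "\<psi> \<in> L2 \<Omega> \<Longrightarrow> continuous_on {0..T} (\<lambda>t. L2_inner \<Omega> (uh t) \<psi>)"
    and "uh \<in> L2B T (H1 \<Omega>) (grad_norm \<Omega>)" "uh \<in> L2B T (L2 \<Omega>) (L2_norm \<Omega>)"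
proof -
  obtain k :: nat and w v where wv: "\<And>i. i < k \<Longrightarrow> w i \<in> W1_h T n" "\<And>i. i < k \<Longrightarrow> v i \<in> V_h \<Omega> \<T>"
    and uh: "uh = (\<lambda>t x. \<Sum>i<k. w i t * v i x)"
    using assms unfolding X0_h_def tensor_space_def by blast
  show "uh t \<in> V_h \<Omega> \<T>" unfolding uh by (rule V.sum_mem) (simp add: wv)
  show "uh 0 = (\<lambda>x. 0)" unfolding uh using wv(1) by (simp add: W1_h_def)
  show "uh t x = uh (node i) x + (t - node i) * increment uh i x"
    if i: "i < n" and t: "t \<in> {node i..node (Suc i)}"
  proof -
    have lin: "w j t = w j (node i) + (t - node i) * (1 / h * w j (node (Suc i)) + - (1 / h) * w j (node i))" if j: "j < k" for j
    proof -
      obtain a c where ac: "\<forall>t\<in>{node i..node (Suc i)}. w j t = a * t + c"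
        using wv(1)[OF j] i unfolding W1_h_def node_def by blast
      then have "w j t = a * t + c" "w j (node i) = a * node i + c" "w j (node (Suc i)) = a * (node i + h) + c"
        using t h_pos by (auto simp: node_Suc)
      then show ?thesis using h_pos by (simp add: field_simps)
    qed
    have "uh t x = (\<Sum>j<k. w j (node i) * v j x + (t - node i) * (1 / h * (w j (node (Suc i)) * v j x) + - (1 / h) * (w j (node i) * v j x)))"
      unfolding uh
    proof (rule sum.cong[OF refl])
      fix j assume "j \<in> {..<k}"
      then have j: "j < k" by simp
      have ring: "(a + s * (p * b + q * c)) * z = a * z + s * (p * (b * z) + q * (c * z))" for a s p b q c z :: real
        by (simp add: algebra_simps)
      show "w j t * v j x = w j (node i) * v j x + (t - node i) * (1 / h * (w j (node (Suc i)) * v j x) + - (1 / h) * (w j (node i) * v j x))"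
        unfolding lin[OF j] by (rule ring)
    qed
    also have "\<dots> = uh (node i) x + (t - node i) * increment uh i x"
      unfolding uh increment_def by (simp only: sum.distrib sum_distrib_left[symmetric])
    finally show ?thesis .
  qed
  have wc: "continuous_on {0..T} (w j)" if "j < k" for j using wv(1)[OF that] by (simp add: W1_h_def)
  have vH: "v j \<in> H1 \<Omega>" if "j < k" for j using H10_H1[OF V_h_H10[OF wv(2)[OF that]]] .
  show "continuous_on {0..T} (\<lambda>t. L2_inner \<Omega> (uh t) \<psi>)" if \<psi>: "\<psi> \<in> L2 \<Omega>"
  proof -
    have "L2_inner \<Omega> (uh t) \<psi> = (\<Sum>j<k. w j t * L2_inner \<Omega> (v j) \<psi>)" for t
      unfolding uh by (rule L2.sum_left) (use vH H1_L2 \<psi> in auto)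
    then show ?thesis using wc by (auto intro!: continuous_intros)
  qed
  have "(\<lambda>t x. \<Sum>j<l. w j t * v j x) \<in> L2B T (H1 \<Omega>) (grad_norm \<Omega>) \<and>
      (\<lambda>t x. \<Sum>j<l. w j t * v j x) \<in> L2B T (L2 \<Omega>) (L2_norm \<Omega>)" if "l \<le> k" for l
    using that
  proof (induction l)
    case 0
    then show ?case using H1B_const[OF H1_zero] L2B_const[OF L2.zero_mem] by simp
  next
    case (Suc l)
    then have l: "l < k" by simp
    note wL = continuous_time_L2[OF wc[OF l]]
    have eq: "(\<lambda>t x. \<Sum>j<Suc l. w j t * v j x) = (\<lambda>t x. 1 * (\<Sum>j<l. w j t * v j x) + 1 * (w l t * v l x))"
      by simp
    show ?case
      unfolding eq using Suc H1.L2B_comb[OF _ H1.L2B_tensor[OF wL vH[OF l]]]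
        L2.L2B_comb[OF _ L2.L2B_tensor[OF wL H1_L2[OF vH[OF l]]]] by (meson Suc_leD)
  qed
  from this[of k] show "uh \<in> L2B T (H1 \<Omega>) (grad_norm \<Omega>)" "uh \<in> L2B T (L2 \<Omega>) (L2_norm \<Omega>)"
    unfolding uh by auto
qed

lemma increment_V_h:
  assumes "uh \<in> X0_h \<Omega> T \<T> n"
  shows "increment uh i \<in> V_h \<Omega> \<T>"
  unfolding increment_def by (intro V.comb_mem X0_h_props(1)[OF assms])

lemma discrete_dt_L2B:
  assumes "uh \<in> X0_h \<Omega> T \<T> n"
  shows "discrete_dt uh \<in> L2B T (L2 \<Omega>) (L2_norm \<Omega>)"
proof -
  note iL = H1_L2[OF H10_H1[OF V_h_H10[OF increment_V_h[OF assms]]]]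
  have "(\<lambda>t x. \<Sum>i<l. indicat_real (slab i) t * increment uh i x) \<in> L2B T (L2 \<Omega>) (L2_norm \<Omega>)" for l
  proof (induction l)
    case 0
    then show ?case using L2B_const[OF L2.zero_mem] by simp
  next
    case (Suc l)
    then show ?case using L2.L2B_comb[OF Suc L2.L2B_tensor[OF slab_L2 iL], of 1 1 l l] by simp
  qed
  then show ?thesis by (simp add: discrete_dt_def[abs_def])
qed

text \<open>Discrete functions are continuous across the nodes, so no jump terms arise and the
  slopes on the slabs form the weak derivative; the nodes are the finite exceptional set of the
  integration by parts.\<close>

lemma discrete_weak_time_deriv:
  assumes uh: "uh \<in> X0_h \<Omega> T \<T> n"
  shows "weak_time_deriv \<Omega> T uh (discrete_dt uh)"
  unfolding weak_time_deriv_def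
proof (intro conjI ballI)
  show "uh \<in> L2B T (L2 \<Omega>) (L2_norm \<Omega>)" by (rule X0_h_props(6)[OF uh])
  show dL: "discrete_dt uh \<in> L2B T (L2 \<Omega>) (L2_norm \<Omega>)" by (rule discrete_dt_L2B[OF uh])
  fix \<eta> \<psi> assume \<eta>: "\<eta> \<in> test_functions {0<..<T}" and \<psi>: "\<psi> \<in> L2 \<Omega>"
  note uL = H1_L2[OF H10_H1[OF V_h_H10[OF X0_h_props(1)[OF uh]]]]
    and iL = H1_L2[OF H10_H1[OF V_h_H10[OF increment_V_h[OF uh]]]]
  show "(LINT t|time T. deriv \<eta> t * L2_inner \<Omega> (uh t) \<psi>) = - (LINT t|time T. \<eta> t * L2_inner \<Omega> (discrete_dt uh t) \<psi>)"
  proof (rule time_integration_by_parts[OF \<eta> T_pos X0_h_props(4)[OF uh \<psi>], of "node ` {..n}"])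
    fix t assume t: "t \<in> {0<..<T} - node ` {..n}"
    then obtain i where i: "i < n" "t \<in> slab i" using ex_slab[of t] by blast
    then have "t \<noteq> node (Suc i)" using t by (auto simp: Suc_le_eq)
    then have ti: "t \<in> {node i<..<node (Suc i)}" using i by (auto simp: slab_def)
    have d: "((\<lambda>s. L2_inner \<Omega> (uh (node i)) \<psi> + (s - node i) * L2_inner \<Omega> (increment uh i) \<psi>)
        has_real_derivative L2_inner \<Omega> (discrete_dt uh t) \<psi>) (at t)"
      unfolding discrete_dt_eq[OF i] by (auto intro!: derivative_eq_intros)
    have "L2_inner \<Omega> (uh (node i)) \<psi> + (s - node i) * L2_inner \<Omega> (increment uh i) \<psi> = L2_inner \<Omega> (uh s) \<psi>"
      if "s \<in> {node i<..<node (Suc i)}" for s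
    proof -
      have "uh s = (\<lambda>x. 1 * uh (node i) x + (s - node i) * increment uh i x)"
        using X0_h_props(3)[OF uh i(1), of s] that by auto
      then show ?thesis using L2.comb_left[OF uL iL \<psi>, of 1 "node i" "s - node i" i] by simp
    qed
    from has_field_derivative_transform_within_open[OF d _ ti this]
    show "((\<lambda>t. L2_inner \<Omega> (uh t) \<psi>) has_real_derivative L2_inner \<Omega> (discrete_dt uh t) \<psi>) (at t)" by simp
  qed (use L2.L2B_ip_const[OF dL \<psi>] in auto)
qed

end

section \<open>Error estimates\<close>

lemma sum3_squared_le: "((a::real) + b + c)\<^sup>2 \<le> 3 * (a\<^sup>2 + b\<^sup>2 + c\<^sup>2)"
proof -
  have "0 \<le> (a - b)\<^sup>2 + (b - c)\<^sup>2 + (a - c)\<^sup>2" by simp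
  then show ?thesis by (simp add: power2_eq_square algebra_simps)
qed

text \<open>The factor h that Cauchy-Schwarz on a slab supplies for s^2 balances the h in front of
  x^2, so that no inverse power of h is left. The proof multiplies by h and completes a
  square.\<close>

lemma young_scaled:
  fixes x s q h K :: real
  assumes "0 < h" "s\<^sup>2 \<le> h * q"
  shows "2 * (K * x * s) \<le> h * x\<^sup>2 + K\<^sup>2 * q"
proof -
  have "0 \<le> (h * x - K * s)\<^sup>2" by simp
  also have "\<dots> = h * (h * x\<^sup>2) - h * (2 * (K * x * s)) + K\<^sup>2 * s\<^sup>2"
    by (simp add: power2_eq_square algebra_simps)
  also have "\<dots> \<le> h * (h * x\<^sup>2) - h * (2 * (K * x * s)) + K\<^sup>2 * (h * q)"
    using assms(2) by (intro add_left_mono mult_left_mono) auto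
  finally have "h * (2 * (K * x * s)) \<le> h * (h * x\<^sup>2 + K\<^sup>2 * q)" by (simp add: algebra_simps)
  then show ?thesis using assms(1) by simp
qed

text \<open>Source of the factor 1/2 in front of the energy difference of a slab.\<close>

lemma (in mesh) seg_linear:
  assumes "i < n"
  shows "seg i (\<lambda>t. t - node i) = h\<^sup>2 / 2"
proof -
  let ?a = "node i" and ?b = "node (Suc i)"
  have ab: "?a \<le> ?b" "0 \<le> ?a" "?b \<le> T"
    using node_mono[of i "Suc i"] node_nonneg node_le_T[of "Suc i"] assms by auto
  have "continuous_on {0..T} (\<lambda>t. t - ?a)" by (intro continuous_intros)
  note L = continuous_time_L2[OF this]
  have "((\<lambda>t. indicat_real (slab i) t * (t - ?a)) has_integral seg i (\<lambda>t. t - ?a)) {0<..<T}"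
    unfolding seg_def by (rule has_integral_integral_lebesgue_on[OF seg_integrable[OF L] sets_time])
  then have 1: "((\<lambda>t. if t \<in> {0<..<T} then indicat_real (slab i) t * (t - ?a) else 0) has_integral seg i (\<lambda>t. t - ?a)) UNIV"
    by (simp only: has_integral_restrict_UNIV)
  have "((\<lambda>t. t - ?a) has_integral ((?b - ?a)\<^sup>2 / 2 - (?a - ?a)\<^sup>2 / 2)) {?a..?b}"
  proof (rule fundamental_theorem_of_calculus[OF ab(1)])
    show "((\<lambda>t. (t - ?a)\<^sup>2 / 2) has_vector_derivative t - ?a) (at t within {?a..?b})" for t
      unfolding has_real_derivative_iff_has_vector_derivative[symmetric]
      by (auto intro!: derivative_eq_intros)
  qed
  then have "((\<lambda>t. t - ?a) has_integral h\<^sup>2 / 2) {?a..?b}" by (simp add: node_Suc)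
  then have "((\<lambda>t. if t \<in> {?a..?b} then t - ?a else 0) has_integral h\<^sup>2 / 2) UNIV"
    by (simp only: has_integral_restrict_UNIV)
  then have "((\<lambda>t. if t \<in> {0<..<T} then indicat_real (slab i) t * (t - ?a) else 0) has_integral h\<^sup>2 / 2) UNIV"
    by (rule has_integral_spike_finite[of "{?a, ?b}", rotated 2]) (use ab in \<open>auto simp: slab_def indicator_def\<close>)
  with 1 show ?thesis by (rule has_integral_unique)
qed

text \<open>The interface between the analysis and the finite element data.
  \<open>orthogonality\<close> is the difference of the continuous and the discrete equation, from
  which the right-hand side and the extension of the initial value have dropped out. The projection
  bounds are the case s = 2 in the gradient norm and the case s = 1 in L2.\<close>

locale discretization = mesh \<Omega> T R \<T> m \<phi> n
  for \<Omega> :: "'a::euclidean_space set" and T R \<T> m \<phi> n +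
  fixes u w w2 uh :: "real \<Rightarrow> 'a \<Rightarrow> real" and c1 c2 hx :: real
  assumes u_Y: "u \<in> Y_space \<Omega> T" and init: "initial_value \<Omega> T u (\<lambda>x. 0)"
    and wt: "weak_time_deriv \<Omega> T u w" and wt2: "weak_time_deriv \<Omega> T w w2"
    and u_H2: "u \<in> L2B T (H2 \<Omega>) (H2_norm \<Omega>)" and w_H2: "w \<in> L2B T (H2 \<Omega>) (H2_norm \<Omega>)"
    and w2_H2: "w2 \<in> L2B T (H2 \<Omega>) (H2_norm \<Omega>)"
    and uh: "uh \<in> X0_h \<Omega> T \<T> n"
    and orthogonality: "\<And>v. v \<in> Y_h \<Omega> T \<T> n \<Longrightarrow> v \<in> Y_space \<Omega> T \<Longrightarrow>
      pairing w v - pairing (discrete_dt uh) v + (LINT t|time T. grad_inner \<Omega> (u t) (v t))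
        - (LINT t|time T. grad_inner \<Omega> (uh t) (v t)) = 0"
    and proj_grad: "\<And>g. g \<in> H10 \<Omega> \<Longrightarrow> g \<in> H2 \<Omega> \<Longrightarrow> grad_norm \<Omega> (\<lambda>x. g x - proj g x) \<le> c2 * hx * H2_seminorm \<Omega> g"
    and proj_L2: "\<And>g. g \<in> H10 \<Omega> \<Longrightarrow> L2_norm \<Omega> (\<lambda>x. g x - proj g x) \<le> c1 * hx * grad_norm \<Omega> g"
    and const_nonneg: "0 \<le> c1" "0 \<le> c2" "0 \<le> hx"
begin

section \<open>Coefficients of the error and their energy\<close>

definition M0 where "M0 t = H2_norm \<Omega> (u t)"
definition M1 where "M1 t = H2_norm \<Omega> (w t)"
definition M2 where "M2 t = H2_norm \<Omega> (w2 t)"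

lemma M_L2: "M0 \<in> L2 {0<..<T}" "M1 \<in> L2 {0<..<T}" "M2 \<in> L2 {0<..<T}"
  unfolding M0_def[abs_def] M1_def[abs_def] M2_def[abs_def]
  using L2B_norm_L2[OF u_H2 H2_norm_nonneg] L2B_norm_L2[OF w_H2 H2_norm_nonneg] L2B_norm_L2[OF w2_H2 H2_norm_nonneg] .

lemma M_nonneg: "0 \<le> M0 t" "0 \<le> M1 t" "0 \<le> M2 t"
  by (simp_all add: M0_def M1_def M2_def H2_norm_nonneg)

lemma w_L2B: "w \<in> L2B T (L2 \<Omega>) (L2_norm \<Omega>)" by (rule H2_L2B_L2[OF w_H2])

lemma u_H1B: "u \<in> L2B T (H1 \<Omega>) (grad_norm \<Omega>)" and w_H1B: "w \<in> L2B T (H1 \<Omega>) (grad_norm \<Omega>)"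
  and w2_H1B: "w2 \<in> L2B T (H1 \<Omega>) (grad_norm \<Omega>)"
  using H2_L2B_H1[OF u_H2] H2_L2B_H1[OF w_H2] H2_L2B_H1[OF w2_H2] .

lemma ae_mem:
  "AE t in time T. u t \<in> H10 \<Omega>" "AE t in time T. u t \<in> H2 \<Omega>"
  "AE t in time T. w t \<in> H10 \<Omega>" "AE t in time T. w t \<in> H2 \<Omega>" "AE t in time T. w2 t \<in> H1 \<Omega>"
  using H10.L2B_D(1)[OF Y_L2B[OF u_Y]] u_H2 time_deriv_H10[OF u_Y wt w_H2] w_H2 H1.L2B_D(1)[OF w2_H1B]
  by (auto simp: L2B_def)

text \<open>Coefficients in the basis: \<beta> and \<gamma> belong to the first and second time
  derivative of u, \<open>co\<close> to \<open>uh\<close>. The primitive of \<beta> is the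
  continuous version of the coefficient of u, so \<open>d\<close> belongs to \<open>uh\<close> minus
  the projected u at a node; \<open>avg\<close> is the slope of the interpolant, \<delta> that of
  the difference, and \<psi> the test function on a slab. In \<open>K\<close> the summand with
  \<open>c1\<close> stems from projecting w, the one with \<open>h\<close> from interpolation and
  Green's formula.\<close>

definition \<beta> where "\<beta> j t = grad_inner \<Omega> (w t) (\<phi> j)"
definition \<gamma> where "\<gamma> j t = grad_inner \<Omega> (w2 t) (\<phi> j)"
definition co where "co j t = grad_inner \<Omega> (uh t) (\<phi> j)"
definition d where "d i j = co j (node i) - prim T (\<beta> j) (node i)"
definition \<delta> where "\<delta> i j = (d (Suc i) j - d i j) / h"
definition avg where "avg i j = seg i (\<beta> j) / h"
definition \<psi> where "\<psi> i = lincomb (\<delta> i)"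
definition energy where "energy i = (\<Sum>j<m. (d i j)\<^sup>2)"
definition K where "K = c1 * hx + h * real DIM('a)"

lemma K_nonneg: "0 \<le> K"
  using const_nonneg h_pos by (simp add: K_def add_nonneg_nonneg)

lemma \<beta>_L2: "j < m \<Longrightarrow> \<beta> j \<in> L2 {0<..<T}" and \<gamma>_L2: "j < m \<Longrightarrow> \<gamma> j \<in> L2 {0<..<T}"
  unfolding \<beta>_def[abs_def] \<gamma>_def[abs_def]
  using H1.L2B_ip_const[OF w_H1B basis_H1] H1.L2B_ip_const[OF w2_H1B basis_H1] by auto

lemma \<psi>_mem: "\<psi> i \<in> V_h \<Omega> \<T>" "\<psi> i \<in> H10 \<Omega>" "\<psi> i \<in> H1 \<Omega>" "\<psi> i \<in> L2 \<Omega>"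
  by (simp_all add: \<psi>_def lincomb_mem lincomb_H10 lincomb_H1 lincomb_L2)

lemma uh_H1: "uh t \<in> H1 \<Omega>"
  by (rule H10_H1[OF V_h_H10[OF X0_h_props(1)[OF uh]]])

lemma increment_mem: "increment uh i \<in> V_h \<Omega> \<T>" "increment uh i \<in> H1 \<Omega>" "increment uh i \<in> L2 \<Omega>"
  using increment_V_h[OF uh] V_h_H10 H10_H1 H1_L2 by blast+

lemma increment_coord:
  assumes "j < m"
  shows "grad_inner \<Omega> (increment uh i) (\<phi> j) = avg i j + \<delta> i j"
proof -
  have "grad_inner \<Omega> (increment uh i) (\<phi> j) = 1 / h * co j (node (Suc i)) + - (1 / h) * co j (node i)"
    unfolding increment_def co_def by (rule H1.comb_left[OF uh_H1 uh_H1 basis_H1[OF assms]])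
  then show ?thesis
    using prim_node_diff[OF \<beta>_L2[OF assms], of i] h_pos by (simp add: avg_def \<delta>_def d_def field_simps)
qed

lemma co_slab:
  assumes j: "j < m" and i: "i < n" and t: "t \<in> slab i"
  shows "co j t = (prim T (\<beta> j) (node i) + (t - node i) * avg i j) + (d i j + (t - node i) * \<delta> i j)"
proof -
  have "uh t = (\<lambda>x. 1 * uh (node i) x + (t - node i) * increment uh i x)"
    using X0_h_props(3)[OF uh i, of t] t by (auto simp: slab_def)
  then have "co j t = 1 * co j (node i) + (t - node i) * (avg i j + \<delta> i j)"
    using H1.comb_left[OF uh_H1 increment_mem(2) basis_H1[OF j], of 1 "node i" "t - node i" i]
    by (simp add: co_def increment_coord[OF j])
  then show ?thesis by (simp add: d_def algebra_simps)
qed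

lemma energy_0: "energy 0 = 0"
proof -
  have "d 0 j = 0" if "j < m" for j
    using X0_h_props(2)[OF uh] H1.zero_left[OF basis_H1[OF that]] by (simp add: d_def co_def node_0 prim_0)
  then show ?thesis by (simp add: energy_def)
qed

lemma energy_lincomb: "energy i = (grad_norm \<Omega> (lincomb (d i)))\<^sup>2"
  by (simp add: energy_def lincomb_norm)

text \<open>The increment equals its basis expansion only up to a function of norm zero, hence the
  formulation through inner products.\<close>

lemma increment_ip:
  assumes "v \<in> L2 \<Omega>"
  shows "L2_inner \<Omega> (increment uh i) v = L2_inner \<Omega> (lincomb (avg i)) v + L2_inner \<Omega> (\<psi> i) v"
proof -
  have eq: "proj (increment uh i) = (\<lambda>x. lincomb (avg i) x + \<psi> i x)"
    unfolding proj_def \<psi>_def lincomb_add by (auto simp: lincomb_def increment_coord)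
  have "L2_inner \<Omega> (increment uh i) v = L2_inner \<Omega> (proj (increment uh i)) v"
    using proj_V_h_L2[OF increment_mem(1), of i]
    by (intro L2.ip_diff_zero increment_mem assms) (simp_all add: proj_def lincomb_L2)
  then show ?thesis
    unfolding eq using L2.add_left[OF lincomb_L2 \<psi>_mem(4) assms] by simp
qed

lemma seg_cong_slab:
  assumes "\<And>t. t \<in> slab i \<Longrightarrow> f t = g t"
  shows "seg i f = seg i g"
  unfolding seg_def by (rule Bochner_Integration.integral_cong) (auto simp: indicator_def assms)

lemma seg_cong_AE:
  assumes "f \<in> L2 {0<..<T}" "g \<in> L2 {0<..<T}" "AE t in time T. f t = g t"
  shows "seg i f = seg i g"
  unfolding seg_def
proof (rule integral_cong_AE)
  show "AE t in time T. indicat_real (slab i) t * f t = indicat_real (slab i) t * g t"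
    using assms(3) by eventually_elim simp
qed (intro borel_measurable_integrable seg_integrable assms)+

lemma seg_comb:
  assumes "f \<in> L2 {0<..<T}" "g \<in> L2 {0<..<T}"
  shows "seg i (\<lambda>t. a * f t + b * g t) = a * seg i f + b * seg i g"
  using L2.comb_right[OF assms slab_L2[of i], of a b] by (simp add: seg_def L2_inner_def)

lemma seg_sum:
  assumes "\<And>j. j \<in> I \<Longrightarrow> f j \<in> L2 {0<..<T}"
  shows "seg i (\<lambda>t. \<Sum>j\<in>I. c j * f j t) = (\<Sum>j\<in>I. c j * seg i (f j))"
  using L2.sum_right[where I = I and f = f and c = c, OF assms slab_L2[of i]] by (simp add: seg_def L2_inner_def)

text \<open>Exchanges the coefficients of u, given almost everywhere, for continuous functions that
  can be evaluated at nodes. One null set serves all coefficients because the basis is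
  finite.\<close>

lemma ae_prim:
  "AE t in time T. \<forall>j<m. grad_inner \<Omega> (u t) (\<phi> j) = prim T (\<beta> j) t"
proof -
  have "AE t in time T. \<forall>j\<in>{..<m}. grad_inner \<Omega> (u t) (\<phi> j) = prim T (\<beta> j) t"
    unfolding \<beta>_def[abs_def] using grad_prim_initial[OF wt init u_H1B w_H1B basis_H1]
    by (intro AE_finite_allI) auto
  then show ?thesis by (simp only: Ball_def lessThan_iff)
qed

section \<open>The energy estimate on one slab\<close>

definition q where "q i = seg i (\<lambda>t. (M1 t)\<^sup>2)"

lemma q_nonneg: "0 \<le> q i"
  unfolding q_def by (rule seg_nonneg) simp

lemma seg_M1: "i < n \<Longrightarrow> (seg i M1)\<^sup>2 \<le> h * q i"
  using seg_cauchy_schwarz[OF M_L2(2), of i] M_nonneg(2) by (simp add: q_def)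

text \<open>Since \<open>h\<close> times \<open>avg\<close> is the slab integral of the coefficients
  of w, the left side is the slab integral of (w - P w, \<psi>).\<close>

lemma projection_part:
  assumes i: "i < n"
  shows "seg i (\<lambda>t. L2_inner \<Omega> (w t) (\<psi> i)) - h * L2_inner \<Omega> (lincomb (avg i)) (\<psi> i)
    \<le> c1 * hx * L2_norm \<Omega> (\<psi> i) * seg i M1"
proof -
  let ?p = "\<lambda>t. \<Sum>j<m. L2_inner \<Omega> (\<phi> j) (\<psi> i) * \<beta> j t"
  let ?W = "\<lambda>t. L2_inner \<Omega> (w t) (\<psi> i)"
  have \<beta>': "\<beta> j \<in> L2 {0<..<T}" if "j \<in> {..<m}" for j using \<beta>_L2 that by simp
  have pL: "?p \<in> L2 {0<..<T}" by (rule L2.sum_mem[OF \<beta>'])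
  have WL: "?W \<in> L2 {0<..<T}" by (rule L2.L2B_ip_const[OF w_L2B \<psi>_mem(4)])
  have "h * L2_inner \<Omega> (lincomb (avg i)) (\<psi> i) = h * (\<Sum>j<m. avg i j * L2_inner \<Omega> (\<phi> j) (\<psi> i))"
    unfolding lincomb_def by (subst L2.sum_left) (use basis_H1 H1_L2 \<psi>_mem(4) in auto)
  also have "\<dots> = (\<Sum>j<m. L2_inner \<Omega> (\<phi> j) (\<psi> i) * seg i (\<beta> j))"
    using h_pos by (simp add: sum_distrib_left avg_def mult.commute)
  also have "\<dots> = seg i ?p" by (rule seg_sum[OF \<beta>', symmetric])
  finally have "seg i ?W - h * L2_inner \<Omega> (lincomb (avg i)) (\<psi> i) = seg i ?W - seg i ?p" by simp
  also have "\<dots> = seg i (\<lambda>t. 1 * ?W t + (-1) * ?p t)"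
    using seg_comb[OF WL pL, of i 1 "-1"] by simp
  also have "\<dots> \<le> seg i (\<lambda>t. (c1 * hx * L2_norm \<Omega> (\<psi> i)) * M1 t)"
  proof (rule seg_mono[OF L2.scale_mem[OF M_L2(2)]])
    show "AE t in time T. t \<in> slab i \<longrightarrow> 1 * ?W t + (-1) * ?p t \<le> (c1 * hx * L2_norm \<Omega> (\<psi> i)) * M1 t"
      using ae_mem(3)
    proof eventually_elim
      case (elim t)
      have pr: "L2_inner \<Omega> (proj (w t)) (\<psi> i) = ?p t"
        unfolding proj_def lincomb_def \<beta>_def
        by (subst L2.sum_left) (use basis_H1 H1_L2 \<psi>_mem(4) in \<open>auto simp: mult.commute\<close>)
      have prL: "proj (w t) \<in> L2 \<Omega>" by (simp add: proj_def lincomb_L2)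
      have "1 * ?W t + (-1) * ?p t = L2_inner \<Omega> (\<lambda>x. w t x - proj (w t) x) (\<psi> i)"
        using L2.diff_left[OF H10_L2[OF elim] prL \<psi>_mem(4)] pr by simp
      also have "\<dots> \<le> L2_norm \<Omega> (\<lambda>x. w t x - proj (w t) x) * L2_norm \<Omega> (\<psi> i)"
        using L2.cauchy_schwarz[OF L2.diff_mem[OF H10_L2[OF elim] prL] \<psi>_mem(4), of i] by simp
      also have "\<dots> \<le> (c1 * hx * M1 t) * L2_norm \<Omega> (\<psi> i)"
      proof (rule mult_right_mono[OF order_trans[OF proj_L2[OF elim]]])
        show "c1 * hx * grad_norm \<Omega> (w t) \<le> c1 * hx * M1 t"
          using const_nonneg grad_le_H2_norm[of "w t"] by (intro mult_left_mono) (auto simp: M1_def)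
      qed simp
      finally show ?case by (simp add: mult_ac)
    qed
    show "AE t in time T. 0 \<le> (c1 * hx * L2_norm \<Omega> (\<psi> i)) * M1 t"
      using const_nonneg M_nonneg(2) by (intro AE_I2) (auto intro!: mult_nonneg_nonneg)
  qed
  also have "\<dots> = (c1 * hx * L2_norm \<Omega> (\<psi> i)) * seg i M1"
    using seg_comb[OF M_L2(2) M_L2(2), of i "c1 * hx * L2_norm \<Omega> (\<psi> i)" 0] by simp
  finally show ?thesis .
qed

text \<open>The affine difference to the interpolant is integrated exactly and yields the energies.
  What remains is the interpolation error of the scalar function (grad u, grad \<psi>), whose
  derivative (grad w, grad \<psi>) Green's formula bounds by the L2 norm of \<psi>. The gradient
  norm of \<psi> must not appear, as the energy step controls \<psi> in L2 only.\<close>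

lemma stiffness_part:
  assumes i: "i < n"
  shows "seg i (\<lambda>t. grad_inner \<Omega> (u t) (\<psi> i)) - seg i (\<lambda>t. grad_inner \<Omega> (uh t) (\<psi> i))
    \<le> h * (real DIM('a) * L2_norm \<Omega> (\<psi> i) * seg i M1) - (energy (Suc i) - energy i) / 2"
proof -
  \<comment> \<open>\<open>?b\<close> is (grad w, grad \<psi>) in coordinates, \<open>?B\<close> its
    primitive, \<open>?I\<close> the interpolant of the primitive on this slab, and
    \<open>?e\<close> the gradient product of \<psi> with \<open>uh\<close> minus the
    interpolant.\<close>
  let ?b = "\<lambda>t. \<Sum>j<m. \<delta> i j * \<beta> j t"
  let ?B = "prim T ?b"
  let ?I = "\<lambda>t. ?B (node i) + (t - node i) * (seg i ?b / h)"
  let ?e = "\<lambda>t. \<Sum>j<m. \<delta> i j * (d i j + (t - node i) * \<delta> i j)"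
  have \<beta>': "\<beta> j \<in> L2 {0<..<T}" if "j \<in> {..<m}" for j using \<beta>_L2 that by simp
  have bL: "?b \<in> L2 {0<..<T}" by (rule L2.sum_mem[OF \<beta>'])
  have B_sum: "?B t = (\<Sum>j<m. \<delta> i j * prim T (\<beta> j) t)" for t
    unfolding prim_def by (rule L2.sum_right[OF \<beta>' indicator_time_L2]) auto
  have seg_b: "seg i ?b = (\<Sum>j<m. \<delta> i j * seg i (\<beta> j))" by (rule seg_sum[OF \<beta>'])
  have lin: "continuous_on {0..T} (\<lambda>t. t - node i)" by (intro continuous_intros)
  have lin_L2: "(\<lambda>t. t - node i) \<in> L2 {0<..<T}" by (rule continuous_time_L2[OF lin])
  have uhL: "(\<lambda>t. grad_inner \<Omega> (uh t) (\<psi> i)) \<in> L2 {0<..<T}" and uL: "(\<lambda>t. grad_inner \<Omega> (u t) (\<psi> i)) \<in> L2 {0<..<T}"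
    using H1.L2B_ip_const[OF X0_h_props(5)[OF uh] \<psi>_mem(3)] H1.L2B_ip_const[OF u_H1B \<psi>_mem(3)] .
  have eL: "?e \<in> L2 {0<..<T}" by (rule continuous_time_L2) (intro continuous_intros)
  have IL: "?I \<in> L2 {0<..<T}" by (rule continuous_time_L2) (intro continuous_intros)
  have uh_eq: "grad_inner \<Omega> (uh t) (\<psi> i) = ?I t + ?e t" if t: "t \<in> slab i" for t
  proof -
    have "grad_inner \<Omega> (uh t) (\<psi> i) = (\<Sum>j<m. \<delta> i j * co j t)"
      unfolding \<psi>_def co_def by (rule lincomb_ip[OF uh_H1])
    also have "\<dots> = (\<Sum>j<m. \<delta> i j * prim T (\<beta> j) (node i) + (t - node i) / h * (\<delta> i j * seg i (\<beta> j))
        + \<delta> i j * (d i j + (t - node i) * \<delta> i j))"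
    proof (rule sum.cong[OF refl])
      fix j assume "j \<in> {..<m}"
      then have j: "j < m" by simp
      have ring: "x * ((P + s * (g / k)) + D) = x * P + s / k * (x * g) + x * D" for x P s g k D :: real
        by (simp add: distrib_left)
      show "\<delta> i j * co j t = \<delta> i j * prim T (\<beta> j) (node i) + (t - node i) / h * (\<delta> i j * seg i (\<beta> j))
          + \<delta> i j * (d i j + (t - node i) * \<delta> i j)"
        unfolding co_slab[OF j i t] avg_def by (rule ring)
    qed
    also have "\<dots> = ?I t + ?e t"
      unfolding B_sum seg_b by (simp add: sum.distrib sum_distrib_left sum_divide_distrib)
    finally show ?thesis .
  qed
  have e_seg: "seg i ?e = (energy (Suc i) - energy i) / 2"
  proof -
    have "?e = (\<lambda>t. (\<Sum>j<m. \<delta> i j * d i j) * 1 + (\<Sum>j<m. (\<delta> i j)\<^sup>2) * (t - node i))"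
    proof
      fix t
      show "?e t = (\<Sum>j<m. \<delta> i j * d i j) * 1 + (\<Sum>j<m. (\<delta> i j)\<^sup>2) * (t - node i)"
        unfolding sum_distrib_right sum.distrib[symmetric]
        by (rule sum.cong[OF refl]) (simp add: power2_eq_square algebra_simps)
    qed
    then have "seg i ?e = (\<Sum>j<m. \<delta> i j * d i j) * h + (\<Sum>j<m. (\<delta> i j)\<^sup>2) * (h\<^sup>2 / 2)"
      using seg_comb[OF const_time_L2[of 1] lin_L2, of i] seg_const[OF i, of 1] seg_linear[OF i] by simp
    also have "\<dots> = (\<Sum>j<m. ((d (Suc i) j)\<^sup>2 - (d i j)\<^sup>2) / 2)"
      unfolding sum_distrib_right sum.distrib[symmetric]
    proof (rule sum.cong[OF refl])
      fix j
      \<comment> \<open>With d' = d + h \<delta>, the sum h \<delta> d + h^2 \<delta>^2 / 2 is half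
        of d'^2 - d^2.\<close>
      have "d (Suc i) j = d i j + h * \<delta> i j" using h_pos by (simp add: \<delta>_def)
      then show "\<delta> i j * d i j * h + (\<delta> i j)\<^sup>2 * (h\<^sup>2 / 2) = ((d (Suc i) j)\<^sup>2 - (d i j)\<^sup>2) / 2"
        by (simp add: power2_eq_square algebra_simps)
    qed
    also have "\<dots> = (energy (Suc i) - energy i) / 2"
      by (simp only: energy_def sum_subtractf sum_divide_distrib[symmetric])
    finally show ?thesis .
  qed
  have "AE t in time T. grad_inner \<Omega> (u t) (\<psi> i) = ?B t"
    using ae_prim ae_mem(1)
  proof eventually_elim
    case (elim t)
    then show ?case unfolding \<psi>_def lincomb_ip[OF H10_H1[OF elim(2)]] B_sum by simp
  qed
  then have "seg i (\<lambda>t. grad_inner \<Omega> (u t) (\<psi> i)) = seg i ?B"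
    by (rule seg_cong_AE[OF uL prim_L2[OF bL]])
  moreover have "seg i (\<lambda>t. grad_inner \<Omega> (uh t) (\<psi> i)) = seg i (\<lambda>t. 1 * ?I t + 1 * ?e t)"
    by (rule seg_cong_slab) (simp add: uh_eq)
  moreover have "seg i (\<lambda>t. 1 * ?I t + 1 * ?e t) = seg i ?I + (energy (Suc i) - energy i) / 2"
    using seg_comb[OF IL eL, of i 1 1] e_seg by simp
  moreover have "seg i ?B - seg i ?I \<le> h * (real DIM('a) * L2_norm \<Omega> (\<psi> i) * seg i M1)"
  proof -
    have S: "seg i (\<lambda>r. \<bar>?b r\<bar>) \<le> seg i (\<lambda>t. (real DIM('a) * L2_norm \<Omega> (\<psi> i)) * M1 t)"
    proof (rule seg_mono[OF L2.scale_mem[OF M_L2(2)]])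
      show "AE t in time T. t \<in> slab i \<longrightarrow> \<bar>?b t\<bar> \<le> (real DIM('a) * L2_norm \<Omega> (\<psi> i)) * M1 t"
        using ae_mem(4)
      proof eventually_elim
        case (elim t)
        have "?b t = grad_inner \<Omega> (w t) (\<psi> i)"
          unfolding \<psi>_def \<beta>_def by (rule lincomb_ip[OF H2_H1(1)[OF elim], symmetric])
        then have "\<bar>?b t\<bar> \<le> real DIM('a) * H2_seminorm \<Omega> (w t) * L2_norm \<Omega> (\<psi> i)"
          using grad_inner_H2_bound[OF elim \<psi>_mem(2)] by simp
        also have "\<dots> \<le> real DIM('a) * M1 t * L2_norm \<Omega> (\<psi> i)"
          using H2_semi_le_H2_norm[of "w t"] by (intro mult_right_mono mult_left_mono) (auto simp: M1_def)
        finally show ?case by (simp add: mult_ac)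
      qed
      show "AE t in time T. 0 \<le> (real DIM('a) * L2_norm \<Omega> (\<psi> i)) * M1 t"
        using M_nonneg(2) by (intro AE_I2) (auto intro!: mult_nonneg_nonneg)
    qed
    also have "\<dots> = (real DIM('a) * L2_norm \<Omega> (\<psi> i)) * seg i M1"
      using seg_comb[OF M_L2(2) M_L2(2), of i "real DIM('a) * L2_norm \<Omega> (\<psi> i)" 0] by simp
    finally have S: "seg i (\<lambda>r. \<bar>?b r\<bar>) \<le> real DIM('a) * L2_norm \<Omega> (\<psi> i) * seg i M1" .
    have "seg i ?B - seg i ?I = seg i (\<lambda>t. 1 * ?B t + (-1) * ?I t)"
      using seg_comb[OF prim_L2[OF bL] IL, of i 1 "-1"] by simp
    also have "\<dots> \<le> seg i (\<lambda>t. seg i (\<lambda>r. \<bar>?b r\<bar>))"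
    proof (rule seg_mono[OF const_time_L2])
      show "AE t in time T. t \<in> slab i \<longrightarrow> 1 * ?B t + (-1) * ?I t \<le> seg i (\<lambda>r. \<bar>?b r\<bar>)"
      proof (intro AE_I2 impI)
        fix t assume "t \<in> slab i"
        note le = order_trans[OF abs_ge_self prim_interpolation[OF bL this]]
        have "1 * a + (-1) * b \<le> c" if "a - b \<le> c" for a b c :: real using that by simp
        from this[OF le] show "1 * ?B t + (-1) * ?I t \<le> seg i (\<lambda>r. \<bar>?b r\<bar>)" .
      qed
      show "AE t in time T. 0 \<le> seg i (\<lambda>r. \<bar>?b r\<bar>)" by (intro AE_I2 seg_nonneg) auto
    qed
    also have "\<dots> = h * seg i (\<lambda>r. \<bar>?b r\<bar>)" by (rule seg_const[OF i])
    also have "\<dots> \<le> h * (real DIM('a) * L2_norm \<Omega> (\<psi> i) * seg i M1)"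
      using S h_pos by (intro mult_left_mono) auto
    finally show ?thesis .
  qed
  ultimately show ?thesis by simp
qed

text \<open>Orthogonality is tested with \<psi> on this slab and zero elsewhere. After doubling, the
  left side contains h |\<psi>|^2 twice, and \<open>young_scaled\<close> absorbs one of the two
  copies.\<close>

lemma energy_step:
  assumes i: "i < n"
  shows "h * (L2_norm \<Omega> (\<psi> i))\<^sup>2 + energy (Suc i) - energy i \<le> K\<^sup>2 * q i"
proof -
  let ?v = "\<lambda>t x. indicat_real (slab i) t * \<psi> i x"
  have vY: "?v \<in> Y_space \<Omega> T" by (rule Y_tensor[OF slab_L2 \<psi>_mem(2)])
  have "indicat_real (slab i) \<in> W0_h T n"
    unfolding W0_h_def mem_Collect_eq
  proof (intro allI impI)
    fix k assume "k < n"
    show "\<exists>c. \<forall>t\<in>{real k * (T / real n)<..<real (Suc k) * (T / real n)}. indicat_real (slab i) t = c"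
    proof (intro exI[of _ "if k = i then 1 else 0"] ballI)
      fix t assume "t \<in> {real k * (T / real n)<..<real (Suc k) * (T / real n)}"
      then have "t \<in> slab k" by (simp add: slab_def node_def)
      then show "indicat_real (slab i) t = (if k = i then 1 else 0)"
        using slab_disjoint by (auto simp: indicator_def)
    qed
  qed
  then have "?v \<in> Y_h \<Omega> T \<T> n"
    unfolding Y_h_def tensor_space_def mem_Collect_eq
    by (intro exI[of _ "1::nat"] exI[of _ "\<lambda>_. indicat_real (slab i)"] exI[of _ "\<lambda>_. \<psi> i"]) (simp add: \<psi>_mem(1))
  note orth = orthogonality[OF this vY]
  have p1: "pairing w ?v = seg i (\<lambda>t. L2_inner \<Omega> (w t) (\<psi> i))"
    unfolding pairing_def seg_def
  proof (rule integral_cong_AE)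
    show "AE t in time T. L2_inner \<Omega> (w t) (?v t) = indicat_real (slab i) t * L2_inner \<Omega> (w t) (\<psi> i)"
      using L2.L2B_D(1)[OF w_L2B] by eventually_elim (rule L2.scale_right[OF \<psi>_mem(4)])
  qed (intro borel_measurable_integrable L2.L2B_ip_integrable[OF w_L2B Y_L2B_L2[OF vY]]
      seg_integrable L2.L2B_ip_const[OF w_L2B \<psi>_mem(4)])+
  have p2: "pairing (discrete_dt uh) ?v = h * L2_inner \<Omega> (increment uh i) (\<psi> i)"
  proof -
    have dL: "discrete_dt uh t \<in> L2 \<Omega>" for t
      unfolding discrete_dt_def by (rule L2.sum_mem) (rule increment_mem)
    have "pairing (discrete_dt uh) ?v = seg i (\<lambda>t. L2_inner \<Omega> (discrete_dt uh t) (\<psi> i))"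
      unfolding pairing_def seg_def using L2.scale_right[OF \<psi>_mem(4) dL] by simp
    also have "\<dots> = seg i (\<lambda>t. L2_inner \<Omega> (increment uh i) (\<psi> i))"
      by (rule seg_cong_slab) (simp add: discrete_dt_eq[OF i])
    also have "\<dots> = h * L2_inner \<Omega> (increment uh i) (\<psi> i)" by (rule seg_const[OF i])
    finally show ?thesis .
  qed
  have p3: "(LINT t|time T. grad_inner \<Omega> (u t) (?v t)) = seg i (\<lambda>t. grad_inner \<Omega> (u t) (\<psi> i))"
    unfolding seg_def
  proof (rule integral_cong_AE)
    show "AE t in time T. grad_inner \<Omega> (u t) (?v t) = indicat_real (slab i) t * grad_inner \<Omega> (u t) (\<psi> i)"
      using H1.L2B_D(1)[OF u_H1B] by eventually_elim (rule H1.scale_right[OF \<psi>_mem(3)])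
  qed (intro borel_measurable_integrable H1.L2B_ip_integrable[OF u_H1B Y_L2B_H1[OF vY]]
      seg_integrable H1.L2B_ip_const[OF u_H1B \<psi>_mem(3)])+
  have p4: "(LINT t|time T. grad_inner \<Omega> (uh t) (?v t)) = seg i (\<lambda>t. grad_inner \<Omega> (uh t) (\<psi> i))"
    unfolding seg_def using H1.scale_right[OF \<psi>_mem(3) uh_H1] by simp
  have self: "L2_inner \<Omega> (\<psi> i) (\<psi> i) = (L2_norm \<Omega> (\<psi> i))\<^sup>2" by (rule L2.N_sq[symmetric])
  let ?N = "L2_norm \<Omega> (\<psi> i)" and ?s = "seg i M1"
  have "h * ?N\<^sup>2 \<le> c1 * hx * ?N * ?s + (h * (real DIM('a) * ?N * ?s) - (energy (Suc i) - energy i) / 2)"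
    using orth projection_part[OF i] stiffness_part[OF i] increment_ip[OF \<psi>_mem(4), of i i]
    unfolding p1 p2 p3 p4 self by (simp add: algebra_simps)
  moreover have "K * ?N * ?s = c1 * hx * ?N * ?s + h * (real DIM('a) * ?N * ?s)"
    by (simp add: K_def algebra_simps)
  moreover have "2 * a + e \<le> 2 * x" if "a \<le> b + (c - e / 2)" "x = b + c" for a b c e x :: real
    using that by linarith
  ultimately have "2 * (h * ?N\<^sup>2) + (energy (Suc i) - energy i) \<le> 2 * (K * ?N * ?s)"
    by blast
  also have "\<dots> \<le> h * ?N\<^sup>2 + K\<^sup>2 * q i"
    by (rule young_scaled[OF h_pos seg_M1[OF i]])
  finally show ?thesis by simp
qed

section \<open>Summation over the slabs\<close>

definition Q1 where "Q1 = (LINT t|time T. (M1 t)\<^sup>2)"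

lemma sum_q: "(\<Sum>i<n. q i) \<le> Q1"
  unfolding q_def Q1_def by (rule sum_seg_le) (simp_all add: L2_square_integrable M_L2)

lemma energy_bounds:
  shows "i \<le> n \<Longrightarrow> energy i \<le> K\<^sup>2 * Q1" and "h * (\<Sum>i<n. (L2_norm \<Omega> (\<psi> i))\<^sup>2) \<le> K\<^sup>2 * Q1"
proof -
  have pos: "0 \<le> energy i" "0 \<le> h * (L2_norm \<Omega> (\<psi> i))\<^sup>2" "0 \<le> K\<^sup>2 * q i" for i
    using h_pos q_nonneg by (auto simp: energy_def sum_nonneg)
  have le: "(\<Sum>i<n. K\<^sup>2 * q i) \<le> K\<^sup>2 * Q1"
    unfolding sum_distrib_left[symmetric] by (rule mult_left_mono[OF sum_q]) simp
  note t = telescoping_energy[of energy "\<lambda>i. h * (L2_norm \<Omega> (\<psi> i))\<^sup>2" "\<lambda>i. K\<^sup>2 * q i" n, OF energy_0 pos energy_step]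
  show "energy i \<le> K\<^sup>2 * Q1" if "i \<le> n" using t(1)[OF _ that] le by simp
  show "h * (\<Sum>i<n. (L2_norm \<Omega> (\<psi> i))\<^sup>2) \<le> K\<^sup>2 * Q1"
    using t(2) le by (simp add: sum_distrib_left)
qed

text \<open>Cauchy-Schwarz for a vector of slab integrals, carried out coefficient by coefficient;
  the pointwise hypothesis will be Bessel's inequality.\<close>

lemma sum_coeff_le:
  assumes f: "\<And>j. j < m \<Longrightarrow> f j \<in> L2 {0<..<T}" and M: "M \<in> L2 {0<..<T}" and i: "i < n"
    and le: "AE t in time T. (\<Sum>j<m. (f j t)\<^sup>2) \<le> (M t)\<^sup>2"
  shows "(\<Sum>j<m. (seg i (\<lambda>t. \<bar>f j t\<bar>))\<^sup>2) \<le> h * seg i (\<lambda>t. (M t)\<^sup>2)"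
proof -
  have int: "integrable (time T) (\<lambda>t. indicat_real (slab i) t * (f j t)\<^sup>2)" if "j < m" for j
    by (rule seg_integrable'[OF L2_square_integrable[OF f[OF that]]])
  have "(\<Sum>j<m. (seg i (\<lambda>t. \<bar>f j t\<bar>))\<^sup>2) \<le> (\<Sum>j<m. h * seg i (\<lambda>t. (f j t)\<^sup>2))"
    by (rule sum_mono) (use f seg_cauchy_schwarz i in auto)
  also have "\<dots> = h * (\<Sum>j<m. seg i (\<lambda>t. (f j t)\<^sup>2))" by (rule sum_distrib_left[symmetric])
  also have "(\<Sum>j<m. seg i (\<lambda>t. (f j t)\<^sup>2)) = (LINT t|time T. (\<Sum>j<m. indicat_real (slab i) t * (f j t)\<^sup>2))"
    unfolding seg_def by (rule Bochner_Integration.integral_sum[symmetric]) (use int in auto)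
  also have "h * (LINT t|time T. (\<Sum>j<m. indicat_real (slab i) t * (f j t)\<^sup>2)) \<le> h * seg i (\<lambda>t. (M t)\<^sup>2)"
    unfolding seg_def
  proof (intro mult_left_mono integral_mono_AE)
    show "integrable (time T) (\<lambda>t. \<Sum>j<m. indicat_real (slab i) t * (f j t)\<^sup>2)"
      by (intro Bochner_Integration.integrable_sum int) simp
    show "integrable (time T) (\<lambda>t. indicat_real (slab i) t * (M t)\<^sup>2)"
      by (rule seg_integrable'[OF L2_square_integrable[OF M]])
    show "AE t in time T. (\<Sum>j<m. indicat_real (slab i) t * (f j t)\<^sup>2) \<le> indicat_real (slab i) t * (M t)\<^sup>2"
      using le
    proof eventually_elim
      case (elim t)
      then show ?case unfolding sum_distrib_left[symmetric] by (rule mult_left_mono) simp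
    qed
  qed (use h_pos in simp)
  finally show ?thesis .
qed

lemma coeff_bessel:
  "AE t in time T. (\<Sum>j<m. (\<beta> j t)\<^sup>2) \<le> (M1 t)\<^sup>2" "AE t in time T. (\<Sum>j<m. (\<gamma> j t)\<^sup>2) \<le> (M2 t)\<^sup>2"
proof -
  show "AE t in time T. (\<Sum>j<m. (\<beta> j t)\<^sup>2) \<le> (M1 t)\<^sup>2"
    using H1.L2B_D(1)[OF w_H1B]
  proof eventually_elim
    case (elim t)
    then show ?case
      unfolding \<beta>_def M1_def by (intro order_trans[OF bessel power_mono[OF grad_le_H2_norm]]) auto
  qed
  show "AE t in time T. (\<Sum>j<m. (\<gamma> j t)\<^sup>2) \<le> (M2 t)\<^sup>2"
    using ae_mem(5)
  proof eventually_elim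
    case (elim t)
    then show ?case
      unfolding \<gamma>_def M2_def by (intro order_trans[OF bessel power_mono[OF grad_le_H2_norm]]) auto
  qed
qed

section \<open>Errors of the gradient and of the time derivative\<close>

definition q2 where "q2 i = seg i (\<lambda>t. (M2 t)\<^sup>2)"
definition Q0 where "Q0 = (LINT t|time T. (M0 t)\<^sup>2)"
definition Q2 where "Q2 = (LINT t|time T. (M2 t)\<^sup>2)"

lemma sum_q2: "(\<Sum>i<n. q2 i) \<le> Q2"
  unfolding q2_def Q2_def by (rule sum_seg_le) (simp_all add: L2_square_integrable M_L2)

lemma lincomb_norm_le:
  assumes "\<And>j. j < m \<Longrightarrow> \<bar>c j\<bar> \<le> b j" "(\<Sum>j<m. (b j)\<^sup>2) \<le> B"
  shows "(grad_norm \<Omega> (lincomb c))\<^sup>2 \<le> B"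
proof -
  have "(\<Sum>j<m. (c j)\<^sup>2) \<le> (\<Sum>j<m. (b j)\<^sup>2)"
  proof (rule sum_mono)
    fix j assume "j \<in> {..<m}"
    then have "\<bar>c j\<bar>\<^sup>2 \<le> (b j)\<^sup>2" by (intro power_mono assms(1)) auto
    then show "(c j)\<^sup>2 \<le> (b j)\<^sup>2" by simp
  qed
  then show ?thesis using assms(2) by (simp add: lincomb_norm)
qed

text \<open>Three parts: u minus its projection, the projection minus its interpolant with
  coefficients \<open>B\<close>, and \<open>uh\<close> minus the interpolant with coefficients
  \<open>E\<close>. The factor 3 comes from squaring their sum.\<close>

lemma gradient_error_pointwise:
  "AE t in time T. (grad_norm \<Omega> (\<lambda>x. u t x - uh t x))\<^sup>2
    \<le> 3 * ((c2 * hx)\<^sup>2 * (M0 t)\<^sup>2 + steps (\<lambda>i. h * q i) t + K\<^sup>2 * Q1)"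
  using ae_mem(1,2) ae_prim AE_space
proof eventually_elim
  case (elim t)
  obtain i where i: "i < n" "t \<in> slab i" using ex_slab elim(4) by (auto simp: space_time)
  note uH = H10_H1[OF elim(1)]
  have prH: "proj (u t) \<in> H1 \<Omega>" by (simp add: proj_def lincomb_H1)
  define B where "B j = prim T (\<beta> j) t - (prim T (\<beta> j) (node i) + (t - node i) * (seg i (\<beta> j) / h))" for j
  define \<theta> where "\<theta> = (t - node i) / h"
  have \<theta>: "0 \<le> \<theta>" "\<theta> \<le> 1" using i(2) h_pos by (auto simp: \<theta>_def slab_iff field_simps)
  \<comment> \<open>On a slab the difference is a convex combination of its two nodal values, so the
    energy bounds at the nodes suffice.\<close>
  define E where "E j = (1 - \<theta>) * d i j + \<theta> * d (Suc i) j" for j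
  let ?v = "\<lambda>x. proj (u t) x - uh t x"
  have vV: "?v \<in> V_h \<Omega> \<T>"
    by (rule V.diff_mem) (simp_all add: proj_def lincomb_mem X0_h_props(1)[OF uh])
  have coord: "grad_inner \<Omega> ?v (\<phi> j) = B j - E j" if j: "j < m" for j
  proof -
    have "grad_inner \<Omega> ?v (\<phi> j) = prim T (\<beta> j) t - co j t"
      using H1.diff_left[OF prH uh_H1 basis_H1[OF j]] lincomb_basis[OF j] elim(3) j
      by (simp add: proj_def co_def)
    moreover have "E j = d i j + (t - node i) * \<delta> i j"
      using h_pos by (simp add: E_def \<theta>_def \<delta>_def field_simps)
    ultimately show ?thesis using co_slab[OF j i] by (simp add: B_def avg_def)
  qed
  have "(grad_norm \<Omega> ?v)\<^sup>2 = (grad_norm \<Omega> (lincomb (\<lambda>j. B j - E j)))\<^sup>2"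
    unfolding V_h_norm[OF vV] lincomb_norm by (simp add: coord)
  then have "grad_norm \<Omega> ?v = grad_norm \<Omega> (\<lambda>x. lincomb B x - lincomb E x)"
    unfolding lincomb_diff by (rule power2_eq_imp_eq) auto
  also have "\<dots> \<le> grad_norm \<Omega> (lincomb B) + grad_norm \<Omega> (lincomb E)"
    by (rule H1.triangle_diff[OF lincomb_H1 lincomb_H1])
  finally have v_le: "grad_norm \<Omega> ?v \<le> grad_norm \<Omega> (lincomb B) + grad_norm \<Omega> (lincomb E)" .
  have "grad_norm \<Omega> (\<lambda>x. u t x - uh t x) \<le> grad_norm \<Omega> (\<lambda>x. u t x - proj (u t) x) + grad_norm \<Omega> ?v"
    by (rule H1.triangle_via[OF uH prH uh_H1])
  with v_le have "grad_norm \<Omega> (\<lambda>x. u t x - uh t x)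
      \<le> grad_norm \<Omega> (\<lambda>x. u t x - proj (u t) x) + grad_norm \<Omega> (lincomb B) + grad_norm \<Omega> (lincomb E)"
    by simp
  then have "(grad_norm \<Omega> (\<lambda>x. u t x - uh t x))\<^sup>2
      \<le> (grad_norm \<Omega> (\<lambda>x. u t x - proj (u t) x) + grad_norm \<Omega> (lincomb B) + grad_norm \<Omega> (lincomb E))\<^sup>2"
    by (rule power_mono) simp
  also have "\<dots> \<le> 3 * ((grad_norm \<Omega> (\<lambda>x. u t x - proj (u t) x))\<^sup>2 + (grad_norm \<Omega> (lincomb B))\<^sup>2 + (grad_norm \<Omega> (lincomb E))\<^sup>2)"
    by (rule sum3_squared_le)
  also have "\<dots> \<le> 3 * ((c2 * hx)\<^sup>2 * (M0 t)\<^sup>2 + steps (\<lambda>i. h * q i) t + K\<^sup>2 * Q1)"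
  proof (intro mult_left_mono add_mono)
    have "grad_norm \<Omega> (\<lambda>x. u t x - proj (u t) x) \<le> c2 * hx * M0 t"
      unfolding M0_def
      by (rule order_trans[OF proj_grad[OF elim(1,2)] mult_left_mono[OF H2_semi_le_H2_norm]])
        (use const_nonneg in simp)
    then have "(grad_norm \<Omega> (\<lambda>x. u t x - proj (u t) x))\<^sup>2 \<le> (c2 * hx * M0 t)\<^sup>2" by (rule power_mono) simp
    then show "(grad_norm \<Omega> (\<lambda>x. u t x - proj (u t) x))\<^sup>2 \<le> (c2 * hx)\<^sup>2 * (M0 t)\<^sup>2"
      by (simp add: power_mult_distrib)
    show "(grad_norm \<Omega> (lincomb B))\<^sup>2 \<le> steps (\<lambda>i. h * q i) t"
      unfolding steps_eq[OF i] q_def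
    proof (rule lincomb_norm_le)
      show "\<bar>B j\<bar> \<le> seg i (\<lambda>r. \<bar>\<beta> j r\<bar>)" if "j < m" for j
        unfolding B_def by (rule prim_interpolation[OF \<beta>_L2[OF that] i(2)])
      show "(\<Sum>j<m. (seg i (\<lambda>r. \<bar>\<beta> j r\<bar>))\<^sup>2) \<le> h * seg i (\<lambda>t. (M1 t)\<^sup>2)"
        by (rule sum_coeff_le[OF \<beta>_L2 M_L2(2) i(1) coeff_bessel(1)])
    qed
    have E_eq: "lincomb E = (\<lambda>x. (1 - \<theta>) * lincomb (d i) x + \<theta> * lincomb (d (Suc i)) x)"
      by (auto simp: lincomb_def E_def sum_distrib_left sum.distrib distrib_right mult.assoc)
    have node_le: "grad_norm \<Omega> (lincomb (d k)) \<le> K * sqrt Q1" if "k \<le> n" for k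
    proof (rule power2_le_imp_le)
      show "(grad_norm \<Omega> (lincomb (d k)))\<^sup>2 \<le> (K * sqrt Q1)\<^sup>2"
        using energy_bounds(1)[OF that] by (simp add: energy_lincomb power_mult_distrib Q1_def)
      show "0 \<le> K * sqrt Q1" using K_nonneg by (simp add: Q1_def)
    qed
    have "grad_norm \<Omega> (lincomb E) \<le> grad_norm \<Omega> (\<lambda>x. (1 - \<theta>) * lincomb (d i) x) + grad_norm \<Omega> (\<lambda>x. \<theta> * lincomb (d (Suc i)) x)"
      unfolding E_eq by (intro H1.triangle H1.scale_mem lincomb_H1)
    also have "\<dots> = (1 - \<theta>) * grad_norm \<Omega> (lincomb (d i)) + \<theta> * grad_norm \<Omega> (lincomb (d (Suc i)))"
      using \<theta> by (simp add: H1.N_scale[OF lincomb_H1])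
    also have "\<dots> \<le> (1 - \<theta>) * (K * sqrt Q1) + \<theta> * (K * sqrt Q1)"
      using \<theta> i(1) by (intro add_mono mult_left_mono node_le) auto
    finally have "grad_norm \<Omega> (lincomb E) \<le> K * sqrt Q1" by (simp add: algebra_simps)
    then have "(grad_norm \<Omega> (lincomb E))\<^sup>2 \<le> (K * sqrt Q1)\<^sup>2" by (rule power_mono) simp
    then show "(grad_norm \<Omega> (lincomb E))\<^sup>2 \<le> K\<^sup>2 * Q1" by (simp add: power_mult_distrib Q1_def)
  qed simp
  finally show ?case .
qed

lemma gradient_error:
  "(Y_norm \<Omega> T (\<lambda>t x. u t x - uh t x))\<^sup>2 \<le> 3 * ((c2 * hx)\<^sup>2 * Q0 + h\<^sup>2 * Q1 + T * (K\<^sup>2 * Q1))"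
proof -
  let ?g = "\<lambda>t. 3 * ((c2 * hx)\<^sup>2 * (M0 t)\<^sup>2 + steps (\<lambda>i. h * q i) t + K\<^sup>2 * Q1)"
  have i1: "integrable (time T) (\<lambda>t. (M0 t)\<^sup>2)" by (rule L2_square_integrable[OF M_L2(1)])
  have i2: "integrable (time T) (steps (\<lambda>i. h * q i))" by (rule L2_time_integrable[OF steps_L2])
  have i3: "integrable (time T) (\<lambda>t. K\<^sup>2 * Q1)" by (rule L2_time_integrable[OF const_time_L2])
  have Q1: "0 \<le> Q1" by (simp add: Q1_def)
  have "(Y_norm \<Omega> T (\<lambda>t x. u t x - uh t x))\<^sup>2 = (LINT t|time T. (grad_norm \<Omega> (\<lambda>x. u t x - uh t x))\<^sup>2)"
    by (simp add: Y_norm_def L2B_norm_def)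
  also have "\<dots> \<le> (LINT t|time T. ?g t)"
  proof (rule integral_mono_AE'[OF _ gradient_error_pointwise])
    show "integrable (time T) ?g"
      by (intro Bochner_Integration.integrable_mult_right Bochner_Integration.integrable_add i1 i2 i3)
    have "0 \<le> steps (\<lambda>i. h * q i) t" for t
      unfolding steps_def using h_pos q_nonneg by (intro sum_nonneg mult_nonneg_nonneg) auto
    then show "AE t in time T. 0 \<le> ?g t" using Q1 by (intro AE_I2) (simp add: add_nonneg_nonneg)
  qed
  also have "\<dots> = 3 * ((c2 * hx)\<^sup>2 * Q0 + h * (\<Sum>i<n. h * q i) + T * (K\<^sup>2 * Q1))"
  proof -
    have "(LINT t|time T. K\<^sup>2 * Q1) = T * (K\<^sup>2 * Q1)"
      using T_pos by (simp add: measure_restrict_space space_time)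
    moreover have j1: "integrable (time T) (\<lambda>t. (c2 * hx)\<^sup>2 * (M0 t)\<^sup>2)" using i1 by simp
    ultimately show ?thesis
      by (simp only: integral_mult_right_zero Bochner_Integration.integral_add[OF Bochner_Integration.integrable_add[OF j1 i2] i3]
          Bochner_Integration.integral_add[OF j1 i2] steps_integral Q0_def)
  qed
  also have "h * (\<Sum>i<n. h * q i) \<le> h\<^sup>2 * Q1"
    unfolding sum_distrib_left[symmetric] using sum_q h_pos by (simp add: power2_eq_square)
  finally show ?thesis by simp
qed

text \<open>Three parts: w minus its projection, the projection minus its slab average, and \<psi>.
  The second is estimated through coefficients, that is in the gradient norm, which costs the
  Poincare factor 2R; the second time derivative enters here.\<close>

lemma time_deriv_error_pointwise:
  "AE t in time T. (L2_norm \<Omega> (\<lambda>x. w t x - discrete_dt uh t x))\<^sup>2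
    \<le> 3 * ((c1 * hx)\<^sup>2 * (M1 t)\<^sup>2 + (2 * R)\<^sup>2 * steps (\<lambda>i. h * q2 i) t + steps (\<lambda>i. (L2_norm \<Omega> (\<psi> i))\<^sup>2) t)"
proof -
  have "AE t in time T. t \<in> slab i \<longrightarrow> \<bar>\<beta> j t - avg i j\<bar> \<le> seg i (\<lambda>r. \<bar>\<gamma> j r\<bar>)" if i: "i < n" and j: "j < m" for i j
  proof -
    obtain c where "AE t in time T. \<beta> j t = c + prim T (\<gamma> j) t"
      using grad_prim[OF wt2 w_H1B w2_H1B basis_H1[OF j]] unfolding \<beta>_def \<gamma>_def by blast
    from average_deviation[OF \<beta>_L2[OF j] \<gamma>_L2[OF j] i this]
    show ?thesis by (simp add: avg_def)
  qed
  then have "AE t in time T. \<forall>i\<in>{..<n}. \<forall>j\<in>{..<m}. t \<in> slab i \<longrightarrow> \<bar>\<beta> j t - avg i j\<bar> \<le> seg i (\<lambda>r. \<bar>\<gamma> j r\<bar>)"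
    by (intro AE_finite_allI) auto
  then show ?thesis
    using ae_mem(3) AE_space
  proof eventually_elim
    case (elim t)
    obtain i where i: "i < n" "t \<in> slab i" using ex_slab elim(3) by (auto simp: space_time)
    have wL: "w t \<in> L2 \<Omega>" by (rule H10_L2[OF elim(2)])
    have prL: "proj (w t) \<in> L2 \<Omega>" by (simp add: proj_def lincomb_L2)
    let ?a = "lincomb (avg i)" and ?i = "increment uh i"
    have null: "L2_norm \<Omega> (\<lambda>x. ?i x - (?a x + \<psi> i x)) = 0"
    proof -
      have "proj ?i = (\<lambda>x. ?a x + \<psi> i x)"
        unfolding proj_def \<psi>_def lincomb_add by (auto simp: lincomb_def increment_coord)
      then show ?thesis using proj_V_h_L2[OF increment_mem(1), of i] by simp
    qed
    have a\<psi>: "(\<lambda>x. ?a x + \<psi> i x) \<in> L2 \<Omega>" by (rule L2.add_mem[OF lincomb_L2 \<psi>_mem(4)])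
    have ai: "L2_norm \<Omega> (\<lambda>x. ?a x - ?i x) \<le> L2_norm \<Omega> (\<psi> i)"
      using L2.triangle_via[OF lincomb_L2[of "avg i"] a\<psi> increment_mem(3)[of i]]
        L2.N_minus_commute[OF increment_mem(3)[of i] a\<psi>] null L2.N_scale[OF \<psi>_mem(4), of "-1" i] by simp
    have "L2_norm \<Omega> (\<lambda>x. w t x - discrete_dt uh t x)
        \<le> L2_norm \<Omega> (\<lambda>x. w t x - proj (w t) x) + L2_norm \<Omega> (\<lambda>x. proj (w t) x - ?a x) + L2_norm \<Omega> (\<psi> i)"
      unfolding discrete_dt_eq[OF i]
      using L2.triangle_via[OF wL prL increment_mem(3)[of i]] L2.triangle_via[OF prL lincomb_L2[of "avg i"] increment_mem(3)[of i]] ai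
      by linarith
    then have "(L2_norm \<Omega> (\<lambda>x. w t x - discrete_dt uh t x))\<^sup>2
        \<le> (L2_norm \<Omega> (\<lambda>x. w t x - proj (w t) x) + L2_norm \<Omega> (\<lambda>x. proj (w t) x - ?a x) + L2_norm \<Omega> (\<psi> i))\<^sup>2"
      by (rule power_mono) simp
    also have "\<dots> \<le> 3 * ((L2_norm \<Omega> (\<lambda>x. w t x - proj (w t) x))\<^sup>2 + (L2_norm \<Omega> (\<lambda>x. proj (w t) x - ?a x))\<^sup>2 + (L2_norm \<Omega> (\<psi> i))\<^sup>2)"
      by (rule sum3_squared_le)
    also have "\<dots> \<le> 3 * ((c1 * hx)\<^sup>2 * (M1 t)\<^sup>2 + (2 * R)\<^sup>2 * steps (\<lambda>i. h * q2 i) t + steps (\<lambda>i. (L2_norm \<Omega> (\<psi> i))\<^sup>2) t)"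
    proof (intro mult_left_mono add_mono)
      have "L2_norm \<Omega> (\<lambda>x. w t x - proj (w t) x) \<le> c1 * hx * M1 t"
        unfolding M1_def
        by (rule order_trans[OF proj_L2[OF elim(2)] mult_left_mono[OF grad_le_H2_norm]])
          (use const_nonneg in simp)
      then have "(L2_norm \<Omega> (\<lambda>x. w t x - proj (w t) x))\<^sup>2 \<le> (c1 * hx * M1 t)\<^sup>2" by (rule power_mono) simp
      then show "(L2_norm \<Omega> (\<lambda>x. w t x - proj (w t) x))\<^sup>2 \<le> (c1 * hx)\<^sup>2 * (M1 t)\<^sup>2"
        by (simp add: power_mult_distrib)
      have G: "(grad_norm \<Omega> (\<lambda>x. proj (w t) x - ?a x))\<^sup>2 \<le> h * q2 i"
        unfolding proj_def lincomb_diff q2_def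
      proof (rule lincomb_norm_le)
        show "\<bar>grad_inner \<Omega> (w t) (\<phi> j) - avg i j\<bar> \<le> seg i (\<lambda>r. \<bar>\<gamma> j r\<bar>)" if "j < m" for j
          using elim(1) i that by (simp add: \<beta>_def)
        show "(\<Sum>j<m. (seg i (\<lambda>r. \<bar>\<gamma> j r\<bar>))\<^sup>2) \<le> h * seg i (\<lambda>t. (M2 t)\<^sup>2)"
          by (rule sum_coeff_le[OF \<gamma>_L2 M_L2(3) i(1) coeff_bessel(2)])
      qed
      have "L2_norm \<Omega> (\<lambda>x. proj (w t) x - ?a x) \<le> 2 * R * grad_norm \<Omega> (\<lambda>x. proj (w t) x - ?a x)"
        by (rule H10_poincare[OF H10.diff_mem]) (simp_all add: proj_def lincomb_H10)
      then have "(L2_norm \<Omega> (\<lambda>x. proj (w t) x - ?a x))\<^sup>2 \<le> (2 * R * grad_norm \<Omega> (\<lambda>x. proj (w t) x - ?a x))\<^sup>2"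
        by (rule power_mono) simp
      also have "\<dots> = (2 * R)\<^sup>2 * (grad_norm \<Omega> (\<lambda>x. proj (w t) x - ?a x))\<^sup>2" by (rule power_mult_distrib)
      also have "\<dots> \<le> (2 * R)\<^sup>2 * (h * q2 i)" using G by (intro mult_left_mono) auto
      finally show "(L2_norm \<Omega> (\<lambda>x. proj (w t) x - ?a x))\<^sup>2 \<le> (2 * R)\<^sup>2 * steps (\<lambda>i. h * q2 i) t"
        unfolding steps_eq[OF i] .
      show "(L2_norm \<Omega> (\<psi> i))\<^sup>2 \<le> steps (\<lambda>i. (L2_norm \<Omega> (\<psi> i))\<^sup>2) t"
        unfolding steps_eq[OF i] ..
    qed simp
    finally show ?case .
  qed
qed

lemma time_deriv_error:
  "(L2B_norm T (L2_norm \<Omega>) (\<lambda>t x. w t x - discrete_dt uh t x))\<^sup>2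
    \<le> 3 * ((c1 * hx)\<^sup>2 * Q1 + (2 * R)\<^sup>2 * (h\<^sup>2 * Q2) + K\<^sup>2 * Q1)"
proof -
  let ?s1 = "steps (\<lambda>i. h * q2 i)" and ?s2 = "steps (\<lambda>i. (L2_norm \<Omega> (\<psi> i))\<^sup>2)"
  let ?g = "\<lambda>t. 3 * ((c1 * hx)\<^sup>2 * (M1 t)\<^sup>2 + (2 * R)\<^sup>2 * ?s1 t + ?s2 t)"
  have i1: "integrable (time T) (\<lambda>t. (M1 t)\<^sup>2)" by (rule L2_square_integrable[OF M_L2(2)])
  have i2: "integrable (time T) ?s1" and i3: "integrable (time T) ?s2"
    by (rule L2_time_integrable[OF steps_L2])+
  have q2: "0 \<le> q2 i" for i unfolding q2_def by (rule seg_nonneg) simp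
  have "(L2B_norm T (L2_norm \<Omega>) (\<lambda>t x. w t x - discrete_dt uh t x))\<^sup>2
      = (LINT t|time T. (L2_norm \<Omega> (\<lambda>x. w t x - discrete_dt uh t x))\<^sup>2)"
    by (simp add: L2B_norm_def)
  also have "\<dots> \<le> (LINT t|time T. ?g t)"
  proof (rule integral_mono_AE'[OF _ time_deriv_error_pointwise])
    show "integrable (time T) ?g"
      by (intro Bochner_Integration.integrable_mult_right Bochner_Integration.integrable_add i1 i2 i3)
    have "0 \<le> ?s1 t" "0 \<le> ?s2 t" for t
      unfolding steps_def using h_pos q2 by (auto intro!: sum_nonneg mult_nonneg_nonneg)
    then show "AE t in time T. 0 \<le> ?g t" by (intro AE_I2) (simp add: add_nonneg_nonneg)
  qed
  also have "\<dots> = 3 * ((c1 * hx)\<^sup>2 * Q1 + (2 * R)\<^sup>2 * (h * (\<Sum>i<n. h * q2 i)) + h * (\<Sum>i<n. (L2_norm \<Omega> (\<psi> i))\<^sup>2))"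
    using i1 i2 i3 by (simp add: steps_integral Q1_def)
  also have "\<dots> \<le> 3 * ((c1 * hx)\<^sup>2 * Q1 + (2 * R)\<^sup>2 * (h\<^sup>2 * Q2) + K\<^sup>2 * Q1)"
  proof (intro mult_left_mono add_mono order_refl energy_bounds(2))
    show "h * (\<Sum>i<n. h * q2 i) \<le> h\<^sup>2 * Q2"
      unfolding sum_distrib_left[symmetric] using sum_q2 h_pos by (simp add: power2_eq_square)
  qed auto
  finally show ?thesis .
qed

text \<open>The dual norm is a supremum of reals, so even its sign needs an element of the unit ball
  and boundedness above. The sign is required for squaring the bound.\<close>

lemma dual_norm_error:
  "0 \<le> Y_dual_norm \<Omega> T (dt \<Omega> T (\<lambda>t x. u t x - uh t x))" (is ?nonneg)
  "Y_dual_norm \<Omega> T (dt \<Omega> T (\<lambda>t x. u t x - uh t x))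
    \<le> 2 * R * L2B_norm T (L2_norm \<Omega>) (\<lambda>t x. w t x - discrete_dt uh t x)" (is ?bound)
proof -
  let ?r = "\<lambda>t x. w t x - discrete_dt uh t x"
  have rL: "?r \<in> L2B T (L2 \<Omega>) (L2_norm \<Omega>)"
    using L2.L2B_comb[OF w_L2B discrete_dt_L2B[OF uh], of 1 "-1"] by simp
  have dd: "dual_time_deriv \<Omega> T (\<lambda>t x. u t x - uh t x) (\<lambda>v. pairing w v - pairing (discrete_dt uh) v)"
    using dual_time_deriv_comb[OF weak_time_deriv_dual[OF wt] weak_time_deriv_dual[OF discrete_weak_time_deriv[OF uh]]
        Y_L2B_L2[OF u_Y] X0_h_props(6)[OF uh], of 1 "-1"] by simp
  have le: "\<bar>dt \<Omega> T (\<lambda>t x. u t x - uh t x) v\<bar> \<le> 2 * R * L2B_norm T (L2_norm \<Omega>) ?r"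
    if v: "v \<in> Y_space \<Omega> T" "Y_norm \<Omega> T v \<le> 1" for v
  proof -
    note vL = Y_L2B_L2[OF v(1)]
    note i = L2.L2B_ip_integrable[OF w_L2B vL] L2.L2B_ip_integrable[OF discrete_dt_L2B[OF uh] vL]
    have "pairing ?r v = pairing w v - pairing (discrete_dt uh) v"
      unfolding pairing_def Bochner_Integration.integral_diff[OF i, symmetric]
    proof (rule integral_cong_AE)
      show "AE t in time T. L2_inner \<Omega> (?r t) (v t) = L2_inner \<Omega> (w t) (v t) - L2_inner \<Omega> (discrete_dt uh t) (v t)"
        using L2.L2B_D(1)[OF w_L2B] L2.L2B_D(1)[OF discrete_dt_L2B[OF uh]] L2.L2B_D(1)[OF vL]
        by eventually_elim (rule L2.diff_left)
    qed (intro borel_measurable_integrable L2.L2B_ip_integrable[OF rL vL] Bochner_Integration.integrable_diff i)+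
    then have "\<bar>dt \<Omega> T (\<lambda>t x. u t x - uh t x) v\<bar> = \<bar>pairing ?r v\<bar>" using dt_eq[OF dd v(1)] by simp
    also have "\<dots> \<le> L2B_norm T (L2_norm \<Omega>) ?r * L2B_norm T (L2_norm \<Omega>) v"
      unfolding pairing_def by (rule L2.L2B_ip_bound[OF rL vL])
    also have "\<dots> \<le> L2B_norm T (L2_norm \<Omega>) ?r * (2 * R)"
    proof (rule mult_left_mono)
      show "L2B_norm T (L2_norm \<Omega>) v \<le> 2 * R"
        using L2B_norm_L2_le_Y[OF v(1)] mult_left_mono[OF v(2), of "2 * R"] R_nonneg by simp
    qed (simp add: L2B_norm_def)
    finally show ?thesis by (simp add: mult.commute)
  qed
  have "(\<lambda>t x. 0) \<in> Y_space \<Omega> T" using Y_tensor[OF const_time_L2[of 0] H10_zero] by simp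
  moreover have "Y_norm \<Omega> T (\<lambda>t x. 0) \<le> 1" by (simp add: Y_norm_def L2B_norm_def H1.N_zero)
  ultimately have zero: "(\<lambda>t x. 0) \<in> {v \<in> Y_space \<Omega> T. Y_norm \<Omega> T v \<le> 1}" by simp
  then show ?bound
    unfolding Y_dual_norm_def by (intro cSUP_least) (use le in auto)
  have "bdd_above ((\<lambda>v. \<bar>dt \<Omega> T (\<lambda>t x. u t x - uh t x) v\<bar>) ` {v \<in> Y_space \<Omega> T. Y_norm \<Omega> T v \<le> 1})"
    by (rule bdd_aboveI2[where M = "2 * R * L2B_norm T (L2_norm \<Omega>) ?r"]) (use le in auto)
  from order_trans[OF abs_ge_zero cSUP_upper[OF zero this]] show ?nonneg
    unfolding Y_dual_norm_def .
qed

end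

text \<open>Splits the form so that all terms with the extension \<open>u0\<close> cancel in the
  difference of the continuous and the discrete equation. The functional \<open>l\<close> is any
  representative of the time derivative, so the rule serves the exact and the discrete solution
  alike.\<close>

lemma (in cylinder) bform_add:
  assumes l: "dual_time_deriv \<Omega> T u l" and u: "u \<in> L2B T (L2 \<Omega>) (L2_norm \<Omega>)" "u \<in> L2B T (H1 \<Omega>) (grad_norm \<Omega>)"
    and u0: "u0 \<in> X_space \<Omega> T" and v: "v \<in> Y_space \<Omega> T"
  shows "bform \<Omega> T (\<lambda>t x. u t x + u0 t x) v =
    l v + dt \<Omega> T u0 v + (LINT t|time T. grad_inner \<Omega> (u t) (v t)) + (LINT t|time T. grad_inner \<Omega> (u0 t) (v t))"
proof -
  have u0Y: "u0 \<in> Y_space \<Omega> T" using u0 by (simp add: X_space_def)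
  obtain k where k: "dual_time_deriv \<Omega> T u0 k" using u0 by (auto simp: X_space_def)
  note u0L = Y_L2B_L2[OF u0Y] and u0H = Y_L2B_H1[OF u0Y] and vH = Y_L2B_H1[OF v]
  note i = H1.L2B_ip_integrable[OF u(2) vH] H1.L2B_ip_integrable[OF u0H vH]
  have "dual_time_deriv \<Omega> T (\<lambda>t x. u t x + u0 t x) (\<lambda>v. l v + k v)"
    using dual_time_deriv_comb[OF l k u(1) u0L, of 1 1] by simp
  then have "dt \<Omega> T (\<lambda>t x. u t x + u0 t x) v = l v + k v" by (rule dt_eq[OF _ v])
  moreover have "dt \<Omega> T u0 v = k v" by (rule dt_eq[OF k v])
  moreover have "(LINT t|time T. grad_inner \<Omega> (\<lambda>x. u t x + u0 t x) (v t)) =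
      (LINT t|time T. grad_inner \<Omega> (u t) (v t)) + (LINT t|time T. grad_inner \<Omega> (u0 t) (v t))"
    unfolding Bochner_Integration.integral_add[OF i, symmetric]
  proof (rule integral_cong_AE)
    show "AE t in time T. grad_inner \<Omega> (\<lambda>x. u t x + u0 t x) (v t) = grad_inner \<Omega> (u t) (v t) + grad_inner \<Omega> (u0 t) (v t)"
      using H1.L2B_D(1)[OF u(2)] H1.L2B_D(1)[OF u0H] H1.L2B_D(1)[OF vH]
      by eventually_elim (rule H1.add_left)
    have "(\<lambda>t x. u t x + u0 t x) \<in> L2B T (H1 \<Omega>) (grad_norm \<Omega>)"
      using H1.L2B_comb[OF u(2) u0H, of 1 1] by simp
    then show "(\<lambda>t. grad_inner \<Omega> (\<lambda>x. u t x + u0 t x) (v t)) \<in> borel_measurable (time T)"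
      by (intro borel_measurable_integrable H1.L2B_ip_integrable vH)
  qed (intro borel_measurable_integrable Bochner_Integration.integrable_add i)
  ultimately show ?thesis by (simp add: bform_def)
qed

text \<open>Bookkeeping of constants: the summands of both error bounds contain a squared
  coefficient times one of \<open>Q0\<close>, \<open>Q1\<close>, \<open>Q2\<close>, which is at most
  a constant times \<open>S = (hx * Kn)\<^sup>2\<close>. The mesh size and the solution enter
  through \<open>S\<close> alone.\<close>

lemma (in discretization) error_bound:
  assumes h_le: "h \<le> c_hi * hx" and c_hi: "0 \<le> c_hi"
    and Kn: "Q0 \<le> Kn\<^sup>2" "Q1 \<le> Kn\<^sup>2" "Q2 \<le> Kn\<^sup>2" "0 \<le> Kn"
    and k: "k = c1 + c_hi * real DIM('a)"
  shows "X_norm \<Omega> T (\<lambda>t x. u t x - uh t x) \<le>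
    sqrt (3 * (c2\<^sup>2 + c_hi\<^sup>2 + T * k\<^sup>2) + (2 * R)\<^sup>2 * (3 * (c1\<^sup>2 + (2 * R)\<^sup>2 * c_hi\<^sup>2 + k\<^sup>2))) * Kn * hx"
proof -
  define S where "S = (hx * Kn)\<^sup>2"
  let ?e = "\<lambda>t x. u t x - uh t x" and ?r = "\<lambda>t x. w t x - discrete_dt uh t x"
  have Q: "0 \<le> Q0" "0 \<le> Q1" "0 \<le> Q2" by (simp_all add: Q0_def Q1_def Q2_def)
  have b: "a\<^sup>2 * q \<le> c\<^sup>2 * S" if "a \<le> c * hx" "0 \<le> a" "0 \<le> q" "q \<le> Kn\<^sup>2" for a c q
  proof -
    have "a\<^sup>2 * q \<le> (c * hx)\<^sup>2 * Kn\<^sup>2" using that by (intro mult_mono power_mono) auto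
    then show ?thesis by (simp add: S_def power_mult_distrib mult.assoc)
  qed
  have "K \<le> k * hx"
    using mult_right_mono[OF h_le, of "real DIM('a)"] by (simp add: K_def k algebra_simps)
  then have KQ: "K\<^sup>2 * Q1 \<le> k\<^sup>2 * S" by (rule b[OF _ K_nonneg Q(2) Kn(2)])
  have hQ: "h\<^sup>2 * Q1 \<le> c_hi\<^sup>2 * S" "h\<^sup>2 * Q2 \<le> c_hi\<^sup>2 * S"
    using h_pos h_le Q Kn by (auto intro!: b)
  have cQ: "(c2 * hx)\<^sup>2 * Q0 \<le> c2\<^sup>2 * S" "(c1 * hx)\<^sup>2 * Q1 \<le> c1\<^sup>2 * S"
    using const_nonneg Q Kn by (auto intro!: b)
  have "(Y_norm \<Omega> T ?e)\<^sup>2 \<le> 3 * ((c2 * hx)\<^sup>2 * Q0 + h\<^sup>2 * Q1 + T * (K\<^sup>2 * Q1))"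
    by (rule gradient_error)
  also have "\<dots> \<le> 3 * (c2\<^sup>2 * S + c_hi\<^sup>2 * S + T * (k\<^sup>2 * S))"
    using cQ hQ KQ T_pos by (intro mult_left_mono add_mono) auto
  finally have Y: "(Y_norm \<Omega> T ?e)\<^sup>2 \<le> 3 * (c2\<^sup>2 + c_hi\<^sup>2 + T * k\<^sup>2) * S" by (simp add: algebra_simps)
  have "(L2B_norm T (L2_norm \<Omega>) ?r)\<^sup>2 \<le> 3 * ((c1 * hx)\<^sup>2 * Q1 + (2 * R)\<^sup>2 * (h\<^sup>2 * Q2) + K\<^sup>2 * Q1)"
    by (rule time_deriv_error)
  also have "\<dots> \<le> 3 * (c1\<^sup>2 * S + (2 * R)\<^sup>2 * (c_hi\<^sup>2 * S) + k\<^sup>2 * S)"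
    using cQ hQ KQ by (intro mult_left_mono add_mono) auto
  finally have r: "(L2B_norm T (L2_norm \<Omega>) ?r)\<^sup>2 \<le> 3 * (c1\<^sup>2 + (2 * R)\<^sup>2 * c_hi\<^sup>2 + k\<^sup>2) * S" by (simp add: algebra_simps)
  have "(Y_dual_norm \<Omega> T (dt \<Omega> T ?e))\<^sup>2 \<le> (2 * R * L2B_norm T (L2_norm \<Omega>) ?r)\<^sup>2"
    by (rule power_mono[OF dual_norm_error(2,1)])
  also have "\<dots> = (2 * R)\<^sup>2 * (L2B_norm T (L2_norm \<Omega>) ?r)\<^sup>2" by (rule power_mult_distrib)
  also have "\<dots> \<le> (2 * R)\<^sup>2 * (3 * (c1\<^sup>2 + (2 * R)\<^sup>2 * c_hi\<^sup>2 + k\<^sup>2) * S)"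
    by (rule mult_left_mono[OF r]) simp
  finally have D: "(Y_dual_norm \<Omega> T (dt \<Omega> T ?e))\<^sup>2 \<le> (2 * R)\<^sup>2 * (3 * (c1\<^sup>2 + (2 * R)\<^sup>2 * c_hi\<^sup>2 + k\<^sup>2) * S)" .
  let ?C = "3 * (c2\<^sup>2 + c_hi\<^sup>2 + T * k\<^sup>2) + (2 * R)\<^sup>2 * (3 * (c1\<^sup>2 + (2 * R)\<^sup>2 * c_hi\<^sup>2 + k\<^sup>2))"
  have "X_norm \<Omega> T ?e \<le> sqrt (?C * S)"
    unfolding X_norm_def using add_mono[OF Y D]
    by (intro real_sqrt_le_mono) (simp only: distrib_right mult.assoc)
  also have "\<dots> = sqrt ?C * Kn * hx"
    using Kn(4) const_nonneg(3) by (simp add: real_sqrt_mult S_def)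
  finally show ?thesis .
qed

text \<open>Puts actual data into the abstract setting. The projection constants are arbitrary
  reals, so their positive parts take over.\<close>

lemma (in cylinder) discretization_error:
  fixes \<T> :: "'a set set" and Nt :: nat and hx ht c_hi k C :: real
  assumes C1: "C1 = max 0 (c_proj 1)" and C2: "C2 = max 0 (c_proj 2)" and c_hi: "0 < c_hi"
    and k: "k = C1 + c_hi * real DIM('a)"
    and C: "C = sqrt (3 * (C2\<^sup>2 + c_hi\<^sup>2 + T * k\<^sup>2) + (2 * R)\<^sup>2 * (3 * (C1\<^sup>2 + (2 * R)\<^sup>2 * c_hi\<^sup>2 + k\<^sup>2)))"
    and mesh: "simplicial_decomposition \<Omega> \<T>" and hx_mesh: "hx = mesh_size \<T>"
    and Nt_pos: "0 < Nt" and ht: "ht = T / real Nt" and ht_le: "ht \<le> c_hi * hx"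
    and est: "H10_projection_estimates \<Omega> c_proj \<T>"
    and u0_X: "u0 \<in> X_space \<Omega> T" and u: "u \<in> X0_space \<Omega> T"
    and eq: "\<forall>v\<in>Y_space \<Omega> T. bform \<Omega> T (\<lambda>t x. u t x + u0 t x) v = f v"
    and uh: "uh \<in> X0_h \<Omega> T \<T> Nt"
    and eqh: "\<forall>v\<in>Y_h \<Omega> T \<T> Nt. bform \<Omega> T (\<lambda>t x. uh t x + u0 t x) v = f v"
    and reg: "u \<in> H2B \<Omega> T (H2 \<Omega>) (H2_norm \<Omega>)"
  shows "X_norm \<Omega> T (\<lambda>t x. u t x - uh t x) \<le> C * (H1B_norm \<Omega> T (H2_norm \<Omega>) u + H2B_norm \<Omega> T (H2_norm \<Omega>) u) * hx"
proof -
  have C_nonneg: "0 \<le> C"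
    unfolding C using T_pos by (intro real_sqrt_ge_zero add_nonneg_nonneg mult_nonneg_nonneg) auto
  \<comment> \<open>Positivity of the mesh size follows from that of the time step and
    \<open>ht \<le> c_hi * hx\<close>; it is used to evaluate the real powers in the projection
    estimates.\<close>
  have "0 < T / real Nt" using T_pos Nt_pos by simp
  also have "\<dots> \<le> c_hi * hx" using ht_le ht by simp
  finally have "0 < c_hi * hx" .
  then have hx_pos: "0 < hx" using c_hi by (simp add: zero_less_mult_iff)
  define w where "w = time_deriv \<Omega> T u"
  define w2 where "w2 = time_deriv \<Omega> T w"
  have time_deriv: "weak_time_deriv \<Omega> T z (time_deriv \<Omega> T z)" if "z \<in> H1B \<Omega> T V N" for z V N
    using that someI_ex[of "weak_time_deriv \<Omega> T z"] by (auto simp: H1B_def time_deriv_def)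
  have uB: "u \<in> H1B \<Omega> T (H2 \<Omega>) (H2_norm \<Omega>)" and wB: "w \<in> H1B \<Omega> T (H2 \<Omega>) (H2_norm \<Omega>)"
    using reg by (auto simp: H2B_def w_def)
  have wt: "weak_time_deriv \<Omega> T u w" and wt2: "weak_time_deriv \<Omega> T w w2"
    using time_deriv[OF uB] time_deriv[OF wB] by (auto simp: w_def w2_def)
  have H2: "u \<in> L2B T (H2 \<Omega>) (H2_norm \<Omega>)" "w \<in> L2B T (H2 \<Omega>) (H2_norm \<Omega>)" "w2 \<in> L2B T (H2 \<Omega>) (H2_norm \<Omega>)"
    using uB wB by (auto simp: H1B_def w_def w2_def)
  have uY: "u \<in> Y_space \<Omega> T" and init: "initial_value \<Omega> T u (\<lambda>x. 0)"
    using u by (auto simp: X0_space_def X_space_def)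
  obtain m \<phi> where "galerkin \<Omega> T R \<T> m \<phi>" using ex_galerkin[OF mesh] by blast
  then interpret galerkin \<Omega> T R \<T> m \<phi> .
  interpret mesh \<Omega> T R \<T> m \<phi> Nt by unfold_locales (rule Nt_pos)
  have orth: "pairing w v - pairing (discrete_dt uh) v + (LINT t|time T. grad_inner \<Omega> (u t) (v t))
      - (LINT t|time T. grad_inner \<Omega> (uh t) (v t)) = 0" if v: "v \<in> Y_h \<Omega> T \<T> Nt" "v \<in> Y_space \<Omega> T" for v
    using bform_add[OF weak_time_deriv_dual[OF wt] Y_L2B_L2[OF uY] Y_L2B_H1[OF uY] u0_X v(2)]
      bform_add[OF weak_time_deriv_dual[OF discrete_weak_time_deriv[OF uh]] X0_h_props(6,5)[OF uh] u0_X v(2)]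
      eq eqh v by simp
  have pg: "grad_norm \<Omega> (\<lambda>x. g x - proj g x) \<le> C2 * hx * H2_seminorm \<Omega> g" if g: "g \<in> H10 \<Omega>" "g \<in> H2 \<Omega>" for g
  proof -
    have "g \<in> H10 \<Omega> \<inter> Hs \<Omega> 2" using g by (simp add: Hs_def)
    then have "grad_norm \<Omega> (\<lambda>x. g x - proj g x) \<le> c_proj 2 * mesh_size \<T> powr (2 - 1) * Hs_seminorm \<Omega> 2 g"
      using est proj_is_projection[OF H10_H1[OF g(1)]] unfolding H10_projection_estimates_def by fastforce
    also have "\<dots> = c_proj 2 * (hx * H2_seminorm \<Omega> g)" using hx_pos hx_mesh by (simp add: Hs_seminorm_def)
    also have "\<dots> \<le> C2 * (hx * H2_seminorm \<Omega> g)"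
      using hx_pos by (intro mult_right_mono mult_nonneg_nonneg) (auto simp: C2 H2_seminorm_def sum_nonneg)
    finally show ?thesis by (simp add: mult.assoc)
  qed
  have pl: "L2_norm \<Omega> (\<lambda>x. g x - proj g x) \<le> C1 * hx * grad_norm \<Omega> g" if g: "g \<in> H10 \<Omega>" for g
  proof -
    have "g \<in> H10 \<Omega> \<inter> Hs \<Omega> 1" using g H10_H1 by (simp add: Hs_def)
    then have "L2_norm \<Omega> (\<lambda>x. g x - proj g x) \<le> c_proj 1 * mesh_size \<T> powr 1 * Hs_seminorm \<Omega> 1 g"
      using est proj_is_projection[OF H10_H1[OF g]] unfolding H10_projection_estimates_def by fastforce
    also have "\<dots> = c_proj 1 * (hx * grad_norm \<Omega> g)" using hx_pos hx_mesh by (simp add: Hs_seminorm_def)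
    also have "\<dots> \<le> C1 * (hx * grad_norm \<Omega> g)"
      using hx_pos by (intro mult_right_mono mult_nonneg_nonneg) (auto simp: C1)
    finally show ?thesis by (simp add: mult.assoc)
  qed
  interpret discretization \<Omega> T R \<T> m \<phi> Nt u w w2 uh C1 C2 hx
    by unfold_locales (use uY init wt wt2 H2 uh orth pg pl hx_pos in \<open>auto simp: C1 C2\<close>)
  define Kn where "Kn = H2B_norm \<Omega> T (H2_norm \<Omega>) u"
  have Q: "0 \<le> Q0" "0 \<le> Q1" "0 \<le> Q2" by (simp_all add: Q0_def Q1_def Q2_def)
  \<comment> \<open>The squared H2(0,T;H2) norm is the sum of three nonnegative terms and therefore
    bounds each of them.\<close>
  have "Kn\<^sup>2 = Q0 + Q1 + Q2"
    unfolding Kn_def H2B_norm_def H1B_norm_def L2B_norm_def Q0_def Q1_def Q2_def M0_def M1_def M2_def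
      w_def[symmetric] w2_def[symmetric] by simp
  then have Kn: "Q0 \<le> Kn\<^sup>2" "Q1 \<le> Kn\<^sup>2" "Q2 \<le> Kn\<^sup>2" using Q by auto
  have Kn0: "0 \<le> Kn" by (simp add: Kn_def H2B_norm_def)
  have h_le: "h \<le> c_hi * hx" using ht_le ht by (simp add: h_def)
  have "X_norm \<Omega> T (\<lambda>t x. u t x - uh t x) \<le> C * Kn * hx"
    using error_bound[OF h_le _ Kn Kn0 k] c_hi by (simp add: C)
  also have "\<dots> \<le> C * (H1B_norm \<Omega> T (H2_norm \<Omega>) u + Kn) * hx"
  proof (intro mult_right_mono mult_mono)
    show "Kn \<le> H1B_norm \<Omega> T (H2_norm \<Omega>) u + Kn" by (simp add: H1B_norm_def)
  qed (use C_nonneg Kn0 hx_pos in auto)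
  finally show ?thesis by (simp add: Kn_def)
qed

theorem theorem4p6:
  fixes \<Omega> :: "(real ^ 'n) set" and T :: real
    and \<sigma> \<kappa> c_inv c_lo c_hi :: real and c_proj :: "real \<Rightarrow> real"
  assumes "CARD('n) \<in> {1, 2, 3}"
    and "bounded_lipschitz_domain \<Omega>"
    and "0 < T"
    and "0 < c_lo" and "0 < c_hi"
  shows "\<exists>c>0. \<forall>(\<T> :: (real ^ 'n) set set) (N\<^sub>t :: nat)
      (f :: (real \<Rightarrow> real ^ 'n \<Rightarrow> real) \<Rightarrow> real) (u0 :: real ^ 'n \<Rightarrow> real)
      (u0ext :: real \<Rightarrow> real ^ 'n \<Rightarrow> real) (u :: real \<Rightarrow> real ^ 'n \<Rightarrow> real)
      (uh :: real \<Rightarrow> real ^ 'n \<Rightarrow> real) (h\<^sub>x :: real) (h\<^sub>t :: real).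
      simplicial_decomposition \<Omega> \<T> \<and> shape_regular \<sigma> \<T> \<and> quasi_uniform \<kappa> \<T> \<and>
      h\<^sub>x = mesh_size \<T> \<and> 0 < N\<^sub>t \<and> h\<^sub>t = T / real N\<^sub>t \<and>
      c_lo * h\<^sub>x \<le> h\<^sub>t \<and> h\<^sub>t \<le> c_hi * h\<^sub>x \<and>
      inverse_inequality \<Omega> c_inv \<T> \<and> H10_projection_estimates \<Omega> c_proj \<T> \<and>
      f \<in> Y_dual \<Omega> T \<and> u0 \<in> L2 \<Omega> \<and>
      u0ext \<in> X_space \<Omega> T \<and> initial_value \<Omega> T u0ext u0 \<and>
      u \<in> X0_space \<Omega> T \<and>
      (\<forall>v\<in>Y_space \<Omega> T. bform \<Omega> T (\<lambda>t x. u t x + u0ext t x) v = f v) \<and>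
      uh \<in> X0_h \<Omega> T \<T> N\<^sub>t \<and>
      (\<forall>v\<in>Y_h \<Omega> T \<T> N\<^sub>t. bform \<Omega> T (\<lambda>t x. uh t x + u0ext t x) v = f v) \<and>
      u \<in> L2B T (H2 \<Omega>) (H2_norm \<Omega>) \<inter> H2B \<Omega> T (L2 \<Omega>) (L2_norm \<Omega>) \<and>
      time_deriv \<Omega> T u \<in> L2B T (H2 \<Omega>) (H2_norm \<Omega>) \<and>
      u \<in> H2B \<Omega> T (H2 \<Omega>) (H2_norm \<Omega>)
      \<longrightarrow>
      X_norm \<Omega> T (\<lambda>t x. u t x - uh t x)
        \<le> c * (H1B_norm \<Omega> T (H2_norm \<Omega>) u + H2B_norm \<Omega> T (H2_norm \<Omega>) u) * h\<^sub>x"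
proof -
  define C1 where "C1 = max 0 (c_proj 1)"
  define C2 where "C2 = max 0 (c_proj 2)"
  define k where "k = C1 + c_hi * real DIM(real ^ 'n)"
  have dom: "open \<Omega>" "bounded \<Omega>" using assms(2) by (auto simp: bounded_lipschitz_domain_def)
  obtain R where R: "0 \<le> R" "\<And>x. x \<in> \<Omega> \<Longrightarrow> norm x \<le> R"
    using dom(2) bounded_pos[of \<Omega>] by (auto intro: less_imp_le)
  interpret cylinder \<Omega> T R
    by unfold_locales (use dom assms(3) R in auto)
  \<comment> \<open>Fixed before mesh, data and solution are introduced: it is built from T,
    \<open>R\<close>, the dimension, \<open>c_hi\<close> and the projection constants.\<close>
  define C where "C = sqrt (3 * (C2\<^sup>2 + c_hi\<^sup>2 + T * k\<^sup>2) + (2 * R)\<^sup>2 * (3 * (C1\<^sup>2 + (2 * R)\<^sup>2 * c_hi\<^sup>2 + k\<^sup>2)))"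
  note error = discretization_error[OF C1_def C2_def assms(5) k_def C_def]
  have "0 < C"
    unfolding C_def using assms(3,5)
    by (intro real_sqrt_gt_zero add_pos_nonneg mult_pos_pos mult_nonneg_nonneg add_nonneg_pos) auto
  show ?thesis
    by (intro exI[of _ C] conjI[OF \<open>0 < C\<close>] allI impI) (elim conjE, rule error, assumption+)
qed

end
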